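(* Let $\mathcal{A}$ be a locally noetherian Grothendieck category that is locally stable and local, with unique maximal atom $\mathfrak{m}$. Let $N$ be a noetherian object of $\mathcal{A}$ of dimension one, and assume that for every $\alpha\in\mathrm{AAss}(N/\Gamma_{\mathfrak{m}}(N))$ there exists a monoform object $M$ such that $\mathrm{End}(M)$ is not a skew field and $\alpha=\overline{M}$. Then $H^1_{\mathfrak{m}}(N)$ is not noetherian.
   Context: A nonzero object $H$ of $\mathcal{A}$ is monoform if for every nonzero subobject $N$ of $H$, no nonzero subobject of $H$ is isomorphic to a subobject of $H/N$. Two monoform objects are atom-equivalent if they have isomorphic nonzero subobjects (this is an equivalence relation); the class of $H$ is denoted $\overline{H}$ and called an atom; $\mathrm{ASpec}\,\mathcal{A}$ is the set of atoms. For an object $M$, $\mathrm{ASupp}(M)$ is the set of atoms $\alpha$ such that some $H\in\alpha$ is a subquotient of $M$, and $\mathrm{AAss}(M)$ is the set of atoms $\alpha$ such that some $H\in\alpha$ is a subobject of $M$. A subset $\Phi\subseteq\mathrm{ASpec}\,\mathcal{A}$ is open if for every $\alpha\in\Phi$ there is $H\in\alpha$ with $\mathrm{ASupp}(H)\subseteq\Phi$. Write $\alpha\le\beta$ if every open subset containing $\alpha$ contains $\beta$. The dimension $\dim M$ of an object $M$ is the largest non-negative integer $n$ for which there is a chain $\alpha_0<\alpha_1<\dots<\alpha_n$ of atoms in $\mathrm{ASupp}(M)$. An atom is maximal if it equals $\overline{S}$ for some simple object $S$ (equivalently, $\{\alpha\}$ is open). $\mathcal{A}$ is local if $\mathrm{ASpec}\,\mathcal{A}$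 contains exactly one maximal atom $\mathfrak{m}$. A localizing subcategory is a Serre subcategory whose quotient functor has a right adjoint; it is stable if it is closed under injective envelopes taken in $\mathcal{A}$; $\mathcal{A}$ is locally stable if every localizing subcategory of $\mathcal{A}$ is stable. $\Gamma_{\mathfrak{m}}(M)$ is the largest subobject of $M$ whose atom support is contained in $\{\mathfrak{m}\}$; since $\mathcal{A}$ is locally stable, $\Gamma_{\mathfrak{m}}$ preserves injective objects. $H^i_{\mathfrak{m}}(M)=H^i(\Gamma_{\mathfrak{m}}(I))$, where $I$ is an injective resolution of $M$. *)

theory Defs
  imports "HOL-Algebra.Ring"
begin

unbundle cardinal_syntax

section \<open>Categories, functors, adjunctions\<close>

record ('o, 'a) cat =
  Obj :: "'o set"
  Arr :: "'a set"
  Dom :: "'a \<Rightarrow> 'o"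
  Cod :: "'a \<Rightarrow> 'o"
  Ide :: "'o \<Rightarrow> 'a"
  Comp :: "'a \<Rightarrow> 'a \<Rightarrow> 'a"  (infixl "\<cdot>\<index>" 70)

definition Hom :: "('o, 'a, 'm) cat_scheme \<Rightarrow> 'o \<Rightarrow> 'o \<Rightarrow> 'a set" where
  "Hom C X Y = {f \<in> Arr C. Dom C f = X \<and> Cod C f = Y}"

locale category =
  fixes C :: "('o, 'a, 'm) cat_scheme" (structure)
  assumes Dom_Obj: "f \<in> Arr C \<Longrightarrow> Dom C f \<in> Obj C"
    and Cod_Obj: "f \<in> Arr C \<Longrightarrow> Cod C f \<in> Obj C"
    and Ide_Hom: "X \<in> Obj C \<Longrightarrow> Ide C X \<in> Hom C X X"
    and Comp_Hom: "\<lbrakk>f \<in> Hom C X Y; g \<in> Hom C Y Z\<rbrakk> \<Longrightarrow> g \<cdot> f \<in> Hom C X Z"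
    and Comp_Ide: "f \<in> Hom C X Y \<Longrightarrow> f \<cdot> Ide C X = f"
    and Ide_Comp: "f \<in> Hom C X Y \<Longrightarrow> Ide C Y \<cdot> f = f"
    and Comp_assoc: "\<lbrakk>f \<in> Hom C W X; g \<in> Hom C X Y; h \<in> Hom C Y Z\<rbrakk>
                      \<Longrightarrow> (h \<cdot> g) \<cdot> f = h \<cdot> (g \<cdot> f)"

definition is_mono :: "('o, 'a, 'm) cat_scheme \<Rightarrow> 'a \<Rightarrow> bool" where
  "is_mono C f \<longleftrightarrow> f \<in> Arr C \<and>
     (\<forall>W. \<forall>g \<in> Hom C W (Dom C f). \<forall>h \<in> Hom C W (Dom C f).
        f \<cdot>\<^bsub>C\<^esub> g = f \<cdot>\<^bsub>C\<^esub> h \<longrightarrow> g = h)"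

definition is_epi :: "('o, 'a, 'm) cat_scheme \<Rightarrow> 'a \<Rightarrow> bool" where
  "is_epi C f \<longleftrightarrow> f \<in> Arr C \<and>
     (\<forall>Z. \<forall>g \<in> Hom C (Cod C f) Z. \<forall>h \<in> Hom C (Cod C f) Z.
        g \<cdot>\<^bsub>C\<^esub> f = h \<cdot>\<^bsub>C\<^esub> f \<longrightarrow> g = h)"

definition is_iso :: "('o, 'a, 'm) cat_scheme \<Rightarrow> 'a \<Rightarrow> bool" where
  "is_iso C f \<longleftrightarrow> f \<in> Arr C \<and>
     (\<exists>g \<in> Hom C (Cod C f) (Dom C f).
        g \<cdot>\<^bsub>C\<^esub> f = Ide C (Dom C f) \<and> f \<cdot>\<^bsub>C\<^esub> g = Ide C (Cod C f))"

definition isomorphic :: "('o, 'a, 'm) cat_scheme \<Rightarrow> 'o \<Rightarrow> 'o \<Rightarrow> bool" where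
  "isomorphic C X Y \<longleftrightarrow> (\<exists>f \<in> Hom C X Y. is_iso C f)"

definition is_zero :: "('o, 'a, 'm) cat_scheme \<Rightarrow> 'o \<Rightarrow> bool" where
  "is_zero C X \<longleftrightarrow> X \<in> Obj C \<and>
     (\<forall>Y \<in> Obj C. (\<exists>!f. f \<in> Hom C X Y) \<and> (\<exists>!f. f \<in> Hom C Y X))"

definition is_coproduct ::
  "('o, 'a, 'm) cat_scheme \<Rightarrow> 'i set \<Rightarrow> ('i \<Rightarrow> 'o) \<Rightarrow> 'o \<Rightarrow> ('i \<Rightarrow> 'a) \<Rightarrow> bool" where
  "is_coproduct C I X P \<iota> \<longleftrightarrow> P \<in> Obj C \<and> (\<forall>i\<in>I. \<iota> i \<in> Hom C (X i) P) \<and>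
     (\<forall>Y \<in> Obj C. \<forall>f. (\<forall>i\<in>I. f i \<in> Hom C (X i) Y) \<longrightarrow>
        (\<exists>!h. h \<in> Hom C P Y \<and> (\<forall>i\<in>I. h \<cdot>\<^bsub>C\<^esub> \<iota> i = f i)))"

definition is_functor ::
  "('o, 'a, 'm) cat_scheme \<Rightarrow> ('p, 'b, 'n) cat_scheme \<Rightarrow> ('o \<Rightarrow> 'p) \<Rightarrow> ('a \<Rightarrow> 'b) \<Rightarrow> bool" where
  "is_functor C D Fo Fa \<longleftrightarrow>
     (\<forall>X \<in> Obj C. Fo X \<in> Obj D \<and> Fa (Ide C X) = Ide D (Fo X)) \<and>
     (\<forall>f \<in> Arr C. Fa f \<in> Hom D (Fo (Dom C f)) (Fo (Cod C f))) \<and>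
     (\<forall>f \<in> Arr C. \<forall>g \<in> Arr C. Cod C f = Dom C g \<longrightarrow>
        Fa (g \<cdot>\<^bsub>C\<^esub> f) = Fa g \<cdot>\<^bsub>D\<^esub> Fa f)"

text \<open>A right adjoint is a functor \<open>G\<close> together with bijections
  \<open>\<Phi> X Y : Hom(F X, Y) \<rightarrow> Hom(X, G Y)\<close> natural in both variables.\<close>

definition has_right_adjoint ::
  "('o, 'a, 'm) cat_scheme \<Rightarrow> ('p, 'b, 'n) cat_scheme \<Rightarrow> ('o \<Rightarrow> 'p) \<Rightarrow> ('a \<Rightarrow> 'b) \<Rightarrow> bool" where
  "has_right_adjoint C D Fo Fa \<longleftrightarrow>
     (\<exists>(Go :: 'p \<Rightarrow> 'o) (Ga :: 'b \<Rightarrow> 'a) (\<Phi> :: 'o \<Rightarrow> 'p \<Rightarrow> 'b \<Rightarrow> 'a).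
        is_functor D C Go Ga \<and>
        (\<forall>X \<in> Obj C. \<forall>Y \<in> Obj D. bij_betw (\<Phi> X Y) (Hom D (Fo X) Y) (Hom C X (Go Y))) \<and>
        (\<forall>f \<in> Arr C. \<forall>g \<in> Arr D. \<forall>h \<in> Hom D (Fo (Cod C f)) (Dom D g).
           \<Phi> (Dom C f) (Cod D g) (g \<cdot>\<^bsub>D\<^esub> h \<cdot>\<^bsub>D\<^esub> Fa f) =
           Ga g \<cdot>\<^bsub>C\<^esub> \<Phi> (Cod C f) (Dom D g) h \<cdot>\<^bsub>C\<^esub> f))"

section \<open>Abelian categories\<close>

record ('o, 'a) preadd_cat = "('o, 'a) cat" +
  Add :: "'a \<Rightarrow> 'a \<Rightarrow> 'a"
  ZeroArr :: "'o \<Rightarrow> 'o \<Rightarrow> 'a"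

definition hom_group :: "('o, 'a, 'm) preadd_cat_scheme \<Rightarrow> 'o \<Rightarrow> 'o \<Rightarrow> 'a monoid" where
  "hom_group C X Y = \<lparr>carrier = Hom C X Y, mult = Add C, one = ZeroArr C X Y\<rparr>"

locale preadditive_category = category C
  for C :: "('o, 'a, 'm) preadd_cat_scheme" (structure) +
  assumes hom_comm_group: "\<lbrakk>X \<in> Obj C; Y \<in> Obj C\<rbrakk> \<Longrightarrow> comm_group (hom_group C X Y)"
    and Comp_Add_right: "\<lbrakk>f \<in> Hom C X Y; f' \<in> Hom C X Y; g \<in> Hom C Y Z\<rbrakk>
                          \<Longrightarrow> g \<cdot> Add C f f' = Add C (g \<cdot> f) (g \<cdot> f')"
    and Comp_Add_left: "\<lbrakk>f \<in> Hom C X Y; g \<in> Hom C Y Z; g' \<in> Hom C Y Z\<rbrakk>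
                          \<Longrightarrow> Add C g g' \<cdot> f = Add C (g \<cdot> f) (g' \<cdot> f)"

definition is_kernel :: "('o, 'a, 'm) preadd_cat_scheme \<Rightarrow> 'a \<Rightarrow> 'a \<Rightarrow> bool" where
  "is_kernel C k f \<longleftrightarrow> k \<in> Arr C \<and> f \<in> Arr C \<and> Cod C k = Dom C f \<and>
     f \<cdot>\<^bsub>C\<^esub> k = ZeroArr C (Dom C k) (Cod C f) \<and>
     (\<forall>W. \<forall>g \<in> Hom C W (Dom C f). f \<cdot>\<^bsub>C\<^esub> g = ZeroArr C W (Cod C f) \<longrightarrow>
        (\<exists>!h. h \<in> Hom C W (Dom C k) \<and> k \<cdot>\<^bsub>C\<^esub> h = g))"

definition is_cokernel :: "('o, 'a, 'm) preadd_cat_scheme \<Rightarrow> 'a \<Rightarrow> 'a \<Rightarrow> bool" where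
  "is_cokernel C c f \<longleftrightarrow> c \<in> Arr C \<and> f \<in> Arr C \<and> Dom C c = Cod C f \<and>
     c \<cdot>\<^bsub>C\<^esub> f = ZeroArr C (Dom C f) (Cod C c) \<and>
     (\<forall>Z. \<forall>g \<in> Hom C (Cod C f) Z. g \<cdot>\<^bsub>C\<^esub> f = ZeroArr C (Dom C f) Z \<longrightarrow>
        (\<exists>!h. h \<in> Hom C (Cod C c) Z \<and> h \<cdot>\<^bsub>C\<^esub> c = g))"

locale abelian_category = preadditive_category +
  assumes zero_object: "\<exists>Z. is_zero C Z"
    and binary_coproducts: "\<lbrakk>X \<in> Obj C; Y \<in> Obj C\<rbrakk>
          \<Longrightarrow> \<exists>P \<iota>. is_coproduct C (UNIV :: bool set) (\<lambda>b. if b then X else Y) P \<iota>"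
    and kernels: "f \<in> Arr C \<Longrightarrow> \<exists>k. is_kernel C k f"
    and cokernels: "f \<in> Arr C \<Longrightarrow> \<exists>c. is_cokernel C c f"
    and mono_is_kernel: "is_mono C f \<Longrightarrow> \<exists>g. is_kernel C f g"
    and epi_is_cokernel: "is_epi C f \<Longrightarrow> \<exists>g. is_cokernel C f g"

text \<open>Exactness of \<open>X \<rightarrow> Y \<rightarrow> Z\<close> at \<open>Y\<close>: the image of the first arrow (the kernel of
  its cokernel) is the kernel of the second one.\<close>

definition exact_at :: "('o, 'a, 'm) preadd_cat_scheme \<Rightarrow> 'a \<Rightarrow> 'a \<Rightarrow> bool" where
  "exact_at C f g \<longleftrightarrow> (\<exists>c k. is_cokernel C c f \<and> is_kernel C k c \<and> is_kernel C k g)"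

definition short_exact :: "('o, 'a, 'm) preadd_cat_scheme \<Rightarrow> 'a \<Rightarrow> 'a \<Rightarrow> bool" where
  "short_exact C f g \<longleftrightarrow> is_kernel C f g \<and> is_cokernel C g f"

section \<open>Grothendieck categories\<close>

text \<open>Smallness is relative to a universe, as usual. A universe is given by its cardinality,
  which has to be an uncountable (strongly) inaccessible cardinal; the small sets are those of
  smaller cardinality.\<close>

definition universe :: "'u set \<Rightarrow> bool" where
  "universe U \<longleftrightarrow> |UNIV :: nat set| <o |U| \<and> regularCard |U| \<and>
     (\<forall>A :: 'u set. |A| <o |U| \<longrightarrow> |Pow A| <o |U| )"

definition small :: "'u set \<Rightarrow> 'x set \<Rightarrow> bool" where
  "small U A \<longleftrightarrow> |A| <o |U|"

definition directed_poset :: "'i set \<Rightarrow> 'i rel \<Rightarrow> bool" where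
  "directed_poset I r \<longleftrightarrow> partial_order_on I r \<and> I \<noteq> {} \<and>
     (\<forall>i\<in>I. \<forall>j\<in>I. \<exists>k\<in>I. (i, k) \<in> r \<and> (j, k) \<in> r)"

definition direct_system ::
  "('o, 'a, 'm) cat_scheme \<Rightarrow> 'i set \<Rightarrow> 'i rel \<Rightarrow> ('i \<Rightarrow> 'o) \<Rightarrow> ('i \<Rightarrow> 'i \<Rightarrow> 'a) \<Rightarrow> bool" where
  "direct_system C I r X x \<longleftrightarrow>
     (\<forall>i\<in>I. X i \<in> Obj C \<and> x i i = Ide C (X i)) \<and>
     (\<forall>i j. (i, j) \<in> r \<longrightarrow> x i j \<in> Hom C (X i) (X j)) \<and>
     (\<forall>i j k. (i, j) \<in> r \<longrightarrow> (j, k) \<in> r \<longrightarrow> x j k \<cdot>\<^bsub>C\<^esub> x i j = x i k)"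

definition is_cocone ::
  "('o, 'a, 'm) cat_scheme \<Rightarrow> 'i set \<Rightarrow> 'i rel \<Rightarrow> ('i \<Rightarrow> 'o) \<Rightarrow> ('i \<Rightarrow> 'i \<Rightarrow> 'a) \<Rightarrow>
     'o \<Rightarrow> ('i \<Rightarrow> 'a) \<Rightarrow> bool" where
  "is_cocone C I r X x L l \<longleftrightarrow> L \<in> Obj C \<and> (\<forall>i\<in>I. l i \<in> Hom C (X i) L) \<and>
     (\<forall>i j. (i, j) \<in> r \<longrightarrow> l j \<cdot>\<^bsub>C\<^esub> x i j = l i)"

definition is_direct_limit ::
  "('o, 'a, 'm) cat_scheme \<Rightarrow> 'i set \<Rightarrow> 'i rel \<Rightarrow> ('i \<Rightarrow> 'o) \<Rightarrow> ('i \<Rightarrow> 'i \<Rightarrow> 'a) \<Rightarrow>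
     'o \<Rightarrow> ('i \<Rightarrow> 'a) \<Rightarrow> bool" where
  "is_direct_limit C I r X x L l \<longleftrightarrow> is_cocone C I r X x L l \<and>
     (\<forall>L' l'. is_cocone C I r X x L' l' \<longrightarrow>
        (\<exists>!h. h \<in> Hom C L L' \<and> (\<forall>i\<in>I. h \<cdot>\<^bsub>C\<^esub> l i = l' i)))"

definition is_system_map ::
  "('o, 'a, 'm) cat_scheme \<Rightarrow> 'i set \<Rightarrow> 'i rel \<Rightarrow> ('i \<Rightarrow> 'o) \<Rightarrow> ('i \<Rightarrow> 'i \<Rightarrow> 'a) \<Rightarrow>
     ('i \<Rightarrow> 'o) \<Rightarrow> ('i \<Rightarrow> 'i \<Rightarrow> 'a) \<Rightarrow> ('i \<Rightarrow> 'a) \<Rightarrow> bool" where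
  "is_system_map C I r X x Y y f \<longleftrightarrow> (\<forall>i\<in>I. f i \<in> Hom C (X i) (Y i)) \<and>
     (\<forall>i j. (i, j) \<in> r \<longrightarrow> f j \<cdot>\<^bsub>C\<^esub> x i j = y i j \<cdot>\<^bsub>C\<^esub> f i)"

definition generating_set :: "('o, 'a, 'm) cat_scheme \<Rightarrow> 'o set \<Rightarrow> bool" where
  "generating_set C S \<longleftrightarrow> S \<subseteq> Obj C \<and>
     (\<forall>X Y. \<forall>f \<in> Hom C X Y. \<forall>g \<in> Hom C X Y. f \<noteq> g \<longrightarrow>
        (\<exists>G\<in>S. \<exists>h \<in> Hom C G X. f \<cdot>\<^bsub>C\<^esub> h \<noteq> g \<cdot>\<^bsub>C\<^esub> h))"

text \<open>Direct limits exist by the existence of coproducts and cokernels; the axiom on them below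
  says that they are exact. Index sets are taken in \<open>'u\<close>, which is no restriction since every
  small set is in bijection with a subset of \<open>U\<close>.\<close>

locale grothendieck_category = abelian_category C
  for U :: "'u set" and C :: "('o, 'a, 'm) preadd_cat_scheme" (structure) +
  assumes universe: "universe U"
    and locally_small: "\<lbrakk>X \<in> Obj C; Y \<in> Obj C\<rbrakk> \<Longrightarrow> small U (Hom C X Y)"
    and coproducts: "\<And>(I :: 'u set) X. \<lbrakk>small U I; \<forall>i\<in>I. X i \<in> Obj C\<rbrakk>
          \<Longrightarrow> \<exists>P \<iota>. is_coproduct C I X P \<iota>"
    and exact_direct_limits:
      "\<And>(I :: 'u set) r X x Y y Z z f g LX lX LY lY LZ lZ u v.
        \<lbrakk>small U I; directed_poset I r;
         direct_system C I r X x; direct_system C I r Y y; direct_system C I r Z z;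
         is_system_map C I r X x Y y f; is_system_map C I r Y y Z z g;
         \<forall>i\<in>I. short_exact C (f i) (g i);
         is_direct_limit C I r X x LX lX; is_direct_limit C I r Y y LY lY;
         is_direct_limit C I r Z z LZ lZ;
         u \<in> Hom C LX LY; \<forall>i\<in>I. u \<cdot> lX i = lY i \<cdot> f i;
         v \<in> Hom C LY LZ; \<forall>i\<in>I. v \<cdot> lY i = lZ i \<cdot> g i\<rbrakk>
        \<Longrightarrow> short_exact C u v"
    and generator: "\<exists>G. generating_set C {G}"

text \<open>Subobjects of \<open>M\<close> are represented by monomorphisms with codomain \<open>M\<close>.\<close>

definition subobj :: "('o, 'a, 'm) cat_scheme \<Rightarrow> 'o \<Rightarrow> 'a \<Rightarrow> bool" where
  "subobj C M s \<longleftrightarrow> is_mono C s \<and> Cod C s = M"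

definition sub_le :: "('o, 'a, 'm) cat_scheme \<Rightarrow> 'a \<Rightarrow> 'a \<Rightarrow> bool" where
  "sub_le C s t \<longleftrightarrow> (\<exists>h \<in> Hom C (Dom C s) (Dom C t). t \<cdot>\<^bsub>C\<^esub> h = s)"

definition noetherian_obj :: "('o, 'a, 'm) cat_scheme \<Rightarrow> 'o \<Rightarrow> bool" where
  "noetherian_obj C M \<longleftrightarrow> M \<in> Obj C \<and>
     (\<forall>s :: nat \<Rightarrow> 'a. (\<forall>n. subobj C M (s n)) \<and> (\<forall>n. sub_le C (s n) (s (Suc n))) \<longrightarrow>
        (\<exists>n0. \<forall>n\<ge>n0. sub_le C (s n) (s n0)))"

locale locally_noetherian_grothendieck_category = grothendieck_category +
  assumes noetherian_generators:
    "\<exists>S. small U S \<and> (\<forall>G\<in>S. noetherian_obj C G) \<and> generating_set C S"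

section \<open>Atoms\<close>

definition monoform :: "('o, 'a, 'm) preadd_cat_scheme \<Rightarrow> 'o \<Rightarrow> bool" where
  "monoform C H \<longleftrightarrow> H \<in> Obj C \<and> \<not> is_zero C H \<and>
     (\<forall>n q. subobj C H n \<and> \<not> is_zero C (Dom C n) \<and> is_cokernel C q n \<longrightarrow>
        \<not> (\<exists>s t. subobj C H s \<and> \<not> is_zero C (Dom C s) \<and> subobj C (Cod C q) t \<and>
               isomorphic C (Dom C s) (Dom C t)))"

definition atom_equiv :: "('o, 'a, 'm) cat_scheme \<Rightarrow> 'o \<Rightarrow> 'o \<Rightarrow> bool" where
  "atom_equiv C H H' \<longleftrightarrow>
     (\<exists>s t. subobj C H s \<and> subobj C H' t \<and> \<not> is_zero C (Dom C s) \<and> \<not> is_zero C (Dom C t) \<and>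
            isomorphic C (Dom C s) (Dom C t))"

definition atom_of :: "('o, 'a, 'm) preadd_cat_scheme \<Rightarrow> 'o \<Rightarrow> 'o set" where
  "atom_of C H = {H'. monoform C H' \<and> atom_equiv C H H'}"

definition ASpec :: "('o, 'a, 'm) preadd_cat_scheme \<Rightarrow> 'o set set" where
  "ASpec C = {atom_of C H | H. monoform C H}"

text \<open>Subquotients are quotients of subobjects.\<close>

definition subquotient :: "('o, 'a, 'm) cat_scheme \<Rightarrow> 'o \<Rightarrow> 'o \<Rightarrow> bool" where
  "subquotient C M H \<longleftrightarrow>
     (\<exists>s e. subobj C M s \<and> is_epi C e \<and> Dom C e = Dom C s \<and> Cod C e = H)"

definition ASupp :: "('o, 'a, 'm) preadd_cat_scheme \<Rightarrow> 'o \<Rightarrow> 'o set set" where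
  "ASupp C M = {\<alpha> \<in> ASpec C. \<exists>H\<in>\<alpha>. subquotient C M H}"

definition AAss :: "('o, 'a, 'm) preadd_cat_scheme \<Rightarrow> 'o \<Rightarrow> 'o set set" where
  "AAss C M = {\<alpha> \<in> ASpec C. \<exists>H\<in>\<alpha>. \<exists>s. subobj C M s \<and> Dom C s = H}"

definition open_atoms :: "('o, 'a, 'm) preadd_cat_scheme \<Rightarrow> 'o set set \<Rightarrow> bool" where
  "open_atoms C \<Phi> \<longleftrightarrow> \<Phi> \<subseteq> ASpec C \<and> (\<forall>\<alpha>\<in>\<Phi>. \<exists>H\<in>\<alpha>. ASupp C H \<subseteq> \<Phi>)"

definition atom_le :: "('o, 'a, 'm) preadd_cat_scheme \<Rightarrow> 'o set \<Rightarrow> 'o set \<Rightarrow> bool" where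
  "atom_le C \<alpha> \<beta> \<longleftrightarrow> (\<forall>\<Phi>. open_atoms C \<Phi> \<and> \<alpha> \<in> \<Phi> \<longrightarrow> \<beta> \<in> \<Phi>)"

definition atom_less :: "('o, 'a, 'm) preadd_cat_scheme \<Rightarrow> 'o set \<Rightarrow> 'o set \<Rightarrow> bool" where
  "atom_less C \<alpha> \<beta> \<longleftrightarrow> atom_le C \<alpha> \<beta> \<and> \<alpha> \<noteq> \<beta>"

definition atom_chain :: "('o, 'a, 'm) preadd_cat_scheme \<Rightarrow> 'o \<Rightarrow> nat \<Rightarrow> bool" where
  "atom_chain C M n \<longleftrightarrow>
     (\<exists>\<alpha> :: nat \<Rightarrow> 'o set. (\<forall>i\<le>n. \<alpha> i \<in> ASupp C M) \<and> (\<forall>i<n. atom_less C (\<alpha> i) (\<alpha> (Suc i))))"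

definition has_dimension :: "('o, 'a, 'm) preadd_cat_scheme \<Rightarrow> 'o \<Rightarrow> nat \<Rightarrow> bool" where
  "has_dimension C M n \<longleftrightarrow> atom_chain C M n \<and> (\<forall>k. atom_chain C M k \<longrightarrow> k \<le> n)"

definition simple_obj :: "('o, 'a, 'm) cat_scheme \<Rightarrow> 'o \<Rightarrow> bool" where
  "simple_obj C S \<longleftrightarrow> S \<in> Obj C \<and> \<not> is_zero C S \<and>
     (\<forall>s. subobj C S s \<longrightarrow> is_zero C (Dom C s) \<or> is_iso C s)"

definition maximal_atom :: "('o, 'a, 'm) preadd_cat_scheme \<Rightarrow> 'o set \<Rightarrow> bool" where
  "maximal_atom C \<alpha> \<longleftrightarrow> \<alpha> \<in> ASpec C \<and> (\<exists>S. simple_obj C S \<and> \<alpha> = atom_of C S)"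

definition local_cat :: "('o, 'a, 'm) preadd_cat_scheme \<Rightarrow> bool" where
  "local_cat C \<longleftrightarrow> (\<exists>!\<alpha>. maximal_atom C \<alpha>)"

section \<open>Serre quotients, localizing subcategories, stability\<close>

text \<open>Full subcategories are given by their classes of objects.\<close>

definition serre_subcat :: "('o, 'a, 'm) preadd_cat_scheme \<Rightarrow> 'o set \<Rightarrow> bool" where
  "serre_subcat C X \<longleftrightarrow> X \<subseteq> Obj C \<and> X \<noteq> {} \<and>
     (\<forall>f g. short_exact C f g \<longrightarrow> (Cod C f \<in> X \<longleftrightarrow> Dom C f \<in> X \<and> Cod C g \<in> X))"

text \<open>The quotient category by \<open>X\<close> is the localization at the arrows whose kernel and cokernel
  lie in \<open>X\<close>. These admit a calculus of fractions, so an arrow \<open>M \<rightarrow> N\<close> of the quotient is a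
  class of roofs \<open>M \<leftarrow>s\<midarrow> P \<midarrow>f\<rightarrow> N\<close>, written \<open>(s, f)\<close>, with \<open>s\<close> such an arrow.\<close>

definition quot_iso :: "('o, 'a, 'm) preadd_cat_scheme \<Rightarrow> 'o set \<Rightarrow> 'a \<Rightarrow> bool" where
  "quot_iso C X s \<longleftrightarrow> s \<in> Arr C \<and> (\<forall>k. is_kernel C k s \<longrightarrow> Dom C k \<in> X) \<and>
     (\<forall>c. is_cokernel C c s \<longrightarrow> Cod C c \<in> X)"

definition roofs :: "('o, 'a, 'm) preadd_cat_scheme \<Rightarrow> 'o set \<Rightarrow> ('a \<times> 'a) set" where
  "roofs C X = {(s, f). quot_iso C X s \<and> f \<in> Arr C \<and> Dom C s = Dom C f}"

definition roof_equiv ::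
  "('o, 'a, 'm) preadd_cat_scheme \<Rightarrow> 'o set \<Rightarrow> 'a \<times> 'a \<Rightarrow> 'a \<times> 'a \<Rightarrow> bool" where
  "roof_equiv C X = (\<lambda>(s, f) (t, g). (s, f) \<in> roofs C X \<and> (t, g) \<in> roofs C X \<and>
     Cod C s = Cod C t \<and> Cod C f = Cod C g \<and>
     (\<exists>Q. \<exists>u \<in> Hom C Q (Dom C s). \<exists>v \<in> Hom C Q (Dom C t).
        s \<cdot>\<^bsub>C\<^esub> u = t \<cdot>\<^bsub>C\<^esub> v \<and> f \<cdot>\<^bsub>C\<^esub> u = g \<cdot>\<^bsub>C\<^esub> v \<and> quot_iso C X (s \<cdot>\<^bsub>C\<^esub> u)))"

definition roof_class ::
  "('o, 'a, 'm) preadd_cat_scheme \<Rightarrow> 'o set \<Rightarrow> 'a \<times> 'a \<Rightarrow> ('a \<times> 'a) set" where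
  "roof_class C X r = {r'. roof_equiv C X r r'}"

text \<open>The composite of the classes of \<open>(s, f)\<close> and \<open>(t, g)\<close> is the class of \<open>(s u, g v)\<close>, where
  \<open>f u = t v\<close> is any completion to a commutative square with \<open>u\<close> inverted.\<close>

definition quot_comp ::
  "('o, 'a, 'm) preadd_cat_scheme \<Rightarrow> 'o set \<Rightarrow> ('a \<times> 'a) set \<Rightarrow> ('a \<times> 'a) set \<Rightarrow> ('a \<times> 'a) set"
  where
  "quot_comp C X b a = {r. \<exists>s f t g Q u v. (s, f) \<in> a \<and> (t, g) \<in> b \<and>
     u \<in> Hom C Q (Dom C f) \<and> v \<in> Hom C Q (Dom C t) \<and> quot_iso C X u \<and>
     f \<cdot>\<^bsub>C\<^esub> u = t \<cdot>\<^bsub>C\<^esub> v \<and> roof_equiv C X (s \<cdot>\<^bsub>C\<^esub> u, g \<cdot>\<^bsub>C\<^esub> v) r}"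

definition quot_cat ::
  "('o, 'a, 'm) preadd_cat_scheme \<Rightarrow> 'o set \<Rightarrow> ('o, ('a \<times> 'a) set) cat" where
  "quot_cat C X = \<lparr>
     Obj = Obj C,
     Arr = roof_class C X ` roofs C X,
     Dom = (\<lambda>a. Cod C (fst (SOME r. r \<in> a))),
     Cod = (\<lambda>a. Cod C (snd (SOME r. r \<in> a))),
     Ide = (\<lambda>M. roof_class C X (Ide C M, Ide C M)),
     Comp = quot_comp C X\<rparr>"

definition quot_functor_arr ::
  "('o, 'a, 'm) preadd_cat_scheme \<Rightarrow> 'o set \<Rightarrow> 'a \<Rightarrow> ('a \<times> 'a) set" where
  "quot_functor_arr C X f = roof_class C X (Ide C (Dom C f), f)"

definition localizing_subcat :: "('o, 'a, 'm) preadd_cat_scheme \<Rightarrow> 'o set \<Rightarrow> bool" where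
  "localizing_subcat C X \<longleftrightarrow> serre_subcat C X \<and>
     has_right_adjoint C (quot_cat C X) (\<lambda>M. M) (quot_functor_arr C X)"

definition injective_obj :: "('o, 'a, 'm) cat_scheme \<Rightarrow> 'o \<Rightarrow> bool" where
  "injective_obj C E \<longleftrightarrow> E \<in> Obj C \<and>
     (\<forall>i. is_mono C i \<longrightarrow> (\<forall>f \<in> Hom C (Dom C i) E. \<exists>g \<in> Hom C (Cod C i) E. g \<cdot>\<^bsub>C\<^esub> i = f))"

definition essential_mono :: "('o, 'a, 'm) cat_scheme \<Rightarrow> 'a \<Rightarrow> bool" where
  "essential_mono C e \<longleftrightarrow> is_mono C e \<and>
     (\<forall>f \<in> Arr C. Dom C f = Cod C e \<and> is_mono C (f \<cdot>\<^bsub>C\<^esub> e) \<longrightarrow> is_mono C f)"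

definition is_injective_envelope :: "('o, 'a, 'm) cat_scheme \<Rightarrow> 'a \<Rightarrow> bool" where
  "is_injective_envelope C e \<longleftrightarrow> essential_mono C e \<and> injective_obj C (Cod C e)"

definition stable_subcat :: "('o, 'a, 'm) cat_scheme \<Rightarrow> 'o set \<Rightarrow> bool" where
  "stable_subcat C X \<longleftrightarrow> (\<forall>e. is_injective_envelope C e \<and> Dom C e \<in> X \<longrightarrow> Cod C e \<in> X)"

definition locally_stable :: "('o, 'a, 'm) preadd_cat_scheme \<Rightarrow> bool" where
  "locally_stable C \<longleftrightarrow> (\<forall>X. localizing_subcat C X \<longrightarrow> stable_subcat C X)"

section \<open>Local cohomology\<close>

text \<open>\<open>is_Gamma C \<mm> M \<gamma>\<close>: the monomorphism \<open>\<gamma>\<close> is the inclusion into \<open>M\<close> of the largest subobject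
  with atom support contained in \<open>{\<mm>}\<close>.\<close>

definition is_Gamma :: "('o, 'a, 'm) preadd_cat_scheme \<Rightarrow> 'o set \<Rightarrow> 'o \<Rightarrow> 'a \<Rightarrow> bool" where
  "is_Gamma C \<mm> M \<gamma> \<longleftrightarrow> subobj C M \<gamma> \<and> ASupp C (Dom C \<gamma>) \<subseteq> {\<mm>} \<and>
     (\<forall>s. subobj C M s \<and> ASupp C (Dom C s) \<subseteq> {\<mm>} \<longrightarrow> sub_le C s \<gamma>)"

definition is_injective_resolution ::
  "('o, 'a, 'm) preadd_cat_scheme \<Rightarrow> 'o \<Rightarrow> 'a \<Rightarrow> (nat \<Rightarrow> 'o) \<Rightarrow> (nat \<Rightarrow> 'a) \<Rightarrow> bool" where
  "is_injective_resolution C M e I d \<longleftrightarrow>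
     (\<forall>n. injective_obj C (I n) \<and> d n \<in> Hom C (I n) (I (Suc n))) \<and>
     e \<in> Hom C M (I 0) \<and> is_kernel C e (d 0) \<and>
     (\<forall>n. exact_at C (d n) (d (Suc n)))"

definition is_cohomology ::
  "('o, 'a, 'm) preadd_cat_scheme \<Rightarrow> (nat \<Rightarrow> 'a) \<Rightarrow> nat \<Rightarrow> 'o \<Rightarrow> bool" where
  "is_cohomology C \<delta> i H \<longleftrightarrow>
     (\<exists>k. is_kernel C k (\<delta> i) \<and>
        (case i of
           0 \<Rightarrow> H = Dom C k
         | Suc j \<Rightarrow> \<exists>b \<in> Hom C (Dom C (\<delta> j)) (Dom C k). \<exists>c.
                     k \<cdot>\<^bsub>C\<^esub> b = \<delta> j \<and> is_cokernel C c b \<and> Cod C c = H))"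

text \<open>\<open>is_local_cohomology C \<mm> i M H\<close>: the object \<open>H\<close> is a realisation of \<open>H\<^sup>i\<^sub>\<mm>(M)\<close>, which is
  determined up to isomorphism only. The complex \<open>\<delta>\<close> is the restriction of the resolution \<open>d\<close>
  to the subobjects \<open>\<gamma> n\<close>.\<close>

definition is_local_cohomology ::
  "('o, 'a, 'm) preadd_cat_scheme \<Rightarrow> 'o set \<Rightarrow> nat \<Rightarrow> 'o \<Rightarrow> 'o \<Rightarrow> bool" where
  "is_local_cohomology C \<mm> i M H \<longleftrightarrow>
     (\<exists>e I d \<gamma> \<delta>. is_injective_resolution C M e I d \<and>
        (\<forall>n. is_Gamma C \<mm> (I n) (\<gamma> n)) \<and>
        (\<forall>n. \<delta> n \<in> Hom C (Dom C (\<gamma> n)) (Dom C (\<gamma> (Suc n))) \<and>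
             \<gamma> (Suc n) \<cdot>\<^bsub>C\<^esub> \<delta> n = d n \<cdot>\<^bsub>C\<^esub> \<gamma> n) \<and>
        is_cohomology C \<delta> i H)"

section \<open>Endomorphism rings\<close>

definition End_ring :: "('o, 'a, 'm) preadd_cat_scheme \<Rightarrow> 'o \<Rightarrow> 'a ring" where
  "End_ring C M = \<lparr>carrier = Hom C M M, mult = Comp C, one = Ide C M,
                   zero = ZeroArr C M M, add = Add C\<rparr>"

definition skew_field :: "('a, 'm) ring_scheme \<Rightarrow> bool" where
  "skew_field R \<longleftrightarrow> ring R \<and> Units R = carrier R - {\<zero>\<^bsub>R\<^esub>}"

end

theory Submission
  imports Defs
begin

text \<open>Let \<open>\<alpha> \<noteq> \<mm>\<close> be an associated atom of \<open>N / \<Gamma> N\<close> and \<open>M \<in> \<alpha>\<close> a monoform object with a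
  monomorphism \<open>f : M \<rightarrow> M\<close> that is not invertible. Stability of the localizing subcategories of
  objects with prescribed support shows that \<open>M\<close>, which lies in the injective envelope of every
  \<open>L \<in> \<alpha>\<close>, has no larger support than \<open>L\<close>; as \<open>dim N = 1\<close>, its support is contained in
  \<open>{\<alpha>, \<mm>}\<close>, so all proper quotients of \<open>M\<close> are \<open>\<mm>\<close>-torsion. Embed \<open>M\<close> in the first term
  \<open>I\<^sub>0\<close> of the resolution so that it meets \<open>N\<close>, and extend along \<open>f\<close> to a chain of
  monomorphisms \<open>g\<^sub>n : M \<rightarrow> I\<^sub>0\<close> with \<open>g\<^sub>n\<^sub>+\<^sub>1 f = g\<^sub>n\<close>. Modulo \<open>N\<close> their images are torsion, so
  they lie in the preimage \<open>W\<close> of \<open>\<Gamma> I\<^sub>1\<close>. If \<open>H\<^sup>1 = W / (N + \<Gamma> I\<^sub>0)\<close> were noetherian, then so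
  would be \<open>W / \<Gamma> I\<^sub>0\<close>, the chain would become stationary, and \<open>f\<close> would be invertible.

  By (AB5) the objects whose support lies in a given set are closed under sums. The torsionfree
  quotient of any object then embeds into a closed one by a single pushout, and this reflection
  is the right adjoint that makes the subcategory localizing.\<close>

section \<open>Categories with zero arrows\<close>

text \<open>Local stability is a hypothesis on localizing subcategories, and by definition these
  carry a right adjoint on the explicit category of roofs. To use it for a class of objects with
  prescribed support, that adjoint must be produced for an arbitrary set of atoms; this accounts for
  the long middle part on coproducts, closed objects and roofs. Stability is also a statement about
  injective envelopes, whereas the only injective objects at hand are the terms of the given
  resolution; envelopes are therefore carved out of an injective object into which the source is
  already known to embed. Diagram chases use generalised elements, that is, arrows from an arbitrary
  test object; choosing a preimage under an epimorphism becomes replacing the test object by an epic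
  cover. The endomorphism \<open>f\<close> exists because nonzero endomorphisms of a monoform object
  are monic, so a failure of invertibility can only be a failure to be epic.\<close>

context category
begin

abbreviation "mor \<equiv> Hom C"

lemma hom_iff: "f \<in> mor X Y \<longleftrightarrow> f \<in> Arr C \<and> Dom C f = X \<and> Cod C f = Y \<and> X \<in> Obj C \<and> Y \<in> Obj C"
  using Dom_Obj Cod_Obj by (auto simp: Hom_def)

lemma homI: "f \<in> Arr C \<Longrightarrow> f \<in> mor (Dom C f) (Cod C f)"
  by (simp add: Hom_def)

lemma hom_obj: "f \<in> mor X Y \<Longrightarrow> X \<in> Obj C \<and> Y \<in> Obj C"
  by (simp add: hom_iff)

lemma hom_DC: "f \<in> mor X Y \<Longrightarrow> Dom C f = X" "f \<in> mor X Y \<Longrightarrow> Cod C f = Y"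
  by (simp_all add: hom_iff)

lemma arr_comp [simp]:
  assumes "f \<in> Arr C" "g \<in> Arr C" "Cod C f = Dom C g"
  shows "g \<cdot> f \<in> Arr C" "Dom C (g \<cdot> f) = Dom C f" "Cod C (g \<cdot> f) = Cod C g"
  using Comp_Hom[of f "Dom C f" "Dom C g" g "Cod C g"] assms by (auto simp: Hom_def)

lemma arr_assoc [simp]:
  assumes "f \<in> Arr C" "g \<in> Arr C" "h \<in> Arr C" "Cod C f = Dom C g" "Cod C g = Dom C h"
  shows "(h \<cdot> g) \<cdot> f = h \<cdot> (g \<cdot> f)"
  using Comp_assoc[of f "Dom C f" "Dom C g" g "Dom C h" h "Cod C h"] assms by (auto simp: Hom_def)

lemma arr_ide [simp]:
  assumes "X \<in> Obj C"
  shows "Ide C X \<in> Arr C" "Dom C (Ide C X) = X" "Cod C (Ide C X) = X"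
  using Ide_Hom[OF assms] by (auto simp: Hom_def)

lemma comp_ide [simp]:
  assumes "f \<in> Arr C"
  shows "Dom C f = X \<Longrightarrow> f \<cdot> Ide C X = f" "Cod C f = X \<Longrightarrow> Ide C X \<cdot> f = f"
  using Comp_Ide[of f "Dom C f" "Cod C f"] Ide_Comp[of f "Dom C f" "Cod C f"] assms
  by (auto simp: Hom_def)

text \<open>Moves a commuting square past a generalised element \<open>w\<close>. This form and
  \<open>comp_ext1\<close> carry nearly all the bookkeeping of associativity in the diagram
  chases.\<close>

lemma comp_ext:
  assumes "g \<cdot> f = g' \<cdot> f'" "f \<in> mor X Y" "g \<in> mor Y Z" "f' \<in> mor X Y'" "g' \<in> mor Y' Z" "w \<in> mor W X"
  shows "g \<cdot> (f \<cdot> w) = g' \<cdot> (f' \<cdot> w)"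
  using assms(1) Comp_assoc[OF assms(6,2,3)] Comp_assoc[OF assms(6,4,5)] by simp

lemma comp_ext1:
  assumes "g \<cdot> f = h" "f \<in> mor X Y" "g \<in> mor Y Z" "w \<in> mor W X"
  shows "g \<cdot> (f \<cdot> w) = h \<cdot> w"
  using assms(1) Comp_assoc[OF assms(4,2,3)] by simp

lemma monoD: "is_mono C f \<Longrightarrow> f \<in> mor X Y \<Longrightarrow> g \<in> mor W X \<Longrightarrow> h \<in> mor W X \<Longrightarrow> f \<cdot> g = f \<cdot> h \<Longrightarrow> g = h"
  using hom_DC(1)[of f X Y] unfolding is_mono_def by blast

lemma epiD: "is_epi C f \<Longrightarrow> f \<in> mor X Y \<Longrightarrow> g \<in> mor Y Z \<Longrightarrow> h \<in> mor Y Z \<Longrightarrow> g \<cdot> f = h \<cdot> f \<Longrightarrow> g = h"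
  using hom_DC(2)[of f X Y] unfolding is_epi_def by blast

lemma mono_arr: "is_mono C f \<Longrightarrow> f \<in> Arr C" and epi_arr: "is_epi C f \<Longrightarrow> f \<in> Arr C"
  by (simp_all add: is_mono_def is_epi_def)

lemma mono_comp: assumes "is_mono C f" "is_mono C g" "f \<in> mor X Y" "g \<in> mor Y Z" shows "is_mono C (g \<cdot> f)"
  unfolding is_mono_def
proof (intro conjI allI ballI impI)
  show "g \<cdot> f \<in> Arr C" using assms by (simp add: hom_iff)
  fix W a b assume "a \<in> mor W (Dom C (g \<cdot> f))" "b \<in> mor W (Dom C (g \<cdot> f))" and e: "g \<cdot> f \<cdot> a = g \<cdot> f \<cdot> b"
  then have a: "a \<in> mor W X" and b: "b \<in> mor W X" using assms by (auto simp: hom_iff)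
  have "g \<cdot> (f \<cdot> a) = g \<cdot> (f \<cdot> b)" using e Comp_assoc[OF a assms(3,4)] Comp_assoc[OF b assms(3,4)] by simp
  then have "f \<cdot> a = f \<cdot> b" using monoD[OF assms(2,4)] Comp_Hom[OF _ assms(3)] a b by blast
  then show "a = b" using monoD[OF assms(1,3)] a b by blast
qed

lemma epi_comp: assumes "is_epi C f" "is_epi C g" "f \<in> mor X Y" "g \<in> mor Y Z" shows "is_epi C (g \<cdot> f)"
  unfolding is_epi_def
proof (intro conjI allI ballI impI)
  show "g \<cdot> f \<in> Arr C" using assms by (simp add: hom_iff)
  fix W a b assume "a \<in> mor (Cod C (g \<cdot> f)) W" "b \<in> mor (Cod C (g \<cdot> f)) W" and e: "a \<cdot> (g \<cdot> f) = b \<cdot> (g \<cdot> f)"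
  then have a: "a \<in> mor Z W" and b: "b \<in> mor Z W" using assms by (auto simp: hom_iff)
  have "(a \<cdot> g) \<cdot> f = (b \<cdot> g) \<cdot> f" using e Comp_assoc[OF assms(3,4) a] Comp_assoc[OF assms(3,4) b] by simp
  then have "a \<cdot> g = b \<cdot> g" using epiD[OF assms(1,3)] Comp_Hom[OF assms(4)] a b by blast
  then show "a = b" using epiD[OF assms(2,4)] a b by blast
qed

lemma mono_cancel: assumes "is_mono C (g \<cdot> f)" "f \<in> mor X Y" "g \<in> mor Y Z" shows "is_mono C f"
  unfolding is_mono_def
proof (intro conjI allI ballI impI)
  show "f \<in> Arr C" using assms by (simp add: hom_iff)
  fix W a b assume "a \<in> mor W (Dom C f)" "b \<in> mor W (Dom C f)" and e: "f \<cdot> a = f \<cdot> b"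
  then have a: "a \<in> mor W X" and b: "b \<in> mor W X" using assms by (auto simp: hom_iff)
  have "(g \<cdot> f) \<cdot> a = (g \<cdot> f) \<cdot> b" using e Comp_assoc[OF a assms(2,3)] Comp_assoc[OF b assms(2,3)] by simp
  then show "a = b" using monoD[OF assms(1) Comp_Hom[OF assms(2,3)]] a b by blast
qed

lemma epi_cancel: assumes "is_epi C (g \<cdot> f)" "f \<in> mor X Y" "g \<in> mor Y Z" shows "is_epi C g"
  unfolding is_epi_def
proof (intro conjI allI ballI impI)
  show "g \<in> Arr C" using assms by (simp add: hom_iff)
  fix W a b assume "a \<in> mor (Cod C g) W" "b \<in> mor (Cod C g) W" and e: "a \<cdot> g = b \<cdot> g"
  then have a: "a \<in> mor Z W" and b: "b \<in> mor Z W" using assms by (auto simp: hom_iff)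
  have "a \<cdot> (g \<cdot> f) = b \<cdot> (g \<cdot> f)" using e Comp_assoc[OF assms(2,3) a] Comp_assoc[OF assms(2,3) b] by simp
  then show "a = b" using epiD[OF assms(1) Comp_Hom[OF assms(2,3)]] a b by blast
qed

lemma ide_mono: "X \<in> Obj C \<Longrightarrow> is_mono C (Ide C X)" and ide_epi: "X \<in> Obj C \<Longrightarrow> is_epi C (Ide C X)"
  by (auto simp: is_mono_def is_epi_def hom_iff)

lemma isoE:
  assumes "is_iso C f" "f \<in> mor X Y"
  obtains g where "g \<in> mor Y X" "g \<cdot> f = Ide C X" "f \<cdot> g = Ide C Y"
  using assms by (auto simp: is_iso_def hom_iff)

lemma isoI: "f \<in> mor X Y \<Longrightarrow> g \<in> mor Y X \<Longrightarrow> g \<cdot> f = Ide C X \<Longrightarrow> f \<cdot> g = Ide C Y \<Longrightarrow> is_iso C f"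
  by (auto simp: is_iso_def hom_iff)

lemma iso_mono_epi: assumes "is_iso C f" shows "is_mono C f" "is_epi C f"
proof -
  have f: "f \<in> mor (Dom C f) (Cod C f)" using assms by (simp add: is_iso_def homI)
  obtain g where g: "g \<in> mor (Cod C f) (Dom C f)" "g \<cdot> f = Ide C (Dom C f)" "f \<cdot> g = Ide C (Cod C f)"
    using isoE[OF assms f] .
  show "is_mono C f" using mono_cancel[of g f] f g by (metis ide_mono hom_obj)
  show "is_epi C f" using epi_cancel[of f g] f g by (metis ide_epi hom_obj)
qed

end

section \<open>Preadditive categories: differences, zero arrows, kernels\<close>

context preadditive_category
begin

abbreviation "zer \<equiv> ZeroArr C"

text \<open>The structure provides only \<open>Add\<close> and zero arrows, so the negative is taken
  in the group \<open>hom_group\<close> that the domain and codomain of \<open>f\<close>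
  select.\<close>

definition dif :: "'a \<Rightarrow> 'a \<Rightarrow> 'a" where
  "dif f g = Add C f (inv\<^bsub>hom_group C (Dom C f) (Cod C f)\<^esub> g)"

lemma hom_group_simps [simp]: "carrier (hom_group C X Y) = mor X Y" "mult (hom_group C X Y) = Add C"
  "one (hom_group C X Y) = zer X Y"
  by (simp_all add: hom_group_def)

lemma zer_hom: "X \<in> Obj C \<Longrightarrow> Y \<in> Obj C \<Longrightarrow> zer X Y \<in> mor X Y"
proof -
  assume "X \<in> Obj C" "Y \<in> Obj C"
  then interpret G: comm_group "hom_group C X Y" by (rule hom_comm_group)
  show ?thesis using G.one_closed by simp
qed

lemma arr_zer [simp]: assumes "X \<in> Obj C" "Y \<in> Obj C"
  shows "zer X Y \<in> Arr C" "Dom C (zer X Y) = X" "Cod C (zer X Y) = Y"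
  using zer_hom[OF assms] by (auto simp: hom_iff)

lemma comp_zer [simp]: assumes "f \<in> Arr C" "Dom C f = Y" "X \<in> Obj C"
  shows "f \<cdot> zer X Y = zer X (Cod C f)"
proof -
  let ?Z = "Cod C f"
  have f: "f \<in> mor Y ?Z" using assms by (simp add: Hom_def)
  have Y: "Y \<in> Obj C" "?Z \<in> Obj C" using hom_obj f by auto
  interpret G: comm_group "hom_group C X ?Z" using hom_comm_group assms Y by simp
  interpret K: comm_group "hom_group C X Y" using hom_comm_group assms Y by simp
  have z: "zer X Y \<in> mor X Y" using zer_hom assms Y by simp
  have "Add C (f \<cdot> zer X Y) (f \<cdot> zer X Y) = f \<cdot> Add C (zer X Y) (zer X Y)"
    using Comp_Add_right[OF z z f] by simp
  also have "Add C (zer X Y) (zer X Y) = zer X Y" using K.l_one[of "zer X Y"] z by simp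
  finally show ?thesis using G.r_cancel_one[of "f \<cdot> zer X Y" "f \<cdot> zer X Y"] Comp_Hom[OF z f] by simp
qed

lemma zer_comp [simp]: assumes "f \<in> Arr C" "Cod C f = Y" "Z \<in> Obj C"
  shows "zer Y Z \<cdot> f = zer (Dom C f) Z"
proof -
  let ?X = "Dom C f"
  have f: "f \<in> mor ?X Y" using assms by (simp add: Hom_def)
  have Y: "Y \<in> Obj C" "?X \<in> Obj C" using hom_obj f by auto
  interpret G: comm_group "hom_group C ?X Z" using hom_comm_group assms Y by simp
  interpret K: comm_group "hom_group C Y Z" using hom_comm_group assms Y by simp
  have z: "zer Y Z \<in> mor Y Z" using zer_hom assms Y by simp
  have "Add C (zer Y Z \<cdot> f) (zer Y Z \<cdot> f) = Add C (zer Y Z) (zer Y Z) \<cdot> f"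
    using Comp_Add_left[OF f z z] by simp
  also have "Add C (zer Y Z) (zer Y Z) = zer Y Z" using K.l_one[of "zer Y Z"] z by simp
  finally show ?thesis using G.r_cancel_one[of "zer Y Z \<cdot> f" "zer Y Z \<cdot> f"] Comp_Hom[OF f z] by simp
qed

lemma comp_zer': "f \<in> mor Y Z \<Longrightarrow> X \<in> Obj C \<Longrightarrow> f \<cdot> zer X Y = zer X Z"
  by (simp add: hom_iff)

lemma zer_comp': "f \<in> mor X Y \<Longrightarrow> Z \<in> Obj C \<Longrightarrow> zer Y Z \<cdot> f = zer X Z"
  by (simp add: hom_iff)

lemma dif_hom: "f \<in> mor X Y \<Longrightarrow> g \<in> mor X Y \<Longrightarrow> dif f g \<in> mor X Y"
proof -
  assume f: "f \<in> mor X Y" and g: "g \<in> mor X Y"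
  interpret G: comm_group "hom_group C X Y" using hom_comm_group f hom_obj by blast
  show ?thesis using f g G.m_closed G.inv_closed by (auto simp: dif_def hom_DC)
qed

lemma dif_eq: assumes f: "f \<in> mor X Y" and g: "g \<in> mor X Y" shows "dif f g = zer X Y \<longleftrightarrow> f = g"
proof -
  interpret G: comm_group "hom_group C X Y" using hom_comm_group f hom_obj by blast
  show ?thesis using f g G.r_inv G.inv_equality G.inv_inv by (auto simp: dif_def hom_DC) (metis G.inv_closed G.inv_equality G.inv_inv hom_group_simps)
qed

text \<open>Characterises the difference by \<open>Add\<close> alone, so that distributivity of
  composition over \<open>dif\<close> follows without computing with inverses.\<close>

lemma dif_unique: assumes f: "f \<in> mor X Y" and g: "g \<in> mor X Y" and h: "h \<in> mor X Y" and "Add C h g = f"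
  shows "h = dif f g"
proof -
  interpret G: comm_group "hom_group C X Y" using hom_comm_group f hom_obj by blast
  show ?thesis using assms G.inv_solve_right by (auto simp: dif_def hom_DC)
qed

lemma dif_add: assumes f: "f \<in> mor X Y" and g: "g \<in> mor X Y" shows "Add C (dif f g) g = f"
proof -
  interpret G: comm_group "hom_group C X Y" using hom_comm_group f hom_obj by blast
  show ?thesis using f g G.m_assoc[of f "inv\<^bsub>hom_group C X Y\<^esub> g" g] G.inv_closed G.l_inv G.r_one by (simp add: dif_def hom_DC)
qed

lemma comp_dif: assumes "f \<in> mor X Y" "g \<in> mor X Y" "h \<in> mor Y Z"
  shows "h \<cdot> dif f g = dif (h \<cdot> f) (h \<cdot> g)"
proof -
  note d = dif_hom[OF assms(1,2)]
  have "Add C (h \<cdot> dif f g) (h \<cdot> g) = h \<cdot> f"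
    using Comp_Add_right[OF d assms(2,3)] dif_add[OF assms(1,2)] by simp
  then show ?thesis
    by (rule dif_unique[OF Comp_Hom[OF assms(1,3)] Comp_Hom[OF assms(2,3)] Comp_Hom[OF d assms(3)]])
qed

lemma dif_comp: assumes "f \<in> mor X Y" "g \<in> mor X Y" "h \<in> mor W X"
  shows "dif f g \<cdot> h = dif (f \<cdot> h) (g \<cdot> h)"
proof -
  note d = dif_hom[OF assms(1,2)]
  have "Add C (dif f g \<cdot> h) (g \<cdot> h) = f \<cdot> h"
    using Comp_Add_left[OF assms(3) d assms(2)] dif_add[OF assms(1,2)] by simp
  then show ?thesis
    by (rule dif_unique[OF Comp_Hom[OF assms(3,1)] Comp_Hom[OF assms(3,2)] Comp_Hom[OF assms(3) d]])
qed

lemma dif_zer: assumes f: "f \<in> mor X Y" shows "dif f (zer X Y) = f"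
proof -
  interpret G: comm_group "hom_group C X Y" using hom_comm_group f hom_obj by blast
  show ?thesis using f G.inv_one G.r_one[of f] by (simp add: dif_def hom_DC)
qed

lemma mono_zerI:
  assumes "f \<in> mor X Y" "\<And>W g. g \<in> mor W X \<Longrightarrow> f \<cdot> g = zer W Y \<Longrightarrow> g = zer W X"
  shows "is_mono C f"
  unfolding is_mono_def
proof (intro conjI allI ballI impI)
  show "f \<in> Arr C" using assms by (simp add: hom_iff)
  fix W a b assume "a \<in> mor W (Dom C f)" "b \<in> mor W (Dom C f)" and e: "f \<cdot> a = f \<cdot> b"
  then have a: "a \<in> mor W X" and b: "b \<in> mor W X" using assms by (auto simp: hom_iff)
  have "f \<cdot> dif a b = zer W Y" using comp_dif[OF a b assms(1)] e dif_eq Comp_Hom[OF _ assms(1)] a b by metis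
  then show "a = b" using assms(2)[OF dif_hom[OF a b]] dif_eq[OF a b] by simp
qed

lemma epi_zerI:
  assumes "f \<in> mor X Y" "\<And>Z g. g \<in> mor Y Z \<Longrightarrow> g \<cdot> f = zer X Z \<Longrightarrow> g = zer Y Z"
  shows "is_epi C f"
  unfolding is_epi_def
proof (intro conjI allI ballI impI)
  show "f \<in> Arr C" using assms by (simp add: hom_iff)
  fix W a b assume "a \<in> mor (Cod C f) W" "b \<in> mor (Cod C f) W" and e: "a \<cdot> f = b \<cdot> f"
  then have a: "a \<in> mor Y W" and b: "b \<in> mor Y W" using assms by (auto simp: hom_iff)
  have "dif a b \<cdot> f = zer X W" using dif_comp[OF a b assms(1)] e dif_eq Comp_Hom[OF assms(1)] a b by metis
  then show "a = b" using assms(2)[OF dif_hom[OF a b]] dif_eq[OF a b] by simp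
qed

lemma mono_zerD: "is_mono C f \<Longrightarrow> f \<in> mor X Y \<Longrightarrow> g \<in> mor W X \<Longrightarrow> f \<cdot> g = zer W Y \<Longrightarrow> g = zer W X"
  using monoD[of f X Y g W "zer W X"] zer_hom hom_obj comp_zer' by metis

lemma epi_zerD: "is_epi C f \<Longrightarrow> f \<in> mor X Y \<Longrightarrow> g \<in> mor Y Z \<Longrightarrow> g \<cdot> f = zer X Z \<Longrightarrow> g = zer Y Z"
  using epiD[of f X Y g Z "zer Y Z"] zer_hom hom_obj zer_comp' by metis

lemma zero_iff: assumes X: "X \<in> Obj C" shows "is_zero C X \<longleftrightarrow> Ide C X = zer X X"
proof
  assume "is_zero C X"
  then show "Ide C X = zer X X" using X Ide_Hom zer_hom unfolding is_zero_def by blast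
next
  assume e: "Ide C X = zer X X"
  have 1: "f = zer X Y" if "f \<in> mor X Y" for f Y
    using that e X Comp_Ide comp_zer' by metis
  have 2: "f = zer Y X" if "f \<in> mor Y X" for f Y
    using that e X Ide_Comp zer_comp' by metis
  show "is_zero C X" unfolding is_zero_def using 1 2 X zer_hom by blast
qed

lemma zero_hom: "is_zero C X \<Longrightarrow> f \<in> mor X Y \<Longrightarrow> f = zer X Y" "is_zero C X \<Longrightarrow> f \<in> mor Y X \<Longrightarrow> f = zer Y X"
proof -
  assume X: "is_zero C X"
  { assume f: "f \<in> mor X Y"
    have "Y \<in> Obj C" "X \<in> Obj C" using hom_obj f by auto
    then show "f = zer X Y" using X f zer_hom[of X Y] unfolding is_zero_def by blast }
  { assume f: "f \<in> mor Y X"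
    have "Y \<in> Obj C" "X \<in> Obj C" using hom_obj f by auto
    then show "f = zer Y X" using X f zer_hom[of Y X] unfolding is_zero_def by blast }
qed

lemma mono_zero: assumes "is_mono C f" "f \<in> mor X Y" "f = zer X Y" shows "is_zero C X"
proof -
  have X: "X \<in> Obj C" using assms hom_obj by blast
  have "f \<cdot> Ide C X = zer X Y" using assms Comp_Ide by simp
  then show ?thesis using zero_iff[OF X] mono_zerD[OF assms(1,2) Ide_Hom[OF X]] by simp
qed

lemma epi_zero: assumes "is_epi C f" "f \<in> mor X Y" "f = zer X Y" shows "is_zero C Y"
proof -
  have X: "Y \<in> Obj C" using assms hom_obj by blast
  have "Ide C Y \<cdot> f = zer X Y" using assms Ide_Comp by simp
  then show ?thesis using zero_iff[OF X] epi_zerD[OF assms(1,2) Ide_Hom[OF X]] by simp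
qed

lemma zero_mono: assumes "is_zero C Z" "M \<in> Obj C" shows "zer Z M \<in> mor Z M" "is_mono C (zer Z M)"
proof -
  show z: "zer Z M \<in> mor Z M" using zer_hom assms by (simp add: is_zero_def)
  show "is_mono C (zer Z M)" by (rule mono_zerI[OF z]) (use zero_hom(2)[OF assms(1)] in blast)
qed

lemma nonzero_mono: assumes "is_mono C a" "a \<in> mor X Y" "\<not> is_zero C X" shows "a \<noteq> zer X Y"
  using mono_zero[OF assms(1,2)] assms(3) by blast

lemma nonzero_factor: assumes "e \<in> mor X I" "m \<in> mor I Y" "m \<cdot> e \<noteq> zer X Y" shows "\<not> is_zero C I"
proof
  assume "is_zero C I"
  then have "e = zer X I" using zero_hom(2) assms(1) by blast
  then show False using assms(3) comp_zer'[OF assms(2)] hom_obj[OF assms(1)] by simp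
qed

text \<open>A factorisation through a monomorphism is automatically unique, so only its existence
  has to be supplied.\<close>

lemma kernelI:
  assumes "k \<in> mor K X" "f \<in> mor X Y" "is_mono C k" "f \<cdot> k = zer K Y"
    "\<And>W g. g \<in> mor W X \<Longrightarrow> f \<cdot> g = zer W Y \<Longrightarrow> \<exists>h \<in> mor W K. k \<cdot> h = g"
  shows "is_kernel C k f"
proof -
  have "\<exists>!h. h \<in> mor W K \<and> k \<cdot> h = g" if g: "g \<in> mor W X" "f \<cdot> g = zer W Y" for W g
    using assms(5)[OF g] monoD[OF assms(3,1)] by metis
  moreover have e: "Dom C k = K" "Cod C k = X" "Dom C f = X" "Cod C f = Y" "k \<in> Arr C" "f \<in> Arr C"
    using assms(1,2) by (simp_all add: hom_iff)
  ultimately show ?thesis unfolding is_kernel_def e using assms(4) e(5,6) by blast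
qed

lemma cokernelI:
  assumes "c \<in> mor Y K" "f \<in> mor X Y" "is_epi C c" "c \<cdot> f = zer X K"
    "\<And>W g. g \<in> mor Y W \<Longrightarrow> g \<cdot> f = zer X W \<Longrightarrow> \<exists>h \<in> mor K W. h \<cdot> c = g"
  shows "is_cokernel C c f"
proof -
  have "\<exists>!h. h \<in> mor K W \<and> h \<cdot> c = g" if g: "g \<in> mor Y W" "g \<cdot> f = zer X W" for W g
    using assms(5)[OF g] epiD[OF assms(3,1)] by metis
  moreover have e: "Dom C c = Y" "Cod C c = K" "Dom C f = X" "Cod C f = Y" "c \<in> Arr C" "f \<in> Arr C"
    using assms(1,2) by (simp_all add: hom_iff)
  ultimately show ?thesis unfolding is_cokernel_def e using assms(4) e(5,6) by blast
qed

lemma kernel_hom: "is_kernel C k f \<Longrightarrow> f \<in> mor X Y \<Longrightarrow> k \<in> mor (Dom C k) X"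
  by (auto simp: is_kernel_def Hom_def)

lemma cokernel_hom: "is_cokernel C c f \<Longrightarrow> f \<in> mor X Y \<Longrightarrow> c \<in> mor Y (Cod C c)"
  by (auto simp: is_cokernel_def Hom_def)

lemma kernel_eq: "is_kernel C k f \<Longrightarrow> f \<in> mor X Y \<Longrightarrow> k \<in> mor K X \<Longrightarrow> f \<cdot> k = zer K Y"
  by (auto simp: is_kernel_def Hom_def)

lemma cokernel_eq: "is_cokernel C c f \<Longrightarrow> f \<in> mor X Y \<Longrightarrow> c \<in> mor Y K \<Longrightarrow> c \<cdot> f = zer X K"
  by (auto simp: is_cokernel_def Hom_def)

lemma kernelE:
  assumes "is_kernel C k f" "f \<in> mor X Y" "k \<in> mor K X" "g \<in> mor W X" "f \<cdot> g = zer W Y"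
  obtains h where "h \<in> mor W K" "k \<cdot> h = g"
proof -
  have e: "Dom C f = X" "Cod C f = Y" "Dom C k = K" using assms(2,3) by (simp_all add: hom_DC)
  then have "\<exists>!h. h \<in> mor W K \<and> k \<cdot> h = g" using assms unfolding is_kernel_def e by blast
  then show ?thesis using that by blast
qed

lemma cokernelE:
  assumes "is_cokernel C c f" "f \<in> mor X Y" "c \<in> mor Y K" "g \<in> mor Y W" "g \<cdot> f = zer X W"
  obtains h where "h \<in> mor K W" "h \<cdot> c = g"
proof -
  have e: "Dom C f = X" "Cod C f = Y" "Cod C c = K" using assms(2,3) by (simp_all add: hom_DC)
  then have "\<exists>!h. h \<in> mor K W \<and> h \<cdot> c = g" using assms unfolding is_cokernel_def e by blast
  then show ?thesis using that by blast
qed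

lemma kernel_mono: assumes "is_kernel C k f" shows "is_mono C k"
proof -
  let ?X = "Dom C f" and ?Y = "Cod C f" and ?K = "Dom C k"
  have f: "f \<in> mor ?X ?Y" and k: "k \<in> mor ?K ?X" using assms by (auto simp: is_kernel_def Hom_def)
  show ?thesis
  proof (rule mono_zerI[OF k])
    fix W g assume g: "g \<in> mor W ?K" and e: "k \<cdot> g = zer W ?X"
    have "f \<cdot> zer W ?X = zer W ?Y" using comp_zer'[OF f] g hom_obj by blast
    moreover have "zer W ?X \<in> mor W ?X" using g f zer_hom hom_obj by blast
    ultimately have "\<exists>!h. h \<in> mor W ?K \<and> k \<cdot> h = zer W ?X" using assms unfolding is_kernel_def by blast
    moreover have "zer W ?K \<in> mor W ?K" "k \<cdot> zer W ?K = zer W ?X" using g k comp_zer' zer_hom hom_obj by blast+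
    ultimately show "g = zer W ?K" using g e by blast
  qed
qed

lemma cokernel_epi: assumes "is_cokernel C c f" shows "is_epi C c"
proof -
  let ?X = "Dom C f" and ?Y = "Cod C f" and ?K = "Cod C c"
  have f: "f \<in> mor ?X ?Y" and k: "c \<in> mor ?Y ?K" using assms by (auto simp: is_cokernel_def Hom_def)
  show ?thesis
  proof (rule epi_zerI[OF k])
    fix W g assume g: "g \<in> mor ?K W" and e: "g \<cdot> c = zer ?Y W"
    have "zer ?Y W \<cdot> f = zer ?X W" using zer_comp'[OF f] g hom_obj by blast
    moreover have "zer ?Y W \<in> mor ?Y W" using g f zer_hom hom_obj by blast
    ultimately have "\<exists>!h. h \<in> mor ?K W \<and> h \<cdot> c = zer ?Y W" using assms unfolding is_cokernel_def by blast
    moreover have "zer ?K W \<in> mor ?K W" "zer ?K W \<cdot> c = zer ?Y W" using g k zer_comp' zer_hom hom_obj by blast+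
    ultimately show "g = zer ?K W" using g e by blast
  qed
qed

lemma zero_kernel_mono:
  assumes k: "is_kernel C k f" "k \<in> mor K X" and f: "f \<in> mor X Y" and K: "is_zero C K"
  shows "is_mono C f"
proof (rule mono_zerI[OF f])
  fix T x assume x: "x \<in> mor T X" "f \<cdot> x = zer T Y"
  obtain y where y: "y \<in> mor T K" "k \<cdot> y = x" using kernelE[OF k(1) f k(2) x] .
  then show "x = zer T X" using zero_hom(2)[OF K y(1)] comp_zer'[OF k(2)] hom_obj[OF x(1)] by simp
qed

section \<open>Coproducts in preadditive categories\<close>

lemma coproduct_inj: "is_coproduct C I X P \<iota> \<Longrightarrow> i \<in> I \<Longrightarrow> \<iota> i \<in> mor (X i) P"
  unfolding is_coproduct_def by blast

lemma coproduct_obj: "is_coproduct C I X P \<iota> \<Longrightarrow> P \<in> Obj C"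
  unfolding is_coproduct_def by blast

lemma coproduct_copair:
  assumes P: "is_coproduct C I X P \<iota>" and Y: "Y \<in> Obj C" and f: "\<And>i. i \<in> I \<Longrightarrow> f i \<in> mor (X i) Y"
  obtains h where "h \<in> mor P Y" "\<And>i. i \<in> I \<Longrightarrow> h \<cdot> \<iota> i = f i"
proof -
  have "\<forall>i\<in>I. f i \<in> mor (X i) Y" using f by blast
  then have "\<exists>!h. h \<in> mor P Y \<and> (\<forall>i\<in>I. h \<cdot> \<iota> i = f i)"
    using spec[OF bspec[OF conjunct2[OF conjunct2[OF P[unfolded is_coproduct_def]]] Y], of f] by (rule mp[rotated])
  then show ?thesis using that by blast
qed

lemma coproduct_zer:
  assumes P: "is_coproduct C I X P \<iota>" and h: "h \<in> mor P Y" "\<And>i. i \<in> I \<Longrightarrow> h \<cdot> \<iota> i = zer (X i) Y"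
  shows "h = zer P Y"
proof -
  have Y: "Y \<in> Obj C" using h hom_obj by blast
  let ?z = "\<lambda>i. zer (X i) Y"
  have "\<forall>i\<in>I. ?z i \<in> mor (X i) Y" using zer_hom[OF _ Y] coproduct_inj[OF P] hom_obj by blast
  then have "\<exists>!h. h \<in> mor P Y \<and> (\<forall>i\<in>I. h \<cdot> \<iota> i = ?z i)"
    using spec[OF bspec[OF conjunct2[OF conjunct2[OF P[unfolded is_coproduct_def]]] Y], of ?z] by (rule mp[rotated])
  moreover have "zer P Y \<in> mor P Y \<and> (\<forall>i\<in>I. zer P Y \<cdot> \<iota> i = ?z i)"
    using zer_hom[OF coproduct_obj[OF P] Y] zer_comp'[OF coproduct_inj[OF P] Y] by blast
  ultimately show ?thesis using h by blast
qed

lemma coproduct_eq: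
  assumes P: "is_coproduct C I X P \<iota>" and h: "h \<in> mor P Y" "k \<in> mor P Y" "\<And>i. i \<in> I \<Longrightarrow> h \<cdot> \<iota> i = k \<cdot> \<iota> i"
  shows "h = k"
proof -
  have "dif h k = zer P Y"
  proof (rule coproduct_zer[OF P dif_hom[OF h(1,2)]])
    fix i assume i: "i \<in> I"
    note ii = coproduct_inj[OF P i]
    show "dif h k \<cdot> \<iota> i = zer (X i) Y" using dif_comp[OF h(1,2) ii] dif_eq[OF Comp_Hom[OF ii h(1)] Comp_Hom[OF ii h(2)]] h(3)[OF i] by simp
  qed
  then show ?thesis using dif_eq[OF h(1,2)] by simp
qed

end

section \<open>Abelian categories\<close>

context abelian_category
begin

lemma obtain_kernel:
  assumes "f \<in> mor X Y"
  obtains k K where "is_kernel C k f" "k \<in> mor K X" "is_mono C k" "f \<cdot> k = zer K Y"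
  using kernels[of f] assms kernel_hom kernel_mono kernel_eq by (metis hom_iff)

lemma obtain_cokernel:
  assumes "f \<in> mor X Y"
  obtains c K where "is_cokernel C c f" "c \<in> mor Y K" "is_epi C c" "c \<cdot> f = zer X K"
  using cokernels[of f] assms cokernel_hom cokernel_epi cokernel_eq by (metis hom_iff)

text \<open>The axiom only makes \<open>m\<close> the kernel of some \<open>g\<close>. Since
  \<open>g\<close> kills \<open>m\<close> it factors through \<open>c\<close>; whatever
  \<open>c\<close> kills is then killed by \<open>g\<close> and lifts to \<open>m\<close>.\<close>

lemma mono_kernel_cokernel:
  assumes m: "is_mono C m" and c: "is_cokernel C c m"
  shows "is_kernel C m c"
proof -
  let ?X = "Dom C m" and ?Y = "Cod C m" and ?Z = "Cod C c"
  have mh: "m \<in> mor ?X ?Y" using m mono_arr homI by blast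
  have ch: "c \<in> mor ?Y ?Z" using cokernel_hom[OF c mh] .
  obtain g where g: "is_kernel C m g" using mono_is_kernel[OF m] by blast
  then have gh: "g \<in> mor ?Y (Cod C g)" by (auto simp: is_kernel_def Hom_def)
  have gm: "g \<cdot> m = zer ?X (Cod C g)" using kernel_eq[OF g gh mh] .
  obtain g' where g': "g' \<in> mor ?Z (Cod C g)" "g' \<cdot> c = g" using cokernelE[OF c mh ch gh gm] .
  show ?thesis
  proof (rule kernelI[OF mh ch m cokernel_eq[OF c mh ch]])
    fix W x assume x: "x \<in> mor W ?Y" and e: "c \<cdot> x = zer W ?Z"
    have "g \<cdot> x = zer W (Cod C g)" using Comp_assoc[OF x ch g'(1)] g' e comp_zer' x hom_obj by metis
    then show "\<exists>h \<in> mor W ?X. m \<cdot> h = x" using kernelE[OF g gh mh x] by metis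
  qed
qed

lemma epi_cokernel_kernel:
  assumes e: "is_epi C e" and k: "is_kernel C k e"
  shows "is_cokernel C e k"
proof -
  let ?X = "Dom C e" and ?Y = "Cod C e" and ?Z = "Dom C k"
  have eh: "e \<in> mor ?X ?Y" using e epi_arr homI by blast
  have kh: "k \<in> mor ?Z ?X" using kernel_hom[OF k eh] .
  obtain g where g: "is_cokernel C e g" using epi_is_cokernel[OF e] by blast
  then have gh: "g \<in> mor (Dom C g) ?X" by (auto simp: is_cokernel_def Hom_def)
  have gm: "e \<cdot> g = zer (Dom C g) ?Y" using cokernel_eq[OF g gh eh] .
  obtain g' where g': "g' \<in> mor (Dom C g) ?Z" "k \<cdot> g' = g" using kernelE[OF k eh kh gh gm] .
  show ?thesis
  proof (rule cokernelI[OF eh kh e kernel_eq[OF k eh kh]])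
    fix W x assume x: "x \<in> mor ?X W" and e: "x \<cdot> k = zer ?Z W"
    have "x \<cdot> g = zer (Dom C g) W" using Comp_assoc[OF g'(1) kh x] g' e zer_comp' x hom_obj by metis
    then show "\<exists>h \<in> mor ?Y W. h \<cdot> e = x" using cokernelE[OF g gh eh x] by metis
  qed
qed

lemma mono_factor:
  assumes "is_mono C m" "m \<in> mor X Y" "is_cokernel C c m" "c \<in> mor Y Z" "x \<in> mor W Y" "c \<cdot> x = zer W Z"
  obtains h where "h \<in> mor W X" "m \<cdot> h = x"
  using kernelE[OF mono_kernel_cokernel[OF assms(1,3)] assms(4,2,5,6)] .

lemma epi_factor:
  assumes "is_epi C e" "e \<in> mor X Y" "is_kernel C k e" "k \<in> mor Z X" "x \<in> mor X W" "x \<cdot> k = zer Z W"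
  obtains h where "h \<in> mor Y W" "h \<cdot> e = x"
  using cokernelE[OF epi_cokernel_kernel[OF assms(1,3)] assms(4,2,5,6)] .

text \<open>The kernel condition of \<open>epi_factor\<close> in terms of generalised elements,
  which spares naming a kernel at each use.\<close>

lemma epi_factor_all:
  assumes "is_epi C e" "e \<in> mor X Y" "x \<in> mor X W"
    "\<And>T t. t \<in> mor T X \<Longrightarrow> e \<cdot> t = zer T Y \<Longrightarrow> x \<cdot> t = zer T W"
  obtains h where "h \<in> mor Y W" "h \<cdot> e = x"
proof -
  obtain k K where "is_kernel C k e" "k \<in> mor K X" "is_mono C k" "e \<cdot> k = zer K Y"
    using obtain_kernel[OF assms(2)] .
  then show ?thesis using epi_factor[OF assms(1,2) _ _ assms(3)] assms(4) that by metis
qed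

lemma mono_epi_iso:
  assumes "is_mono C f" "is_epi C f" shows "is_iso C f"
proof -
  let ?X = "Dom C f" and ?Y = "Cod C f"
  have f: "f \<in> mor ?X ?Y" using assms mono_arr homI by blast
  obtain c K where c: "is_cokernel C c f" "c \<in> mor ?Y K" "c \<cdot> f = zer ?X K" using obtain_cokernel[OF f] .
  have "c = zer ?Y K" using epi_zerD[OF assms(2) f c(2,3)] .
  then have "c \<cdot> Ide C ?Y = zer ?Y K" using c Comp_Ide by metis
  then obtain h where h: "h \<in> mor ?Y ?X" "f \<cdot> h = Ide C ?Y"
    using mono_factor[OF assms(1) f c(1,2)] Ide_Hom f hom_obj by metis
  have "f \<cdot> (h \<cdot> f) = f \<cdot> Ide C ?X" using h f Comp_assoc[OF f h(1) f] Comp_Ide[OF f] Ide_Comp[OF f] by metis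
  then have "h \<cdot> f = Ide C ?X" using monoD[OF assms(1) f Comp_Hom[OF f h(1)]] Ide_Hom f hom_obj by metis
  then show ?thesis using isoI[OF f h(1) _ h(2)] by blast
qed

text \<open>Here \<open>m\<close> is the kernel of the cokernel \<open>c\<close> of
  \<open>f\<close>. If \<open>t\<close> kills \<open>e\<close> and \<open>k\<close> is the kernel of
  \<open>t\<close>, then \<open>f\<close> factors through the smaller subobject \<open>m k\<close>.
  The cokernel of \<open>m k\<close> kills \<open>f\<close>, hence factors through \<open>c\<close>,
  hence kills \<open>m\<close>; so \<open>m\<close> factors through \<open>m k\<close>, which makes
  \<open>k\<close> split epic and \<open>t\<close> zero.\<close>

lemma image_factorization:
  assumes f: "f \<in> mor X Y"
  obtains I e m where "e \<in> mor X I" "m \<in> mor I Y" "is_epi C e" "is_mono C m" "m \<cdot> e = f"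
proof -
  obtain c K where c: "is_cokernel C c f" "c \<in> mor Y K" "is_epi C c" "c \<cdot> f = zer X K" using obtain_cokernel[OF f] .
  obtain m I where m: "is_kernel C m c" "m \<in> mor I Y" "is_mono C m" "c \<cdot> m = zer I K" using obtain_kernel[OF c(2)] .
  obtain e where e: "e \<in> mor X I" "m \<cdot> e = f" using kernelE[OF m(1) c(2) m(2) f c(4)] .
  have "is_epi C e"
  proof (rule epi_zerI[OF e(1)])
    fix Z t assume t: "t \<in> mor I Z" and z: "t \<cdot> e = zer X Z"
    obtain k L where k: "is_kernel C k t" "k \<in> mor L I" "is_mono C k" "t \<cdot> k = zer L Z" using obtain_kernel[OF t] .
    obtain e' where e': "e' \<in> mor X L" "k \<cdot> e' = e" using kernelE[OF k(1) t k(2) e(1) z] .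
    have mk: "m \<cdot> k \<in> mor L Y" "is_mono C (m \<cdot> k)" using Comp_Hom[OF k(2) m(2)] mono_comp[OF k(3) m(3) k(2) m(2)] by auto
    obtain c' K' where c': "is_cokernel C c' (m \<cdot> k)" "c' \<in> mor Y K'" "c' \<cdot> (m \<cdot> k) = zer L K'" using obtain_cokernel[OF mk(1)] by metis
    have "c' \<cdot> f = (c' \<cdot> (m \<cdot> k)) \<cdot> e'" 
      using Comp_assoc[OF e'(1) mk(1) c'(2)] Comp_assoc[OF e'(1) k(2) m(2)] e' e by simp
    also have "\<dots> = zer X K'" using c'(3) zer_comp'[OF e'(1)] c'(2) hom_obj by metis
    finally obtain c'' where c'': "c'' \<in> mor K K'" "c'' \<cdot> c = c'" using cokernelE[OF c(1) f c(2) c'(2)] by metis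
    have "c' \<cdot> m = zer I K'" using Comp_assoc[OF m(2) c(2) c''(1)] c'' m(4) comp_zer'[OF c''(1)] m(2) hom_obj by metis
    then obtain r where r: "r \<in> mor I L" "m \<cdot> k \<cdot> r = m" using mono_factor[OF mk(2,1) c'(1,2) m(2)] by metis
    have "m \<cdot> (k \<cdot> r) = m \<cdot> Ide C I" using r Comp_assoc[OF r(1) k(2) m(2)] Comp_Ide[OF m(2)] by simp
    then have kr: "k \<cdot> r = Ide C I" using monoD[OF m(3,2) Comp_Hom[OF r(1) k(2)] Ide_Hom] m(2) hom_obj by blast
    have "t = t \<cdot> (k \<cdot> r)" using kr Comp_Ide[OF t] by simp
    also have "\<dots> = zer I Z" using Comp_assoc[OF r(1) k(2) t] k(4) zer_comp'[OF r(1)] t hom_obj by metis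
    finally show "t = zer I Z" .
  qed
  then show ?thesis using that e m by blast
qed

section \<open>Biproducts, pullbacks and lifting after a cover\<close>

lemma obtain_biproduct:
  assumes X: "X \<in> Obj C" and Y: "Y \<in> Obj C"
  obtains P i j p q where "i \<in> mor X P" "j \<in> mor Y P" "p \<in> mor P X" "q \<in> mor P Y"
    "p \<cdot> i = Ide C X" "q \<cdot> j = Ide C Y" "p \<cdot> j = zer Y X" "q \<cdot> i = zer X Y"
    "\<And>T x y. x \<in> mor T X \<Longrightarrow> y \<in> mor T Y \<Longrightarrow> \<exists>t \<in> mor T P. p \<cdot> t = x \<and> q \<cdot> t = y"
    "\<And>T t. t \<in> mor T P \<Longrightarrow> p \<cdot> t = zer T X \<Longrightarrow> q \<cdot> t = zer T Y \<Longrightarrow> t = zer T P"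
    "\<And>Z x y. x \<in> mor X Z \<Longrightarrow> y \<in> mor Y Z \<Longrightarrow> \<exists>t \<in> mor P Z. t \<cdot> i = x \<and> t \<cdot> j = y"
    "\<And>Z t. t \<in> mor P Z \<Longrightarrow> t \<cdot> i = zer X Z \<Longrightarrow> t \<cdot> j = zer Y Z \<Longrightarrow> t = zer P Z"
proof -
  obtain P \<iota> where "is_coproduct C (UNIV :: bool set) (\<lambda>b. if b then X else Y) P \<iota>"
    using binary_coproducts[OF X Y] by blast
  note cop = this[unfolded is_coproduct_def]
  define i where "i = \<iota> True"
  define j where "j = \<iota> False"
  have "\<iota> b \<in> mor (if b then X else Y) P" for b using cop by blast
  from this[of True] this[of False] have i: "i \<in> mor X P" and j: "j \<in> mor Y P" by (simp_all add: i_def j_def)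
  have P: "P \<in> Obj C" using cop by blast
  have cp: "\<exists>!t. t \<in> mor P Z \<and> t \<cdot> i = x \<and> t \<cdot> j = y" if "x \<in> mor X Z" "y \<in> mor Y Z" for Z x y
  proof -
    have Z: "Z \<in> Obj C" using that hom_obj by blast
    have xy: "\<forall>b\<in>UNIV. (if b then x else y) \<in> mor (if b then X else Y) Z" using that by auto
    have *: "\<exists>!h. h \<in> mor P Z \<and> (\<forall>b\<in>UNIV. h \<cdot> \<iota> b = (if b then x else y))"
      using spec[OF bspec[OF conjunct2[OF conjunct2[OF cop]] Z], of "\<lambda>b. if b then x else y"] xy by (rule mp)
    have "(h \<in> mor P Z \<and> (\<forall>b\<in>UNIV. h \<cdot> \<iota> b = (if b then x else y))) = (h \<in> mor P Z \<and> h \<cdot> i = x \<and> h \<cdot> j = y)" for h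
      by (auto simp: i_def j_def)
    then show ?thesis using * by simp
  qed
  obtain p where p: "p \<in> mor P X" "p \<cdot> i = Ide C X" "p \<cdot> j = zer Y X" using cp[OF Ide_Hom[OF X] zer_hom[OF Y X]] by blast
  obtain q where q: "q \<in> mor P Y" "q \<cdot> i = zer X Y" "q \<cdot> j = Ide C Y" using cp[OF zer_hom[OF X Y] Ide_Hom[OF Y]] by blast
  have u: "t = zer P Z" if "t \<in> mor P Z" "t \<cdot> i = zer X Z" "t \<cdot> j = zer Y Z" for t Z
  proof -
    have Z: "Z \<in> Obj C" using that hom_obj by blast
    have "zer P Z \<in> mor P Z" "zer P Z \<cdot> i = zer X Z" "zer P Z \<cdot> j = zer Y Z" using zer_comp'[OF i] zer_comp'[OF j] zer_hom P Z by auto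
    then show ?thesis using that cp[OF zer_hom[OF X Z] zer_hom[OF Y Z]] by blast
  qed
  \<comment> \<open>This is \<open>i p + j q = 1\<close>, checked on the two summands; it turns the
    coproduct of the axiom into a product.\<close>
  have id: "dif (Ide C P) (i \<cdot> p) = j \<cdot> q"
  proof -
    have ip: "i \<cdot> p \<in> mor P P" "j \<cdot> q \<in> mor P P" using i j p q Comp_Hom by blast+
    note h = Ide_Hom[OF P]
    note d = dif_hom[OF dif_hom[OF h ip(1)] ip(2)] and dh = dif_hom[OF h ip(1)]
    have a: "Ide C P \<cdot> i = i" "Ide C P \<cdot> j = j" "i \<cdot> p \<cdot> i = i" "i \<cdot> p \<cdot> j = zer Y P" "j \<cdot> q \<cdot> i = zer X P" "j \<cdot> q \<cdot> j = j"
      using i j p q X Y P comp_zer' by (auto simp: hom_iff)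
    have "dif (dif (Ide C P) (i \<cdot> p)) (j \<cdot> q) \<cdot> i = dif (dif i i) (zer X P)"
      using dif_comp[OF dh ip(2) i] dif_comp[OF h ip(1) i] a by simp
    then have 1: "dif (dif (Ide C P) (i \<cdot> p)) (j \<cdot> q) \<cdot> i = zer X P" using dif_eq[OF i i] dif_zer zer_hom X P by simp
    have "dif (dif (Ide C P) (i \<cdot> p)) (j \<cdot> q) \<cdot> j = dif (dif j (zer Y P)) j"
      using dif_comp[OF dh ip(2) j] dif_comp[OF h ip(1) j] a by simp
    then have 2: "dif (dif (Ide C P) (i \<cdot> p)) (j \<cdot> q) \<cdot> j = zer Y P" using dif_eq[OF j j] dif_zer[OF j] by simp
    show ?thesis using u[OF d 1 2] dif_eq[OF dh ip(2)] by simp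
  qed
  have v: "t = zer T P" if t: "t \<in> mor T P" "p \<cdot> t = zer T X" "q \<cdot> t = zer T Y" for t T
  proof -
    have T: "T \<in> Obj C" using t hom_obj by blast
    have ip: "i \<cdot> p \<in> mor P P" "j \<cdot> q \<in> mor P P" using i j p q Comp_Hom by blast+
    have "i \<cdot> p \<cdot> t = zer T P" "j \<cdot> q \<cdot> t = zer T P"
      using Comp_assoc[OF t(1) p(1) i] Comp_assoc[OF t(1) q(1) j] t comp_zer'[OF i T] comp_zer'[OF j T] by auto
    then have "dif t (zer T P) = zer T P"
      using id dif_comp[OF Ide_Hom[OF P] ip(1) t(1)] Ide_Comp[OF t(1)] by simp
    then show ?thesis using dif_zer[OF t(1)] by simp
  qed
  have w: "\<exists>t \<in> mor T P. p \<cdot> t = x \<and> q \<cdot> t = y" if x: "x \<in> mor T X" and y: "y \<in> mor T Y" for T x y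
  proof -
    \<comment> \<open>The pairing is \<open>i x + j y\<close>, written as
      \<open>i x - j (0 - y)\<close> because the calculus is developed for differences only.\<close>
    let ?y = "dif (zer T Y) y"
    have T: "T \<in> Obj C" using x hom_obj by blast
    note zy = zer_hom[OF T Y] and zx = zer_hom[OF T X]
    have y': "?y \<in> mor T Y" using dif_hom[OF zy y] .
    have yy: "dif (zer T Y) ?y = y"
    proof -
      interpret G: comm_group "hom_group C T Y" using hom_comm_group T Y .
      have "Add C y ?y = zer T Y" using dif_add[OF zy y] G.m_comm[of ?y y] y y' by simp
      then show ?thesis using dif_unique[OF zy y' y] by simp
    qed
    have h: "i \<cdot> x \<in> mor T P" "j \<cdot> ?y \<in> mor T P" using Comp_Hom i j x y' by blast+
    have "p \<cdot> dif (i \<cdot> x) (j \<cdot> ?y) = dif x (zer T X)"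
      using comp_dif[OF h p(1)] p Comp_assoc[OF x i p(1)] Comp_assoc[OF y' j p(1)] Ide_Comp[OF x] zer_comp'[OF y' X] by simp
    moreover have "q \<cdot> dif (i \<cdot> x) (j \<cdot> ?y) = dif (zer T Y) ?y"
      using comp_dif[OF h q(1)] q Comp_assoc[OF x i q(1)] Comp_assoc[OF y' j q(1)] Ide_Comp[OF y'] zer_comp'[OF x Y] by simp
    ultimately show ?thesis using dif_hom[OF h] yy dif_zer[OF x] by auto
  qed
  show ?thesis using that[OF i j p(1) q(1) p(2) q(3) p(3) q(2) w v _ u] cp by blast
qed

text \<open>The pullback is the kernel of \<open>u = f a - g b\<close> on the biproduct. If
  \<open>f\<close> is epic then so is \<open>u\<close>, because \<open>u i = f\<close>. An arrow
  \<open>t\<close> with \<open>t q = 0\<close> then gives \<open>t b = w u\<close>; composing with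
  \<open>i\<close> yields \<open>w f = 0\<close>, so \<open>w = 0\<close> and finally
  \<open>t = 0\<close>.\<close>

lemma obtain_pullback:
  assumes f: "f \<in> mor X Z" and g: "g \<in> mor Y Z"
  obtains P p q where "p \<in> mor P X" "q \<in> mor P Y" "f \<cdot> p = g \<cdot> q"
    "\<And>T x y. x \<in> mor T X \<Longrightarrow> y \<in> mor T Y \<Longrightarrow> f \<cdot> x = g \<cdot> y \<Longrightarrow> \<exists>t \<in> mor T P. p \<cdot> t = x \<and> q \<cdot> t = y"
    "\<And>T t. t \<in> mor T P \<Longrightarrow> p \<cdot> t = zer T X \<Longrightarrow> q \<cdot> t = zer T Y \<Longrightarrow> t = zer T P"
    "is_mono C f \<Longrightarrow> is_mono C q" "is_mono C g \<Longrightarrow> is_mono C p" "is_epi C f \<Longrightarrow> is_epi C q"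
proof -
  have X: "X \<in> Obj C" and Y: "Y \<in> Obj C" and Z: "Z \<in> Obj C" using f g hom_obj by auto
  obtain B i j a b where B: "i \<in> mor X B" "j \<in> mor Y B" "a \<in> mor B X" "b \<in> mor B Y"
    "a \<cdot> i = Ide C X" "b \<cdot> j = Ide C Y" "a \<cdot> j = zer Y X" "b \<cdot> i = zer X Y"
    "\<And>T x y. x \<in> mor T X \<Longrightarrow> y \<in> mor T Y \<Longrightarrow> \<exists>t \<in> mor T B. a \<cdot> t = x \<and> b \<cdot> t = y"
    "\<And>T t. t \<in> mor T B \<Longrightarrow> a \<cdot> t = zer T X \<Longrightarrow> b \<cdot> t = zer T Y \<Longrightarrow> t = zer T B"
    "\<And>Z x y. x \<in> mor X Z \<Longrightarrow> y \<in> mor Y Z \<Longrightarrow> \<exists>t \<in> mor B Z. t \<cdot> i = x \<and> t \<cdot> j = y"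
    "\<And>Z t. t \<in> mor B Z \<Longrightarrow> t \<cdot> i = zer X Z \<Longrightarrow> t \<cdot> j = zer Y Z \<Longrightarrow> t = zer B Z"
    by (rule obtain_biproduct[OF X Y]) (blast intro: that)
  define u where "u = dif (f \<cdot> a) (g \<cdot> b)"
  have fa: "f \<cdot> a \<in> mor B Z" "g \<cdot> b \<in> mor B Z" using f g B Comp_Hom by blast+
  have u: "u \<in> mor B Z" using dif_hom[OF fa] by (simp add: u_def)
  have uc: "u \<cdot> t = zer T Z \<longleftrightarrow> f \<cdot> (a \<cdot> t) = g \<cdot> (b \<cdot> t)" if t: "t \<in> mor T B" for T t
    using dif_comp[OF fa t] Comp_assoc[OF t B(3) f] Comp_assoc[OF t B(4) g] dif_eq[OF Comp_Hom[OF t fa(1)] Comp_Hom[OF t fa(2)]]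
    by (simp add: u_def)
  obtain k P where k: "is_kernel C k u" "k \<in> mor P B" "is_mono C k" "u \<cdot> k = zer P Z" using obtain_kernel[OF u] .
  define p where "p = a \<cdot> k"
  define q where "q = b \<cdot> k"
  have pq: "p \<in> mor P X" "q \<in> mor P Y" using k B Comp_Hom by (auto simp: p_def q_def)
  have eq: "f \<cdot> p = g \<cdot> q" using uc[OF k(2)] k(4) by (simp add: p_def q_def)
  have ex: "\<exists>t \<in> mor T P. p \<cdot> t = x \<and> q \<cdot> t = y" if x: "x \<in> mor T X" and y: "y \<in> mor T Y" and e: "f \<cdot> x = g \<cdot> y" for T x y
  proof -
    obtain s where s: "s \<in> mor T B" "a \<cdot> s = x" "b \<cdot> s = y" using B(9)[OF x y] by blast
    then have "u \<cdot> s = zer T Z" using uc[OF s(1)] e by simp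
    then obtain t where t: "t \<in> mor T P" "k \<cdot> t = s" using kernelE[OF k(1) u k(2) s(1)] by metis
    then show ?thesis using s Comp_assoc[OF t(1) k(2) B(3)] Comp_assoc[OF t(1) k(2) B(4)] by (auto simp: p_def q_def)
  qed
  have un: "t = zer T P" if t: "t \<in> mor T P" and "p \<cdot> t = zer T X" "q \<cdot> t = zer T Y" for T t
  proof -
    have "k \<cdot> t = zer T B" using B(10)[OF Comp_Hom[OF t k(2)]] that Comp_assoc[OF t k(2) B(3)] Comp_assoc[OF t k(2) B(4)]
      by (simp add: p_def q_def)
    then show ?thesis using mono_zerD[OF k(3,2) t] by simp
  qed
  have mo: "is_mono C q" if m: "is_mono C f"
  proof (rule mono_zerI[OF pq(2)])
    fix W t assume t: "t \<in> mor W P" and e: "q \<cdot> t = zer W Y"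
    have "f \<cdot> (p \<cdot> t) = g \<cdot> (q \<cdot> t)" using comp_ext[OF eq pq(1) f pq(2) g t] .
    also have "\<dots> = zer W Z" using e comp_zer'[OF g] t hom_obj by metis
    finally have "p \<cdot> t = zer W X" using mono_zerD[OF m f Comp_Hom[OF t pq(1)]] by blast
    then show "t = zer W P" using un[OF t] e by blast
  qed
  have mo': "is_mono C p" if m: "is_mono C g"
  proof (rule mono_zerI[OF pq(1)])
    fix W t assume t: "t \<in> mor W P" and e: "p \<cdot> t = zer W X"
    have "g \<cdot> (q \<cdot> t) = f \<cdot> (p \<cdot> t)" using comp_ext[OF eq pq(1) f pq(2) g t] by simp
    also have "\<dots> = zer W Z" using e comp_zer'[OF f] t hom_obj by metis
    finally have "q \<cdot> t = zer W Y" using mono_zerD[OF m g Comp_Hom[OF t pq(2)]] by blast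
    then show "t = zer W P" using un[OF t] e by blast
  qed
  have ep: "is_epi C q" if m: "is_epi C f"
  proof (rule epi_zerI[OF pq(2)])
    fix W t assume t: "t \<in> mor Y W" and e: "t \<cdot> q = zer P W"
    have ui: "u \<cdot> i = f"
    proof -
      have "(f \<cdot> a) \<cdot> i = f" "(g \<cdot> b) \<cdot> i = zer X Z"
        using Comp_assoc[OF B(1,3) f] Comp_assoc[OF B(1,4) g] B Comp_Ide[OF f] comp_zer'[OF g X] by auto
      then show ?thesis using dif_comp[OF fa B(1)] dif_zer[OF f] by (simp add: u_def)
    qed
    then have ue: "is_epi C u" using epi_cancel[OF _ B(1) u] m by simp
    have tb: "t \<cdot> b \<in> mor B W" using Comp_Hom[OF B(4) t] .
    have "(t \<cdot> b) \<cdot> k = zer P W" using Comp_assoc[OF k(2) B(4) t] e by (simp add: q_def)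
    then obtain w where w: "w \<in> mor Z W" "w \<cdot> u = t \<cdot> b" using epi_factor[OF ue u k(1,2) tb] by metis
    have W: "W \<in> Obj C" using t hom_obj by blast
    have "w \<cdot> f = (t \<cdot> b) \<cdot> i" using w Comp_assoc[OF B(1) u w(1)] ui by simp
    also have "\<dots> = zer X W" using Comp_assoc[OF B(1,4) t] B(8) comp_zer'[OF t X] by simp
    finally have "w = zer Z W" using epi_zerD[OF m f w(1)] by blast
    then have "t \<cdot> b = zer B W" using w zer_comp'[OF u W] by simp
    then have "t \<cdot> (b \<cdot> j) = zer Y W" using Comp_assoc[OF B(2,4) t] zer_comp'[OF B(2) W] by simp
    then show "t = zer Y W" using B(6) Comp_Ide[OF t] by simp
  qed
  show ?thesis using that[OF pq eq ex un mo mo' ep] by blast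
qed

text \<open>The substitute for choosing preimages of elements: what dies in the cokernel of
  \<open>f\<close> lifts along \<open>f\<close> after the test object is covered by an epimorphism.
  The cover is a pullback of the epic part of \<open>f\<close>.\<close>

lemma cokernel_lift:
  assumes f: "f \<in> mor X Y" and c: "is_cokernel C c f" "c \<in> mor Y K" and y: "y \<in> mor T Y" "c \<cdot> y = zer T K"
  obtains S p x where "p \<in> mor S T" "is_epi C p" "x \<in> mor S X" "f \<cdot> x = y \<cdot> p"
proof -
  obtain I e m where em: "e \<in> mor X I" "m \<in> mor I Y" "is_epi C e" "is_mono C m" "m \<cdot> e = f"
    using image_factorization[OF f] .
  obtain c' K' where c': "is_cokernel C c' m" "c' \<in> mor Y K'" "is_epi C c'" "c' \<cdot> m = zer I K'" using obtain_cokernel[OF em(2)] .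
  have "c' \<cdot> f = zer X K'" using em c' Comp_assoc[OF em(1,2) c'(2)] zer_comp'[OF em(1)] hom_obj by metis
  then obtain h where h: "h \<in> mor K K'" "h \<cdot> c = c'" using cokernelE[OF c(1) f c(2) c'(2)] by metis
  have "c' \<cdot> y = zer T K'" using h Comp_assoc[OF y(1) c(2) h(1)] y comp_zer'[OF h(1)] hom_obj by metis
  then obtain y' where y': "y' \<in> mor T I" "m \<cdot> y' = y" using mono_factor[OF em(4,2) c'(1,2) y(1)] by metis
  obtain S x p where P: "x \<in> mor S X" "p \<in> mor S T" "e \<cdot> x = y' \<cdot> p" "is_epi C p"
    by (rule obtain_pullback[OF em(1) y'(1)]) (use em(3) in blast)
  have "f \<cdot> x = m \<cdot> (e \<cdot> x)" using em Comp_assoc[OF P(1) em(1,2)] by simp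
  also have "\<dots> = y \<cdot> p" using P(3) y' Comp_assoc[OF P(2) y'(1) em(2)] by simp
  finally show ?thesis using that P by blast
qed

lemma epi_lift:
  assumes f: "f \<in> mor X Y" "is_epi C f" and y: "y \<in> mor T Y"
  obtains S p x where "p \<in> mor S T" "is_epi C p" "x \<in> mor S X" "f \<cdot> x = y \<cdot> p"
proof -
  obtain S x p where P: "x \<in> mor S X" "p \<in> mor S T" "f \<cdot> x = y \<cdot> p" "is_epi C p"
    by (rule obtain_pullback[OF f(1) y]) (use f(2) in blast)
  then show ?thesis using that by blast
qed

section \<open>Serre subcategories and negligible arrows\<close>

lemma comp_eq_zer:
  assumes "f \<in> mor X Y" "g \<in> mor Y Z" "h \<in> mor W X" "g \<cdot> f = zer X Z"
  shows "g \<cdot> (f \<cdot> h) = zer W Z"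
  using Comp_assoc[OF assms(3,1,2)] assms zer_comp'[OF assms(3)] hom_obj by metis

text \<open>For a Serre subcategory these are the arrows that become zero in the quotient category;
  by \<open>negl_image\<close> they are those whose image lies in \<open>\<X>\<close>. Conditions on
  kernels and cokernels can then be stated on arrows.\<close>

definition negl :: "'a set \<Rightarrow> 'b \<Rightarrow> bool" where
  "negl \<X> f \<longleftrightarrow> (\<exists>D\<in>\<X>. \<exists>a b X Y. b \<in> mor X D \<and> a \<in> mor D Y \<and> f = a \<cdot> b)"

lemma negl_comp_left: assumes "negl \<X> f" "f \<in> mor X Y" "g \<in> mor Y Z" shows "negl \<X> (g \<cdot> f)"
proof -
  obtain D a b X' Y' where d: "D \<in> \<X>" "b \<in> mor X' D" "a \<in> mor D Y'" "f = a \<cdot> b"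
    using assms(1) unfolding negl_def by blast
  have "Y' = Y" using Comp_Hom[OF d(2,3)] d(4) assms(2) by (simp add: hom_iff)
  then show ?thesis using d Comp_assoc[OF d(2,3), of g Z] Comp_Hom[OF d(3), of g Z] assms(3) unfolding negl_def by metis
qed

lemma negl_comp_right: assumes "negl \<X> f" "f \<in> mor X Y" "g \<in> mor W X" shows "negl \<X> (f \<cdot> g)"
proof -
  obtain D a b X' Y' where d: "D \<in> \<X>" "b \<in> mor X' D" "a \<in> mor D Y'" "f = a \<cdot> b"
    using assms(1) unfolding negl_def by blast
  have "X' = X" using Comp_Hom[OF d(2,3)] d(4) assms(2) by (simp add: hom_iff)
  then show ?thesis using d Comp_assoc[of g W X b D a Y'] Comp_Hom[of g W X b D] assms(3) unfolding negl_def by metis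
qed

end

locale serre = abelian_category C for C :: "('o, 'a, 'm) preadd_cat_scheme" (structure) +
  fixes \<X> :: "'o set"
  assumes serre: "serre_subcat C \<X>"
begin

lemma X_obj: "D \<in> \<X> \<Longrightarrow> D \<in> Obj C"
  using serre by (auto simp: serre_subcat_def)

lemma X_short_exact:
  assumes "is_kernel C k e" "is_epi C e" "k \<in> mor K B" "e \<in> mor B D"
  shows "B \<in> \<X> \<longleftrightarrow> K \<in> \<X> \<and> D \<in> \<X>"
proof -
  have "short_exact C k e" using assms epi_cokernel_kernel by (auto simp: short_exact_def)
  then have "Cod C k \<in> \<X> \<longleftrightarrow> Dom C k \<in> \<X> \<and> Cod C e \<in> \<X>" using serre unfolding serre_subcat_def by blast
  then show ?thesis using assms(3,4) by (simp add: hom_DC)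
qed

lemma X_sub: assumes "is_mono C m" "m \<in> mor D E" "E \<in> \<X>" shows "D \<in> \<X>"
proof -
  obtain c K where c: "is_cokernel C c m" "c \<in> mor E K" "is_epi C c" "c \<cdot> m = zer D K" using obtain_cokernel[OF assms(2)] .
  show ?thesis using X_short_exact[OF mono_kernel_cokernel[OF assms(1) c(1)] c(3) assms(2) c(2)] assms(3) by blast
qed

lemma X_quot: assumes "is_epi C e" "e \<in> mor D E" "D \<in> \<X>" shows "E \<in> \<X>"
proof -
  obtain k K where k: "is_kernel C k e" "k \<in> mor K D" using obtain_kernel[OF assms(2)] .
  show ?thesis using X_short_exact[OF k(1) assms(1) k(2) assms(2)] assms(3) by blast
qed

text \<open>The arrow \<open>g\<close> need not be epic: its image is a subobject of
  \<open>D\<close> and so lies in \<open>\<X>\<close>.\<close>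

lemma X_ext: assumes "is_kernel C k g" "k \<in> mor K B" "g \<in> mor B D" "K \<in> \<X>" "D \<in> \<X>" shows "B \<in> \<X>"
proof -
  obtain I e m where em: "e \<in> mor B I" "m \<in> mor I D" "is_epi C e" "is_mono C m" "m \<cdot> e = g"
    using image_factorization[OF assms(3)] .
  have mk: "is_mono C k" using kernel_mono[OF assms(1)] .
  have gk: "g \<cdot> k = zer K D" using kernel_eq[OF assms(1,3,2)] .
  have "m \<cdot> (e \<cdot> k) = zer K D" using em gk Comp_assoc[OF assms(2) em(1,2)] by simp
  then have ek: "e \<cdot> k = zer K I" using mono_zerD[OF em(4,2) Comp_Hom[OF assms(2) em(1)]] by blast
  have "is_kernel C k e"
  proof (rule kernelI[OF assms(2) em(1) mk ek])
    fix W x assume x: "x \<in> mor W B" "e \<cdot> x = zer W I"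
    have "g \<cdot> x = zer W D" using em x Comp_assoc[OF x(1) em(1,2)] comp_zer'[OF em(2)] hom_obj by metis
    then show "\<exists>h\<in>mor W K. k \<cdot> h = x" using kernelE[OF assms(1,3,2) x(1)] by metis
  qed
  then show ?thesis using X_short_exact[OF _ em(3) assms(2) em(1)] X_sub[OF em(4,2)] assms by blast
qed

lemma X_zero: assumes "is_zero C Z" shows "Z \<in> \<X>"
proof -
  obtain D where D: "D \<in> \<X>" using serre by (auto simp: serre_subcat_def)
  show ?thesis using X_sub[OF zero_mono(2,1)[OF assms X_obj[OF D]] D] .
qed

text \<open>The image \<open>I\<close> is a subquotient of the object \<open>D\<close> through which
  the arrow factors: the image of \<open>b\<close> lies in \<open>D\<close> and maps onto
  \<open>I\<close>.\<close>

lemma negl_image: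
  assumes "e \<in> mor X I" "m \<in> mor I Y" "is_epi C e" "is_mono C m" "negl \<X> (m \<cdot> e)"
  shows "I \<in> \<X>"
proof -
  obtain D a b X' Y' where d: "D \<in> \<X>" "b \<in> mor X' D" "a \<in> mor D Y'" "m \<cdot> e = a \<cdot> b"
    using assms(5) unfolding negl_def by blast
  have XY: "X' = X" "Y' = Y" using Comp_Hom[OF d(2,3)] d(4) Comp_Hom[OF assms(1,2)] by (simp_all add: hom_iff)
  have b: "b \<in> mor X D" and a: "a \<in> mor D Y" using d XY by auto
  obtain D' e' m' where em: "e' \<in> mor X D'" "m' \<in> mor D' D" "is_epi C e'" "is_mono C m'" "m' \<cdot> e' = b"
    using image_factorization[OF b] .
  have D': "D' \<in> \<X>" using X_sub[OF em(4,2) d(1)] .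
  obtain w where w: "w \<in> mor D' I" "w \<cdot> e' = e"
  proof (rule epi_factor_all[OF em(3,1) assms(1)])
    fix T t assume t: "t \<in> mor T X" "e' \<cdot> t = zer T D'"
    have T: "T \<in> Obj C" using t hom_obj by blast
    have "b \<cdot> t = zer T D" using em Comp_assoc[OF t(1) em(1,2)] t comp_zer'[OF em(2) T] by metis
    then have "m \<cdot> (e \<cdot> t) = zer T Y" using Comp_assoc[OF t(1) assms(1,2)] Comp_assoc[OF t(1) b a] d(4) comp_zer'[OF a T] by simp
    then show "e \<cdot> t = zer T I" using mono_zerD[OF assms(4,2) Comp_Hom[OF t(1) assms(1)]] by blast
  qed
  show ?thesis using X_quot[OF epi_cancel[OF _ em(1) w(1)] w(1) D'] w(2) assms(3) by simp
qed

lemma negl_mono_cancel: assumes "negl \<X> (m \<cdot> f)" "is_mono C m" "f \<in> mor X Y" "m \<in> mor Y Z" shows "negl \<X> f"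
proof -
  obtain I e m' where em: "e \<in> mor X I" "m' \<in> mor I Y" "is_epi C e" "is_mono C m'" "m' \<cdot> e = f"
    using image_factorization[OF assms(3)] .
  have "negl \<X> ((m \<cdot> m') \<cdot> e)" using assms(1) em(5) Comp_assoc[OF em(1,2) assms(4)] by simp
  then have "I \<in> \<X>" using negl_image[OF em(1) Comp_Hom[OF em(2) assms(4)] em(3) mono_comp[OF em(4) assms(2) em(2) assms(4)]] by blast
  then show ?thesis using em negl_def by blast
qed

lemma negl_epi_cancel: assumes "negl \<X> (f \<cdot> e)" "is_epi C e" "e \<in> mor X Y" "f \<in> mor Y Z" shows "negl \<X> f"
proof -
  obtain I e' m' where em: "e' \<in> mor Y I" "m' \<in> mor I Z" "is_epi C e'" "is_mono C m'" "m' \<cdot> e' = f"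
    using image_factorization[OF assms(4)] .
  have "negl \<X> (m' \<cdot> (e' \<cdot> e))" using assms(1) em(5) Comp_assoc[OF assms(3) em(1,2)] by simp
  then have "I \<in> \<X>" using negl_image[OF Comp_Hom[OF assms(3) em(1)] em(2) epi_comp[OF assms(2) em(3) assms(3) em(1)] em(4)] by blast
  then show ?thesis using em negl_def by blast
qed

lemma negl_mono: assumes "negl \<X> m" "is_mono C m" "m \<in> mor D Y" shows "D \<in> \<X>"
  using negl_image[OF Ide_Hom assms(3) ide_epi assms(2)] assms Comp_Ide hom_obj by metis

lemma negl_epi: assumes "negl \<X> e" "is_epi C e" "e \<in> mor X D" shows "D \<in> \<X>"
  using negl_image[OF assms(3) Ide_Hom assms(2) ide_mono] assms Ide_Comp hom_obj by metis

lemma negl_zer: "X \<in> Obj C \<Longrightarrow> Y \<in> Obj C \<Longrightarrow> negl \<X> (zer X Y)"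
  using zero_object X_zero negl_def zer_hom comp_zer' by (metis is_zero_def)

text \<open>The image \<open>I\<close> of \<open>x\<close> is an extension of the image of
  \<open>t x\<close> by the part of \<open>I\<close> that \<open>t\<close> kills, and both lie in
  \<open>\<X>\<close>.\<close>

lemma negl_left_cancel:
  assumes t: "t \<in> mor Y Z" and k: "\<And>T x. x \<in> mor T Y \<Longrightarrow> t \<cdot> x = zer T Z \<Longrightarrow> negl \<X> x"
    and x: "x \<in> mor X Y" and n: "negl \<X> (t \<cdot> x)"
  shows "negl \<X> x"
proof -
  obtain I e m where em: "e \<in> mor X I" "m \<in> mor I Y" "is_epi C e" "is_mono C m" "m \<cdot> e = x"
    using image_factorization[OF x] .
  have tm: "t \<cdot> m \<in> mor I Z" using Comp_Hom[OF em(2) t] .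
  have "negl \<X> ((t \<cdot> m) \<cdot> e)" using n em Comp_assoc[OF em(1,2) t] by simp
  then have n: "negl \<X> (t \<cdot> m)" using negl_epi_cancel[OF _ em(3,1) tm] by blast
  obtain k K where kk: "is_kernel C k (t \<cdot> m)" "k \<in> mor K I" "is_mono C k" "t \<cdot> m \<cdot> k = zer K Z" using obtain_kernel[OF tm] .
  have "negl \<X> (m \<cdot> k)" using assms(2)[OF Comp_Hom[OF kk(2) em(2)]] kk(4) Comp_assoc[OF kk(2) em(2) t] by simp
  then have K: "K \<in> \<X>" using negl_mono[OF _ mono_comp[OF kk(3) em(4) kk(2) em(2)] Comp_Hom[OF kk(2) em(2)]] by blast
  obtain I' e' m' where em': "e' \<in> mor I I'" "m' \<in> mor I' Z" "is_epi C e'" "is_mono C m'" "m' \<cdot> e' = t \<cdot> m"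
    using image_factorization[OF tm] .
  have I': "I' \<in> \<X>" using negl_image[OF em'(1-4)] n em'(5) by simp
  have "is_kernel C k e'"
  proof (rule kernelI[OF kk(2) em'(1) kk(3)])
    show "e' \<cdot> k = zer K I'" using mono_zerD[OF em'(4,2) Comp_Hom[OF kk(2) em'(1)]] Comp_assoc[OF kk(2) em'(1,2)] em'(5) kk(4) by simp
    fix W y assume y: "y \<in> mor W I" "e' \<cdot> y = zer W I'"
    have "t \<cdot> m \<cdot> y = zer W Z" using Comp_assoc[OF y(1) em'(1,2)] em'(5) y comp_zer'[OF em'(2)] hom_obj by metis
    then show "\<exists>h\<in>mor W K. k \<cdot> h = y" using kernelE[OF kk(1) tm kk(2) y(1)] by metis
  qed
  then have "I \<in> \<X>" using X_ext[OF _ kk(2) em'(1) K I'] by blast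
  then show ?thesis using em negl_def by blast
qed

text \<open>The image \<open>I\<close> of \<open>y\<close> contains the image of \<open>y s\<close>,
  and the quotient of \<open>I\<close> by it receives an epimorphism from \<open>Y\<close> that
  kills \<open>s\<close>; both pieces lie in \<open>\<X>\<close>.\<close>

lemma negl_right_cancel:
  assumes s: "s \<in> mor X Y" and k: "\<And>Z y. y \<in> mor Y Z \<Longrightarrow> y \<cdot> s = zer X Z \<Longrightarrow> negl \<X> y"
    and y: "y \<in> mor Y Z" and n: "negl \<X> (y \<cdot> s)"
  shows "negl \<X> y"
proof -
  obtain I e m where em: "e \<in> mor Y I" "m \<in> mor I Z" "is_epi C e" "is_mono C m" "m \<cdot> e = y"
    using image_factorization[OF y] .
  have es: "e \<cdot> s \<in> mor X I" using Comp_Hom[OF s em(1)] .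
  have "negl \<X> (m \<cdot> (e \<cdot> s))" using n em Comp_assoc[OF s em(1,2)] by simp
  then have n: "negl \<X> (e \<cdot> s)" using negl_mono_cancel[OF _ em(4) es em(2)] by blast
  obtain I' e' m' where em': "e' \<in> mor X I'" "m' \<in> mor I' I" "is_epi C e'" "is_mono C m'" "m' \<cdot> e' = e \<cdot> s"
    using image_factorization[OF es] .
  have I': "I' \<in> \<X>" using negl_image[OF em'(1-4)] n em'(5) by simp
  obtain c K where c: "is_cokernel C c m'" "c \<in> mor I K" "is_epi C c" "c \<cdot> m' = zer I' K" using obtain_cokernel[OF em'(2)] .
  have "c \<cdot> e \<cdot> s = c \<cdot> (m' \<cdot> e')" using Comp_assoc[OF s em(1) c(2)] em'(5) by simp
  also have "\<dots> = zer X K" using comp_eq_zer[OF em'(2) c(2) em'(1) c(4)] .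
  finally have "negl \<X> (c \<cdot> e)" using assms(2)[OF Comp_Hom[OF em(1) c(2)]] by blast
  then have "K \<in> \<X>" using negl_epi[OF _ epi_comp[OF em(3) c(3) em(1) c(2)] Comp_Hom[OF em(1) c(2)]] by blast
  then have "I \<in> \<X>" using X_ext[OF mono_kernel_cokernel[OF em'(4) c(1)] em'(2) c(2) I'] by blast
  then show ?thesis using em negl_def by blast
qed

text \<open>Replaces the kernel and the cokernel by arrows that \<open>s\<close> kills on either
  side. The arguments about inverted arrows below are conducted in this form.\<close>

lemma quot_iso_iff:
  assumes s: "s \<in> mor X Y"
  shows "quot_iso C \<X> s \<longleftrightarrow> (\<forall>T. \<forall>x \<in> mor T X. s \<cdot> x = zer T Y \<longrightarrow> negl \<X> x) \<and>
    (\<forall>Z. \<forall>y \<in> mor Y Z. y \<cdot> s = zer X Z \<longrightarrow> negl \<X> y)" (is "_ \<longleftrightarrow> ?A \<and> ?B")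
proof (intro iffI conjI)
  assume q: "quot_iso C \<X> s"
  show ?A
  proof (intro allI ballI impI)
    fix T x assume x: "x \<in> mor T X" "s \<cdot> x = zer T Y"
    obtain k K where k: "is_kernel C k s" "k \<in> mor K X" using obtain_kernel[OF s] .
    obtain h where h: "h \<in> mor T K" "k \<cdot> h = x" using kernelE[OF k(1) s k(2) x] .
    have "K \<in> \<X>" using q k by (auto simp: quot_iso_def hom_iff)
    then show "negl \<X> x" using h k negl_def by blast
  qed
  show ?B
  proof (intro allI ballI impI)
    fix Z y assume y: "y \<in> mor Y Z" "y \<cdot> s = zer X Z"
    obtain c K where c: "is_cokernel C c s" "c \<in> mor Y K" using obtain_cokernel[OF s] .
    obtain h where h: "h \<in> mor K Z" "h \<cdot> c = y" using cokernelE[OF c(1) s c(2) y] .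
    have "K \<in> \<X>" using q c by (auto simp: quot_iso_def hom_iff)
    then show "negl \<X> y" using h c negl_def by blast
  qed
next
  assume AB: "?A \<and> ?B"
  have "Dom C k \<in> \<X>" if k: "is_kernel C k s" for k
    using negl_mono[OF _ kernel_mono[OF k] kernel_hom[OF k s]] kernel_eq[OF k s kernel_hom[OF k s]] AB kernel_hom[OF k s] by blast
  moreover have "Cod C c \<in> \<X>" if c: "is_cokernel C c s" for c
    using negl_epi[OF _ cokernel_epi[OF c] cokernel_hom[OF c s]] cokernel_eq[OF c s cokernel_hom[OF c s]] AB cokernel_hom[OF c s] by blast
  ultimately show "quot_iso C \<X> s" using s by (auto simp: quot_iso_def hom_iff)
qed

lemma quot_isoI:
  assumes "s \<in> mor X Y" "\<And>T x. x \<in> mor T X \<Longrightarrow> s \<cdot> x = zer T Y \<Longrightarrow> negl \<X> x"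
    "\<And>Z y. y \<in> mor Y Z \<Longrightarrow> y \<cdot> s = zer X Z \<Longrightarrow> negl \<X> y"
  shows "quot_iso C \<X> s"
  using quot_iso_iff[OF assms(1)] assms(2,3) by blast

lemma quot_isoD1: "quot_iso C \<X> s \<Longrightarrow> s \<in> mor X Y \<Longrightarrow> x \<in> mor T X \<Longrightarrow> s \<cdot> x = zer T Y \<Longrightarrow> negl \<X> x"
  using quot_iso_iff by blast

lemma quot_isoD2: "quot_iso C \<X> s \<Longrightarrow> s \<in> mor X Y \<Longrightarrow> y \<in> mor Y Z \<Longrightarrow> y \<cdot> s = zer X Z \<Longrightarrow> negl \<X> y"
  using quot_iso_iff by blast

lemma mono_quot_iso:
  assumes s: "is_mono C s" "s \<in> mor X Y" and c: "\<And>Z y. y \<in> mor Y Z \<Longrightarrow> y \<cdot> s = zer X Z \<Longrightarrow> negl \<X> y"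
  shows "quot_iso C \<X> s"
proof (rule quot_isoI[OF s(2) _ c])
  fix T x assume x: "x \<in> mor T X" "s \<cdot> x = zer T Y"
  then show "negl \<X> x" using mono_zerD[OF s] negl_zer hom_obj[OF x(1)] by metis
qed

lemma quot_iso_ide: assumes "X \<in> Obj C" shows "quot_iso C \<X> (Ide C X)"
proof (rule mono_quot_iso[OF ide_mono[OF assms] Ide_Hom[OF assms]])
  show "negl \<X> y" if "y \<in> mor X Z" "y \<cdot> Ide C X = zer X Z" for Z y
    using that Comp_Ide negl_zer hom_obj by metis
qed

lemma quot_iso_comp:
  assumes s: "quot_iso C \<X> s" "s \<in> mor X Y" and t: "quot_iso C \<X> t" "t \<in> mor Y Z"
  shows "quot_iso C \<X> (t \<cdot> s)"
proof (rule quot_isoI[OF Comp_Hom[OF s(2) t(2)]])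
  fix T x assume x: "x \<in> mor T X" "t \<cdot> s \<cdot> x = zer T Z"
  have "t \<cdot> (s \<cdot> x) = zer T Z" using x Comp_assoc[OF x(1) s(2) t(2)] by simp
  then have "negl \<X> (s \<cdot> x)" using quot_isoD1[OF t Comp_Hom[OF x(1) s(2)]] by blast
  then show "negl \<X> x" using negl_left_cancel[OF s(2) _ x(1)] quot_isoD1[OF s] by blast
next
  fix W y assume y: "y \<in> mor Z W" "y \<cdot> (t \<cdot> s) = zer X W"
  have "y \<cdot> t \<cdot> s = zer X W" using y Comp_assoc[OF s(2) t(2) y(1)] by simp
  then have "negl \<X> (y \<cdot> t)" using quot_isoD2[OF s Comp_Hom[OF t(2) y(1)]] by blast
  then show "negl \<X> y" using negl_right_cancel[OF t(2) _ y(1)] quot_isoD2[OF t] by blast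
qed

text \<open>Base change supplies the squares of the calculus of fractions. If \<open>q\<close> kills
  \<open>x\<close>, then \<open>f\<close> kills \<open>p x\<close>, and \<open>p\<close> is monic on
  the image of \<open>x\<close>; if \<open>y\<close> kills \<open>q\<close>, then \<open>y\<close>
  factors through the image of \<open>Y\<close> in the cokernel of \<open>f\<close>, an object of
  \<open>\<X>\<close>.\<close>

lemma pullback_quot_iso:
  assumes f: "f \<in> mor X Z" "quot_iso C \<X> f" and g: "g \<in> mor Y Z"
  obtains P p q where "p \<in> mor P X" "q \<in> mor P Y" "f \<cdot> p = g \<cdot> q" "quot_iso C \<X> q"
    "\<And>T x y. x \<in> mor T X \<Longrightarrow> y \<in> mor T Y \<Longrightarrow> f \<cdot> x = g \<cdot> y \<Longrightarrow> \<exists>t \<in> mor T P. p \<cdot> t = x \<and> q \<cdot> t = y"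
    "is_mono C f \<Longrightarrow> is_mono C q"
proof -
  obtain P p q where P: "p \<in> mor P X" "q \<in> mor P Y" "f \<cdot> p = g \<cdot> q"
    "\<And>T x y. x \<in> mor T X \<Longrightarrow> y \<in> mor T Y \<Longrightarrow> f \<cdot> x = g \<cdot> y \<Longrightarrow> \<exists>t \<in> mor T P. p \<cdot> t = x \<and> q \<cdot> t = y"
    "\<And>T t. t \<in> mor T P \<Longrightarrow> p \<cdot> t = zer T X \<Longrightarrow> q \<cdot> t = zer T Y \<Longrightarrow> t = zer T P"
    "is_mono C f \<Longrightarrow> is_mono C q"
    by (rule obtain_pullback[OF f(1) g]) (blast intro: that)
  have "quot_iso C \<X> q"
  proof (rule quot_isoI[OF P(2)])
    fix T x assume x: "x \<in> mor T P" "q \<cdot> x = zer T Y"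
    have T: "T \<in> Obj C" using x hom_obj by blast
    have "f \<cdot> (p \<cdot> x) = zer T Z" using comp_ext[OF P(3) P(1) f(1) P(2) g x(1)] x(2) comp_zer'[OF g T] by simp
    then have n: "negl \<X> (p \<cdot> x)" using quot_isoD1[OF f(2,1) Comp_Hom[OF x(1) P(1)]] by blast
    obtain I e m where em: "e \<in> mor T I" "m \<in> mor I P" "is_epi C e" "is_mono C m" "m \<cdot> e = x"
      using image_factorization[OF x(1)] .
    have "(q \<cdot> m) \<cdot> e = zer T Y" using Comp_assoc[OF em(1,2) P(2)] em(5) x(2) by simp
    then have qm: "q \<cdot> m = zer I Y" using epi_zerD[OF em(3,1) Comp_Hom[OF em(2) P(2)]] by blast
    have pm: "is_mono C (p \<cdot> m)"
    proof (rule mono_zerI[OF Comp_Hom[OF em(2) P(1)]])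
      fix W t assume t: "t \<in> mor W I" "p \<cdot> m \<cdot> t = zer W X"
      have "p \<cdot> (m \<cdot> t) = zer W X" "q \<cdot> (m \<cdot> t) = zer W Y"
        using t Comp_assoc[OF t(1) em(2) P(1)] comp_eq_zer[OF em(2) P(2) t(1) qm] by auto
      then have "m \<cdot> t = zer W P" using P(5)[OF Comp_Hom[OF t(1) em(2)]] by blast
      then show "t = zer W I" using mono_zerD[OF em(4,2) t(1)] by blast
    qed
    have "negl \<X> ((p \<cdot> m) \<cdot> e)" using n em(5) Comp_assoc[OF em(1,2) P(1)] by simp
    then have "I \<in> \<X>" using negl_image[OF em(1) Comp_Hom[OF em(2) P(1)] em(3) pm] by blast
    then show "negl \<X> x" using em negl_def by blast
  next
    fix W y assume y: "y \<in> mor Y W" "y \<cdot> q = zer P W"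
    have W: "W \<in> Obj C" using y hom_obj by blast
    obtain c K where c: "is_cokernel C c f" "c \<in> mor Z K" "is_epi C c" "c \<cdot> f = zer X K" using obtain_cokernel[OF f(1)] .
    have cg: "c \<cdot> g \<in> mor Y K" using Comp_Hom[OF g c(2)] .
    have K: "K \<in> \<X>" using negl_epi[OF quot_isoD2[OF f(2,1) c(2,4)] c(3,2)] .
    obtain I e m where em: "e \<in> mor Y I" "m \<in> mor I K" "is_epi C e" "is_mono C m" "m \<cdot> e = c \<cdot> g"
      using image_factorization[OF cg] .
    have I: "I \<in> \<X>" using X_sub[OF em(4,2) K] .
    \<comment> \<open>If \<open>e\<close> kills \<open>t\<close>, then \<open>g t\<close> dies in
      the cokernel of \<open>f\<close>; after a cover it lifts along \<open>f\<close>, so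
      \<open>t\<close> comes from the pullback, where \<open>y\<close> vanishes.\<close>
    obtain h where h: "h \<in> mor I W" "h \<cdot> e = y"
    proof (rule epi_factor_all[OF em(3,1) y(1)])
      fix T t assume t: "t \<in> mor T Y" "e \<cdot> t = zer T I"
      have T: "T \<in> Obj C" using t hom_obj by blast
      have "c \<cdot> (g \<cdot> t) = m \<cdot> (e \<cdot> t)" using Comp_assoc[OF t(1) g c(2)] Comp_assoc[OF t(1) em(1,2)] em(5) by simp
      also have "\<dots> = zer T K" using t(2) comp_zer'[OF em(2) T] by simp
      finally have z: "c \<cdot> (g \<cdot> t) = zer T K" .
      obtain S r x where S: "r \<in> mor S T" "is_epi C r" "x \<in> mor S X" "f \<cdot> x = g \<cdot> t \<cdot> r"
        using cokernel_lift[OF f(1) c(1,2) Comp_Hom[OF t(1) g] z] .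
      have tr: "t \<cdot> r \<in> mor S Y" using Comp_Hom[OF S(1) t(1)] .
      have "f \<cdot> x = g \<cdot> (t \<cdot> r)" using S(4) Comp_assoc[OF S(1) t(1) g] by simp
      then obtain u where u: "u \<in> mor S P" "q \<cdot> u = t \<cdot> r" using P(4)[OF S(3) tr] by blast
      have "(y \<cdot> t) \<cdot> r = y \<cdot> (q \<cdot> u)" using u(2) Comp_assoc[OF S(1) t(1) y(1)] by simp
      also have "\<dots> = zer S W" using comp_eq_zer[OF P(2) y(1) u(1) y(2)] .
      finally show "y \<cdot> t = zer T W" using epi_zerD[OF S(2,1) Comp_Hom[OF t(1) y(1)]] by blast
    qed
    then show "negl \<X> y" using em I negl_def by blast
  qed
  then show ?thesis using that[OF P(1,2,3) _ P(4,6)] by blast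
qed

end

section \<open>Noetherian objects\<close>

context abelian_category
begin

text \<open>Lying in a subobject is a local property: the cokernel of \<open>t\<close> kills
  \<open>x\<close> as soon as it kills \<open>x\<close> after an epic cover.\<close>

lemma mono_factor_epi:
  assumes t: "is_mono C t" "t \<in> mor D M" and x: "x \<in> mor T M" and p: "is_epi C p" "p \<in> mor S T"
    and z: "z \<in> mor S D" "t \<cdot> z = x \<cdot> p"
  obtains h where "h \<in> mor T D" "t \<cdot> h = x"
proof -
  obtain c K where c: "is_cokernel C c t" "c \<in> mor M K" "is_epi C c" "c \<cdot> t = zer D K" using obtain_cokernel[OF t(2)] .
  have "c \<cdot> x \<cdot> p = zer S K" using Comp_assoc[OF p(2) x c(2)] z(2) comp_eq_zer[OF t(2) c(2) z(1) c(4)] by simp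
  then have "c \<cdot> x = zer T K" using epi_zerD[OF p Comp_Hom[OF x c(2)]] by blast
  then show ?thesis using mono_factor[OF t c(1,2) x] that by blast
qed

lemma sub_le_iff: "s \<in> mor A M \<Longrightarrow> t \<in> mor B M' \<Longrightarrow> sub_le C s t \<longleftrightarrow> (\<exists>h \<in> mor A B. t \<cdot> h = s)"
  by (simp add: sub_le_def hom_DC)

lemma subobj_mor: "subobj C M s \<Longrightarrow> s \<in> mor (Dom C s) M" and subobj_mono: "subobj C M s \<Longrightarrow> is_mono C s"
  by (auto simp: subobj_def Hom_def mono_arr)

lemma subobjI: "is_mono C s \<Longrightarrow> s \<in> mor A M \<Longrightarrow> subobj C M s"
  by (simp add: subobj_def hom_DC)

lemma sub_le_refl: "s \<in> mor A M \<Longrightarrow> sub_le C s s"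
  using sub_le_iff Comp_Ide Ide_Hom hom_obj by blast

lemma sub_le_trans:
  assumes "s \<in> mor A M" "t \<in> mor B M" "u \<in> mor D M" "sub_le C s t" "sub_le C t u" shows "sub_le C s u"
proof -
  obtain h where h: "h \<in> mor A B" "t \<cdot> h = s" using assms sub_le_iff by blast
  obtain g where g: "g \<in> mor B D" "u \<cdot> g = t" using assms sub_le_iff by blast
  have "u \<cdot> (g \<cdot> h) = s" using h g Comp_assoc[OF h(1) g(1) assms(3)] by simp
  then show ?thesis using sub_le_iff[OF assms(1,3)] Comp_Hom[OF h(1) g(1)] by blast
qed

lemma chain_mono:
  assumes "\<And>n. subobj C M (s n)" "\<And>n. sub_le C (s n) (s (Suc n))" "i \<le> j"
  shows "sub_le C (s i) (s j)"
  using assms(3)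
proof (induction j rule: dec_induct)
  case base
  then show ?case using sub_le_refl[OF subobj_mor[OF assms(1)]] .
next
  case (step n)
  then show ?case using sub_le_trans[OF subobj_mor subobj_mor subobj_mor, OF assms(1) assms(1) assms(1) _ assms(2)] by blast
qed

lemma noeth_obj: "noetherian_obj C M \<Longrightarrow> M \<in> Obj C"
  by (simp add: noetherian_obj_def)

lemma noethD:
  assumes "noetherian_obj C M" "\<And>n. subobj C M (s n)" "\<And>n. sub_le C (s n) (s (Suc n))"
  obtains n0 where "\<And>n. n \<ge> n0 \<Longrightarrow> sub_le C (s n) (s n0)"
  using assms unfolding noetherian_obj_def by metis

lemma noeth_sub:
  assumes "is_mono C m" "m \<in> mor D M" "noetherian_obj C M" shows "noetherian_obj C D"
  unfolding noetherian_obj_def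
proof (intro conjI allI impI)
  show "D \<in> Obj C" using assms hom_obj by blast
  fix s :: "nat \<Rightarrow> _" assume "(\<forall>n. subobj C D (s n)) \<and> (\<forall>n. sub_le C (s n) (s (Suc n)))"
  then have s: "subobj C D (s n)" and le: "sub_le C (s n) (s (Suc n))" for n by auto
  note sm = subobj_mor[OF s] and mm = subobj_mono[OF s]
  have ms: "m \<cdot> s n \<in> mor (Dom C (s n)) M" for n using Comp_Hom[OF sm assms(2)] .
  have le': "sub_le C (m \<cdot> s i) (m \<cdot> s j) \<longleftrightarrow> sub_le C (s i) (s j)" for i j
  proof -
    have "m \<cdot> s j \<cdot> h = m \<cdot> s i \<longleftrightarrow> s j \<cdot> h = s i" if h: "h \<in> mor (Dom C (s i)) (Dom C (s j))" for h
      using Comp_assoc[OF h sm assms(2)] monoD[OF assms(1,2) Comp_Hom[OF h sm] sm] by auto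
    then show ?thesis using sub_le_iff[OF ms ms] sub_le_iff[OF sm sm] by blast
  qed
  have 1: "subobj C M (m \<cdot> s n)" for n using subobjI[OF mono_comp[OF mm assms(1) sm assms(2)] ms] .
  have 2: "sub_le C (m \<cdot> s n) (m \<cdot> s (Suc n))" for n using le le' by blast
  obtain n0 where "\<And>n. n \<ge> n0 \<Longrightarrow> sub_le C (m \<cdot> s n) (m \<cdot> s n0)"
    using noethD[OF assms(3), of "\<lambda>n. m \<cdot> s n", OF 1 2] by blast
  then show "\<exists>n0. \<forall>n\<ge>n0. sub_le C (s n) (s n0)" using le' by blast
qed

text \<open>Lists the generalised elements of the preimage, so that later arguments need neither the
  pullback square nor its universal property.\<close>

lemma obtain_preimage:
  assumes s: "is_mono C s" "s \<in> mor D Q" and e: "e \<in> mor M Q"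
  obtains K k where "k \<in> mor K M" "is_mono C k"
    "\<And>T x. x \<in> mor T M \<Longrightarrow> (\<exists>y \<in> mor T K. k \<cdot> y = x) \<longleftrightarrow> (\<exists>z \<in> mor T D. s \<cdot> z = e \<cdot> x)"
proof -
  obtain K p k where P: "p \<in> mor K D" "k \<in> mor K M" "s \<cdot> p = e \<cdot> k"
    "\<And>T x y. x \<in> mor T D \<Longrightarrow> y \<in> mor T M \<Longrightarrow> s \<cdot> x = e \<cdot> y \<Longrightarrow> \<exists>t \<in> mor T K. p \<cdot> t = x \<and> k \<cdot> t = y"
    "is_mono C k"
    by (rule obtain_pullback[OF s(2) e]) (use s(1) in \<open>blast intro: that\<close>)
  have "(\<exists>y \<in> mor T K. k \<cdot> y = x) \<longleftrightarrow> (\<exists>z \<in> mor T D. s \<cdot> z = e \<cdot> x)" if x: "x \<in> mor T M" for T x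
  proof
    assume "\<exists>y \<in> mor T K. k \<cdot> y = x"
    then obtain y where y: "y \<in> mor T K" "k \<cdot> y = x" by blast
    have "s \<cdot> (p \<cdot> y) = e \<cdot> x" using comp_ext[OF P(3,1) s(2) P(2) e y(1)] y(2) by simp
    then show "\<exists>z \<in> mor T D. s \<cdot> z = e \<cdot> x" using Comp_Hom[OF y(1) P(1)] by blast
  next
    assume "\<exists>z \<in> mor T D. s \<cdot> z = e \<cdot> x"
    then show "\<exists>y \<in> mor T K. k \<cdot> y = x" using P(4)[OF _ x] by blast
  qed
  then show ?thesis using that P by blast
qed

lemma obtain_preimage_chain:
  assumes s: "\<And>n. subobj C Q (s n)" "\<And>n. sub_le C (s n) (s (Suc n))" and e: "e \<in> mor M Q"
  obtains k where "\<And>n :: nat. subobj C M (k n)" "\<And>n. sub_le C (k n) (k (Suc n))"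
    "\<And>n T x. x \<in> mor T M \<Longrightarrow> (\<exists>y \<in> mor T (Dom C (k n)). k n \<cdot> y = x) \<longleftrightarrow> (\<exists>z \<in> mor T (Dom C (s n)). s n \<cdot> z = e \<cdot> x)"
proof -
  note sm = subobj_mor[OF s(1)] and mm = subobj_mono[OF s(1)]
  have "\<exists>k. subobj C M k \<and> (\<forall>T. \<forall>x \<in> mor T M. (\<exists>y \<in> mor T (Dom C k). k \<cdot> y = x) \<longleftrightarrow> (\<exists>z \<in> mor T (Dom C (s n)). s n \<cdot> z = e \<cdot> x))" for n
  proof -
    obtain K k where k: "k \<in> mor K M" "is_mono C k"
    "\<And>T x. x \<in> mor T M \<Longrightarrow> (\<exists>y \<in> mor T K. k \<cdot> y = x) \<longleftrightarrow> (\<exists>z \<in> mor T (Dom C (s n)). s n \<cdot> z = e \<cdot> x)"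
      by (rule obtain_preimage[OF mm sm e, of n]) (blast intro: that)
    have "Dom C k = K" using k by (simp add: hom_DC)
    then show ?thesis using k subobjI by blast
  qed
  then obtain k where k: "\<And>n. subobj C M (k n)"
     "\<And>n T x. x \<in> mor T M \<Longrightarrow> (\<exists>y \<in> mor T (Dom C (k n)). k n \<cdot> y = x) \<longleftrightarrow> (\<exists>z \<in> mor T (Dom C (s n)). s n \<cdot> z = e \<cdot> x)"
    by metis
  have "sub_le C (k n) (k (Suc n))" for n
  proof -
    note km = subobj_mor[OF k(1)[of n]]
    have "\<exists>y \<in> mor (Dom C (k n)) (Dom C (k n)). k n \<cdot> y = k n" using Comp_Ide[OF km] Ide_Hom hom_obj[OF km] by blast
    then obtain z where z: "z \<in> mor (Dom C (k n)) (Dom C (s n))" "s n \<cdot> z = e \<cdot> k n" using k(2)[OF km] by blast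
    obtain h where h: "h \<in> mor (Dom C (s n)) (Dom C (s (Suc n)))" "s (Suc n) \<cdot> h = s n"
      using s(2)[of n] sub_le_iff[OF sm sm] by blast
    have "s (Suc n) \<cdot> (h \<cdot> z) = e \<cdot> k n" using h z Comp_assoc[OF z(1) h(1) sm] by simp
    then have "\<exists>y \<in> mor (Dom C (k n)) (Dom C (k (Suc n))). k (Suc n) \<cdot> y = k n" using k(2)[OF km] Comp_Hom[OF z(1) h(1)] by blast
    then show ?thesis using sub_le_iff[OF km subobj_mor[OF k(1)]] by blast
  qed
  then show ?thesis using that[of k] k by blast
qed

lemma noeth_quot:
  assumes e: "is_epi C e" "e \<in> mor M Q" and M: "noetherian_obj C M" shows "noetherian_obj C Q"
  unfolding noetherian_obj_def
proof (intro conjI allI impI)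
  show "Q \<in> Obj C" using assms hom_obj by blast
  fix s :: "nat \<Rightarrow> _" assume "(\<forall>n. subobj C Q (s n)) \<and> (\<forall>n. sub_le C (s n) (s (Suc n)))"
  then have s: "subobj C Q (s n)" and le: "sub_le C (s n) (s (Suc n))" for n by auto
  note sm = subobj_mor[OF s] and mm = subobj_mono[OF s]
  obtain k where k: "\<And>n. subobj C M (k n)" "\<And>n. sub_le C (k n) (k (Suc n))"
    "\<And>n T x. x \<in> mor T M \<Longrightarrow> (\<exists>y \<in> mor T (Dom C (k n)). k n \<cdot> y = x) \<longleftrightarrow> (\<exists>z \<in> mor T (Dom C (s n)). s n \<cdot> z = e \<cdot> x)"
    by (rule obtain_preimage_chain[where s = s, OF s le e(2)]) (blast intro: that)
  obtain n0 where n0: "\<And>n. n \<ge> n0 \<Longrightarrow> sub_le C (k n) (k n0)" using noethD[where s = k, OF M k(1,2)] by blast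
  have "sub_le C (s n) (s n0)" if n: "n \<ge> n0" for n
  proof -
    let ?A = "Dom C (s n)"
    obtain S p x where x: "p \<in> mor S ?A" "is_epi C p" "x \<in> mor S M" "e \<cdot> x = s n \<cdot> p"
      using epi_lift[OF e(2,1) sm] .
    then obtain y where y: "y \<in> mor S (Dom C (k n))" "k n \<cdot> y = x" using k(3)[OF x(3)] x(1,4) by metis
    obtain h where h: "h \<in> mor (Dom C (k n)) (Dom C (k n0))" "k n0 \<cdot> h = k n"
      using n0[OF n] sub_le_iff[OF subobj_mor subobj_mor, OF k(1) k(1)] by blast
    have "k n0 \<cdot> (h \<cdot> y) = x" using h y Comp_assoc[OF y(1) h(1) subobj_mor[OF k(1)]] by simp
    then obtain z where z: "z \<in> mor S (Dom C (s n0))" "s n0 \<cdot> z = e \<cdot> x" using k(3)[OF x(3)] Comp_Hom[OF y(1) h(1)] by blast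
    obtain g where "g \<in> mor ?A (Dom C (s n0))" "s n0 \<cdot> g = s n"
      using mono_factor_epi[OF mm sm sm x(2,1) z(1)] z(2) x(4) by metis
    then show ?thesis using sub_le_iff[OF sm sm] by blast
  qed
  then show "\<exists>n0. \<forall>n\<ge>n0. sub_le C (s n) (s n0)" by blast
qed

text \<open>Let \<open>u n\<close> be the trace of \<open>s n\<close> on \<open>K\<close> and
  \<open>m n\<close> its image in \<open>D\<close>; both chains are stationary from
  \<open>n0\<close> on. After a cover, an element of \<open>s n\<close> has the same image in
  \<open>D\<close> as some element of \<open>s n0\<close>; their difference lies in \<open>K\<close>
  and in \<open>s n\<close>, hence in \<open>u n\<close>, hence in \<open>s n0\<close>.\<close>

lemma noeth_ext:
  assumes k: "is_kernel C k g" "k \<in> mor K B" and g: "g \<in> mor B D" and K: "noetherian_obj C K" and D: "noetherian_obj C D"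
  shows "noetherian_obj C B"
  unfolding noetherian_obj_def
proof (intro conjI allI impI)
  show "B \<in> Obj C" using assms hom_obj by blast
  fix s :: "nat \<Rightarrow> _" assume "(\<forall>n. subobj C B (s n)) \<and> (\<forall>n. sub_le C (s n) (s (Suc n)))"
  then have s: "subobj C B (s n)" and le: "sub_le C (s n) (s (Suc n))" for n by auto
  note sm = subobj_mor[OF s] and mm = subobj_mono[OF s]
  obtain u where u: "\<And>n. subobj C K (u n)" "\<And>n. sub_le C (u n) (u (Suc n))"
    "\<And>n T x. x \<in> mor T K \<Longrightarrow> (\<exists>y \<in> mor T (Dom C (u n)). u n \<cdot> y = x) \<longleftrightarrow> (\<exists>z \<in> mor T (Dom C (s n)). s n \<cdot> z = k \<cdot> x)"
    by (rule obtain_preimage_chain[where s = s, OF s le k(2)]) (blast intro: that)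
  have "\<exists>I e m. e \<in> mor (Dom C (s n)) I \<and> m \<in> mor I D \<and> is_epi C e \<and> is_mono C m \<and> m \<cdot> e = g \<cdot> s n" for n
    using image_factorization[OF Comp_Hom[OF sm g], of n] by metis
  then obtain I e m where em: "\<And>n. e n \<in> mor (Dom C (s n)) (I n)" "\<And>n. m n \<in> mor (I n) D" "\<And>n. is_epi C (e n)"
    "\<And>n. is_mono C (m n)" "\<And>n. m n \<cdot> e n = g \<cdot> s n" by metis
  have dm: "Dom C (m n) = I n" for n using em(2) hom_DC by blast
  have ms: "subobj C D (m n)" for n using subobjI em(2,4) by blast
  have ml: "sub_le C (m n) (m (Suc n))" for n
  proof -
    obtain h where h: "h \<in> mor (Dom C (s n)) (Dom C (s (Suc n)))" "s (Suc n) \<cdot> h = s n"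
      using le[of n] sub_le_iff[OF sm sm] by blast
    have "m (Suc n) \<cdot> (e (Suc n) \<cdot> h) = g \<cdot> s (Suc n) \<cdot> h" using em(5) Comp_assoc[OF h(1) em(1,2)] by simp
    also have "\<dots> = m n \<cdot> e n" using h Comp_assoc[OF h(1) sm g] em(5) by simp
    finally obtain v where "v \<in> mor (I n) (I (Suc n))" "m (Suc n) \<cdot> v = m n"
      using mono_factor_epi[OF em(4,2) em(2) em(3,1) Comp_Hom[OF h(1) em(1)]] by metis
    then show ?thesis using sub_le_iff[OF em(2) em(2)] by blast
  qed
  obtain n1 where n1: "\<And>n. n \<ge> n1 \<Longrightarrow> sub_le C (u n) (u n1)" using noethD[where s = u, OF K u(1,2)] by blast
  obtain n2 where n2: "\<And>n. n \<ge> n2 \<Longrightarrow> sub_le C (m n) (m n2)" using noethD[where s = m, OF D ms ml] by blast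
  define n0 where "n0 = max n1 n2"
  have "sub_le C (s n) (s n0)" if n: "n \<ge> n0" for n
  proof -
    let ?A = "Dom C (s n)"
    let ?E = "Dom C (s n0)"
    have "sub_le C (u n1) (u n0)" by (rule chain_mono[of K]) (simp_all add: u n0_def)
    then have un: "sub_le C (u n) (u n0)" using sub_le_trans[OF subobj_mor subobj_mor subobj_mor, OF u(1) u(1) u(1)] n1[of n] n by (metis max.bounded_iff n0_def)
    have "sub_le C (m n2) (m n0)" by (rule chain_mono[of D]) (simp_all add: ms ml n0_def)
    then have mn: "sub_le C (m n) (m n0)" using sub_le_trans[OF em(2) em(2) em(2)] n2[of n] n by (metis max.bounded_iff n0_def)
    obtain h where h: "h \<in> mor (I n) (I n0)" "m n0 \<cdot> h = m n" using mn sub_le_iff[OF em(2) em(2)] by blast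
    obtain S p z where z: "p \<in> mor S ?A" "is_epi C p" "z \<in> mor S ?E" "e n0 \<cdot> z = (h \<cdot> e n) \<cdot> p"
      using epi_lift[OF em(1,3) Comp_Hom[OF em(1) h(1)]] .
    have sz: "s n0 \<cdot> z \<in> mor S B" "s n \<cdot> p \<in> mor S B" using Comp_Hom z sm by blast+
    have "g \<cdot> (s n0 \<cdot> z) = m n0 \<cdot> (e n0 \<cdot> z)" using comp_ext[OF em(5) em(1) em(2) sm g z(3)] by simp
    also have "\<dots> = m n0 \<cdot> (h \<cdot> (e n \<cdot> p))" using z(4) Comp_assoc[OF z(1) em(1) h(1)] by simp
    also have "\<dots> = m n \<cdot> (e n \<cdot> p)" using comp_ext1[OF h(2,1) em(2) Comp_Hom[OF z(1) em(1)]] .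
    also have "\<dots> = g \<cdot> (s n \<cdot> p)" using comp_ext[OF em(5) em(1) em(2) sm g z(1)] .
    finally have eq: "g \<cdot> (s n \<cdot> p) = g \<cdot> (s n0 \<cdot> z)" by simp
    let ?d = "dif (s n \<cdot> p) (s n0 \<cdot> z)"
    have d: "?d \<in> mor S B" using dif_hom sz by blast
    have "g \<cdot> ?d = zer S D" using comp_dif[OF sz(2,1) g] eq dif_eq[OF Comp_Hom[OF sz(2) g] Comp_Hom[OF sz(1) g]] by simp
    then obtain y where y: "y \<in> mor S K" "k \<cdot> y = ?d" using kernelE[OF k(1) g k(2) d] by metis
    have "sub_le C (s n0) (s n)" by (rule chain_mono[of B]) (simp_all add: s le n)
    then obtain w where w: "w \<in> mor ?E ?A" "s n \<cdot> w = s n0" using sub_le_iff[OF sm sm] by blast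
    have wz: "w \<cdot> z \<in> mor S ?A" using Comp_Hom[OF z(3) w(1)] .
    have "s n \<cdot> dif p (w \<cdot> z) = ?d" using comp_dif[OF z(1) wz sm] w(2) Comp_assoc[OF z(3) w(1) sm] by simp
    then have "\<exists>z \<in> mor S ?A. s n \<cdot> z = k \<cdot> y" using dif_hom[OF z(1) wz] y(2) by metis
    then obtain y' where y': "y' \<in> mor S (Dom C (u n))" "u n \<cdot> y' = y" using u(3)[OF y(1)] by metis
    obtain h' where h': "h' \<in> mor (Dom C (u n)) (Dom C (u n0))" "u n0 \<cdot> h' = u n"
      using un sub_le_iff[OF subobj_mor subobj_mor, OF u(1) u(1)] by blast
    have "u n0 \<cdot> (h' \<cdot> y') = y" using comp_ext1[OF h'(2,1) subobj_mor[OF u(1)] y'(1)] y'(2) by simp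
    then obtain v where v: "v \<in> mor S ?E" "s n0 \<cdot> v = ?d" using u(3)[OF y(1)] Comp_Hom[OF y'(1) h'(1)] y(2) by metis
    \<comment> \<open>Passing to the cokernel of \<open>s n0\<close> removes the cover: there
      \<open>s n\<close> vanishes after an epimorphism, so it vanishes.\<close>
    obtain c L where c: "is_cokernel C c (s n0)" "c \<in> mor B L" "is_epi C c" "c \<cdot> s n0 = zer ?E L" using obtain_cokernel[OF sm] .
    have "c \<cdot> ?d = zer S L" using comp_eq_zer[OF sm c(2) v(1) c(4)] v(2) by simp
    then have "c \<cdot> (s n \<cdot> p) = c \<cdot> (s n0 \<cdot> z)" using comp_dif[OF sz(2,1) c(2)] dif_eq[OF Comp_Hom[OF sz(2) c(2)] Comp_Hom[OF sz(1) c(2)]] by simp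
    then have "c \<cdot> s n \<cdot> p = zer S L" using comp_eq_zer[OF sm c(2) z(3) c(4)] Comp_assoc[OF z(1) sm c(2)] by simp
    then have "c \<cdot> s n = zer ?A L" using epi_zerD[OF z(2,1) Comp_Hom[OF sm c(2)]] by blast
    then obtain f where "f \<in> mor ?A ?E" "s n0 \<cdot> f = s n" using mono_factor[OF mm sm c(1,2) sm] by blast
    then show ?thesis using sub_le_iff[OF sm sm] by blast
  qed
  then show "\<exists>n0. \<forall>n\<ge>n0. sub_le C (s n) (s n0)" by blast
qed

text \<open>The kernel of \<open>g\<close> is only required to be hit locally by \<open>A\<close>;
  it is then a subobject of the image of \<open>a\<close>, which is a quotient of
  \<open>A\<close>.\<close>

lemma noeth_ext':
  assumes a: "a \<in> mor A B" and g: "g \<in> mor B D" and A: "noetherian_obj C A" and D: "noetherian_obj C D"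
    and ex: "\<And>T x. x \<in> mor T B \<Longrightarrow> g \<cdot> x = zer T D \<Longrightarrow> \<exists>S. \<exists>p \<in> mor S T. \<exists>y \<in> mor S A. is_epi C p \<and> a \<cdot> y = x \<cdot> p"
  shows "noetherian_obj C B"
proof -
  obtain k K where k: "is_kernel C k g" "k \<in> mor K B" "is_mono C k" "g \<cdot> k = zer K D" using obtain_kernel[OF g] .
  obtain I e m where em: "e \<in> mor A I" "m \<in> mor I B" "is_epi C e" "is_mono C m" "m \<cdot> e = a"
    using image_factorization[OF a] .
  obtain S p y where S: "p \<in> mor S K" "y \<in> mor S A" "is_epi C p" "a \<cdot> y = k \<cdot> p" using ex[OF k(2,4)] by blast
  have "m \<cdot> (e \<cdot> y) = k \<cdot> p" using S(4) em(5) Comp_assoc[OF S(2) em(1,2)] by simp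
  then obtain h where h: "h \<in> mor K I" "m \<cdot> h = k" using mono_factor_epi[OF em(4,2) k(2) S(3,1) Comp_Hom[OF S(2) em(1)]] by metis
  have "is_mono C h" using mono_cancel[OF _ h(1) em(2)] h(2) k(3) by simp
  then have "noetherian_obj C K" using noeth_sub[OF _ h(1) noeth_quot[OF em(3,1) A]] by blast
  then show ?thesis using noeth_ext[OF k(1,2) g _ D] by blast
qed

lemma noeth_max:
  assumes M: "noetherian_obj C M" and P: "\<And>s. P s \<Longrightarrow> subobj C M s" "P s0"
  obtains s where "P s" "\<And>t. P t \<Longrightarrow> sub_le C s t \<Longrightarrow> sub_le C t s"
proof (rule ccontr)
  assume "\<not> thesis"
  then have *: "\<exists>t. P t \<and> sub_le C s t \<and> \<not> sub_le C t s" if "P s" for s using that by (metis \<open>\<not> thesis\<close> \<open>\<And>s. \<lbrakk>P s; \<And>t. \<lbrakk>P t; sub_le C s t\<rbrakk> \<Longrightarrow> sub_le C t s\<rbrakk> \<Longrightarrow> thesis\<close>)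
  obtain f where f: "\<And>n. P (f n)" "\<And>n::nat. sub_le C (f n) (f (Suc n)) \<and> \<not> sub_le C (f (Suc n)) (f n)"
    using dependent_nat_choice[of "\<lambda>_. P" "\<lambda>_ s t. sub_le C s t \<and> \<not> sub_le C t s"] P(2) * by metis
  obtain n0 where "\<And>n. n \<ge> n0 \<Longrightarrow> sub_le C (f n) (f n0)" using noethD[OF M, of f] P(1) f by blast
  then show False using f(2)[of n0] by (metis le_SucI order_refl)
qed

section \<open>Essential monomorphisms\<close>

text \<open>The elementwise form of essentiality: a nonzero element of the codomain has a nonzero
  restriction that comes from the domain. It implies \<open>essential_mono\<close> and is the form
  in which essentiality passes to directed unions.\<close>

definition ess :: "'b \<Rightarrow> bool" where
  "ess e \<longleftrightarrow> is_mono C e \<and> (\<forall>T. \<forall>x \<in> mor T (Cod C e). x \<noteq> zer T (Cod C e) \<longrightarrow>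
     (\<exists>W. \<exists>w \<in> mor W T. \<exists>z \<in> mor W (Dom C e). x \<cdot> w = e \<cdot> z \<and> x \<cdot> w \<noteq> zer W (Cod C e)))"

lemma essI:
  assumes "is_mono C e" "e \<in> mor X Y"
    "\<And>T x. x \<in> mor T Y \<Longrightarrow> x \<noteq> zer T Y \<Longrightarrow> \<exists>W. \<exists>w \<in> mor W T. \<exists>z \<in> mor W X. x \<cdot> w = e \<cdot> z \<and> x \<cdot> w \<noteq> zer W Y"
  shows "ess e"
  using assms hom_DC[OF assms(2)] unfolding ess_def by simp

lemma essE:
  assumes "ess e" "e \<in> mor X Y" "x \<in> mor T Y" "x \<noteq> zer T Y"
  obtains W w z where "w \<in> mor W T" "z \<in> mor W X" "x \<cdot> w = e \<cdot> z" "x \<cdot> w \<noteq> zer W Y"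
  using assms hom_DC[OF assms(2)] unfolding ess_def by metis

lemma ess_mono: "ess e \<Longrightarrow> is_mono C e"
  by (simp add: ess_def)

lemma ess_mono_cancel:
  assumes e: "ess e" "e \<in> mor X Y" and g: "g \<in> mor Y Z" "is_mono C (g \<cdot> e)"
  shows "is_mono C g"
proof (rule mono_zerI[OF g(1)])
  fix W x assume x: "x \<in> mor W Y" "g \<cdot> x = zer W Z"
  show "x = zer W Y"
  proof (rule ccontr)
    assume "x \<noteq> zer W Y"
    then obtain V w z where w: "w \<in> mor V W" "z \<in> mor V X" "x \<cdot> w = e \<cdot> z" "x \<cdot> w \<noteq> zer V Y" using essE[OF e x(1)] by metis
    have "g \<cdot> e \<cdot> z = g \<cdot> (x \<cdot> w)" using w(3) Comp_assoc[OF w(2) e(2) g(1)] by simp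
    also have "\<dots> = zer V Z" using comp_eq_zer[OF x(1) g(1) w(1) x(2)] .
    finally have "z = zer V X" using mono_zerD[OF g(2) Comp_Hom[OF e(2) g(1)] w(2)] by blast
    then show False using w(3,4) comp_zer'[OF e(2)] hom_obj[OF w(1)] by simp
  qed
qed

lemma ess_essential_mono: assumes "ess e" shows "essential_mono C e"
proof -
  have e: "e \<in> mor (Dom C e) (Cod C e)" using homI ess_mono[OF assms] mono_arr by blast
  have "is_mono C f" if "f \<in> Arr C" "Dom C f = Cod C e" "is_mono C (f \<cdot> e)" for f
    using ess_mono_cancel[OF assms e, of f "Cod C f"] homI[OF that(1)] that by simp
  then show ?thesis using ess_mono[OF assms] by (auto simp: essential_mono_def)
qed

section \<open>Monoform objects and atoms\<close>

lemma nonzero_obj: "f \<in> mor X Y \<Longrightarrow> f \<noteq> zer X Y \<Longrightarrow> \<not> is_zero C X \<and> \<not> is_zero C Y"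
  using zero_hom by blast

lemma nonzero_ide: "X \<in> Obj C \<Longrightarrow> \<not> is_zero C X \<Longrightarrow> Ide C X \<noteq> zer X X"
  using zero_iff by blast

lemma mono_mono_zero: "is_mono C a \<Longrightarrow> a \<in> mor X Y \<Longrightarrow> is_zero C Y \<Longrightarrow> is_zero C X"
  using mono_zero zero_hom by blast

lemma epi_epi_zero: "is_epi C a \<Longrightarrow> a \<in> mor X Y \<Longrightarrow> is_zero C X \<Longrightarrow> is_zero C Y"
  using epi_zero zero_hom by blast

text \<open>Monoform objects are those whose nonzero partial endomorphisms are monic. If
  \<open>b\<close> on the subobject \<open>V\<close> has a kernel \<open>K\<close> that is not zero,
  then \<open>V / K\<close> is a subobject both of \<open>H\<close> and of \<open>H / K\<close>.
  Conversely, a subobject of \<open>H / N\<close> that is isomorphic to one of \<open>H\<close> has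
  a preimage containing \<open>N\<close>, and the resulting nonzero arrow from this preimage to
  \<open>H\<close> kills \<open>N\<close>.\<close>

lemma monoform_iff:
  assumes H: "H \<in> Obj C"
  shows "monoform C H \<longleftrightarrow> \<not> is_zero C H \<and>
    (\<forall>V. \<forall>a \<in> mor V H. \<forall>b \<in> mor V H. is_mono C a \<and> b \<noteq> zer V H \<longrightarrow> is_mono C b)"
proof (intro iffI conjI allI ballI impI)
  assume m: "monoform C H"
  then show "\<not> is_zero C H" by (simp add: monoform_def)
  fix V a b assume a: "a \<in> mor V H" and b: "b \<in> mor V H" and "is_mono C a \<and> b \<noteq> zer V H"
  then have am: "is_mono C a" and b0: "b \<noteq> zer V H" by auto
  obtain k K where k: "is_kernel C k b" "k \<in> mor K V" "is_mono C k" "b \<cdot> k = zer K H" using obtain_kernel[OF b] .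
  have K: "is_zero C K"
  proof (rule ccontr)
    assume K: "\<not> is_zero C K"
    let ?n = "a \<cdot> k"
    have n: "?n \<in> mor K H" "is_mono C ?n" using Comp_Hom[OF k(2) a] mono_comp[OF k(3) am k(2) a] by auto
    obtain q Q where q: "is_cokernel C q ?n" "q \<in> mor H Q" "is_epi C q" "q \<cdot> ?n = zer K Q" using obtain_cokernel[OF n(1)] .
    obtain I e s where es: "e \<in> mor V I" "s \<in> mor I H" "is_epi C e" "is_mono C s" "s \<cdot> e = b" using image_factorization[OF b] .
    have qa: "q \<cdot> a \<in> mor V Q" using Comp_Hom[OF a q(2)] .
    obtain J f t where ft: "f \<in> mor V J" "t \<in> mor J Q" "is_epi C f" "is_mono C t" "t \<cdot> f = q \<cdot> a" using image_factorization[OF qa] .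
    \<comment> \<open>Both \<open>e\<close> and \<open>f\<close> have kernel \<open>K\<close>, so
      their images \<open>I\<close> and \<open>J\<close> are two copies of
      \<open>V / K\<close>.\<close>
    have key: "e \<cdot> x = zer T I \<longleftrightarrow> f \<cdot> x = zer T J" if x: "x \<in> mor T V" for T x
    proof -
      have T: "T \<in> Obj C" using x hom_obj by blast
      have "e \<cdot> x = zer T I \<longleftrightarrow> b \<cdot> x = zer T H"
        using mono_zerD[OF es(4,2) Comp_Hom[OF x es(1)]] Comp_assoc[OF x es(1,2)] es(5) comp_zer'[OF es(2) T] by auto
      also have "\<dots> \<longleftrightarrow> (\<exists>y \<in> mor T K. k \<cdot> y = x)"
        using kernelE[OF k(1) b k(2) x] comp_eq_zer[OF k(2) b _ k(4)] by metis
      also have "\<dots> \<longleftrightarrow> q \<cdot> a \<cdot> x = zer T Q"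
      proof
        assume "\<exists>y \<in> mor T K. k \<cdot> y = x"
        then obtain y where y: "y \<in> mor T K" "k \<cdot> y = x" by blast
        have "q \<cdot> (a \<cdot> k \<cdot> y) = zer T Q" using comp_eq_zer[OF n(1) q(2) y(1) q(4)] .
        then show "q \<cdot> a \<cdot> x = zer T Q" using y Comp_assoc[OF y(1) k(2) a] Comp_assoc[OF x a q(2)] by simp
      next
        assume "q \<cdot> a \<cdot> x = zer T Q"
        then have "q \<cdot> (a \<cdot> x) = zer T Q" using Comp_assoc[OF x a q(2)] by simp
        then obtain y where y: "y \<in> mor T K" "a \<cdot> k \<cdot> y = a \<cdot> x" using mono_factor[OF n(2,1) q(1,2) Comp_Hom[OF x a]] by metis
        then have "a \<cdot> (k \<cdot> y) = a \<cdot> x" using Comp_assoc[OF y(1) k(2) a] by simp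
        then have "k \<cdot> y = x" using monoD[OF am a Comp_Hom[OF y(1) k(2)] x] by blast
        then show "\<exists>y \<in> mor T K. k \<cdot> y = x" using y by blast
      qed
      also have "\<dots> \<longleftrightarrow> f \<cdot> x = zer T J"
        using mono_zerD[OF ft(4,2) Comp_Hom[OF x ft(1)]] Comp_assoc[OF x ft(1,2)] ft(5) comp_zer'[OF ft(2) T] by auto
      finally show ?thesis .
    qed
    obtain u where u: "u \<in> mor I J" "u \<cdot> e = f" using epi_factor_all[OF es(3,1) ft(1)] key by blast
    obtain v where v: "v \<in> mor J I" "v \<cdot> f = e" using epi_factor_all[OF ft(3,1) es(1)] key by blast
    have I: "I \<in> Obj C" "J \<in> Obj C" using es ft hom_obj by auto
    have "v \<cdot> u \<cdot> e = Ide C I \<cdot> e" using Comp_assoc[OF es(1) u(1) v(1)] u v Ide_Comp[OF es(1)] by simp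
    then have vu: "v \<cdot> u = Ide C I" using epiD[OF es(3,1) Comp_Hom[OF u(1) v(1)] Ide_Hom[OF I(1)]] by blast
    have "u \<cdot> v \<cdot> f = Ide C J \<cdot> f" using Comp_assoc[OF ft(1) v(1) u(1)] u v Ide_Comp[OF ft(1)] by simp
    then have uv: "u \<cdot> v = Ide C J" using epiD[OF ft(3,1) Comp_Hom[OF v(1) u(1)] Ide_Hom[OF I(2)]] by blast
    have iso: "isomorphic C I J" using isoI[OF u(1) v(1) vu uv] u(1) by (auto simp: isomorphic_def)
    have I0: "\<not> is_zero C I" using nonzero_factor[OF es(1,2)] es(5) b0 by simp
    have "subobj C H ?n" "subobj C H s" "subobj C Q t" using subobjI n es(4,2) ft(4,2) by auto
    moreover have "Dom C ?n = K" "Cod C q = Q" "Dom C s = I" "Dom C t = J" using hom_DC n(1) q(2) es(2) ft(2) by blast+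
    ultimately show False using m q(1) K I0 iso unfolding monoform_def by metis
  qed
  show "is_mono C b" using zero_kernel_mono[OF k(1,2) b K] .
next
  assume A: "\<not> is_zero C H \<and>
    (\<forall>V. \<forall>a \<in> mor V H. \<forall>b \<in> mor V H. is_mono C a \<and> b \<noteq> zer V H \<longrightarrow> is_mono C b)"
  show "monoform C H" unfolding monoform_def
  proof (intro conjI allI impI notI)
    show "H \<in> Obj C" by (rule H)
    show False if "is_zero C H" using A that by blast
    fix n q assume nq: "subobj C H n \<and> \<not> is_zero C (Dom C n) \<and> is_cokernel C q n"
      and "\<exists>s t. subobj C H s \<and> \<not> is_zero C (Dom C s) \<and> subobj C (Cod C q) t \<and> isomorphic C (Dom C s) (Dom C t)"
    then obtain s t i where st: "subobj C H s" "\<not> is_zero C (Dom C s)" "subobj C (Cod C q) t" "i \<in> mor (Dom C s) (Dom C t)" "is_iso C i"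
      unfolding isomorphic_def by blast
    note s = subobj_mor[OF st(1)] and t = subobj_mor[OF st(3)]
    have n: "n \<in> mor (Dom C n) H" "is_mono C n" using nq subobj_mor subobj_mono by auto
    have q: "q \<in> mor H (Cod C q)" "is_epi C q" "q \<cdot> n = zer (Dom C n) (Cod C q)"
      using nq cokernel_hom n cokernel_epi cokernel_eq by metis+
    obtain j where j: "j \<in> mor (Dom C t) (Dom C s)" "j \<cdot> i = Ide C (Dom C s)" using isoE[OF st(5,4)] by blast
    obtain P p r where P: "p \<in> mor P H" "r \<in> mor P (Dom C t)"
      "\<And>T x y. x \<in> mor T H \<Longrightarrow> y \<in> mor T (Dom C t) \<Longrightarrow> q \<cdot> x = t \<cdot> y \<Longrightarrow> \<exists>u \<in> mor T P. p \<cdot> u = x \<and> r \<cdot> u = y"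
      "is_mono C p" "is_epi C r"
      by (rule obtain_pullback[OF q(1) t]) (use q(2) subobj_mono[OF st(3)] in \<open>blast intro: that\<close>)
    let ?b = "s \<cdot> j \<cdot> r"
    have sj: "s \<cdot> j \<in> mor (Dom C t) H" using Comp_Hom[OF j(1) s] .
    have b: "?b \<in> mor P H" using Comp_Hom[OF P(2) sj] .
    have "?b \<noteq> zer P H"
    proof
      assume "?b = zer P H"
      then have "s \<cdot> j = zer (Dom C t) H" using epi_zerD[OF P(5,2) sj] by blast
      then have "s \<cdot> (j \<cdot> i) = zer (Dom C s) H" using comp_eq_zer[OF j(1) s st(4)] by blast
      then have "s = zer (Dom C s) H" using j(2) Comp_Ide[OF s] by simp
      then show False using mono_zero[OF subobj_mono[OF st(1)] s] st(2) by blast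
    qed
    then have "is_mono C ?b" using A P(1,4) b by blast
    then have rm: "is_mono C r" using mono_cancel[OF _ P(2) sj] by blast
    have D: "Dom C n \<in> Obj C" "Dom C t \<in> Obj C" using n t hom_obj by auto
    obtain u where u: "u \<in> mor (Dom C n) P" "p \<cdot> u = n" "r \<cdot> u = zer (Dom C n) (Dom C t)"
      using P(3)[OF n(1) zer_hom[OF D]] q(3) comp_zer'[OF t D(1)] by metis
    have "u = zer (Dom C n) P" using mono_zerD[OF rm P(2) u(1,3)] .
    then have "n = zer (Dom C n) H" using u(2) comp_zer'[OF P(1) D(1)] by simp
    then show False using mono_zero[OF n(2,1)] nq by blast
  qed
qed

lemma monoform_obj: "monoform C H \<Longrightarrow> H \<in> Obj C" and monoform_nonzero: "monoform C H \<Longrightarrow> \<not> is_zero C H"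
  by (simp_all add: monoform_def)

lemma monoformD:
  "monoform C H \<Longrightarrow> a \<in> mor V H \<Longrightarrow> is_mono C a \<Longrightarrow> b \<in> mor V H \<Longrightarrow> b \<noteq> zer V H \<Longrightarrow> is_mono C b"
  using monoform_iff[OF monoform_obj] by blast

lemma monoform_sub:
  assumes H: "monoform C H" and m: "is_mono C m" "m \<in> mor D H" and D: "\<not> is_zero C D"
  shows "monoform C D"
proof -
  have "is_mono C b" if a: "a \<in> mor V D" "is_mono C a" and b: "b \<in> mor V D" "b \<noteq> zer V D" for V a b
  proof -
    have "m \<cdot> b \<noteq> zer V H" using mono_zerD[OF m b(1)] b(2) by blast
    then have "is_mono C (m \<cdot> b)"
      using monoformD[OF H Comp_Hom[OF a(1) m(2)] mono_comp[OF a(2) m(1) a(1) m(2)] Comp_Hom[OF b(1) m(2)]] by blast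
    then show ?thesis using mono_cancel[OF _ b(1) m(2)] by blast
  qed
  then show ?thesis using monoform_iff[of D] D hom_obj[OF m(2)] by blast
qed

text \<open>If the image \<open>I\<close> of \<open>x\<close> met \<open>A\<close> only in zero,
  then the biproduct of \<open>A\<close> and \<open>I\<close> would embed in \<open>H\<close> by
  \<open>?v\<close>. The arrow \<open>a p\<close> from it is nonzero, hence monic, but it kills
  \<open>I\<close>; so \<open>I\<close> would be zero.\<close>

lemma monoform_ess:
  assumes H: "monoform C H" and a: "is_mono C a" "a \<in> mor A H" and A: "\<not> is_zero C A"
  shows "ess a"
proof (rule essI[OF a])
  fix T x assume x: "x \<in> mor T H" "x \<noteq> zer T H"
  show "\<exists>W. \<exists>w\<in>mor W T. \<exists>z\<in>mor W A. x \<cdot> w = a \<cdot> z \<and> x \<cdot> w \<noteq> zer W H"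
  proof (rule ccontr)
    assume n: "\<not> ?thesis"
    obtain I e m where em: "e \<in> mor T I" "m \<in> mor I H" "is_epi C e" "is_mono C m" "m \<cdot> e = x"
      using image_factorization[OF x(1)] .
    have AO: "A \<in> Obj C" "I \<in> Obj C" using a em hom_obj by auto
    obtain B i j p q where B: "i \<in> mor A B" "j \<in> mor I B" "p \<in> mor B A" "q \<in> mor B I"
    "p \<cdot> i = Ide C A" "q \<cdot> j = Ide C I" "p \<cdot> j = zer I A" "q \<cdot> i = zer A I"
    "\<And>T t. t \<in> mor T B \<Longrightarrow> p \<cdot> t = zer T A \<Longrightarrow> q \<cdot> t = zer T I \<Longrightarrow> t = zer T B"
      by (rule obtain_biproduct[OF AO]) (blast intro: that)
    have ap: "a \<cdot> p \<in> mor B H" "m \<cdot> q \<in> mor B H" using B a em Comp_Hom by blast+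
    let ?v = "dif (a \<cdot> p) (m \<cdot> q)"
    have v: "?v \<in> mor B H" using dif_hom[OF ap] .
    have vm: "is_mono C ?v"
    proof (rule mono_zerI[OF v])
      fix W y assume y: "y \<in> mor W B" "?v \<cdot> y = zer W H"
      have W: "W \<in> Obj C" using y hom_obj by blast
      have py: "p \<cdot> y \<in> mor W A" "q \<cdot> y \<in> mor W I" using Comp_Hom y B by blast+
      have eq: "a \<cdot> (p \<cdot> y) = m \<cdot> (q \<cdot> y)"
        using y(2) dif_comp[OF ap y(1)] dif_eq[OF Comp_Hom[OF y(1) ap(1)] Comp_Hom[OF y(1) ap(2)]]
          Comp_assoc[OF y(1) B(3) a(2)] Comp_assoc[OF y(1) B(4) em(2)] by simp
      obtain S r z where S: "r \<in> mor S W" "is_epi C r" "z \<in> mor S T" "e \<cdot> z = q \<cdot> y \<cdot> r" using epi_lift[OF em(1,3) py(2)] .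
      have "x \<cdot> z = m \<cdot> (e \<cdot> z)" using em(5) Comp_assoc[OF S(3) em(1,2)] by simp
      also have "\<dots> = m \<cdot> (q \<cdot> y) \<cdot> r" using S(4) Comp_assoc[OF S(1) py(2) em(2)] by simp
      also have "\<dots> = a \<cdot> (p \<cdot> y \<cdot> r)" using eq Comp_assoc[OF S(1) py(1) a(2)] by simp
      finally have "x \<cdot> z = a \<cdot> (p \<cdot> y \<cdot> r)" .
      then have xz: "x \<cdot> z = zer S H" using n S(3) Comp_Hom[OF S(1) py(1)] by blast
      then have "m \<cdot> (q \<cdot> y) \<cdot> r = zer S H" using \<open>x \<cdot> z = m \<cdot> (e \<cdot> z)\<close> \<open>m \<cdot> (e \<cdot> z) = m \<cdot> (q \<cdot> y) \<cdot> r\<close> by simp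
      then have mz: "m \<cdot> (q \<cdot> y) = zer W H" using epi_zerD[OF S(2,1) Comp_Hom[OF py(2) em(2)]] by blast
      then have "q \<cdot> y = zer W I" "p \<cdot> y = zer W A"
        using mono_zerD[OF em(4,2) py(2)] mono_zerD[OF a py(1)] eq by auto
      then show "y = zer W B" using B(9) y by blast
    qed
    have "a \<cdot> p \<noteq> zer B H"
    proof
      assume "a \<cdot> p = zer B H"
      then have "a \<cdot> (p \<cdot> i) = zer A H" using comp_eq_zer[OF B(3) a(2) B(1)] by blast
      then have "a = zer A H" using B(5) Comp_Ide[OF a(2)] by simp
      then show False using mono_zero[OF a] A by blast
    qed
    then have apm: "is_mono C (a \<cdot> p)" using monoformD[OF H v vm ap(1)] by blast
    have "a \<cdot> p \<cdot> j = zer I H" using Comp_assoc[OF B(2,3) a(2)] B(7) comp_zer'[OF a(2) AO(2)] by simp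
    then have "j = zer I B" using mono_zerD[OF apm ap(1) B(2)] by blast
    then have "Ide C I = zer I I" using B(6) comp_zer'[OF B(4) AO(2)] by simp
    then have "is_zero C I" using zero_iff AO by blast
    then have "x = zer T H" using em(5) zero_hom(2)[OF _ em(1)] comp_zer'[OF em(2)] hom_obj[OF x(1)] by metis
    then show False using x by blast
  qed
qed

lemma atom_equiv_iff:
  "atom_equiv C H H' \<longleftrightarrow> (\<exists>V a b. \<not> is_zero C V \<and> a \<in> mor V H \<and> is_mono C a \<and> b \<in> mor V H' \<and> is_mono C b)"
proof
  assume "atom_equiv C H H'"
  then obtain s t i where st: "subobj C H s" "subobj C H' t" "\<not> is_zero C (Dom C s)" "i \<in> mor (Dom C s) (Dom C t)" "is_iso C i"
    unfolding atom_equiv_def isomorphic_def by blast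
  have "t \<cdot> i \<in> mor (Dom C s) H'" "is_mono C (t \<cdot> i)"
    using Comp_Hom[OF st(4) subobj_mor[OF st(2)]] mono_comp[OF iso_mono_epi(1)[OF st(5)] subobj_mono[OF st(2)] st(4) subobj_mor[OF st(2)]] by auto
  then show "\<exists>V a b. \<not> is_zero C V \<and> a \<in> mor V H \<and> is_mono C a \<and> b \<in> mor V H' \<and> is_mono C b"
    using st subobj_mor subobj_mono by blast
next
  assume "\<exists>V a b. \<not> is_zero C V \<and> a \<in> mor V H \<and> is_mono C a \<and> b \<in> mor V H' \<and> is_mono C b"
  then obtain V a b where V: "\<not> is_zero C V" "a \<in> mor V H" "is_mono C a" "b \<in> mor V H'" "is_mono C b" by blast
  have VO: "V \<in> Obj C" using V hom_obj by blast
  have "isomorphic C V V" unfolding isomorphic_def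
    using isoI[OF Ide_Hom[OF VO] Ide_Hom[OF VO]] Ide_Hom[OF VO] Comp_Ide[OF Ide_Hom[OF VO]] by metis
  moreover have "Dom C a = V" "Dom C b = V" using V hom_DC by auto
  moreover have "subobj C H a" "subobj C H' b" using V subobjI by auto
  ultimately show "atom_equiv C H H'" using V(1) unfolding atom_equiv_def by metis
qed

lemma atom_equiv_sym: "atom_equiv C H H' \<Longrightarrow> atom_equiv C H' H"
  unfolding atom_equiv_iff by blast

lemma atom_equiv_refl: "monoform C H \<Longrightarrow> atom_equiv C H H"
  unfolding atom_equiv_iff using Ide_Hom ide_mono monoform_obj monoform_nonzero by blast

text \<open>The subobjects \<open>b\<close> and \<open>c\<close> of the monoform object
  \<open>H'\<close> have a nonzero intersection because \<open>b\<close> is essential, and this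
  intersection embeds in \<open>H\<close> and in \<open>H''\<close>.\<close>

lemma atom_equiv_trans:
  assumes "atom_equiv C H H'" "atom_equiv C H' H''" "monoform C H'"
  shows "atom_equiv C H H''"
proof -
  obtain V a b where V: "\<not> is_zero C V" "a \<in> mor V H" "is_mono C a" "b \<in> mor V H'" "is_mono C b"
    using assms(1) unfolding atom_equiv_iff by blast
  obtain W c d where W: "\<not> is_zero C W" "c \<in> mor W H'" "is_mono C c" "d \<in> mor W H''" "is_mono C d"
    using assms(2) unfolding atom_equiv_iff by blast
  have "ess b" using monoform_ess[OF assms(3) V(5,4,1)] .
  then obtain S w z where S: "w \<in> mor S W" "z \<in> mor S V" "c \<cdot> w = b \<cdot> z" "c \<cdot> w \<noteq> zer S H'"
    using essE[OF _ V(4) W(2)] nonzero_mono[OF W(3,2,1)] by metis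
  have cw: "c \<cdot> w \<in> mor S H'" using Comp_Hom[OF S(1) W(2)] .
  obtain I e m where em: "e \<in> mor S I" "m \<in> mor I W" "is_epi C e" "is_mono C m" "m \<cdot> e = w"
    using image_factorization[OF S(1)] .
  have "w \<noteq> zer S W" using S(4) comp_zer'[OF W(2)] hom_obj[OF S(1)] by auto
  then have I: "\<not> is_zero C I" using nonzero_factor[OF em(1,2)] em(5) by simp
  have cm: "c \<cdot> m \<in> mor I H'" "is_mono C (c \<cdot> m)" using Comp_Hom[OF em(2) W(2)] mono_comp[OF em(4) W(3) em(2) W(2)] by auto
  have "b \<cdot> z = (c \<cdot> m) \<cdot> e" using S(3) em(5) Comp_assoc[OF em(1,2) W(2)] by simp
  then obtain h where h: "h \<in> mor I V" "b \<cdot> h = c \<cdot> m" using mono_factor_epi[OF V(5,4) cm(1) em(3,1) S(2)] by blast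
  have hm: "is_mono C h" using mono_cancel[OF _ h(1) V(4)] h(2) cm(2) by simp
  have "a \<cdot> h \<in> mor I H" "is_mono C (a \<cdot> h)" "d \<cdot> m \<in> mor I H''" "is_mono C (d \<cdot> m)"
    using Comp_Hom[OF h(1) V(2)] mono_comp[OF hm V(3) h(1) V(2)] Comp_Hom[OF em(2) W(4)] mono_comp[OF em(4) W(5) em(2) W(4)] by auto
  then show ?thesis using I unfolding atom_equiv_iff by blast
qed

lemma atom_of_eq: assumes "monoform C H" "monoform C H'" shows "atom_of C H = atom_of C H' \<longleftrightarrow> atom_equiv C H H'"
proof
  assume "atom_of C H = atom_of C H'"
  moreover have "H' \<in> atom_of C H'" using assms atom_equiv_refl by (simp add: atom_of_def)
  ultimately show "atom_equiv C H H'" by (auto simp: atom_of_def)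
next
  assume "atom_equiv C H H'"
  then show "atom_of C H = atom_of C H'" unfolding atom_of_def
    using atom_equiv_trans atom_equiv_sym assms by blast
qed

lemma in_atom_of: "monoform C H \<Longrightarrow> H' \<in> atom_of C H \<Longrightarrow> monoform C H' \<and> atom_of C H' = atom_of C H"
  using atom_of_eq[of H H'] by (auto simp: atom_of_def)

lemma in_ASpec: "\<alpha> \<in> ASpec C \<Longrightarrow> H \<in> \<alpha> \<Longrightarrow> monoform C H \<and> \<alpha> = atom_of C H"
  unfolding ASpec_def using in_atom_of by blast

lemma atom_of_self: "monoform C H \<Longrightarrow> H \<in> atom_of C H"
  using atom_equiv_refl by (simp add: atom_of_def)

lemma atom_of_ASpec: "monoform C H \<Longrightarrow> atom_of C H \<in> ASpec C"
  by (auto simp: ASpec_def)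

lemma atom_of_sub:
  assumes H: "monoform C H" and m: "is_mono C m" "m \<in> mor D H" and D: "\<not> is_zero C D"
  shows "monoform C D" "atom_of C D = atom_of C H"
proof -
  show d: "monoform C D" using monoform_sub[OF assms] .
  have "atom_equiv C D H" unfolding atom_equiv_iff using D m Ide_Hom ide_mono monoform_obj[OF d] by blast
  then show "atom_of C D = atom_of C H" using atom_of_eq[OF d H] by blast
qed

section \<open>Atom supports of subobjects, quotients and extensions\<close>

lemma subquotient_iff:
  "subquotient C M H \<longleftrightarrow> (\<exists>P s e. s \<in> mor P M \<and> is_mono C s \<and> e \<in> mor P H \<and> is_epi C e)"
proof
  assume "subquotient C M H"
  then obtain s e where s: "subobj C M s" "is_epi C e" "Dom C e = Dom C s" "Cod C e = H" unfolding subquotient_def by blast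
  then have "e \<in> mor (Dom C s) H" using epi_arr by (auto simp: Hom_def)
  then show "\<exists>P s e. s \<in> mor P M \<and> is_mono C s \<and> e \<in> mor P H \<and> is_epi C e" using s subobj_mor subobj_mono by blast
next
  assume "\<exists>P s e. s \<in> mor P M \<and> is_mono C s \<and> e \<in> mor P H \<and> is_epi C e"
  then obtain P s e where "s \<in> mor P M" "is_mono C s" "e \<in> mor P H" "is_epi C e" by blast
  then show "subquotient C M H" unfolding subquotient_def using subobjI hom_DC by metis
qed

lemma ASuppI: "monoform C H \<Longrightarrow> subquotient C M H \<Longrightarrow> atom_of C H \<in> ASupp C M"
  unfolding ASupp_def using atom_of_ASpec atom_of_self by blast

lemma ASuppE:
  assumes "\<alpha> \<in> ASupp C M"
  obtains H P s e where "monoform C H" "\<alpha> = atom_of C H" "s \<in> mor P M" "is_mono C s" "e \<in> mor P H" "is_epi C e"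
  using assms in_ASpec unfolding ASupp_def subquotient_iff by blast

lemma atom_in_ASupp: assumes M: "monoform C M" shows "atom_of C M \<in> ASupp C M"
proof -
  note i = monoform_obj[OF M]
  have "subquotient C M M" unfolding subquotient_iff using Ide_Hom[OF i] ide_mono[OF i] ide_epi[OF i] by blast
  then show ?thesis using ASuppI M by blast
qed

lemma ASupp_sub: assumes m: "is_mono C m" "m \<in> mor D M" shows "ASupp C D \<subseteq> ASupp C M"
proof
  fix \<alpha> assume "\<alpha> \<in> ASupp C D"
  then obtain H P s e where H: "monoform C H" "\<alpha> = atom_of C H" "s \<in> mor P D" "is_mono C s" "e \<in> mor P H" "is_epi C e" by (rule ASuppE)
  then have "subquotient C M H" unfolding subquotient_iff using Comp_Hom[OF H(3) m(2)] mono_comp[OF H(4) m(1) H(3) m(2)] by blast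
  then show "\<alpha> \<in> ASupp C M" using ASuppI H by blast
qed

lemma ASupp_quot: assumes g: "is_epi C g" "g \<in> mor M Q" shows "ASupp C Q \<subseteq> ASupp C M"
proof
  fix \<alpha> assume "\<alpha> \<in> ASupp C Q"
  then obtain H P s e where H: "monoform C H" "\<alpha> = atom_of C H" "s \<in> mor P Q" "is_mono C s" "e \<in> mor P H" "is_epi C e" by (rule ASuppE)
  obtain R p q where R: "p \<in> mor R M" "q \<in> mor R P" "is_mono C p" "is_epi C q"
    by (rule obtain_pullback[OF g(2) H(3)]) (use g(1) H(4) in \<open>blast intro: that\<close>)
  then have "subquotient C M H" unfolding subquotient_iff using Comp_Hom[OF R(2) H(5)] epi_comp[OF R(4) H(6) R(2) H(5)] by blast
  then show "\<alpha> \<in> ASupp C M" using ASuppI H by blast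
qed

text \<open>Let the subobject \<open>P\<close> of \<open>B\<close> map onto \<open>H\<close>, and
  let \<open>L\<close> be its intersection with \<open>K\<close>. Either the image of
  \<open>L\<close> in \<open>H\<close> is nonzero, and then it is a subquotient of \<open>K\<close>
  in the same atom; or \<open>e\<close> kills \<open>L\<close>, and \<open>H\<close> is already a
  quotient of the image of \<open>P\<close> in \<open>D\<close>.\<close>

lemma ASupp_ext:
  assumes k: "is_kernel C k g" "k \<in> mor K B" and g: "g \<in> mor B D"
  shows "ASupp C B \<subseteq> ASupp C K \<union> ASupp C D"
proof
  fix \<alpha> assume "\<alpha> \<in> ASupp C B"
  then obtain H P s e where H: "monoform C H" "\<alpha> = atom_of C H" "s \<in> mor P B" "is_mono C s" "e \<in> mor P H" "is_epi C e" by (rule ASuppE)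
  have gs: "g \<cdot> s \<in> mor P D" using Comp_Hom[OF H(3) g] .
  obtain l L where l: "is_kernel C l (g \<cdot> s)" "l \<in> mor L P" "is_mono C l" "g \<cdot> s \<cdot> l = zer L D" using obtain_kernel[OF gs] .
  obtain h where h: "h \<in> mor L K" "k \<cdot> h = s \<cdot> l"
    using kernelE[OF k(1) g k(2) Comp_Hom[OF l(2) H(3)]] l(4) Comp_assoc[OF l(2) H(3) g] by metis
  have hm: "is_mono C h" using mono_cancel[OF _ h(1) k(2)] h(2) mono_comp[OF l(3) H(4) l(2) H(3)] by simp
  have el: "e \<cdot> l \<in> mor L H" using Comp_Hom[OF l(2) H(5)] .
  obtain I u m where um: "u \<in> mor L I" "m \<in> mor I H" "is_epi C u" "is_mono C m" "m \<cdot> u = e \<cdot> l"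
    using image_factorization[OF el] .
  show "\<alpha> \<in> ASupp C K \<union> ASupp C D"
  proof (cases "is_zero C I")
    case False
    then have "monoform C I" "atom_of C I = \<alpha>" using atom_of_sub[OF H(1) um(4,2)] H(2) by auto
    moreover have "subquotient C K I" unfolding subquotient_iff using h hm um by blast
    ultimately show ?thesis using ASuppI by blast
  next
    case True
    then have "e \<cdot> l = zer L H" using um zero_hom(2)[OF True um(1)] comp_zer'[OF um(2)] hom_obj[OF el] by metis
    obtain J f t where ft: "f \<in> mor P J" "t \<in> mor J D" "is_epi C f" "is_mono C t" "t \<cdot> f = g \<cdot> s" using image_factorization[OF gs] .
    obtain w where w: "w \<in> mor J H" "w \<cdot> f = e"
    proof (rule epi_factor_all[OF ft(3,1) H(5)])
      fix T x assume x: "x \<in> mor T P" "f \<cdot> x = zer T J"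
      have "g \<cdot> s \<cdot> x = zer T D" using x ft(5) Comp_assoc[OF x(1) ft(1,2)] comp_zer'[OF ft(2)] hom_obj[OF x(1)] by metis
      then obtain y where "y \<in> mor T L" "l \<cdot> y = x" using kernelE[OF l(1) gs l(2) x(1)] by metis
      then show "e \<cdot> x = zer T H" using comp_eq_zer[OF l(2) H(5) _ \<open>e \<cdot> l = zer L H\<close>] by blast
    qed
    have "is_epi C w" using epi_cancel[OF _ ft(1) w(1)] w(2) H(6) by simp
    then have "subquotient C D H" unfolding subquotient_iff using ft w by blast
    then show ?thesis using ASuppI H by blast
  qed
qed

text \<open>Used in two ways below: with \<open>{\<mm>}\<close> it is the class of torsion objects,
  and with the support of an object it serves to bound the supports of essential extensions of that
  object.\<close>

definition supported :: "'a set set \<Rightarrow> 'a set" where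
  "supported \<Phi> = {M \<in> Obj C. ASupp C M \<subseteq> \<Phi>}"

lemma zero_supported: assumes "is_zero C Z" shows "Z \<in> supported \<Phi>"
proof -
  have "False" if "\<alpha> \<in> ASupp C Z" for \<alpha>
    using that
  proof (rule ASuppE)
    fix H P s e assume H: "monoform C H" "s \<in> mor P Z" "is_mono C s" "e \<in> mor P H" "is_epi C e"
    have "is_zero C H" using epi_epi_zero[OF H(5,4) mono_mono_zero[OF H(3,2) assms]] .
    then show False using monoform_nonzero[OF H(1)] by blast
  qed
  then show ?thesis using assms by (auto simp: supported_def is_zero_def)
qed

lemma serre_supported: "serre_subcat C (supported \<Phi>)"
  unfolding serre_subcat_def
proof (intro conjI allI impI)
  show "supported \<Phi> \<subseteq> Obj C" by (auto simp: supported_def)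
  show "supported \<Phi> \<noteq> {}" using zero_object zero_supported by blast
  fix f g assume fg: "short_exact C f g"
  then have k: "is_kernel C f g" and c: "is_cokernel C g f" by (auto simp: short_exact_def)
  have g: "g \<in> mor (Cod C f) (Cod C g)" and f: "f \<in> mor (Dom C f) (Cod C f)"
    using k c by (auto simp: Hom_def is_kernel_def)
  have o: "Dom C f \<in> Obj C" "Cod C f \<in> Obj C" "Cod C g \<in> Obj C" using f g hom_obj by auto
  show "Cod C f \<in> supported \<Phi> \<longleftrightarrow> Dom C f \<in> supported \<Phi> \<and> Cod C g \<in> supported \<Phi>"
    using ASupp_sub[OF kernel_mono[OF k] f] ASupp_quot[OF cokernel_epi[OF c] g] ASupp_ext[OF k f g] o
    unfolding supported_def by blast
qed

text \<open>If the atom occurred in \<open>V\<close>, some nonzero \<open>B\<close> would embed in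
  \<open>H\<close> and also be a subquotient of \<open>V\<close>. Its preimage \<open>S\<close> in
  \<open>H\<close> contains \<open>A\<close>, and \<open>S -> B -> H\<close> is nonzero, hence
  monic; but it vanishes on \<open>A\<close>.\<close>

lemma atom_notin_proper_quotient:
  assumes H: "monoform C H" and a: "a \<in> mor A H" "a \<noteq> zer A H" and q: "q \<in> mor H V" "is_epi C q" "q \<cdot> a = zer A V"
  shows "atom_of C H \<notin> ASupp C V"
proof
  assume "atom_of C H \<in> ASupp C V"
  then obtain G P s e where G: "monoform C G" "atom_of C H = atom_of C G" "s \<in> mor P V" "is_mono C s" "e \<in> mor P G" "is_epi C e" by (rule ASuppE)
  then have "atom_equiv C G H" using atom_of_eq[OF G(1) H] by simp
  then obtain B b h where B: "\<not> is_zero C B" "b \<in> mor B G" "is_mono C b" "h \<in> mor B H" "is_mono C h" unfolding atom_equiv_iff by blast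
  obtain R r p where R: "r \<in> mor R H" "p \<in> mor R P" "is_mono C r" "is_epi C p"
    "\<And>T x y. x \<in> mor T H \<Longrightarrow> y \<in> mor T P \<Longrightarrow> q \<cdot> x = s \<cdot> y \<Longrightarrow> \<exists>t \<in> mor T R. r \<cdot> t = x \<and> p \<cdot> t = y"
    by (rule obtain_pullback[OF q(1) G(3)]) (use q(2) G(4) in \<open>blast intro: that\<close>)
  have ep: "e \<cdot> p \<in> mor R G" "is_epi C (e \<cdot> p)" using Comp_Hom[OF R(2) G(5)] epi_comp[OF R(4) G(6) R(2) G(5)] by auto
  obtain S x y where S: "x \<in> mor S R" "y \<in> mor S B" "is_mono C x" "is_epi C y"
    "\<And>T x' y'. x' \<in> mor T R \<Longrightarrow> y' \<in> mor T B \<Longrightarrow> e \<cdot> p \<cdot> x' = b \<cdot> y' \<Longrightarrow> \<exists>t \<in> mor T S. x \<cdot> t = x' \<and> y \<cdot> t = y'"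
    by (rule obtain_pullback[OF ep(1) B(2)]) (use ep(2) B(3) in \<open>blast intro: that\<close>)
  have rx: "r \<cdot> x \<in> mor S H" "is_mono C (r \<cdot> x)" using Comp_Hom[OF S(1) R(1)] mono_comp[OF S(3) R(3) S(1) R(1)] by auto
  have hy: "h \<cdot> y \<in> mor S H" using Comp_Hom[OF S(2) B(4)] .
  have "h \<cdot> y \<noteq> zer S H"
    using epi_zerD[OF S(4,2) B(4)] nonzero_mono[OF B(5,4,1)] by blast
  then have "is_mono C (h \<cdot> y)" using monoformD[OF H rx hy] by blast
  then have ym: "is_mono C y" using mono_cancel[OF _ S(2) B(4)] by blast
  have A: "A \<in> Obj C" "P \<in> Obj C" "B \<in> Obj C" using a G B hom_obj by auto
  obtain t where t: "t \<in> mor A R" "r \<cdot> t = a" "p \<cdot> t = zer A P"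
    using R(5)[OF a(1) zer_hom[OF A(1,2)]] q(3) comp_zer'[OF G(3) A(1)] by metis
  have "e \<cdot> p \<cdot> t = zer A G" using Comp_assoc[OF t(1) R(2) G(5)] t(3) comp_zer'[OF G(5) A(1)] by simp
  then obtain u where u: "u \<in> mor A S" "x \<cdot> u = t" "y \<cdot> u = zer A B"
    using S(5)[OF t(1) zer_hom[OF A(1,3)]] comp_zer'[OF B(2) A(1)] by metis
  have "u = zer A S" using mono_zerD[OF ym S(2) u(1,3)] .
  then have "t = zer A R" using u(2) comp_zer'[OF S(1) A(1)] by simp
  then have "a = zer A H" using t(2) comp_zer'[OF R(1) A(1)] by simp
  then show False using a by blast
qed

section \<open>Simple objects and existence of monoform subobjects\<close>

text \<open>A nonzero image of \<open>z\<close> would be a subobject of \<open>M\<close>, so it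
  would have the atom of \<open>M\<close> in its support, which lies in
  \<open>\<Phi>\<close>.\<close>

lemma negl_to_monoform:
  assumes M: "monoform C M" "atom_of C M \<notin> \<Phi>" and z: "z \<in> mor S M" "negl (supported \<Phi>) z"
  shows "z = zer S M"
proof (rule ccontr)
  interpret serre C "supported \<Phi>" by unfold_locales (rule serre_supported)
  assume "z \<noteq> zer S M"
  obtain J e m where em: "e \<in> mor S J" "m \<in> mor J M" "is_epi C e" "is_mono C m" "m \<cdot> e = z" using image_factorization[OF z(1)] .
  have J: "J \<in> supported \<Phi>" using negl_image[OF em(1-4)] em(5) z(2) by simp
  have "\<not> is_zero C J" using nonzero_factor[OF em(1,2)] em(5) \<open>z \<noteq> zer S M\<close> by simp
  then have "monoform C J" "atom_of C J = atom_of C M" using atom_of_sub[OF M(1) em(4,2)] by auto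
  then show False using atom_in_ASupp[of J] J M(2) by (auto simp: supported_def)
qed

lemma simple_monoform_sub:
  assumes S: "simple_obj C S" and b: "is_mono C b" "b \<in> mor V S" "\<not> is_zero C V"
  shows "is_iso C b"
  using assms subobjI[OF b(1,2)] hom_DC[OF b(2)] unfolding simple_obj_def by auto

lemma simple_monoform: assumes S: "simple_obj C S" shows "monoform C S"
proof -
  have "is_mono C b" if a: "a \<in> mor V S" "is_mono C a" and b: "b \<in> mor V S" "b \<noteq> zer V S" for V a b
  proof -
    have V: "\<not> is_zero C V" using nonzero_obj[OF b] by blast
    then have "is_iso C a" using simple_monoform_sub[OF S a(2,1)] by blast
    then obtain c where c: "c \<in> mor S V" "a \<cdot> c = Ide C S" "c \<cdot> a = Ide C V" using isoE[OF _ a(1)] by metis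
    obtain k K where k: "is_kernel C k b" "k \<in> mor K V" "is_mono C k" "b \<cdot> k = zer K S" using obtain_kernel[OF b(1)] .
    have "is_zero C K"
    proof (rule ccontr)
      assume "\<not> is_zero C K"
      then have iso: "is_iso C (a \<cdot> k)" using simple_monoform_sub[OF S mono_comp[OF k(3) a(2) k(2) a(1)] Comp_Hom[OF k(2) a(1)]] by blast
      have "k = c \<cdot> (a \<cdot> k)" using Comp_assoc[OF k(2) a(1) c(1)] c(3) Ide_Comp[OF k(2)] by simp
      moreover have "is_epi C (c \<cdot> (a \<cdot> k))"
        using epi_comp[OF iso_mono_epi(2)[OF iso] _ Comp_Hom[OF k(2) a(1)] c(1)] iso_mono_epi(2)[OF isoI[OF c(1) a(1) c(2,3)]] by blast
      ultimately have "is_epi C k" by simp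
      then show False using epi_zerD[OF _ k(2) b(1) k(4)] b(2) by blast
    qed
    then show "is_mono C b" by (rule zero_kernel_mono[OF k(1,2) b(1)])
  qed
  moreover have S': "S \<in> Obj C" "\<not> is_zero C S" using S by (simp_all add: simple_obj_def)
  ultimately show ?thesis using monoform_iff[OF S'(1)] S'(2) by blast
qed

lemma simple_ASupp: assumes S: "simple_obj C S" shows "ASupp C S \<subseteq> {atom_of C S}"
proof
  fix \<alpha> assume "\<alpha> \<in> ASupp C S"
  then obtain H P s e where H: "monoform C H" "\<alpha> = atom_of C H" "s \<in> mor P S" "is_mono C s" "e \<in> mor P H" "is_epi C e" by (rule ASuppE)
  have P: "\<not> is_zero C P" using epi_epi_zero[OF H(6,5)] monoform_nonzero[OF H(1)] by blast
  then have s: "is_iso C s" using simple_monoform_sub[OF S H(4,3)] by blast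
  have Pm: "monoform C P" "atom_of C P = atom_of C S" using atom_of_sub[OF simple_monoform[OF S] H(4,3) P] by auto
  have "is_mono C e"
  proof (rule mono_zerI[OF H(5)])
    fix W x assume x: "x \<in> mor W P" "e \<cdot> x = zer W H"
    show "x = zer W P"
    proof (rule ccontr)
      assume "x \<noteq> zer W P"
      obtain I f m where em: "f \<in> mor W I" "m \<in> mor I P" "is_epi C f" "is_mono C m" "m \<cdot> f = x"
        using image_factorization[OF x(1)] .
      have I: "\<not> is_zero C I" using nonzero_factor[OF em(1,2)] em(5) \<open>x \<noteq> zer W P\<close> by simp
      have iso: "is_iso C (s \<cdot> m)" using simple_monoform_sub[OF S mono_comp[OF em(4) H(4) em(2) H(3)] Comp_Hom[OF em(2) H(3)] I] .
      obtain c where c: "c \<in> mor S P" "s \<cdot> c = Ide C S" "c \<cdot> s = Ide C P" using isoE[OF s H(3)] by metis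
      have "m = c \<cdot> (s \<cdot> m)" using Comp_assoc[OF em(2) H(3) c(1)] c(3) Ide_Comp[OF em(2)] by simp
      moreover have "is_epi C (c \<cdot> (s \<cdot> m))"
        using epi_comp[OF iso_mono_epi(2)[OF iso] _ Comp_Hom[OF em(2) H(3)] c(1)] iso_mono_epi(2)[OF isoI[OF c(1) H(3) c(2,3)]] by blast
      ultimately have "is_epi C m" by simp
      then have xe: "is_epi C x" using epi_comp[OF em(3) _ em(1,2)] em(5) by simp
      then have "e = zer P H" using epi_zerD[OF xe x(1) H(5) x(2)] by blast
      then show False using epi_zero[OF H(6,5)] monoform_nonzero[OF H(1)] by blast
    qed
  qed
  then have "atom_of C P = atom_of C H" using atom_of_sub[OF H(1) _ H(5) P] by blast
  then show "\<alpha> \<in> {atom_of C S}" using Pm H(2) by simp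
qed

text \<open>The quotient by a maximal proper subobject, where proper is expressed as not
  epic.\<close>

lemma noeth_simple_quot:
  assumes M: "noetherian_obj C M" "\<not> is_zero C M"
  obtains S e where "simple_obj C S" "e \<in> mor M S" "is_epi C e"
proof -
  have MO: "M \<in> Obj C" using noeth_obj M by blast
  let ?P = "\<lambda>s. subobj C M s \<and> \<not> is_epi C s"
  obtain Z where Z: "is_zero C Z" using zero_object by blast
  note z = zero_mono(1)[OF Z MO]
  have "is_mono C (zer Z M)" using zero_mono(2)[OF Z MO] .
  moreover have "\<not> is_epi C (zer Z M)" using epi_zero[OF _ z] M(2) by blast
  ultimately have P0: "?P (zer Z M)" using subobjI[OF _ z] by blast
  obtain s where s: "?P s" "\<And>t. ?P t \<Longrightarrow> sub_le C s t \<Longrightarrow> sub_le C t s" using noeth_max[OF M(1), of ?P, OF _ P0] by blast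
  have sm: "s \<in> mor (Dom C s) M" "is_mono C s" using s subobj_mor subobj_mono by auto
  obtain q Q where q: "is_cokernel C q s" "q \<in> mor M Q" "is_epi C q" "q \<cdot> s = zer (Dom C s) Q" using obtain_cokernel[OF sm(1)] .
  have Q: "\<not> is_zero C Q"
  proof
    assume Q: "is_zero C Q"
    have "is_epi C s"
    proof (rule epi_zerI[OF sm(1)])
      fix W g assume "g \<in> mor M W" "g \<cdot> s = zer (Dom C s) W"
      then obtain h where h: "h \<in> mor Q W" "h \<cdot> q = g" using cokernelE[OF q(1) sm(1) q(2)] by metis
      then show "g = zer M W" using zero_hom(1)[OF Q h(1)] zer_comp'[OF q(2)] hom_obj[OF h(1)] by simp
    qed
    then show False using s by blast
  qed
  have "simple_obj C Q" unfolding simple_obj_def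
  proof (intro conjI allI impI)
    show "Q \<in> Obj C" using q hom_obj by blast
    show "\<not> is_zero C Q" by (rule Q)
    fix t assume t: "subobj C Q t"
    note tm = subobj_mor[OF t] and tmo = subobj_mono[OF t]
    obtain K k where k: "k \<in> mor K M" "is_mono C k"
    "\<And>T x. x \<in> mor T M \<Longrightarrow> (\<exists>y \<in> mor T K. k \<cdot> y = x) \<longleftrightarrow> (\<exists>z \<in> mor T (Dom C t). t \<cdot> z = q \<cdot> x)"
      by (rule obtain_preimage[OF tmo tm q(2)]) (blast intro: that)
    have "\<exists>z \<in> mor (Dom C s) (Dom C t). t \<cdot> z = q \<cdot> s" using q(4) comp_zer'[OF tm] zer_hom hom_obj[OF tm] hom_obj[OF sm(1)] by metis
    then have le: "sub_le C s k" using k(3)[OF sm(1)] sub_le_iff[OF sm(1) k(1)] by blast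
    show "is_zero C (Dom C t) \<or> is_iso C t"
    proof (cases "is_epi C k")
      case True
      have "\<exists>z \<in> mor K (Dom C t). t \<cdot> z = q \<cdot> k" using k(3)[OF k(1)] Comp_Ide[OF k(1)] Ide_Hom hom_obj[OF k(1)] by blast
      then obtain z where "z \<in> mor K (Dom C t)" "t \<cdot> z = q \<cdot> k" by blast
      then have "is_epi C t" using epi_cancel[OF _ _ tm] epi_comp[OF True q(3) k(1) q(2)] by metis
      then show ?thesis using mono_epi_iso tmo by blast
    next
      case False
      then have "sub_le C k s" using s(2)[of k] le subobjI[OF k(2,1)] by blast
      then obtain h where h: "h \<in> mor K (Dom C s)" "s \<cdot> h = k" using sub_le_iff[OF k(1) sm(1)] by blast
      obtain S p x where S: "p \<in> mor S (Dom C t)" "is_epi C p" "x \<in> mor S M" "q \<cdot> x = t \<cdot> p" using epi_lift[OF q(2,3) tm] .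
      then obtain y where y: "y \<in> mor S K" "k \<cdot> y = x" using k(3)[OF S(3)] by metis
      have "x = s \<cdot> (h \<cdot> y)" using comp_ext1[OF h(2,1) sm(1) y(1)] y(2) by simp
      then have "q \<cdot> x = zer S Q" using comp_eq_zer[OF sm(1) q(2) Comp_Hom[OF y(1) h(1)] q(4)] by simp
      then have "t = zer (Dom C t) Q" using epi_zerD[OF S(2,1) tm] S(4) by simp
      then show ?thesis using mono_zero[OF tmo tm] by blast
    qed
  qed
  then show ?thesis using that q by blast
qed

text \<open>Take \<open>l\<close> maximal such that \<open>M / l\<close> shares a nonzero object
  \<open>V\<close> with \<open>M\<close>; then \<open>V\<close> is monoform. Indeed let
  \<open>b\<close> be a nonzero arrow to \<open>V\<close> from a subobject \<open>U\<close> of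
  \<open>V\<close>, with kernel \<open>K\<close>. Its image embeds in \<open>V\<close>, and being
  \<open>U / K\<close> it also embeds in \<open>M / l'\<close>, where \<open>l'\<close> is the
  preimage of \<open>K\<close> in \<open>M\<close>. Maximality forces \<open>K = 0\<close>.\<close>

lemma noeth_monoform_sub:
  assumes M: "noetherian_obj C M" "\<not> is_zero C M"
  obtains H s where "monoform C H" "s \<in> mor H M" "is_mono C s"
proof -
  have MO: "M \<in> Obj C" using noeth_obj M by blast
  let ?P = "\<lambda>l. subobj C M l \<and> (\<exists>V v q v'. \<not> is_zero C V \<and> v \<in> mor V M \<and> is_mono C v \<and>
      is_cokernel C q l \<and> v' \<in> mor V (Cod C q) \<and> is_mono C v')"
  obtain Z where Z: "is_zero C Z" using zero_object by blast
  note z = zero_mono(1)[OF Z MO]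
  have "is_mono C (zer Z M)" using zero_mono(2)[OF Z MO] .
  moreover have "is_cokernel C (Ide C M) (zer Z M)"
  proof (rule cokernelI[OF Ide_Hom[OF MO] z ide_epi[OF MO]])
    show "Ide C M \<cdot> zer Z M = zer Z M" using Ide_Comp[OF z] .
    show "\<exists>h\<in>mor M W. h \<cdot> Ide C M = g" if "g \<in> mor M W" for W g using Comp_Ide[OF that] that by blast
  qed
  moreover have "Cod C (Ide C M) = M" using Ide_Hom[OF MO] hom_DC by blast
  \<comment> \<open>The zero subobject is admissible, with \<open>V = M\<close> and the identity as
    cokernel.\<close>
  ultimately have P0: "?P (zer Z M)" using subobjI[OF _ z] Ide_Hom[OF MO] ide_mono[OF MO] M(2) by metis
  obtain l where l: "?P l" "\<And>t. ?P t \<Longrightarrow> sub_le C l t \<Longrightarrow> sub_le C t l" using noeth_max[OF M(1), of ?P, OF _ P0] by blast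
  have lm: "l \<in> mor (Dom C l) M" "is_mono C l" using l subobj_mor subobj_mono by auto
  obtain V v q Q v' where V: "\<not> is_zero C V" "v \<in> mor V M" "is_mono C v" "is_cokernel C q l" "v' \<in> mor V Q" "is_mono C v'" "Q = Cod C q"
    using l(1) by blast
  have q: "q \<in> mor M Q" "is_epi C q" "q \<cdot> l = zer (Dom C l) Q"
    using V cokernel_hom[OF V(4) lm(1)] cokernel_epi[OF V(4)] cokernel_eq[OF V(4) lm(1)] by auto
  have "is_mono C b" if a: "a \<in> mor U V" "is_mono C a" and b: "b \<in> mor U V" "b \<noteq> zer U V" for U a b
  proof -
    obtain k K where k: "is_kernel C k b" "k \<in> mor K U" "is_mono C k" "b \<cdot> k = zer K V" using obtain_kernel[OF b(1)] .
    obtain I e m where em: "e \<in> mor U I" "m \<in> mor I V" "is_epi C e" "is_mono C m" "m \<cdot> e = b" using image_factorization[OF b(1)] .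
    have I: "\<not> is_zero C I" using nonzero_factor[OF em(1,2)] em(5) b(2) by simp
    let ?n = "v' \<cdot> (a \<cdot> k)"
    have ak: "a \<cdot> k \<in> mor K V" "is_mono C (a \<cdot> k)" using Comp_Hom[OF k(2) a(1)] mono_comp[OF k(3) a(2) k(2) a(1)] by auto
    have n: "?n \<in> mor K Q" "is_mono C ?n" using Comp_Hom[OF ak(1) V(5)] mono_comp[OF ak(2) V(6) ak(1) V(5)] by auto
    obtain q' Q' where q': "is_cokernel C q' ?n" "q' \<in> mor Q Q'" "is_epi C q'" "q' \<cdot> ?n = zer K Q'" using obtain_cokernel[OF n(1)] .
    have qq: "q' \<cdot> q \<in> mor M Q'" "is_epi C (q' \<cdot> q)" using Comp_Hom[OF q(1) q'(2)] epi_comp[OF q(2) q'(3) q(1) q'(2)] by auto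
    obtain l' L' where l': "is_kernel C l' (q' \<cdot> q)" "l' \<in> mor L' M" "is_mono C l'" "q' \<cdot> q \<cdot> l' = zer L' Q'" using obtain_kernel[OF qq(1)] .
    have ql': "is_cokernel C (q' \<cdot> q) l'" using epi_cokernel_kernel[OF qq(2) l'(1)] .
    have va: "v' \<cdot> a \<in> mor U Q" using Comp_Hom[OF a(1) V(5)] .
    have qva: "q' \<cdot> (v' \<cdot> a) \<in> mor U Q'" using Comp_Hom[OF va q'(2)] .
    have kk: "e \<cdot> x = zer T I \<longleftrightarrow> q' \<cdot> (v' \<cdot> a) \<cdot> x = zer T Q'" if x: "x \<in> mor T U" for T x
    proof -
      have T: "T \<in> Obj C" using x hom_obj by blast
      have "e \<cdot> x = zer T I \<longleftrightarrow> b \<cdot> x = zer T V"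
        using mono_zerD[OF em(4,2) Comp_Hom[OF x em(1)]] Comp_assoc[OF x em(1,2)] em(5) comp_zer'[OF em(2) T] by auto
      also have "\<dots> \<longleftrightarrow> (\<exists>y \<in> mor T K. k \<cdot> y = x)"
        using kernelE[OF k(1) b(1) k(2) x] comp_eq_zer[OF k(2) b(1) _ k(4)] by metis
      also have "\<dots> \<longleftrightarrow> q' \<cdot> (v' \<cdot> a) \<cdot> x = zer T Q'"
      proof
        assume "\<exists>y \<in> mor T K. k \<cdot> y = x"
        then obtain y where y: "y \<in> mor T K" "k \<cdot> y = x" by blast
        have "(v' \<cdot> a) \<cdot> x = ?n \<cdot> y"
          using y Comp_assoc[OF y(1) k(2) va] Comp_assoc[OF k(2) a(1) V(5)] by simp
        then show "q' \<cdot> (v' \<cdot> a) \<cdot> x = zer T Q'" using comp_eq_zer[OF n(1) q'(2) y(1) q'(4)] Comp_assoc[OF x va q'(2)] by simp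
      next
        assume "q' \<cdot> (v' \<cdot> a) \<cdot> x = zer T Q'"
        then have "q' \<cdot> (v' \<cdot> a \<cdot> x) = zer T Q'" using Comp_assoc[OF x va q'(2)] by simp
        then obtain y where y: "y \<in> mor T K" "?n \<cdot> y = v' \<cdot> a \<cdot> x" using mono_factor[OF n(2,1) q'(1,2) Comp_Hom[OF x va]] by metis
        then have "(v' \<cdot> a) \<cdot> (k \<cdot> y) = (v' \<cdot> a) \<cdot> x" using Comp_assoc[OF y(1) k(2) va] Comp_assoc[OF k(2) a(1) V(5)] by simp
        then have "k \<cdot> y = x" using monoD[OF mono_comp[OF a(2) V(6) a(1) V(5)] va Comp_Hom[OF y(1) k(2)] x] by blast
        then show "\<exists>y \<in> mor T K. k \<cdot> y = x" using y by blast
      qed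
      finally show ?thesis .
    qed
    obtain t where t: "t \<in> mor I Q'" "t \<cdot> e = q' \<cdot> (v' \<cdot> a)" using epi_factor_all[OF em(3,1) qva] kk by blast
    have tm: "is_mono C t"
    proof (rule mono_zerI[OF t(1)])
      fix W x assume x: "x \<in> mor W I" "t \<cdot> x = zer W Q'"
      obtain S p y where S: "p \<in> mor S W" "is_epi C p" "y \<in> mor S U" "e \<cdot> y = x \<cdot> p" using epi_lift[OF em(1,3) x(1)] .
      have "q' \<cdot> (v' \<cdot> a) \<cdot> y = t \<cdot> (x \<cdot> p)" using t(2) Comp_assoc[OF S(3) em(1) t(1)] S(4) by simp
      also have "\<dots> = zer S Q'" using comp_eq_zer[OF x(1) t(1) S(1) x(2)] .
      finally have "x \<cdot> p = zer S I" using kk[OF S(3)] S(4) by simp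
      then show "x = zer W I" using epi_zerD[OF S(2,1) x(1)] by blast
    qed
    \<comment> \<open>The image \<open>I\<close> of \<open>b\<close> lies in \<open>M\<close>
      through \<open>V\<close> and in \<open>M / l'\<close> through \<open>t\<close>, so
      \<open>l'\<close> competes with \<open>l\<close>.\<close>
    have "?P l'" using subobjI[OF l'(3,2)] I Comp_Hom[OF em(2) V(2)] mono_comp[OF em(4) V(3) em(2) V(2)] ql' tm t(1) hom_DC[OF qq(1)] by metis
    moreover have "sub_le C l l'"
    proof -
      have "q' \<cdot> q \<cdot> l = zer (Dom C l) Q'" using Comp_assoc[OF lm(1) q(1) q'(2)] q(3) comp_zer'[OF q'(2)] hom_obj[OF lm(1)] by simp
      then show ?thesis using kernelE[OF l'(1) qq(1) l'(2) lm(1)] sub_le_iff[OF lm(1) l'(2)] by metis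
    qed
    ultimately have "sub_le C l' l" using l(2) by blast
    then obtain h where h: "h \<in> mor L' (Dom C l)" "l \<cdot> h = l'" using sub_le_iff[OF l'(2) lm(1)] by blast
    have ql'0: "q \<cdot> l' = zer L' Q" using comp_eq_zer[OF lm(1) q(1) h(1) q(3)] h(2) by simp
    obtain S p x where S: "p \<in> mor S K" "is_epi C p" "x \<in> mor S M" "q \<cdot> x = ?n \<cdot> p" using epi_lift[OF q(1,2) n(1)] .
    have "q' \<cdot> q \<cdot> x = zer S Q'" using Comp_assoc[OF S(3) q(1) q'(2)] S(4) comp_eq_zer[OF n(1) q'(2) S(1) q'(4)] by simp
    then obtain y where y: "y \<in> mor S L'" "l' \<cdot> y = x" using kernelE[OF l'(1) qq(1) l'(2) S(3)] by metis
    have "?n \<cdot> p = zer S Q" using comp_eq_zer[OF l'(2) q(1) y(1) ql'0] y(2) S(4) by simp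
    then have "?n = zer K Q" using epi_zerD[OF S(2,1) n(1)] by blast
    then have K: "is_zero C K" using mono_zero[OF n(2,1)] by blast
    show ?thesis using zero_kernel_mono[OF k(1,2) b(1) K] .
  qed
  then have "monoform C V" using monoform_iff[of V] V(1) hom_obj[OF V(2)] by blast
  then show ?thesis using that V by blast
qed

end

section \<open>Unions of subobjects in Grothendieck categories\<close>

context grothendieck_category
begin

section \<open>Small sets and coproducts over arbitrary small index sets\<close>

lemma small_inj: assumes "small U B" "inj_on f A" "f ` A \<subseteq> B" shows "small U A"
proof -
  have "|A| \<le>o |B|" using assms(2,3) card_of_ordLeq by blast
  then show ?thesis using assms(1) ordLeq_ordLess_trans unfolding small_def by blast
qed

lemma small_subset: "small U B \<Longrightarrow> A \<subseteq> B \<Longrightarrow> small U A"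
  using small_inj[of B id A] by simp

lemma small_image: assumes "small U A" shows "small U (f ` A)"
  using assms card_of_image ordLeq_ordLess_trans unfolding small_def by blast

text \<open>The axioms on coproducts and direct limits speak of index sets of type \<open>'u\<close>
  only; this transports any small set to that type.\<close>

lemma small_reindex:
  fixes A :: "'x set"
  assumes "small U A"
  obtains g :: "'x \<Rightarrow> 'u" where "inj_on g A" "small U (g ` A)"
proof -
  have "|A| \<le>o |U|" using assms ordLess_imp_ordLeq by (auto simp: small_def)
  from iffD2[OF card_of_ordLeq this] obtain g :: "'x \<Rightarrow> 'u" where g: "inj_on g A" by blast
  show ?thesis by (rule that[OF g small_image[OF assms]])
qed

lemma small_Pow: fixes A :: "'x set" assumes "small U A" shows "small U (Pow A)"
proof -
  obtain g :: "'x \<Rightarrow> 'u" where g: "inj_on g A" "small U (g ` A)" using small_reindex[OF assms] .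
  have "small U (Pow (g ` A))" using universe g(2) by (simp add: universe_def small_def)
  then show ?thesis using small_inj[of "Pow (g ` A)" "\<lambda>X. g ` X" "Pow A"] inj_on_image_Pow[OF g(1)] by auto
qed

lemma small_finite: fixes A :: "'x set" assumes "finite A" shows "small U A"
proof -
  obtain f :: "'x \<Rightarrow> nat" where "inj_on f A" using finite_imp_inj_to_nat_seg[OF assms] by blast
  then have "|A| \<le>o |UNIV :: nat set|" using card_of_ordLeq[of A "UNIV :: nat set"] by blast
  then show ?thesis using universe ordLeq_ordLess_trans unfolding small_def universe_def by blast
qed

lemma small_Times_ordLeq:
  fixes S :: "'s set" and T :: "'t set"
  assumes S: "small U S" and le: "|T| \<le>o |S|"
  shows "small U (S \<times> T)" "small U (T \<times> S)"
proof -
  have "small U (S \<times> T) \<and> small U (T \<times> S)"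
  proof (cases "finite S \<or> T = {}")
    case True
    then have "finite (S \<times> T)" "finite (T \<times> S)" using card_of_ordLeq_finite[OF le] by auto
    then show ?thesis by (simp add: small_finite)
  next
    case False
    then have "|S \<times> T| =o |S|" "|T \<times> S| =o |S|" using card_of_Times_infinite[OF _ _ le] by auto
    from this[THEN ordIso_ordLess_trans, OF S[unfolded small_def]] show ?thesis
      by (simp add: small_def)
  qed
  then show "small U (S \<times> T)" "small U (T \<times> S)" by auto
qed

lemma small_Times:
  fixes A :: "'x set" and B :: "'y set"
  assumes "small U A" "small U B" shows "small U (A \<times> B)"
proof -
  have "|A| \<le>o |B| \<or> |B| \<le>o |A|" by (rule ordLeq_total[OF card_of_Well_order card_of_Well_order])
  then show ?thesis
  proof
    assume "|A| \<le>o |B|"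
    from small_Times_ordLeq(2)[OF assms(2) this] show ?thesis .
  next
    assume "|B| \<le>o |A|"
    from small_Times_ordLeq(1)[OF assms(1) this] show ?thesis .
  qed
qed

lemma coproduct_exists:
  fixes I :: "'x set"
  assumes I: "small U I" "\<And>i. i \<in> I \<Longrightarrow> X i \<in> Obj C"
  obtains P \<iota> where "is_coproduct C I X P \<iota>"
proof -
  obtain g :: "'x \<Rightarrow> 'u" where g: "inj_on g I" "small U (g ` I)" using small_reindex[OF I(1)] .
  have ob: "\<forall>i\<in>g ` I. (X \<circ> inv_into I g) i \<in> Obj C" using I(2) g(1) by (auto simp: inv_into_into)
  obtain P \<iota> where "is_coproduct C (g ` I) (X \<circ> inv_into I g) P \<iota>" using coproducts[OF g(2) ob] by blast
  note cop = this[unfolded is_coproduct_def]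
  have P: "P \<in> Obj C" using cop by blast
  have io: "(\<iota> \<circ> g) i \<in> mor (X i) P" if "i \<in> I" for i
  proof -
    have "\<iota> (g i) \<in> mor ((X \<circ> inv_into I g) (g i)) P" using cop that by blast
    then show ?thesis using that g(1) by simp
  qed
  have ex: "\<exists>!h. h \<in> mor P Y \<and> (\<forall>i\<in>I. h \<cdot> (\<iota> \<circ> g) i = f i)" if Y: "Y \<in> Obj C" and f: "\<forall>i\<in>I. f i \<in> mor (X i) Y" for Y f
  proof -
    have "\<forall>i\<in>g ` I. (f \<circ> inv_into I g) i \<in> mor ((X \<circ> inv_into I g) i) Y" using f g(1) by (auto simp: inv_into_into)
    then have "\<exists>!h. h \<in> mor P Y \<and> (\<forall>i\<in>g ` I. h \<cdot> \<iota> i = (f \<circ> inv_into I g) i)"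
      using spec[OF bspec[OF conjunct2[OF conjunct2[OF cop]] Y], of "f \<circ> inv_into I g"] by (rule mp[rotated])
    moreover have "(\<forall>i\<in>g ` I. h \<cdot> \<iota> i = (f \<circ> inv_into I g) i) \<longleftrightarrow> (\<forall>i\<in>I. h \<cdot> (\<iota> \<circ> g) i = f i)" for h
      using g(1) by auto
    ultimately show ?thesis by simp
  qed
  have "is_coproduct C I X P (\<iota> \<circ> g)" unfolding is_coproduct_def using P io ex by blast
  then show ?thesis by (rule that)
qed

section \<open>Generators, and families of subobjects that need not be small\<close>

lemma obtain_generator:
  obtains G where "G \<in> Obj C" "\<And>X Y f. f \<in> mor X Y \<Longrightarrow> (\<And>h. h \<in> mor G X \<Longrightarrow> f \<cdot> h = zer G Y) \<Longrightarrow> f = zer X Y"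
proof -
  obtain G where G: "generating_set C {G}" using generator by blast
  have "f = zer X Y" if f: "f \<in> mor X Y" and z: "\<And>h. h \<in> mor G X \<Longrightarrow> f \<cdot> h = zer G Y" for X Y f
  proof (rule ccontr)
    assume n: "f \<noteq> zer X Y"
    have XY: "X \<in> Obj C" "Y \<in> Obj C" using f hom_obj by auto
    obtain h where h: "h \<in> mor G X" "f \<cdot> h \<noteq> zer X Y \<cdot> h"
      using G f zer_hom[OF XY] n unfolding generating_set_def by blast
    then show False using z zer_comp'[OF h(1) XY(2)] by simp
  qed
  then show ?thesis using that[of G] G by (auto simp: generating_set_def)
qed

text \<open>Inclusion of subobjects is decided by the arrows from the generator. This is what bounds
  the number of subobjects by a small set.\<close>

lemma factor_by_generator:
  assumes G: "\<And>X Y f. f \<in> mor X Y \<Longrightarrow> (\<And>h. h \<in> mor G X \<Longrightarrow> f \<cdot> h = zer G Y) \<Longrightarrow> f = zer X Y"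
    and m: "is_mono C m" "m \<in> mor A M" and s: "s \<in> mor B M"
    and f: "\<And>h. h \<in> mor G B \<Longrightarrow> \<exists>y \<in> mor G A. m \<cdot> y = s \<cdot> h"
  obtains h where "h \<in> mor B A" "m \<cdot> h = s"
proof -
  obtain c K where c: "is_cokernel C c m" "c \<in> mor M K" "is_epi C c" "c \<cdot> m = zer A K" using obtain_cokernel[OF m(2)] .
  have "c \<cdot> s = zer B K"
  proof (rule G[OF Comp_Hom[OF s c(2)]])
    fix h assume h: "h \<in> mor G B"
    then obtain y where y: "y \<in> mor G A" "m \<cdot> y = s \<cdot> h" using f by blast
    then show "c \<cdot> s \<cdot> h = zer G K" using comp_eq_zer[OF m(2) c(2) y(1) c(4)] Comp_assoc[OF h s c(2)] by simp
  qed
  then show ?thesis using mono_factor[OF m c(1,2) s] that by blast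
qed

text \<open>The family \<open>J\<close> need not be small. The arrows \<open>G -> M\<close> that
  factor through some member of it form a small set \<open>H\<close>, and an arrow on
  \<open>M\<close> kills \<open>J\<close> if and only if it kills \<open>H\<close>; so the cokernel
  of a coproduct over \<open>H\<close> serves for \<open>J\<close>.\<close>

lemma joint_cokernel:
  assumes M: "M \<in> Obj C" and J: "\<And>j. j \<in> J \<Longrightarrow> j \<in> mor (Dom C j) M"
  obtains q Q where "q \<in> mor M Q" "is_epi C q" "\<And>j. j \<in> J \<Longrightarrow> q \<cdot> j = zer (Dom C j) Q"
    "\<And>Z g. g \<in> mor M Z \<Longrightarrow> (\<And>j. j \<in> J \<Longrightarrow> g \<cdot> j = zer (Dom C j) Z) \<Longrightarrow> \<exists>h \<in> mor Q Z. h \<cdot> q = g"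
proof -
  obtain G where G: "G \<in> Obj C" "\<And>X Y f. f \<in> mor X Y \<Longrightarrow> (\<And>h. h \<in> mor G X \<Longrightarrow> f \<cdot> h = zer G Y) \<Longrightarrow> f = zer X Y"
    by (rule obtain_generator) (blast intro: that)
  define H where "H = {h \<in> mor G M. \<exists>j\<in>J. \<exists>y \<in> mor G (Dom C j). j \<cdot> y = h}"
  have sH: "small U H" by (rule small_subset[OF locally_small[OF G(1) M]]) (auto simp: H_def)
  obtain P \<iota> where P: "is_coproduct C H (\<lambda>_. G) P \<iota>" using coproduct_exists[OF sH, of "\<lambda>_. G"] G(1) by blast
  obtain \<sigma> where \<sigma>: "\<sigma> \<in> mor P M" "\<And>i. i \<in> H \<Longrightarrow> \<sigma> \<cdot> \<iota> i = i"
    by (rule coproduct_copair[OF P M, of "\<lambda>i. i"]) (auto simp: H_def)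
  obtain q Q where q: "is_cokernel C q \<sigma>" "q \<in> mor M Q" "is_epi C q" "q \<cdot> \<sigma> = zer P Q" using obtain_cokernel[OF \<sigma>(1)] .
  have "q \<cdot> j = zer (Dom C j) Q" if j: "j \<in> J" for j
  proof (rule G(2)[OF Comp_Hom[OF J[OF j] q(2)]])
    fix h assume h: "h \<in> mor G (Dom C j)"
    have jh: "j \<cdot> h \<in> H" using h j Comp_Hom[OF h J[OF j]] by (auto simp: H_def)
    have "q \<cdot> (\<sigma> \<cdot> \<iota> (j \<cdot> h)) = zer G Q" using comp_eq_zer[OF \<sigma>(1) q(2) coproduct_inj[OF P jh] q(4)] .
    then show "q \<cdot> j \<cdot> h = zer G Q" using \<sigma>(2)[OF jh] Comp_assoc[OF h J[OF j] q(2)] by simp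
  qed
  moreover have "\<exists>h \<in> mor Q Z. h \<cdot> q = g" if g: "g \<in> mor M Z" "\<And>j. j \<in> J \<Longrightarrow> g \<cdot> j = zer (Dom C j) Z" for Z g
  proof -
    have "g \<cdot> \<sigma> = zer P Z"
    proof (rule coproduct_zer[OF P Comp_Hom[OF \<sigma>(1) g(1)]])
      fix i assume i: "i \<in> H"
      then obtain j y where j: "j \<in> J" "y \<in> mor G (Dom C j)" "j \<cdot> y = i" by (auto simp: H_def)
      have "g \<cdot> i = zer G Z" using comp_eq_zer[OF J[OF j(1)] g(1) j(2) g(2)[OF j(1)]] j(3) by simp
      then show "g \<cdot> \<sigma> \<cdot> \<iota> i = zer G Z" using Comp_assoc[OF coproduct_inj[OF P i] \<sigma>(1) g(1)] \<sigma>(2)[OF i] by simp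
    qed
    then show ?thesis using cokernelE[OF q(1) \<sigma>(1) q(2) g(1)] by metis
  qed
  ultimately show ?thesis using that[OF q(2,3)] by blast
qed

text \<open>All terms are quotients of one object \<open>W\<close>. Functoriality, the cocone
  equations and the universal property can therefore be checked after composition with the epic
  arrows \<open>w i\<close>, and the limit is the largest common quotient of the terms.\<close>

lemma quotient_system:
  assumes I: "directed_poset I r" "r \<subseteq> I \<times> I"
    and w: "\<And>i. i \<in> I \<Longrightarrow> w i \<in> mor W (Q i)" "\<And>i. i \<in> I \<Longrightarrow> is_epi C (w i)"
    and q: "\<And>i j. (i, j) \<in> r \<Longrightarrow> q i j \<in> mor (Q i) (Q j)" "\<And>i j. (i, j) \<in> r \<Longrightarrow> q i j \<cdot> w i = w j"
    and o: "\<omega> \<in> mor W L" "is_epi C \<omega>" and l: "\<And>i. i \<in> I \<Longrightarrow> l i \<in> mor (Q i) L" "\<And>i. i \<in> I \<Longrightarrow> l i \<cdot> w i = \<omega>"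
    and u: "\<And>Z t. t \<in> mor W Z \<Longrightarrow> (\<And>i. i \<in> I \<Longrightarrow> \<exists>t' \<in> mor (Q i) Z. t' \<cdot> w i = t) \<Longrightarrow> \<exists>h \<in> mor L Z. h \<cdot> \<omega> = t"
  shows "direct_system C I r Q q" "is_direct_limit C I r Q q L l"
proof -
  have refl: "(i, i) \<in> r" if "i \<in> I" for i
    using I(1) that by (auto simp: directed_poset_def order_on_defs refl_on_def)
  have Qo: "Q i \<in> Obj C" if "i \<in> I" for i using hom_obj[OF w(1)[OF that]] by blast
  have "q i i = Ide C (Q i)" if i: "i \<in> I" for i
    using epiD[OF w(2,1)[OF i] q(1)[OF refl[OF i]] Ide_Hom[OF Qo[OF i]]] q(2)[OF refl[OF i]] Ide_Comp[OF w(1)[OF i]] by simp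
  moreover have "q j k \<cdot> q i j = q i k" if ij: "(i, j) \<in> r" and jk: "(j, k) \<in> r" for i j k
  proof -
    have ik: "(i, k) \<in> r" using I(1) ij jk by (auto simp: directed_poset_def order_on_defs dest: transD)
    have i: "i \<in> I" using ij I(2) by blast
    have "q j k \<cdot> q i j \<cdot> w i = q i k \<cdot> w i"
      using Comp_assoc[OF w(1)[OF i] q(1)[OF ij] q(1)[OF jk]] q(2) ij jk ik by simp
    then show ?thesis using epiD[OF w(2,1)[OF i] Comp_Hom[OF q(1)[OF ij] q(1)[OF jk]] q(1)[OF ik]] by blast
  qed
  ultimately show "direct_system C I r Q q" unfolding direct_system_def using Qo q(1) by blast
  have "l j \<cdot> q i j = l i" if ij: "(i, j) \<in> r" for i j
  proof -
    have i: "i \<in> I" "j \<in> I" using ij I(2) by blast+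
    have "l j \<cdot> q i j \<cdot> w i = l i \<cdot> w i" using Comp_assoc[OF w(1)[OF i(1)] q(1)[OF ij] l(1)[OF i(2)]] q(2)[OF ij] l(2) i by simp
    then show ?thesis using epiD[OF w(2,1)[OF i(1)] Comp_Hom[OF q(1)[OF ij] l(1)[OF i(2)]] l(1)[OF i(1)]] by blast
  qed
  then have co: "is_cocone C I r Q q L l" unfolding is_cocone_def using l(1) hom_obj[OF o(1)] by blast
  have "\<exists>!h. h \<in> mor L L' \<and> (\<forall>i\<in>I. h \<cdot> l i = l' i)" if c: "is_cocone C I r Q q L' l'" for L' l'
  proof -
    have l': "\<And>i. i \<in> I \<Longrightarrow> l' i \<in> mor (Q i) L'" "\<And>i j. (i, j) \<in> r \<Longrightarrow> l' j \<cdot> q i j = l' i"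
      using c unfolding is_cocone_def by auto
    have lw: "l' i \<cdot> w i = l' j \<cdot> w j" if ij: "(i, j) \<in> r" for i j
    proof -
      have i: "i \<in> I" "j \<in> I" using ij I(2) by blast+
      show ?thesis using Comp_assoc[OF w(1)[OF i(1)] q(1)[OF ij] l'(1)[OF i(2)]] q(2)[OF ij] l'(2)[OF ij] by simp
    qed
    have all: "l' i \<cdot> w i = l' j \<cdot> w j" if ij: "i \<in> I" "j \<in> I" for i j
    proof -
      obtain k where "(i, k) \<in> r" "(j, k) \<in> r" using I(1) ij unfolding directed_poset_def by blast
      then show ?thesis using lw by metis
    qed
    obtain i0 where i0: "i0 \<in> I" using I(1) unfolding directed_poset_def by blast
    have "l' i0 \<cdot> w i0 \<in> mor W L'" using Comp_Hom[OF w(1) l'(1)] i0 by blast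
    then have "\<exists>h \<in> mor L L'. h \<cdot> \<omega> = l' i0 \<cdot> w i0" by (rule u) (use l'(1) all[OF _ i0] in blast)
    then obtain h where h: "h \<in> mor L L'" "h \<cdot> \<omega> = l' i0 \<cdot> w i0" by blast
    have hl: "h \<cdot> l i = l' i" if i: "i \<in> I" for i
    proof -
      have "h \<cdot> l i \<cdot> w i = l' i \<cdot> w i" using Comp_assoc[OF w(1)[OF i] l(1)[OF i] h(1)] l(2)[OF i] h(2) all[OF i i0] by simp
      then show ?thesis using epiD[OF w(2,1)[OF i] Comp_Hom[OF l(1)[OF i] h(1)] l'(1)[OF i]] by blast
    qed
    have "h' = h" if h': "h' \<in> mor L L'" "\<forall>i\<in>I. h' \<cdot> l i = l' i" for h'
    proof -
      have "h' \<cdot> \<omega> = l' i0 \<cdot> w i0" using Comp_assoc[OF w(1)[OF i0] l(1)[OF i0] h'(1)] l(2)[OF i0] h'(2) i0 by simp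
      then show ?thesis using epiD[OF o(2,1) h'(1) h(1)] h(2) by simp
    qed
    then show ?thesis using h(1) hl by blast
  qed
  then show "is_direct_limit C I r Q q L l" unfolding is_direct_limit_def using co by blast
qed

text \<open>This is (AB5), applied to the direct limit of \<open>0 \<rightarrow> L / l\<^sup>-\<^sup>1(D) \<rightarrow> M / D\<close> over \<open>D \<in> \<D>\<close>,
  whose last term has the limit \<open>0\<close>. No smallness of \<open>\<D>\<close> is assumed, because a subobject of \<open>M\<close>
  is determined by the arrows from a generator that factor through it.\<close>

lemma directed_cover_preimage:
  assumes D: "\<D> \<noteq> {}" "\<And>m. m \<in> \<D> \<Longrightarrow> subobj C M m"
      "\<And>m m'. m \<in> \<D> \<Longrightarrow> m' \<in> \<D> \<Longrightarrow> \<exists>n\<in>\<D>. sub_le C m n \<and> sub_le C m' n"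
    and cover: "\<And>Z g. g \<in> mor M Z \<Longrightarrow> (\<And>m. m \<in> \<D> \<Longrightarrow> g \<cdot> m = zer (Dom C m) Z) \<Longrightarrow> g = zer M Z"
    and l: "l \<in> mor L M" and f: "f \<in> mor L Z"
    and kill: "\<And>m T x y. m \<in> \<D> \<Longrightarrow> x \<in> mor T L \<Longrightarrow> y \<in> mor T (Dom C m) \<Longrightarrow> l \<cdot> x = m \<cdot> y \<Longrightarrow> f \<cdot> x = zer T Z"
  shows "f = zer L Z"
proof -
  have M: "M \<in> Obj C" and LO: "L \<in> Obj C" using l hom_obj by auto
  obtain G where G: "G \<in> Obj C" "\<And>X Y f. f \<in> mor X Y \<Longrightarrow> (\<And>h. h \<in> mor G X \<Longrightarrow> f \<cdot> h = zer G Y) \<Longrightarrow> f = zer X Y"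
    by (rule obtain_generator) (blast intro: that)
  note mm = subobj_mor[OF D(2)] and mo = subobj_mono[OF D(2)]
  define \<sigma> where "\<sigma> m = {h \<in> mor G M. \<exists>y \<in> mor G (Dom C m). m \<cdot> y = h}" for m
  have \<sigma>: "sub_le C m m' \<longleftrightarrow> \<sigma> m \<subseteq> \<sigma> m'" if m: "m \<in> \<D>" and m': "m' \<in> \<D>" for m m'
  proof
    assume "sub_le C m m'"
    then obtain h where h: "h \<in> mor (Dom C m) (Dom C m')" "m' \<cdot> h = m" using sub_le_iff[OF mm[OF m] mm[OF m']] by blast
    show "\<sigma> m \<subseteq> \<sigma> m'"
    proof
      fix x assume "x \<in> \<sigma> m"
      then obtain y where y: "x \<in> mor G M" "y \<in> mor G (Dom C m)" "m \<cdot> y = x" by (auto simp: \<sigma>_def)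
      then show "x \<in> \<sigma> m'" using comp_ext1[OF h(2,1) mm[OF m'] y(2)] Comp_Hom[OF y(2) h(1)] unfolding \<sigma>_def by auto
    qed
  next
    assume s: "\<sigma> m \<subseteq> \<sigma> m'"
    obtain h where "h \<in> mor (Dom C m) (Dom C m')" "m' \<cdot> h = m"
    proof (rule factor_by_generator[OF G(2) mo[OF m'] mm[OF m'] mm[OF m]])
      fix h assume h: "h \<in> mor G (Dom C m)"
      then have "m \<cdot> h \<in> \<sigma> m" using Comp_Hom[OF h mm[OF m]] by (auto simp: \<sigma>_def)
      then show "\<exists>y\<in>mor G (Dom C m'). m' \<cdot> y = m \<cdot> h" using s by (auto simp: \<sigma>_def)
    qed
    then show "sub_le C m m'" using sub_le_iff[OF mm[OF m] mm[OF m']] by blast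
  qed
  have "small U (Pow (mor G M))" using small_Pow locally_small[OF G(1) M] by blast
  then have "small U (\<sigma> ` \<D>)" by (rule small_subset) (auto simp: \<sigma>_def)
  then obtain g :: "'a set \<Rightarrow> 'u" where g: "inj_on g (\<sigma> ` \<D>)" "small U (g ` \<sigma> ` \<D>)" using small_reindex by blast
  define I where "I = g ` \<sigma> ` \<D>"
  have "\<exists>m. m \<in> \<D> \<and> g (\<sigma> m) = i" if "i \<in> I" for i using that by (auto simp: I_def)
  then obtain \<rho> where \<rho>: "\<And>i. i \<in> I \<Longrightarrow> \<rho> i \<in> \<D>" "\<And>i. i \<in> I \<Longrightarrow> g (\<sigma> (\<rho> i)) = i" by metis
  \<comment> \<open>One subobject is kept for each set of arrows from \<open>G\<close>, so the
    preorder \<open>sub_le\<close> becomes antisymmetric on \<open>I\<close>.\<close>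
  define r where "r = {(i, j). i \<in> I \<and> j \<in> I \<and> sub_le C (\<rho> i) (\<rho> j)}"
  have rI: "r \<subseteq> I \<times> I" by (auto simp: r_def)
  have rs: "(i, j) \<in> r \<longleftrightarrow> i \<in> I \<and> j \<in> I \<and> \<sigma> (\<rho> i) \<subseteq> \<sigma> (\<rho> j)" for i j using \<sigma> \<rho>(1) by (auto simp: r_def)
  have rep: "\<exists>i\<in>I. \<sigma> (\<rho> i) = \<sigma> m" if m: "m \<in> \<D>" for m
  proof -
    have i: "g (\<sigma> m) \<in> I" using m by (simp add: I_def)
    then have "\<sigma> (\<rho> (g (\<sigma> m))) = \<sigma> m" using inj_onD[OF g(1)] \<rho> m by blast
    then show ?thesis using i by blast
  qed
  have dp: "directed_poset I r" unfolding directed_poset_def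
  proof (intro conjI ballI)
    have "i = j" if "i \<in> I" "j \<in> I" "\<sigma> (\<rho> i) = \<sigma> (\<rho> j)" for i j using \<rho>(2) that by metis
    then show "partial_order_on I r" by (auto simp: order_on_defs refl_on_def rs antisym_def trans_def intro: subset_antisym)
    show "I \<noteq> {}" using D(1) by (simp add: I_def)
    fix i j assume ij: "i \<in> I" "j \<in> I"
    obtain n where n: "n \<in> \<D>" "sub_le C (\<rho> i) n" "sub_le C (\<rho> j) n" using D(3) \<rho>(1) ij by blast
    obtain k where k: "k \<in> I" "\<sigma> (\<rho> k) = \<sigma> n" using rep[OF n(1)] by blast
    have "\<sigma> (\<rho> i) \<subseteq> \<sigma> (\<rho> k)" "\<sigma> (\<rho> j) \<subseteq> \<sigma> (\<rho> k)"
      using n(2,3) \<sigma>[OF \<rho>(1)[OF ij(1)] n(1)] \<sigma>[OF \<rho>(1)[OF ij(2)] n(1)] k(2) by simp_all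
    then have "(i, k) \<in> r" "(j, k) \<in> r" using rs ij k(1) by simp_all
    then show "\<exists>k\<in>I. (i, k) \<in> r \<and> (j, k) \<in> r" using k(1) by blast
  qed
  have "\<exists>A a. a \<in> mor A L \<and> is_mono C a \<and> (\<forall>T. \<forall>x \<in> mor T L. (\<exists>y \<in> mor T A. a \<cdot> y = x) \<longleftrightarrow> (\<exists>z \<in> mor T (Dom C (\<rho> i)). \<rho> i \<cdot> z = l \<cdot> x))"
    if i: "i \<in> I" for i
    by (rule obtain_preimage[OF mo mm l, OF \<rho>(1) \<rho>(1), OF i i]) blast
  then obtain A a where a: "\<And>i. i \<in> I \<Longrightarrow> a i \<in> mor (A i) L" "\<And>i. i \<in> I \<Longrightarrow> is_mono C (a i)"
    "\<And>i T x. i \<in> I \<Longrightarrow> x \<in> mor T L \<Longrightarrow> (\<exists>y \<in> mor T (A i). a i \<cdot> y = x) \<longleftrightarrow> (\<exists>z \<in> mor T (Dom C (\<rho> i)). \<rho> i \<cdot> z = l \<cdot> x)"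
    by metis
  have "\<exists>b B. is_cokernel C b (a i) \<and> b \<in> mor L B \<and> is_epi C b \<and> b \<cdot> a i = zer (A i) B" if i: "i \<in> I" for i
    by (rule obtain_cokernel[OF a(1)[OF i]]) blast
  then obtain b B where b: "\<And>i. i \<in> I \<Longrightarrow> is_cokernel C (b i) (a i)" "\<And>i. i \<in> I \<Longrightarrow> b i \<in> mor L (B i)" "\<And>i. i \<in> I \<Longrightarrow> is_epi C (b i)"
      "\<And>i. i \<in> I \<Longrightarrow> b i \<cdot> a i = zer (A i) (B i)" by metis
  have "\<exists>c K. is_cokernel C c (\<rho> i) \<and> c \<in> mor M K \<and> is_epi C c \<and> c \<cdot> \<rho> i = zer (Dom C (\<rho> i)) K" if i: "i \<in> I" for i
    by (rule obtain_cokernel[OF mm[OF \<rho>(1)[OF i]]]) blast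
  then obtain c K where c: "\<And>i. i \<in> I \<Longrightarrow> is_cokernel C (c i) (\<rho> i)" "\<And>i. i \<in> I \<Longrightarrow> c i \<in> mor M (K i)" "\<And>i. i \<in> I \<Longrightarrow> is_epi C (c i)"
      "\<And>i. i \<in> I \<Longrightarrow> c i \<cdot> \<rho> i = zer (Dom C (\<rho> i)) (K i)" by metis
  \<comment> \<open>\<open>u\<close> embeds \<open>L\<close> modulo the preimage of
    \<open>\<rho> i\<close> into \<open>M\<close> modulo \<open>\<rho> i\<close>.\<close>
  have "\<exists>u \<in> mor (B i) (K i). u \<cdot> b i = c i \<cdot> l \<and> is_mono C u" if i: "i \<in> I" for i
  proof -
    note \<rho>m = mm[OF \<rho>(1)[OF i]] and \<rho>o = mo[OF \<rho>(1)[OF i]]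
    have cl: "c i \<cdot> l \<in> mor L (K i)" using Comp_Hom[OF l c(2)[OF i]] .
    have "c i \<cdot> l \<cdot> a i = zer (A i) (K i)"
    proof -
      have "\<exists>y \<in> mor (A i) (A i). a i \<cdot> y = a i" using Comp_Ide[OF a(1)[OF i]] Ide_Hom hom_obj[OF a(1)[OF i]] by blast
      then obtain z where z: "z \<in> mor (A i) (Dom C (\<rho> i))" "\<rho> i \<cdot> z = l \<cdot> a i" using a(3)[OF i a(1)[OF i]] by blast
      then show ?thesis using comp_eq_zer[OF \<rho>m c(2)[OF i] z(1) c(4)[OF i]] Comp_assoc[OF a(1)[OF i] l c(2)[OF i]] by simp
    qed
    then obtain u where u: "u \<in> mor (B i) (K i)" "u \<cdot> b i = c i \<cdot> l" using cokernelE[OF b(1)[OF i] a(1)[OF i] b(2)[OF i] cl] by metis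
    have "is_mono C u"
    proof (rule mono_zerI[OF u(1)])
      fix W x assume x: "x \<in> mor W (B i)" "u \<cdot> x = zer W (K i)"
      obtain S p y where S: "p \<in> mor S W" "is_epi C p" "y \<in> mor S L" "b i \<cdot> y = x \<cdot> p" using epi_lift[OF b(2,3)[OF i] x(1)] .
      have "c i \<cdot> (l \<cdot> y) = u \<cdot> (x \<cdot> p)" using comp_ext[OF u(2) b(2)[OF i] u(1) l c(2)[OF i] S(3)] S(4) by simp
      also have "\<dots> = zer S (K i)" using comp_eq_zer[OF x(1) u(1) S(1) x(2)] .
      finally obtain z where z: "z \<in> mor S (Dom C (\<rho> i))" "\<rho> i \<cdot> z = l \<cdot> y"
        using mono_factor[OF \<rho>o \<rho>m c(1,2)[OF i] Comp_Hom[OF S(3) l]] by metis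
      then obtain y' where y': "y' \<in> mor S (A i)" "a i \<cdot> y' = y" using a(3)[OF i S(3)] by blast
      have "x \<cdot> p = zer S (B i)" using comp_eq_zer[OF a(1)[OF i] b(2)[OF i] y'(1) b(4)[OF i]] y'(2) S(4) by simp
      then show "x = zer W (B i)" using epi_zerD[OF S(2,1) x(1)] by blast
    qed
    then show ?thesis using u by blast
  qed
  then obtain u where u: "\<And>i. i \<in> I \<Longrightarrow> u i \<in> mor (B i) (K i)" "\<And>i. i \<in> I \<Longrightarrow> u i \<cdot> b i = c i \<cdot> l" "\<And>i. i \<in> I \<Longrightarrow> is_mono C (u i)"
    by metis
  have "\<exists>d E. is_cokernel C d (u i) \<and> d \<in> mor (K i) E \<and> is_epi C d \<and> d \<cdot> u i = zer (B i) E" if i: "i \<in> I" for i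
    by (rule obtain_cokernel[OF u(1)[OF i]]) blast
  then obtain d E where d: "\<And>i. i \<in> I \<Longrightarrow> is_cokernel C (d i) (u i)" "\<And>i. i \<in> I \<Longrightarrow> d i \<in> mor (K i) (E i)" "\<And>i. i \<in> I \<Longrightarrow> is_epi C (d i)"
      "\<And>i. i \<in> I \<Longrightarrow> d i \<cdot> u i = zer (B i) (E i)" by metis
  \<comment> \<open>The third term \<open>E i\<close> is presented as a quotient of \<open>M\<close>
    as well, so that its limit is computed like that of \<open>K i\<close>.\<close>
  define e where "e i = d i \<cdot> c i" for i
  have e: "e i \<in> mor M (E i)" "is_epi C (e i)" if i: "i \<in> I" for i
    using Comp_Hom[OF c(2)[OF i] d(2)[OF i]] epi_comp[OF c(3)[OF i] d(3)[OF i] c(2)[OF i] d(2)[OF i]] by (simp_all add: e_def)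
  have "\<exists>x \<in> mor (B i) (B j). x \<cdot> b i = b j" if ij: "(i, j) \<in> r" for i j
  proof -
    have i: "i \<in> I" "j \<in> I" using ij by (auto simp: r_def)
    obtain h where h: "h \<in> mor (Dom C (\<rho> i)) (Dom C (\<rho> j))" "\<rho> j \<cdot> h = \<rho> i"
      using ij sub_le_iff[OF mm mm, OF \<rho>(1) \<rho>(1), OF i] by (auto simp: r_def)
    have "\<exists>y \<in> mor (A i) (A i). a i \<cdot> y = a i" using Comp_Ide[OF a(1)[OF i(1)]] Ide_Hom hom_obj[OF a(1)[OF i(1)]] by blast
    then obtain z where z: "z \<in> mor (A i) (Dom C (\<rho> i))" "\<rho> i \<cdot> z = l \<cdot> a i" using a(3)[OF i(1) a(1)[OF i(1)]] by blast
    have "\<rho> j \<cdot> (h \<cdot> z) = l \<cdot> a i" using comp_ext1[OF h(2,1) mm[OF \<rho>(1)[OF i(2)]] z(1)] z(2) by simp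
    then obtain y where y: "y \<in> mor (A i) (A j)" "a j \<cdot> y = a i" using a(3)[OF i(2) a(1)[OF i(1)]] Comp_Hom[OF z(1) h(1)] by blast
    have "b j \<cdot> a i = zer (A i) (B j)" using comp_eq_zer[OF a(1)[OF i(2)] b(2)[OF i(2)] y(1) b(4)[OF i(2)]] y(2) by simp
    then show ?thesis using cokernelE[OF b(1)[OF i(1)] a(1)[OF i(1)] b(2)[OF i(1)] b(2)[OF i(2)]] by metis
  qed
  then obtain x where x: "\<And>i j. (i, j) \<in> r \<Longrightarrow> x i j \<in> mor (B i) (B j)" "\<And>i j. (i, j) \<in> r \<Longrightarrow> x i j \<cdot> b i = b j" by metis
  have "\<exists>y \<in> mor (K i) (K j). y \<cdot> c i = c j" if ij: "(i, j) \<in> r" for i j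
  proof -
    have i: "i \<in> I" "j \<in> I" using ij by (auto simp: r_def)
    obtain h where h: "h \<in> mor (Dom C (\<rho> i)) (Dom C (\<rho> j))" "\<rho> j \<cdot> h = \<rho> i"
      using ij sub_le_iff[OF mm mm, OF \<rho>(1) \<rho>(1), OF i] by (auto simp: r_def)
    have "c j \<cdot> \<rho> i = zer (Dom C (\<rho> i)) (K j)" using comp_eq_zer[OF mm[OF \<rho>(1)[OF i(2)]] c(2)[OF i(2)] h(1) c(4)[OF i(2)]] h(2) by simp
    then show ?thesis using cokernelE[OF c(1)[OF i(1)] mm[OF \<rho>(1)[OF i(1)]] c(2)[OF i(1)] c(2)[OF i(2)]] by metis
  qed
  then obtain y where y: "\<And>i j. (i, j) \<in> r \<Longrightarrow> y i j \<in> mor (K i) (K j)" "\<And>i j. (i, j) \<in> r \<Longrightarrow> y i j \<cdot> c i = c j" by metis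
  have uxy: "u j \<cdot> x i j = y i j \<cdot> u i" if ij: "(i, j) \<in> r" for i j
  proof -
    have i: "i \<in> I" "j \<in> I" using ij by (auto simp: r_def)
    have "u j \<cdot> x i j \<cdot> b i = c j \<cdot> l" using Comp_assoc[OF b(2)[OF i(1)] x(1)[OF ij] u(1)[OF i(2)]] x(2)[OF ij] u(2)[OF i(2)] by simp
    also have "\<dots> = y i j \<cdot> (u i \<cdot> b i)" using Comp_assoc[OF l c(2)[OF i(1)] y(1)[OF ij]] y(2)[OF ij] u(2)[OF i(1)] by simp
    also have "\<dots> = y i j \<cdot> u i \<cdot> b i" using Comp_assoc[OF b(2)[OF i(1)] u(1)[OF i(1)] y(1)[OF ij]] by simp
    finally show ?thesis using epiD[OF b(3,2)[OF i(1)] Comp_Hom[OF x(1)[OF ij] u(1)[OF i(2)]] Comp_Hom[OF u(1)[OF i(1)] y(1)[OF ij]]] by blast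
  qed
  have "\<exists>z \<in> mor (E i) (E j). z \<cdot> d i = d j \<cdot> y i j" if ij: "(i, j) \<in> r" for i j
  proof -
    have i: "i \<in> I" "j \<in> I" using ij by (auto simp: r_def)
    have "d j \<cdot> y i j \<cdot> u i = d j \<cdot> (u j \<cdot> x i j)" using Comp_assoc[OF u(1)[OF i(1)] y(1)[OF ij] d(2)[OF i(2)]] uxy[OF ij] by simp
    also have "\<dots> = zer (B i) (E j)" using comp_eq_zer[OF u(1)[OF i(2)] d(2)[OF i(2)] x(1)[OF ij] d(4)[OF i(2)]] .
    finally show ?thesis using cokernelE[OF d(1)[OF i(1)] u(1)[OF i(1)] d(2)[OF i(1)] Comp_Hom[OF y(1)[OF ij] d(2)[OF i(2)]]] by metis
  qed
  then obtain z where z: "\<And>i j. (i, j) \<in> r \<Longrightarrow> z i j \<in> mor (E i) (E j)" "\<And>i j. (i, j) \<in> r \<Longrightarrow> z i j \<cdot> d i = d j \<cdot> y i j" by metis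
  have ze: "z i j \<cdot> e i = e j" if ij: "(i, j) \<in> r" for i j
  proof -
    have i: "i \<in> I" "j \<in> I" using ij by (auto simp: r_def)
    show ?thesis using comp_ext[OF z(2)[OF ij] d(2)[OF i(1)] z(1)[OF ij] y(1)[OF ij] d(2)[OF i(2)] c(2)[OF i(1)]] y(2)[OF ij] by (simp add: e_def)
  qed
  obtain O0 where O0: "is_zero C O0" using zero_object by blast
  have OO: "O0 \<in> Obj C" using O0 by (simp add: is_zero_def)
  have aJ: "j \<in> mor (Dom C j) L" if "j \<in> a ` I" for j using that a(1) hom_DC(1)[OF a(1)] by auto
  obtain \<omega> LX where w: "\<omega> \<in> mor L LX" "is_epi C \<omega>" "\<And>j. j \<in> a ` I \<Longrightarrow> \<omega> \<cdot> j = zer (Dom C j) LX"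
    "\<And>Z g. g \<in> mor L Z \<Longrightarrow> (\<And>j. j \<in> a ` I \<Longrightarrow> g \<cdot> j = zer (Dom C j) Z) \<Longrightarrow> \<exists>h \<in> mor LX Z. h \<cdot> \<omega> = g"
    by (rule joint_cokernel[OF LO aJ]) (assumption, blast intro: that)
  have wa: "\<omega> \<cdot> a i = zer (A i) LX" if "i \<in> I" for i using w(3)[of "a i"] hom_DC(1)[OF a(1)[OF that]] that by simp
  have "\<exists>t \<in> mor (B i) LX. t \<cdot> b i = \<omega>" if i: "i \<in> I" for i
    using cokernelE[OF b(1)[OF i] a(1)[OF i] b(2)[OF i] w(1) wa[OF i]] by blast
  then obtain lX where lX: "\<And>i. i \<in> I \<Longrightarrow> lX i \<in> mor (B i) LX" "\<And>i. i \<in> I \<Longrightarrow> lX i \<cdot> b i = \<omega>" by metis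
  have X: "direct_system C I r B x" "is_direct_limit C I r B x LX lX"
  proof -
    have uni: "\<exists>h \<in> mor LX Z. h \<cdot> \<omega> = t" if t: "t \<in> mor L Z" "\<And>i. i \<in> I \<Longrightarrow> \<exists>t' \<in> mor (B i) Z. t' \<cdot> b i = t" for Z t
    proof (rule w(4)[OF t(1)])
      fix j assume "j \<in> a ` I"
      then obtain i where i: "i \<in> I" "j = a i" by blast
      obtain t' where t': "t' \<in> mor (B i) Z" "t' \<cdot> b i = t" using t(2)[OF i(1)] by blast
      have "t \<cdot> a i = t' \<cdot> (b i \<cdot> a i)" using Comp_assoc[OF a(1)[OF i(1)] b(2)[OF i(1)] t'(1)] t'(2) by simp
      also have "\<dots> = zer (A i) Z" using b(4)[OF i(1)] comp_zer'[OF t'(1)] hom_obj[OF a(1)[OF i(1)]] by simp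
      finally show "t \<cdot> j = zer (Dom C j) Z" using i(2) hom_DC(1)[OF a(1)[OF i(1)]] by simp
    qed
    show "direct_system C I r B x" "is_direct_limit C I r B x LX lX"
      by (rule quotient_system[where w = b and q = x and l = lX and Q = B and I = I and r = r and \<omega> = \<omega>, OF dp rI b(2,3) x w(1,2) lX uni]; assumption)+
  qed
  have zM: "zer M O0 \<in> mor M O0" using zer_hom[OF M OO] .
  have zMe: "is_epi C (zer M O0)" by (rule epi_zerI[OF zM]) (use zero_hom(1)[OF O0] in blast)
  have zc: "zer (K i) O0 \<cdot> c i = zer M O0" if "i \<in> I" for i using zer_comp'[OF c(2)[OF that] OO] .
  have zz: "zer (E i) O0 \<cdot> e i = zer M O0" if "i \<in> I" for i using zer_comp'[OF e(1)[OF that] OO] .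
  \<comment> \<open>By \<open>cover\<close> an arrow on \<open>M\<close> that kills all
    \<open>\<rho> i\<close> is zero; hence the zero object \<open>O0\<close> is the limit of the
    quotients \<open>K i\<close> and of their quotients \<open>E i\<close>.\<close>
  have univ: "\<exists>h \<in> mor O0 Z. h \<cdot> zer M O0 = t" if t: "t \<in> mor M Z" "\<And>i. i \<in> I \<Longrightarrow> t \<cdot> \<rho> i = zer (Dom C (\<rho> i)) Z" for Z t
  proof -
    have ZO: "Z \<in> Obj C" using t hom_obj by blast
    have "t = zer M Z"
    proof (rule cover[OF t(1)])
      fix m assume m: "m \<in> \<D>"
      obtain i where i: "i \<in> I" "\<sigma> (\<rho> i) = \<sigma> m" using rep[OF m] by blast
      then have "sub_le C m (\<rho> i)" using \<sigma>[OF m \<rho>(1)[OF i(1)]] by simp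
      then obtain h where h: "h \<in> mor (Dom C m) (Dom C (\<rho> i))" "\<rho> i \<cdot> h = m" using sub_le_iff[OF mm[OF m] mm[OF \<rho>(1)[OF i(1)]]] by blast
      show "t \<cdot> m = zer (Dom C m) Z" using comp_eq_zer[OF mm[OF \<rho>(1)[OF i(1)]] t(1) h(1) t(2)[OF i(1)]] h(2) by simp
    qed
    then show ?thesis using zer_hom[OF OO ZO] zer_comp'[OF zM ZO] by auto
  qed
  have univ': "\<exists>h \<in> mor O0 Z. h \<cdot> zer M O0 = t"
    if t: "t \<in> mor M Z" "\<And>i. i \<in> I \<Longrightarrow> \<exists>t' \<in> mor (Q i) Z. t' \<cdot> v i = t"
      and v: "\<And>i. i \<in> I \<Longrightarrow> v i \<in> mor M (Q i)" "\<And>i. i \<in> I \<Longrightarrow> v i \<cdot> \<rho> i = zer (Dom C (\<rho> i)) (Q i)" for Z t v Q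
  proof (rule univ[OF t(1)])
    fix i assume i: "i \<in> I"
    note \<rho>m = mm[OF \<rho>(1)[OF i]]
    obtain t' where t': "t' \<in> mor (Q i) Z" "t' \<cdot> v i = t" using t(2)[OF i] by blast
    have "t \<cdot> \<rho> i = t' \<cdot> (v i \<cdot> \<rho> i)" using Comp_assoc[OF \<rho>m v(1)[OF i] t'(1)] t'(2) by simp
    also have "\<dots> = zer (Dom C (\<rho> i)) Z" using v(2)[OF i] comp_zer'[OF t'(1)] hom_obj[OF \<rho>m] by simp
    finally show "t \<cdot> \<rho> i = zer (Dom C (\<rho> i)) Z" .
  qed
  have KO: "K i \<in> Obj C" "E i \<in> Obj C" "B i \<in> Obj C" if "i \<in> I" for i using hom_obj[OF c(2)[OF that]] hom_obj[OF e(1)[OF that]] hom_obj[OF b(2)[OF that]] by auto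
  have er: "e i \<cdot> \<rho> i = zer (Dom C (\<rho> i)) (E i)" if i: "i \<in> I" for i
    using Comp_assoc[OF mm[OF \<rho>(1)[OF i]] c(2)[OF i] d(2)[OF i]] c(4)[OF i] comp_zer'[OF d(2)[OF i]] hom_obj[OF mm[OF \<rho>(1)[OF i]]] by (simp add: e_def)
  let ?lY = "\<lambda>i. zer (K i) O0" and ?lZ = "\<lambda>i. zer (E i) O0"
  have uY: "\<exists>h \<in> mor O0 Z. h \<cdot> zer M O0 = t" if "t \<in> mor M Z" "\<And>i. i \<in> I \<Longrightarrow> \<exists>t' \<in> mor (K i) Z. t' \<cdot> c i = t" for Z t
    by (rule univ'[OF that(1), where v = c and Q = K]) (use that(2) c(2,4) in blast)+
  have uZ: "\<exists>h \<in> mor O0 Z. h \<cdot> zer M O0 = t" if "t \<in> mor M Z" "\<And>i. i \<in> I \<Longrightarrow> \<exists>t' \<in> mor (E i) Z. t' \<cdot> e i = t" for Z t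
    by (rule univ'[OF that(1), where v = e and Q = E]) (use that(2) e(1) er in blast)+
  note QY = quotient_system[where w = c and q = y and l = ?lY and Q = K and I = I and r = r and \<omega> = "zer M O0", OF dp rI c(2,3) y zM zMe zer_hom[OF KO(1) OO] zc uY]
  have Y: "direct_system C I r K y" "is_direct_limit C I r K y O0 ?lY" by (rule QY; assumption)+
  note QZ = quotient_system[where w = e and q = z and l = ?lZ and Q = E and I = I and r = r and \<omega> = "zer M O0", OF dp rI e z(1) ze zM zMe zer_hom[OF KO(2) OO] zz uZ]
  have Z: "direct_system C I r E z" "is_direct_limit C I r E z O0 ?lZ" by (rule QZ; assumption)+
  have LXO: "LX \<in> Obj C" using w hom_obj by blast
  \<comment> \<open>Exactness makes the limit \<open>LX\<close> of the \<open>B i\<close> a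
    subobject of zero. By \<open>kill\<close> the arrow \<open>f\<close> factors through
    \<open>LX\<close>.\<close>
  have "short_exact C (zer LX O0) (zer O0 O0)"
  proof (rule exact_direct_limits[OF _ dp X(1) Y(1) Z(1) _ _ _ X(2) Y(2) Z(2), where f = u and g = d])
    show "small U I" using g(2) by (simp add: I_def)
    show "is_system_map C I r B x K y u" using u(1) uxy by (auto simp: is_system_map_def)
    show "is_system_map C I r K y E z d" using d(2) z(2) by (auto simp: is_system_map_def)
    show "\<forall>i\<in>I. short_exact C (u i) (d i)" using mono_kernel_cokernel u(3) d(1) by (auto simp: short_exact_def)
    show "zer LX O0 \<in> mor LX O0" "zer O0 O0 \<in> mor O0 O0" using zer_hom LXO OO by auto
    show "\<forall>i\<in>I. zer LX O0 \<cdot> lX i = zer (K i) O0 \<cdot> u i" using zer_comp'[OF lX(1) OO] zer_comp'[OF u(1) OO] by simp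
    show "\<forall>i\<in>I. zer O0 O0 \<cdot> zer (K i) O0 = zer (E i) O0 \<cdot> d i" using zer_comp'[OF zer_hom[OF KO(1) OO] OO] zer_comp'[OF d(2) OO] by simp
  qed
  then have "is_mono C (zer LX O0)" using kernel_mono by (auto simp: short_exact_def)
  then have LX: "is_zero C LX" using mono_zero[OF _ zer_hom[OF LXO OO]] by blast
  have "\<exists>h \<in> mor LX Z. h \<cdot> \<omega> = f"
  proof (rule w(4)[OF f])
    fix j assume "j \<in> a ` I"
    then obtain i where i: "i \<in> I" "j = a i" by blast
    have "\<exists>y \<in> mor (A i) (A i). a i \<cdot> y = a i" using Comp_Ide[OF a(1)[OF i(1)]] Ide_Hom hom_obj[OF a(1)[OF i(1)]] by blast
    then obtain z where z: "z \<in> mor (A i) (Dom C (\<rho> i))" "\<rho> i \<cdot> z = l \<cdot> a i" using a(3)[OF i(1) a(1)[OF i(1)]] by blast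
    then show "f \<cdot> j = zer (Dom C j) Z" using kill[OF \<rho>(1)[OF i(1)] a(1)[OF i(1)] z(1)] i(2) hom_DC(1)[OF a(1)[OF i(1)]] by simp
  qed
  then obtain h where h: "h \<in> mor LX Z" "h \<cdot> \<omega> = f" by blast
  then show ?thesis using zero_hom(1)[OF LX h(1)] zer_comp'[OF w(1)] hom_obj[OF f] by simp
qed

end

text \<open>The biproduct is an extension of one summand by the other. Its purpose is to make the
  images of objects of \<open>\<X>\<close> in \<open>M\<close> a directed family.\<close>

lemma (in serre) X_binary_sum:
  assumes m: "X \<in> \<X>" "m \<in> mor X M" and m': "Y \<in> \<X>" "m' \<in> mor Y M"
  obtains B i j t where "B \<in> \<X>" "i \<in> mor X B" "j \<in> mor Y B" "t \<in> mor B M" "t \<cdot> i = m" "t \<cdot> j = m'"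
proof -
  have XY: "X \<in> Obj C" "Y \<in> Obj C" using m m' X_obj by auto
  obtain B i j p q where B: "i \<in> mor X B" "j \<in> mor Y B" "p \<in> mor B X" "q \<in> mor B Y"
    "p \<cdot> i = Ide C X" "q \<cdot> j = Ide C Y" "p \<cdot> j = zer Y X" "q \<cdot> i = zer X Y"
    "\<And>T x y. x \<in> mor T X \<Longrightarrow> y \<in> mor T Y \<Longrightarrow> \<exists>t \<in> mor T B. p \<cdot> t = x \<and> q \<cdot> t = y"
    "\<And>T t. t \<in> mor T B \<Longrightarrow> p \<cdot> t = zer T X \<Longrightarrow> q \<cdot> t = zer T Y \<Longrightarrow> t = zer T B"
    "\<And>Z x y. x \<in> mor X Z \<Longrightarrow> y \<in> mor Y Z \<Longrightarrow> \<exists>t \<in> mor B Z. t \<cdot> i = x \<and> t \<cdot> j = y"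
    by (rule obtain_biproduct[OF XY]) (blast intro: that)
  have im: "is_mono C i" using mono_cancel[OF _ B(1,3)] B(5) ide_mono[OF XY(1)] by simp
  have "is_kernel C i q"
  proof (rule kernelI[OF B(1,4) im B(8)])
    fix W x assume x: "x \<in> mor W B" "q \<cdot> x = zer W Y"
    have px: "p \<cdot> x \<in> mor W X" using Comp_Hom[OF x(1) B(3)] .
    have ipx: "i \<cdot> (p \<cdot> x) \<in> mor W B" using Comp_Hom[OF px B(1)] .
    have "p \<cdot> (i \<cdot> (p \<cdot> x)) = p \<cdot> x" using Comp_assoc[OF px B(1,3)] B(5) Ide_Comp[OF px] by simp
    then have 1: "p \<cdot> dif (i \<cdot> (p \<cdot> x)) x = zer W X" using comp_dif[OF ipx x(1) B(3)] dif_eq[OF px px] by simp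
    have "q \<cdot> (i \<cdot> (p \<cdot> x)) = q \<cdot> x" using comp_eq_zer[OF B(1,4) px B(8)] x(2) by simp
    then have 2: "q \<cdot> dif (i \<cdot> (p \<cdot> x)) x = zer W Y" using comp_dif[OF ipx x(1) B(4)] dif_eq[OF Comp_Hom[OF x(1) B(4)] Comp_Hom[OF x(1) B(4)]] by simp
    have "i \<cdot> (p \<cdot> x) = x" using B(10)[OF dif_hom[OF ipx x(1)] 1 2] dif_eq[OF ipx x(1)] by simp
    then show "\<exists>h\<in>mor W X. i \<cdot> h = x" using px by blast
  qed
  then have BX: "B \<in> \<X>" using X_ext[OF _ B(1,4) m(1) m'(1)] by blast
  obtain t where "t \<in> mor B M" "t \<cdot> i = m" "t \<cdot> j = m'" using B(11)[OF m(2) m'(2)] by blast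
  then show ?thesis using that[OF BX B(1,2)] by blast
qed

section \<open>Directed unions and maximal subobjects\<close>

context grothendieck_category
begin

text \<open>The kernel \<open>V\<close> of the joint cokernel is generated by \<open>J\<close>. Let
  \<open>w\<close> be the kernel of \<open>g\<close>: all members of \<open>J\<close> lie in the
  subobject \<open>u w\<close>, so its cokernel factors through \<open>q\<close> and kills
  \<open>u\<close>; hence \<open>u\<close> factors through \<open>u w\<close>, and
  \<open>g = 0\<close>.\<close>

lemma joint_cokernel_kernel:
  assumes J: "\<And>j. j \<in> J \<Longrightarrow> j \<in> mor (Dom C j) M"
    and q: "q \<in> mor M Q" "\<And>j. j \<in> J \<Longrightarrow> q \<cdot> j = zer (Dom C j) Q"
      "\<And>Z g. g \<in> mor M Z \<Longrightarrow> (\<And>j. j \<in> J \<Longrightarrow> g \<cdot> j = zer (Dom C j) Z) \<Longrightarrow> \<exists>h \<in> mor Q Z. h \<cdot> q = g"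
    and u: "is_kernel C u q" "u \<in> mor V M"
    and g: "g \<in> mor V Z" "\<And>j y. j \<in> J \<Longrightarrow> y \<in> mor (Dom C j) V \<Longrightarrow> u \<cdot> y = j \<Longrightarrow> g \<cdot> y = zer (Dom C j) Z"
  shows "g = zer V Z"
proof -
  have um: "is_mono C u" and qu: "q \<cdot> u = zer V Q" using kernel_mono[OF u(1)] kernel_eq[OF u(1) q(1) u(2)] .
  obtain w W where w: "is_kernel C w g" "w \<in> mor W V" "is_mono C w" "g \<cdot> w = zer W Z" using obtain_kernel[OF g(1)] .
  have uw: "u \<cdot> w \<in> mor W M" "is_mono C (u \<cdot> w)" using Comp_Hom[OF w(2) u(2)] mono_comp[OF w(3) um w(2) u(2)] by auto
  obtain q' Q' where q': "is_cokernel C q' (u \<cdot> w)" "q' \<in> mor M Q'" "is_epi C q'" "q' \<cdot> (u \<cdot> w) = zer W Q'" using obtain_cokernel[OF uw(1)] .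
  have "\<exists>h \<in> mor Q Q'. h \<cdot> q = q'"
  proof (rule q(3)[OF q'(2)])
    fix j assume j: "j \<in> J"
    obtain y where y: "y \<in> mor (Dom C j) V" "u \<cdot> y = j" using kernelE[OF u(1) q(1) u(2) J[OF j] q(2)[OF j]] .
    obtain v where v: "v \<in> mor (Dom C j) W" "w \<cdot> v = y" using kernelE[OF w(1) g(1) w(2) y(1) g(2)[OF j y]] .
    have "j = u \<cdot> w \<cdot> v" using Comp_assoc[OF v(1) w(2) u(2)] v(2) y(2) by simp
    then show "q' \<cdot> j = zer (Dom C j) Q'" using comp_eq_zer[OF uw(1) q'(2) v(1) q'(4)] by simp
  qed
  then obtain h where h: "h \<in> mor Q Q'" "h \<cdot> q = q'" by blast
  have VO: "V \<in> Obj C" using u hom_obj by blast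
  have "q' \<cdot> u = zer V Q'" using Comp_assoc[OF u(2) q(1) h(1)] h(2) qu comp_zer'[OF h(1) VO] by simp
  then obtain r where r: "r \<in> mor V W" "u \<cdot> w \<cdot> r = u" using mono_factor[OF uw(2,1) q'(1,2) u(2)] by metis
  have "u \<cdot> (w \<cdot> r) = u \<cdot> Ide C V" using r Comp_assoc[OF r(1) w(2) u(2)] Comp_Ide[OF u(2)] by simp
  then have "w \<cdot> r = Ide C V" using monoD[OF um u(2) Comp_Hom[OF r(1) w(2)] Ide_Hom[OF VO]] by blast
  then show "g = zer V Z" using comp_eq_zer[OF w(2) g(1) r(1) w(4)] Comp_Ide[OF g(1)] by simp
qed

text \<open>The union is the kernel of the joint cokernel. The last clause is the form of (AB5) used
  later, a nonzero arrow into the union meets some member; it is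
  \<open>directed_cover_preimage\<close> with \<open>l\<close> and \<open>f\<close> both equal to
  \<open>t\<close>.\<close>

lemma obtain_union:
  assumes c: "\<C> \<noteq> {}" "\<And>c. c \<in> \<C> \<Longrightarrow> subobj C M c"
      "\<And>c c'. c \<in> \<C> \<Longrightarrow> c' \<in> \<C> \<Longrightarrow> \<exists>n\<in>\<C>. sub_le C c n \<and> sub_le C c' n"
  obtains V u where "u \<in> mor V M" "is_mono C u" "\<And>c. c \<in> \<C> \<Longrightarrow> \<exists>y \<in> mor (Dom C c) V. u \<cdot> y = c"
    "\<And>L t. t \<in> mor L V \<Longrightarrow> t \<noteq> zer L V \<Longrightarrow>
       \<exists>c\<in>\<C>. \<exists>T. \<exists>x \<in> mor T L. \<exists>y \<in> mor T (Dom C c). u \<cdot> (t \<cdot> x) = c \<cdot> y \<and> t \<cdot> x \<noteq> zer T V"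
proof -
  note cm = subobj_mor[OF c(2)] and co = subobj_mono[OF c(2)]
  have M: "M \<in> Obj C" using c(1) cm hom_obj by blast
  obtain q Q where q: "q \<in> mor M Q" "is_epi C q" "\<And>j. j \<in> \<C> \<Longrightarrow> q \<cdot> j = zer (Dom C j) Q"
    "\<And>Z g. g \<in> mor M Z \<Longrightarrow> (\<And>j. j \<in> \<C> \<Longrightarrow> g \<cdot> j = zer (Dom C j) Z) \<Longrightarrow> \<exists>h \<in> mor Q Z. h \<cdot> q = g"
    by (rule joint_cokernel[OF M cm]) (assumption, blast intro: that)
  obtain u V where u: "is_kernel C u q" "u \<in> mor V M" "is_mono C u" "q \<cdot> u = zer V Q" using obtain_kernel[OF q(1)] .
  have "\<exists>y \<in> mor (Dom C j) V. u \<cdot> y = j" if j: "j \<in> \<C>" for j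
    using kernelE[OF u(1) q(1) u(2) cm[OF j] q(3)[OF j]] by blast
  then obtain Y where Y: "\<And>j. j \<in> \<C> \<Longrightarrow> Y j \<in> mor (Dom C j) V" "\<And>j. j \<in> \<C> \<Longrightarrow> u \<cdot> Y j = j" by metis
  have DY: "Dom C (Y j) = Dom C j" if "j \<in> \<C>" for j using Y(1)[OF that] hom_DC by blast
  have Yo: "subobj C V (Y j)" if j: "j \<in> \<C>" for j
    using subobjI[OF mono_cancel[OF _ Y(1)[OF j] u(2)] Y(1)[OF j]] Y(2)[OF j] co[OF j] by simp
  have Yle: "sub_le C (Y i) (Y j)" if i: "i \<in> \<C>" and j: "j \<in> \<C>" and le: "sub_le C i j" for i j
  proof -
    obtain h where h: "h \<in> mor (Dom C i) (Dom C j)" "j \<cdot> h = i" using le sub_le_iff[OF cm[OF i] cm[OF j]] by blast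
    have "u \<cdot> (Y j \<cdot> h) = u \<cdot> Y i" using comp_ext1[OF Y(2)[OF j] Y(1)[OF j] u(2) h(1)] h(2) Y(2)[OF i] by simp
    then have "Y j \<cdot> h = Y i" using monoD[OF u(3,2) Comp_Hom[OF h(1) Y(1)[OF j]] Y(1)[OF i]] by blast
    then show ?thesis using sub_le_iff[OF Y(1)[OF i] Y(1)[OF j]] h(1) by blast
  qed
  have cover: "g = zer V Z" if g: "g \<in> mor V Z" "\<And>m. m \<in> Y ` \<C> \<Longrightarrow> g \<cdot> m = zer (Dom C m) Z" for Z g
  proof (rule joint_cokernel_kernel[OF cm q(1,3,4) u(1,2) g(1)])
    fix j y assume j: "j \<in> \<C>" and y: "y \<in> mor (Dom C j) V" "u \<cdot> y = j"
    then have "y = Y j" using monoD[OF u(3,2) y(1) Y(1)[OF j]] Y(2)[OF j] by simp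
    then show "g \<cdot> y = zer (Dom C j) Z" using g(2)[of "Y j"] j DY[OF j] by simp
  qed
  have "\<exists>c\<in>\<C>. \<exists>T. \<exists>x \<in> mor T L. \<exists>y \<in> mor T (Dom C c). u \<cdot> (t \<cdot> x) = c \<cdot> y \<and> t \<cdot> x \<noteq> zer T V"
    if t: "t \<in> mor L V" "t \<noteq> zer L V" for L t
  proof (rule ccontr)
    assume n: "\<not> ?thesis"
    have "t = zer L V"
    proof (rule directed_cover_preimage[where \<D> = "Y ` \<C>", OF _ _ _ cover t(1) t(1)])
      show "Y ` \<C> \<noteq> {}" using c(1) by simp
      show "subobj C V m" if "m \<in> Y ` \<C>" for m using Yo that by blast
      show "\<exists>n\<in>Y ` \<C>. sub_le C m n \<and> sub_le C m' n" if mm: "m \<in> Y ` \<C>" "m' \<in> Y ` \<C>" for m m'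
      proof -
        obtain i j where ij: "i \<in> \<C>" "j \<in> \<C>" "m = Y i" "m' = Y j" using mm by blast
        obtain k where "k \<in> \<C>" "sub_le C i k" "sub_le C j k" using c(3)[OF ij(1,2)] by blast
        then show ?thesis using Yle ij by blast
      qed
      fix m T x y assume m: "m \<in> Y ` \<C>" and x: "x \<in> mor T L" and y: "y \<in> mor T (Dom C m)" and e: "t \<cdot> x = m \<cdot> y"
      obtain j where j: "j \<in> \<C>" "m = Y j" using m by blast
      have y': "y \<in> mor T (Dom C j)" using y DY j by simp
      have "u \<cdot> (t \<cdot> x) = j \<cdot> y" using e j(2) comp_ext1[OF Y(2)[OF j(1)] Y(1)[OF j(1)] u(2) y'] by simp
      then show "t \<cdot> x = zer T V" using n j(1) x y' by blast
    qed
    then show False using t by blast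
  qed
  then show ?thesis using that[OF u(2,3)] Y by blast
qed

text \<open>Monomorphisms into \<open>M\<close> are only preordered, so Zorn's lemma is applied to
  the sets \<open>\<sigma> s\<close> of all arrows factoring through \<open>s\<close>. Test objects
  are arbitrary here, so \<open>s\<close> itself belongs to \<open>\<sigma> s\<close> and inclusion
  of these sets is \<open>sub_le\<close>.\<close>

lemma subobj_Zorn:
  assumes P: "\<And>s. P s \<Longrightarrow> subobj C M s" and P0: "P s0"
    and ch: "\<And>\<C>. \<C> \<noteq> {} \<Longrightarrow> (\<And>c. c \<in> \<C> \<Longrightarrow> P c) \<Longrightarrow>
      (\<And>c c'. c \<in> \<C> \<Longrightarrow> c' \<in> \<C> \<Longrightarrow> \<exists>n\<in>\<C>. sub_le C c n \<and> sub_le C c' n) \<Longrightarrow> \<exists>u. P u \<and> (\<forall>c\<in>\<C>. sub_le C c u)"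
  obtains m where "P m" "\<And>t. P t \<Longrightarrow> sub_le C m t \<Longrightarrow> sub_le C t m"
proof -
  note sm = subobj_mor[OF P]
  define \<sigma> where "\<sigma> s = {h. \<exists>T. \<exists>y \<in> mor T (Dom C s). s \<cdot> y = h}" for s
  have \<sigma>: "sub_le C s t \<longleftrightarrow> \<sigma> s \<subseteq> \<sigma> t" if s: "P s" and t: "P t" for s t
  proof
    assume "sub_le C s t"
    then obtain h where h: "h \<in> mor (Dom C s) (Dom C t)" "t \<cdot> h = s" using sub_le_iff[OF sm[OF s] sm[OF t]] by blast
    show "\<sigma> s \<subseteq> \<sigma> t"
    proof
      fix x assume "x \<in> \<sigma> s"
      then obtain T y where y: "y \<in> mor T (Dom C s)" "s \<cdot> y = x" by (auto simp: \<sigma>_def)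
      then show "x \<in> \<sigma> t" using comp_ext1[OF h(2,1) sm[OF t] y(1)] Comp_Hom[OF y(1) h(1)] unfolding \<sigma>_def by auto
    qed
  next
    assume st: "\<sigma> s \<subseteq> \<sigma> t"
    have "s \<in> \<sigma> s" using Comp_Ide[OF sm[OF s]] Ide_Hom hom_obj[OF sm[OF s]] by (auto simp: \<sigma>_def)
    then obtain T y where y: "y \<in> mor T (Dom C t)" "t \<cdot> y = s" using subsetD[OF st] unfolding \<sigma>_def by blast
    then have "T = Dom C s" using hom_DC(1)[OF Comp_Hom[OF y(1) sm[OF t]]] by simp
    then show "sub_le C s t" using sub_le_iff[OF sm[OF s] sm[OF t]] y by blast
  qed
  let ?A = "\<sigma> ` {s. P s}"
  have "\<exists>m\<in>?A. \<forall>X\<in>?A. m \<subseteq> X \<longrightarrow> X = m"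
  proof (rule subset_Zorn)
    fix K assume K: "subset.chain ?A K"
    show "\<exists>U\<in>?A. \<forall>X\<in>K. X \<subseteq> U"
    proof (cases "K = {}")
      case True
      then show ?thesis using P0 by blast
    next
      case False
      define \<C> where "\<C> = {s. P s \<and> \<sigma> s \<in> K}"
      have KA: "K \<subseteq> ?A" and tot: "\<And>X Y. X \<in> K \<Longrightarrow> Y \<in> K \<Longrightarrow> X \<subseteq> Y \<or> Y \<subseteq> X"
        using K by (auto simp: subset_chain_def)
      have "\<exists>u. P u \<and> (\<forall>c\<in>\<C>. sub_le C c u)"
      proof (rule ch)
        show "\<C> \<noteq> {}" using False KA by (auto simp: \<C>_def)
        show "P c" if "c \<in> \<C>" for c using that by (simp add: \<C>_def)
        fix c c' assume cc: "c \<in> \<C>" "c' \<in> \<C>"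
        then have "\<sigma> c \<subseteq> \<sigma> c' \<or> \<sigma> c' \<subseteq> \<sigma> c" "P c" "P c'" using tot by (auto simp: \<C>_def)
        then show "\<exists>n\<in>\<C>. sub_le C c n \<and> sub_le C c' n" using cc \<sigma> by blast
      qed
      then obtain u where u: "P u" "\<And>c. c \<in> \<C> \<Longrightarrow> sub_le C c u" by blast
      have "X \<subseteq> \<sigma> u" if X: "X \<in> K" for X
      proof -
        obtain s where s: "P s" "X = \<sigma> s" using X KA by blast
        then have "s \<in> \<C>" using X by (simp add: \<C>_def)
        then show ?thesis using u \<sigma> s by blast
      qed
      then show ?thesis using u(1) by blast
    qed
  qed
  then obtain m where m: "P m" "\<And>t. P t \<Longrightarrow> \<sigma> m \<subseteq> \<sigma> t \<Longrightarrow> \<sigma> t = \<sigma> m" by blast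
  have "sub_le C t m" if t: "P t" "sub_le C m t" for t
  proof -
    have "\<sigma> m \<subseteq> \<sigma> t" using \<sigma>[OF m(1) t(1)] t(2) by simp
    then have "\<sigma> t = \<sigma> m" by (rule m(2)[OF t(1)])
    then show ?thesis using \<sigma>[OF t(1) m(1)] by simp
  qed
  then show ?thesis using that[OF m(1)] by blast
qed

section \<open>Injective envelopes\<close>

lemma ess_comp:
  assumes e: "ess e" "e \<in> mor X Y" and f: "ess f" "f \<in> mor Y Z" shows "ess (f \<cdot> e)"
proof (rule essI[OF mono_comp[OF ess_mono[OF e(1)] ess_mono[OF f(1)] e(2) f(2)] Comp_Hom[OF e(2) f(2)]])
  fix T x assume x: "x \<in> mor T Z" "x \<noteq> zer T Z"
  obtain W w z where w: "w \<in> mor W T" "z \<in> mor W Y" "x \<cdot> w = f \<cdot> z" "x \<cdot> w \<noteq> zer W Z" using essE[OF f x] .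
  have "z \<noteq> zer W Y" using w(3,4) comp_zer'[OF f(2)] hom_obj[OF w(1)] by auto
  then obtain V v y where v: "v \<in> mor V W" "y \<in> mor V X" "z \<cdot> v = e \<cdot> y" "z \<cdot> v \<noteq> zer V Y" using essE[OF e w(2)] by metis
  have 1: "x \<cdot> (w \<cdot> v) = f \<cdot> (z \<cdot> v)" using comp_ext[OF w(3,1) x(1) w(2) f(2) v(1)] .
  have "f \<cdot> (z \<cdot> v) \<noteq> zer V Z" using mono_zerD[OF ess_mono[OF f(1)] f(2) Comp_Hom[OF v(1) w(2)]] v(4) by blast
  moreover have "f \<cdot> (z \<cdot> v) = f \<cdot> e \<cdot> y" using v(3) Comp_assoc[OF v(2) e(2) f(2)] by simp
  ultimately show "\<exists>W. \<exists>w\<in>mor W T. \<exists>z\<in>mor W X. x \<cdot> w = f \<cdot> e \<cdot> z \<and> x \<cdot> w \<noteq> zer W Z"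
    using 1 v(2) Comp_Hom[OF v(1) w(1)] by metis
qed

text \<open>Zorn's lemma applies because a directed union of essential extensions of
  \<open>X\<close> is essential: a nonzero arrow into the union has a nonzero restriction that lands
  in some member, and \<open>X\<close> is essential there.\<close>

lemma maximal_essential_extension:
  assumes j: "is_mono C j" "j \<in> mor X I"
  obtains s E e where "s \<in> mor E I" "is_mono C s" "e \<in> mor X E" "s \<cdot> e = j" "ess e"
    "\<And>t F f. t \<in> mor F I \<Longrightarrow> is_mono C t \<Longrightarrow> f \<in> mor X F \<Longrightarrow> t \<cdot> f = j \<Longrightarrow> ess f \<Longrightarrow> sub_le C s t \<Longrightarrow> sub_le C t s"
proof -
  let ?P = "\<lambda>s. subobj C I s \<and> (\<exists>e \<in> mor X (Dom C s). s \<cdot> e = j \<and> ess e)"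
  have XO: "X \<in> Obj C" using j hom_obj by blast
  have "ess (Ide C X)"
  proof (rule essI[OF ide_mono[OF XO] Ide_Hom[OF XO]])
    fix T x assume x: "x \<in> mor T X" "x \<noteq> zer T X"
    have T: "Ide C T \<in> mor T T" using Ide_Hom hom_obj[OF x(1)] by blast
    show "\<exists>W. \<exists>w\<in>mor W T. \<exists>z\<in>mor W X. x \<cdot> w = Ide C X \<cdot> z \<and> x \<cdot> w \<noteq> zer W X"
      using T x Comp_Ide[OF x(1)] Ide_Comp[OF x(1)] by metis
  qed
  moreover have "j \<cdot> Ide C X = j" "Dom C j = X" using Comp_Ide[OF j(2)] hom_DC[OF j(2)] by auto
  ultimately have P0: "?P j" using subobjI[OF j] Ide_Hom[OF XO] by metis
  have ch: "\<exists>u. ?P u \<and> (\<forall>c\<in>\<C>. sub_le C c u)"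
    if c: "\<C> \<noteq> {}" "\<And>c. c \<in> \<C> \<Longrightarrow> ?P c" "\<And>c c'. c \<in> \<C> \<Longrightarrow> c' \<in> \<C> \<Longrightarrow> \<exists>n\<in>\<C>. sub_le C c n \<and> sub_le C c' n" for \<C>
  proof -
    have cs: "subobj C I c" if "c \<in> \<C>" for c using c(2) that by blast
    obtain V u where u: "u \<in> mor V I" "is_mono C u" "\<And>c. c \<in> \<C> \<Longrightarrow> \<exists>y \<in> mor (Dom C c) V. u \<cdot> y = c"
    "\<And>L t. t \<in> mor L V \<Longrightarrow> t \<noteq> zer L V \<Longrightarrow>
       \<exists>c\<in>\<C>. \<exists>T. \<exists>x \<in> mor T L. \<exists>y \<in> mor T (Dom C c). u \<cdot> (t \<cdot> x) = c \<cdot> y \<and> t \<cdot> x \<noteq> zer T V"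
      by (rule obtain_union[OF c(1) cs c(3)]) (assumption, assumption, assumption, blast intro: that)
    obtain c0 e0 where c0: "c0 \<in> \<C>" "e0 \<in> mor X (Dom C c0)" "c0 \<cdot> e0 = j" using c(1,2) by blast
    obtain y0 where y0: "y0 \<in> mor (Dom C c0) V" "u \<cdot> y0 = c0" using u(3)[OF c0(1)] by blast
    define e where "e = y0 \<cdot> e0"
    have e: "e \<in> mor X V" "u \<cdot> e = j" using Comp_Hom[OF c0(2) y0(1)] comp_ext1[OF y0(2,1) u(1) c0(2)] c0(3) by (simp_all add: e_def)
    have em: "is_mono C e" using mono_cancel[OF _ e(1) u(1)] e(2) j(1) by simp
    have "ess e"
    proof (rule essI[OF em e(1)])
      fix T t assume t: "t \<in> mor T V" "t \<noteq> zer T V"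
      obtain c' S x y where x: "c' \<in> \<C>" "x \<in> mor S T" "y \<in> mor S (Dom C c')" "u \<cdot> (t \<cdot> x) = c' \<cdot> y" "t \<cdot> x \<noteq> zer S V"
        using u(4)[OF t] by blast
      note c'm = subobj_mor[OF cs[OF x(1)]] and c'o = subobj_mono[OF cs[OF x(1)]]
      obtain e' where e': "e' \<in> mor X (Dom C c')" "c' \<cdot> e' = j" "ess e'" using c(2)[OF x(1)] by blast
      have SO: "S \<in> Obj C" using x hom_obj by blast
      have "y \<noteq> zer S (Dom C c')"
        using x(4,5) comp_zer'[OF c'm SO] mono_zerD[OF u(2,1) Comp_Hom[OF x(2) t(1)]] by auto
      then obtain W w z where w: "w \<in> mor W S" "z \<in> mor W X" "y \<cdot> w = e' \<cdot> z" "y \<cdot> w \<noteq> zer W (Dom C c')"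
        using essE[OF e'(3,1) x(3)] by metis
      have tx: "t \<cdot> x \<in> mor S V" using Comp_Hom[OF x(2) t(1)] .
      have a: "u \<cdot> (t \<cdot> x \<cdot> w) = c' \<cdot> (y \<cdot> w)" using comp_ext[OF x(4) tx u(1) x(3) c'm w(1)] .
      also have "\<dots> = u \<cdot> (e \<cdot> z)" using w(3) comp_ext1[OF e'(2,1) c'm w(2)] comp_ext1[OF e(2,1) u(1) w(2)] by simp
      finally have 1: "t \<cdot> x \<cdot> w = e \<cdot> z" using monoD[OF u(2,1) Comp_Hom[OF w(1) tx] Comp_Hom[OF w(2) e(1)]] by blast
      have 2: "t \<cdot> x \<cdot> w \<noteq> zer W V"
        using a comp_zer'[OF u(1)] hom_obj[OF w(1)] mono_zerD[OF c'o c'm Comp_Hom[OF w(1) x(3)]] w(4) by auto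
      show "\<exists>W. \<exists>w\<in>mor W T. \<exists>z\<in>mor W X. t \<cdot> w = e \<cdot> z \<and> t \<cdot> w \<noteq> zer W V"
        using 1 2 Comp_assoc[OF w(1) x(2) t(1)] Comp_Hom[OF w(1) x(2)] w(2) by metis
    qed
    then have "?P u" using subobjI[OF u(2,1)] e hom_DC[OF u(1)] by auto
    moreover have "sub_le C c u" if "c \<in> \<C>" for c
      using u(3)[OF that] sub_le_iff[OF subobj_mor[OF cs[OF that]] u(1)] by blast
    ultimately show ?thesis by blast
  qed
  obtain s where s: "?P s" "\<And>t. ?P t \<Longrightarrow> sub_le C s t \<Longrightarrow> sub_le C t s"
    by (rule subobj_Zorn[of ?P, OF _ P0 ch]) (blast, blast, blast, blast, blast intro: that)
  then obtain e where e: "e \<in> mor X (Dom C s)" "s \<cdot> e = j" "ess e" by blast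
  have "sub_le C t s" if "t \<in> mor F I" "is_mono C t" "f \<in> mor X F" "t \<cdot> f = j" "ess f" "sub_le C s t" for t F f
    using s(2)[of t] that subobjI[OF that(2,1)] hom_DC[OF that(1)] by blast
  then show ?thesis using that[of s "Dom C s" e] s(1) subobj_mor subobj_mono e by blast
qed

text \<open>Being disjoint from \<open>E\<close> passes to directed unions, again because a nonzero
  arrow into the union meets a member.\<close>

lemma maximal_complement:
  assumes s: "is_mono C s" "s \<in> mor E I"
  obtains k K where "k \<in> mor K I" "is_mono C k"
    "\<And>T x y. x \<in> mor T K \<Longrightarrow> y \<in> mor T E \<Longrightarrow> k \<cdot> x = s \<cdot> y \<Longrightarrow> k \<cdot> x = zer T I"
    "\<And>l L. l \<in> mor L I \<Longrightarrow> is_mono C l \<Longrightarrow> (\<And>T x y. x \<in> mor T L \<Longrightarrow> y \<in> mor T E \<Longrightarrow> l \<cdot> x = s \<cdot> y \<Longrightarrow> l \<cdot> x = zer T I) \<Longrightarrow>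
       sub_le C k l \<Longrightarrow> sub_le C l k"
proof -
  let ?P = "\<lambda>k. subobj C I k \<and> (\<forall>T. \<forall>x \<in> mor T (Dom C k). \<forall>y \<in> mor T E. k \<cdot> x = s \<cdot> y \<longrightarrow> k \<cdot> x = zer T I)"
  have IO: "I \<in> Obj C" using s hom_obj by blast
  obtain Z where Z: "is_zero C Z" using zero_object by blast
  note z = zero_mono(1)[OF Z IO]
  have "is_mono C (zer Z I)" using zero_mono(2)[OF Z IO] .
  moreover have "zer Z I \<cdot> x = zer T I" if "x \<in> mor T Z" for T x using zer_comp'[OF that IO] .
  ultimately have P0: "?P (zer Z I)" using subobjI[OF _ z] hom_DC[OF z] by simp
  have ch: "\<exists>u. ?P u \<and> (\<forall>c\<in>\<C>. sub_le C c u)"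
    if c: "\<C> \<noteq> {}" "\<And>c. c \<in> \<C> \<Longrightarrow> ?P c" "\<And>c c'. c \<in> \<C> \<Longrightarrow> c' \<in> \<C> \<Longrightarrow> \<exists>n\<in>\<C>. sub_le C c n \<and> sub_le C c' n" for \<C>
  proof -
    have cs: "subobj C I c" if "c \<in> \<C>" for c using c(2) that by blast
    obtain V u where u: "u \<in> mor V I" "is_mono C u" "\<And>c. c \<in> \<C> \<Longrightarrow> \<exists>y \<in> mor (Dom C c) V. u \<cdot> y = c"
    "\<And>L t. t \<in> mor L V \<Longrightarrow> t \<noteq> zer L V \<Longrightarrow>
       \<exists>c\<in>\<C>. \<exists>T. \<exists>x \<in> mor T L. \<exists>y \<in> mor T (Dom C c). u \<cdot> (t \<cdot> x) = c \<cdot> y \<and> t \<cdot> x \<noteq> zer T V"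
      by (rule obtain_union[OF c(1) cs c(3)]) (assumption, assumption, assumption, blast intro: that)
    have "u \<cdot> x = zer T I" if x: "x \<in> mor T V" "y \<in> mor T E" "u \<cdot> x = s \<cdot> y" for T x y
    proof (rule ccontr)
      assume "u \<cdot> x \<noteq> zer T I"
      then have "x \<noteq> zer T V" using comp_zer'[OF u(1)] hom_obj[OF x(1)] by auto
      then obtain c' S r v where r: "c' \<in> \<C>" "r \<in> mor S T" "v \<in> mor S (Dom C c')" "u \<cdot> (x \<cdot> r) = c' \<cdot> v" "x \<cdot> r \<noteq> zer S V"
        using u(4)[OF x(1)] by blast
      have "c' \<cdot> v = s \<cdot> (y \<cdot> r)" using r(4) comp_ext[OF x(3,1) u(1) x(2) s(2) r(2)] by simp
      then have "c' \<cdot> v = zer S I" using c(2)[OF r(1)] r(3) Comp_Hom[OF r(2) x(2)] by blast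
      then have "x \<cdot> r = zer S V" using r(4) mono_zerD[OF u(2,1) Comp_Hom[OF r(2) x(1)]] by simp
      then show False using r(5) by blast
    qed
    then have "?P u" using subobjI[OF u(2,1)] hom_DC[OF u(1)] by simp
    moreover have "sub_le C c u" if "c \<in> \<C>" for c
      using u(3)[OF that] sub_le_iff[OF subobj_mor[OF cs[OF that]] u(1)] by blast
    ultimately show ?thesis by blast
  qed
  obtain k where k: "?P k" "\<And>t. ?P t \<Longrightarrow> sub_le C k t \<Longrightarrow> sub_le C t k"
    by (rule subobj_Zorn[of ?P, OF _ P0 ch]) (blast, blast, blast, blast, blast intro: that)
  have "sub_le C l k" if "l \<in> mor L I" "is_mono C l" "\<And>T x y. x \<in> mor T L \<Longrightarrow> y \<in> mor T E \<Longrightarrow> l \<cdot> x = s \<cdot> y \<Longrightarrow> l \<cdot> x = zer T I" "sub_le C k l" for l L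
    using k(2)[of l] that subobjI[OF that(2,1)] hom_DC[OF that(1)] by blast
  then show ?thesis using that[of k "Dom C k"] k(1) subobj_mor subobj_mono by blast
qed

text \<open>Inside the given \<open>I\<close> choose a maximal essential extension \<open>E\<close>
  of \<open>X\<close> and a maximal \<open>K\<close> disjoint from \<open>E\<close>. By maximality
  of \<open>K\<close>, \<open>E\<close> is essential in \<open>I / K\<close>. Injectivity of
  \<open>I\<close> extends \<open>E -> I\<close> to \<open>I / K\<close>, and the image is an
  essential extension of \<open>X\<close> containing \<open>E\<close>, hence equal to it. This makes
  \<open>E\<close> a retract of \<open>I\<close>.\<close>

lemma injective_envelope_exists:
  assumes j: "is_mono C j" "j \<in> mor X I" and I: "injective_obj C I"
  obtains e E where "e \<in> mor X E" "ess e" "is_injective_envelope C e"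
proof -
  obtain s E e where s: "s \<in> mor E I" "is_mono C s" "e \<in> mor X E" "s \<cdot> e = j" "ess e"
    "\<And>t F f. t \<in> mor F I \<Longrightarrow> is_mono C t \<Longrightarrow> f \<in> mor X F \<Longrightarrow> t \<cdot> f = j \<Longrightarrow> ess f \<Longrightarrow> sub_le C s t \<Longrightarrow> sub_le C t s"
    by (rule maximal_essential_extension[OF j]) (blast intro: that)
  obtain k K where k: "k \<in> mor K I" "is_mono C k"
    "\<And>T x y. x \<in> mor T K \<Longrightarrow> y \<in> mor T E \<Longrightarrow> k \<cdot> x = s \<cdot> y \<Longrightarrow> k \<cdot> x = zer T I"
    "\<And>l L. l \<in> mor L I \<Longrightarrow> is_mono C l \<Longrightarrow> (\<And>T x y. x \<in> mor T L \<Longrightarrow> y \<in> mor T E \<Longrightarrow> l \<cdot> x = s \<cdot> y \<Longrightarrow> l \<cdot> x = zer T I) \<Longrightarrow>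
       sub_le C k l \<Longrightarrow> sub_le C l k"
    by (rule maximal_complement[OF s(2,1)]) (blast intro: that)
  obtain p Q where p: "is_cokernel C p k" "p \<in> mor I Q" "is_epi C p" "p \<cdot> k = zer K Q" using obtain_cokernel[OF k(1)] .
  define a where "a = p \<cdot> s"
  have a: "a \<in> mor E Q" using Comp_Hom[OF s(1) p(2)] by (simp add: a_def)
  have am: "is_mono C a"
  proof (rule mono_zerI[OF a])
    fix W y assume y: "y \<in> mor W E" "a \<cdot> y = zer W Q"
    have "p \<cdot> (s \<cdot> y) = zer W Q" using y Comp_assoc[OF y(1) s(1) p(2)] by (simp add: a_def)
    then obtain x where x: "x \<in> mor W K" "k \<cdot> x = s \<cdot> y" using mono_factor[OF k(2,1) p(1,2) Comp_Hom[OF y(1) s(1)]] by metis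
    then have "s \<cdot> y = zer W I" using k(3)[OF x(1) y(1)] by simp
    then show "y = zer W E" using mono_zerD[OF s(2,1) y(1)] by blast
  qed
  have aess: "ess a"
  proof (rule essI[OF am a])
    fix T t assume t: "t \<in> mor T Q" "t \<noteq> zer T Q"
    obtain J \<epsilon> m where em: "\<epsilon> \<in> mor T J" "m \<in> mor J Q" "is_epi C \<epsilon>" "is_mono C m" "m \<cdot> \<epsilon> = t" using image_factorization[OF t(1)] .
    obtain L l where l: "l \<in> mor L I" "is_mono C l"
      "\<And>T x. x \<in> mor T I \<Longrightarrow> (\<exists>y \<in> mor T L. l \<cdot> y = x) \<longleftrightarrow> (\<exists>z \<in> mor T J. m \<cdot> z = p \<cdot> x)"
      by (rule obtain_preimage[OF em(4,2) p(2)]) (blast intro: that)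
    have "\<exists>z \<in> mor K J. m \<cdot> z = p \<cdot> k" using p(4) comp_zer'[OF em(2)] zer_hom hom_obj[OF em(2)] hom_obj[OF k(1)] by metis
    then have kl: "sub_le C k l" using l(3)[OF k(1)] sub_le_iff[OF k(1) l(1)] by blast
    have "\<not> sub_le C l k"
    proof
      assume "sub_le C l k"
      then obtain h where h: "h \<in> mor L K" "k \<cdot> h = l" using sub_le_iff[OF l(1) k(1)] by blast
      obtain S r x where S: "r \<in> mor S J" "is_epi C r" "x \<in> mor S I" "p \<cdot> x = m \<cdot> r" using epi_lift[OF p(2,3) em(2)] .
      then obtain y where y: "y \<in> mor S L" "l \<cdot> y = x" using l(3)[OF S(3)] by metis
      have "x = k \<cdot> (h \<cdot> y)" using comp_ext1[OF h(2,1) k(1) y(1)] y(2) by simp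
      then have "m \<cdot> r = zer S Q" using comp_eq_zer[OF k(1) p(2) Comp_Hom[OF y(1) h(1)] p(4)] S(4) by simp
      then have "m = zer J Q" using epi_zerD[OF S(2,1) em(2)] by blast
      then show False using t(2) em(5) zer_comp'[OF em(1)] hom_obj[OF em(2)] by simp
    qed
    then obtain S x y where x: "x \<in> mor S L" "y \<in> mor S E" "l \<cdot> x = s \<cdot> y" "l \<cdot> x \<noteq> zer S I" using k(4)[OF l(1,2)] kl by metis
    have SO: "S \<in> Obj C" using x hom_obj by blast
    obtain z where z: "z \<in> mor S J" "m \<cdot> z = p \<cdot> (l \<cdot> x)" using l(3)[OF Comp_Hom[OF x(1) l(1)]] x(1) by blast
    have mz: "m \<cdot> z = a \<cdot> y" using z(2) x(3) Comp_assoc[OF x(2) s(1) p(2)] by (simp add: a_def)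
    have "y \<noteq> zer S E" using x(3,4) comp_zer'[OF s(1) SO] by auto
    then have ay: "a \<cdot> y \<noteq> zer S Q" using mono_zerD[OF am a x(2)] by blast
    obtain R r w where R: "r \<in> mor R S" "is_epi C r" "w \<in> mor R T" "\<epsilon> \<cdot> w = z \<cdot> r" using epi_lift[OF em(1,3) z(1)] .
    have "t \<cdot> w = m \<cdot> (\<epsilon> \<cdot> w)" using em(5) Comp_assoc[OF R(3) em(1,2)] by simp
    also have "\<dots> = a \<cdot> (y \<cdot> r)" using R(4) comp_ext[OF mz z(1) em(2) x(2) a R(1)] by simp
    finally have tw: "t \<cdot> w = a \<cdot> (y \<cdot> r)" .
    have "a \<cdot> (y \<cdot> r) \<noteq> zer R Q" using epi_zerD[OF R(2,1) Comp_Hom[OF x(2) a]] ay Comp_assoc[OF R(1) x(2) a] by auto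
    then show "\<exists>W. \<exists>w\<in>mor W T. \<exists>z\<in>mor W E. t \<cdot> w = a \<cdot> z \<and> t \<cdot> w \<noteq> zer W Q"
      using tw R(3) Comp_Hom[OF R(1) x(2)] by metis
  qed
  \<comment> \<open>The extension \<open>\<phi>\<close> of \<open>s\<close> is monic since
    \<open>a\<close> is essential, so \<open>I / K\<close> becomes a subobject of \<open>I\<close>
    to which the maximality of \<open>s\<close> applies.\<close>
  have "\<exists>g\<in>mor (Cod C a) I. g \<cdot> a = s" using I am s(1) hom_DC[OF a] unfolding injective_obj_def by blast
  then obtain \<phi> where \<phi>: "\<phi> \<in> mor Q I" "\<phi> \<cdot> a = s" using hom_DC[OF a] by auto
  have \<phi>m: "is_mono C \<phi>" using ess_mono_cancel[OF aess a \<phi>(1)] \<phi>(2) s(2) by simp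
  have "\<phi> \<cdot> (a \<cdot> e) = j" using comp_ext1[OF \<phi>(2) a \<phi>(1) s(3)] s(4) by simp
  moreover have "sub_le C s \<phi>" using sub_le_iff[OF s(1) \<phi>(1)] a \<phi>(2) by blast
  ultimately have "sub_le C \<phi> s" using s(6)[OF \<phi>(1) \<phi>m Comp_Hom[OF s(3) a] _ ess_comp[OF s(5,3) aess a]] by blast
  then obtain \<psi> where \<psi>: "\<psi> \<in> mor Q E" "s \<cdot> \<psi> = \<phi>" using sub_le_iff[OF \<phi>(1) s(1)] by blast
  have EO: "E \<in> Obj C" using s hom_obj by blast
  have "s \<cdot> (\<psi> \<cdot> a) = s \<cdot> Ide C E" using comp_ext1[OF \<psi>(2,1) s(1) a] \<phi>(2) Comp_Ide[OF s(1)] by simp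
  then have pa: "\<psi> \<cdot> a = Ide C E" using monoD[OF s(2,1) Comp_Hom[OF a \<psi>(1)] Ide_Hom[OF EO]] by blast
  \<comment> \<open>The projection of \<open>I\<close> onto \<open>I / K\<close> followed by
    \<open>\<psi>\<close> is a retraction onto \<open>E\<close>; a retract of an injective object is
    injective.\<close>
  define r where "r = \<psi> \<cdot> p"
  have r: "r \<in> mor I E" using Comp_Hom[OF p(2) \<psi>(1)] by (simp add: r_def)
  have rs: "r \<cdot> s = Ide C E" using Comp_assoc[OF s(1) p(2) \<psi>(1)] pa by (simp add: r_def a_def)
  have "injective_obj C E" unfolding injective_obj_def
  proof (intro conjI allI impI ballI)
    show "E \<in> Obj C" by (rule EO)
    fix i f assume i: "is_mono C i" and f: "f \<in> mor (Dom C i) E"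
    have ih: "i \<in> mor (Dom C i) (Cod C i)" using homI mono_arr[OF i] by blast
    obtain g where g: "g \<in> mor (Cod C i) I" "g \<cdot> i = s \<cdot> f" using I i Comp_Hom[OF f s(1)] unfolding injective_obj_def by blast
    have "r \<cdot> g \<cdot> i = r \<cdot> (s \<cdot> f)" using Comp_assoc[OF ih g(1) r] g(2) by simp
    also have "\<dots> = f" using Comp_assoc[OF f s(1) r] rs Ide_Comp[OF f] by simp
    finally show "\<exists>g\<in>mor (Cod C i) E. g \<cdot> i = f" using Comp_Hom[OF g(1) r] by blast
  qed
  then have "is_injective_envelope C e" unfolding is_injective_envelope_def using ess_essential_mono[OF s(5)] hom_DC[OF s(3)] by simp
  then show ?thesis using that s(3,5) by blast
qed

text \<open>Stability speaks of envelopes only. The inclusion of \<open>X\<close> into its envelope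
  extends along \<open>e\<close> to \<open>P\<close>, and the extension is monic because
  \<open>e\<close> is essential; so \<open>P\<close> is a subobject of an object of
  \<open>\<X>\<close>.\<close>

lemma stable_essential_extension:
  assumes ls: "locally_stable C" and X: "localizing_subcat C \<X>"
    and e: "ess e" "e \<in> mor X P" "X \<in> \<X>" and j: "is_mono C j" "j \<in> mor X I" "injective_obj C I"
  shows "P \<in> \<X>"
proof -
  obtain i E where i: "i \<in> mor X E" "ess i" "is_injective_envelope C i" using injective_envelope_exists[OF j] .
  have "stable_subcat C \<X>" using ls X by (auto simp: locally_stable_def)
  then have E: "E \<in> \<X>" using i(3) e(3) hom_DC[OF i(1)] unfolding stable_subcat_def by blast
  have "injective_obj C E" using i(3) hom_DC[OF i(1)] by (simp add: is_injective_envelope_def)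
  then obtain g where g: "g \<in> mor P E" "g \<cdot> e = i"
    using ess_mono[OF e(1)] i(1) hom_DC[OF e(2)] unfolding injective_obj_def by metis
  have gm: "is_mono C g" using ess_mono_cancel[OF e(1,2) g(1)] g(2) ess_mono[OF i(2)] by simp
  interpret serre C \<X> using X by unfold_locales (simp add: localizing_subcat_def)
  show ?thesis using X_sub[OF gm g(1) E] .
qed

section \<open>Subcategories given by supports are closed under sums\<close>

text \<open>Suppose a subobject \<open>P\<close> of \<open>M\<close> maps onto a monoform
  \<open>H\<close> whose atom is not in \<open>\<Phi>\<close>. The images in \<open>M\<close> of
  supported objects form a directed cover; what of \<open>P\<close> lies in one of them maps
  negligibly to \<open>H\<close>, hence by zero. By (AB5) all of \<open>P\<close> maps to zero,
  which is absurd.\<close>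

lemma supported_generated:
  assumes M: "M \<in> Obj C"
    and gen: "\<And>Z g. g \<in> mor M Z \<Longrightarrow> (\<And>D x. D \<in> supported \<Phi> \<Longrightarrow> x \<in> mor D M \<Longrightarrow> g \<cdot> x = zer D Z) \<Longrightarrow> g = zer M Z"
  shows "M \<in> supported \<Phi>"
proof -
  interpret serre C "supported \<Phi>" by unfold_locales (rule serre_supported)
  define \<D> where "\<D> = {m. subobj C M m \<and> Dom C m \<in> supported \<Phi>}"
  have im: "\<exists>m\<in>\<D>. \<exists>h \<in> mor D (Dom C m). m \<cdot> h = x" if D: "D \<in> supported \<Phi>" and x: "x \<in> mor D M" for D x
  proof -
    obtain I e m where em: "e \<in> mor D I" "m \<in> mor I M" "is_epi C e" "is_mono C m" "m \<cdot> e = x" using image_factorization[OF x] .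
    have "m \<in> \<D>" using X_quot[OF em(3,1) D] subobjI[OF em(4,2)] hom_DC[OF em(2)] by (simp add: \<D>_def)
    then show ?thesis using em hom_DC[OF em(2)] by metis
  qed
  have "\<alpha> \<in> \<Phi>" if \<alpha>: "\<alpha> \<in> ASupp C M" for \<alpha>
  proof (rule ccontr)
    assume n: "\<alpha> \<notin> \<Phi>"
    obtain H P s e where H: "monoform C H" "\<alpha> = atom_of C H" "s \<in> mor P M" "is_mono C s" "e \<in> mor P H" "is_epi C e"
      using ASuppE[OF \<alpha>] .
    have "e = zer P H"
    proof (rule directed_cover_preimage[where \<D> = \<D>, OF _ _ _ _ H(3) H(5)])
      obtain Z where Z: "is_zero C Z" using zero_object by blast
      have "zer Z M \<in> mor Z M" using zer_hom M Z by (simp add: is_zero_def)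
      then show "\<D> \<noteq> {}" using im zero_supported[OF Z] by blast
      show "subobj C M m" if "m \<in> \<D>" for m using that by (simp add: \<D>_def)
      show "\<exists>n\<in>\<D>. sub_le C m n \<and> sub_le C m' n" if mm: "m \<in> \<D>" "m' \<in> \<D>" for m m'
      proof -
        have m: "m \<in> mor (Dom C m) M" "Dom C m \<in> supported \<Phi>" and m': "m' \<in> mor (Dom C m') M" "Dom C m' \<in> supported \<Phi>"
          using mm subobj_mor by (auto simp: \<D>_def)
        obtain B i j t where BX: "B \<in> supported \<Phi>" and B: "i \<in> mor (Dom C m) B" "j \<in> mor (Dom C m') B"
            and t: "t \<in> mor B M" "t \<cdot> i = m" "t \<cdot> j = m'"
          using X_binary_sum[OF m(2,1) m'(2,1)] .
        obtain n h where nn: "n \<in> \<D>" "h \<in> mor B (Dom C n)" "n \<cdot> h = t" using im[OF BX t(1)] by blast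
        have nm: "n \<in> mor (Dom C n) M" using nn subobj_mor by (auto simp: \<D>_def)
        have "n \<cdot> (h \<cdot> i) = m" "n \<cdot> (h \<cdot> j) = m'" using comp_ext1[OF nn(3,2) nm B(1)] comp_ext1[OF nn(3,2) nm B(2)] t by auto
        then show ?thesis using nn(1) sub_le_iff[OF m(1) nm] sub_le_iff[OF m'(1) nm] Comp_Hom[OF B(1) nn(2)] Comp_Hom[OF B(2) nn(2)] by blast
      qed
      show "g = zer M Z" if g: "g \<in> mor M Z" "\<And>m. m \<in> \<D> \<Longrightarrow> g \<cdot> m = zer (Dom C m) Z" for Z g
      proof (rule gen[OF g(1)])
        fix D x assume D: "D \<in> supported \<Phi>" "x \<in> mor D M"
        obtain m h where m: "m \<in> \<D>" "h \<in> mor D (Dom C m)" "m \<cdot> h = x" using im[OF D] by blast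
        have "m \<in> mor (Dom C m) M" using m subobj_mor by (auto simp: \<D>_def)
        then show "g \<cdot> x = zer D Z" using comp_eq_zer[OF _ g(1) m(2) g(2)[OF m(1)]] m(3) by simp
      qed
      fix m T x y assume m: "m \<in> \<D>" and x: "x \<in> mor T P" and y: "y \<in> mor T (Dom C m)" and eq: "s \<cdot> x = m \<cdot> y"
      have mm: "m \<in> mor (Dom C m) M" "is_mono C m" "Dom C m \<in> supported \<Phi>" using m subobj_mor subobj_mono by (auto simp: \<D>_def)
      have "negl (supported \<Phi>) (s \<cdot> x)" using eq mm y negl_def by blast
      then have nx: "negl (supported \<Phi>) x" using negl_mono_cancel[OF _ H(4) x H(3)] by blast
      then have "negl (supported \<Phi>) (e \<cdot> x)" using negl_comp_left[OF _ x H(5)] by blast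
      then show "e \<cdot> x = zer T H" using negl_to_monoform[OF H(1) _ Comp_Hom[OF x H(5)]] H(2) n by blast
    qed
    then show False using epi_zero[OF H(6,5)] monoform_nonzero[OF H(1)] by blast
  qed
  then show ?thesis using M by (auto simp: supported_def)
qed

section \<open>Coproducts of monomorphisms\<close>

text \<open>The endomorphism of a coproduct projecting onto the summands in a finite set \<open>F\<close> fixes
  exactly the subobject generated by these summands; these subobjects form a directed cover.\<close>

lemma coproduct_mono:
  assumes P': "is_coproduct C I X' P' \<iota>'" and P: "is_coproduct C I X P \<iota>"
    and g: "\<And>i. i \<in> I \<Longrightarrow> g i \<in> mor (X' i) (X i)" "\<And>i. i \<in> I \<Longrightarrow> is_mono C (g i)"
    and \<phi>: "\<phi> \<in> mor P' P" "\<And>i. i \<in> I \<Longrightarrow> \<phi> \<cdot> \<iota>' i = \<iota> i \<cdot> g i"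
  shows "is_mono C \<phi>"
proof (rule mono_zerI[OF \<phi>(1)])
  fix K k assume k: "k \<in> mor K P'" "\<phi> \<cdot> k = zer K P"
  note i' = coproduct_inj[OF P'] and i = coproduct_inj[OF P] and O' = coproduct_obj[OF P']
  have KO: "K \<in> Obj C" using k hom_obj by blast
  have XO: "X i \<in> Obj C" "X' i \<in> Obj C" if "i \<in> I" for i using hom_obj[OF g(1)[OF that]] by auto
  have "\<exists>p \<in> mor P' (X' j). \<forall>i\<in>I. p \<cdot> \<iota>' i = (if i = j then Ide C (X' j) else zer (X' i) (X' j))" if j: "j \<in> I" for j
  proof -
    obtain p where "p \<in> mor P' (X' j)" "\<And>i. i \<in> I \<Longrightarrow> p \<cdot> \<iota>' i = (if i = j then Ide C (X' j) else zer (X' i) (X' j))"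
      by (rule coproduct_copair[OF P' XO(2)[OF j], of "\<lambda>i. if i = j then Ide C (X' j) else zer (X' i) (X' j)"])
        (use XO zer_hom Ide_Hom j in auto)
    then show ?thesis by blast
  qed
  then obtain p where p: "\<And>j. j \<in> I \<Longrightarrow> p j \<in> mor P' (X' j)"
    "\<And>i j. j \<in> I \<Longrightarrow> i \<in> I \<Longrightarrow> p j \<cdot> \<iota>' i = (if i = j then Ide C (X' j) else zer (X' i) (X' j))"
    by metis
  \<comment> \<open>The components of \<open>k\<close> vanish, because the arrows \<open>g j\<close>
    are monic.\<close>
  have pk: "p j \<cdot> k = zer K (X' j)" if j: "j \<in> I" for j
  proof -
    obtain r where r: "r \<in> mor P (X j)" "\<And>i. i \<in> I \<Longrightarrow> r \<cdot> \<iota> i = (if i = j then Ide C (X j) else zer (X i) (X j))"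
      by (rule coproduct_copair[OF P XO(1)[OF j], of "\<lambda>i. if i = j then Ide C (X j) else zer (X i) (X j)"])
        (use XO zer_hom Ide_Hom j in auto)
    have "g j \<cdot> p j = r \<cdot> \<phi>"
    proof (rule coproduct_eq[OF P' Comp_Hom[OF p(1)[OF j] g(1)[OF j]] Comp_Hom[OF \<phi>(1) r(1)]])
      fix l assume l: "l \<in> I"
      have "g j \<cdot> p j \<cdot> \<iota>' l = (if l = j then g j else zer (X' l) (X j))"
        using Comp_assoc[OF i'[OF l] p(1)[OF j] g(1)[OF j]] p(2)[OF j l] Comp_Ide[OF g(1)[OF j]] comp_zer'[OF g(1)[OF j] XO(2)[OF l]] by simp
      moreover have "r \<cdot> \<phi> \<cdot> \<iota>' l = (if l = j then g j else zer (X' l) (X j))"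
        using Comp_assoc[OF i'[OF l] \<phi>(1) r(1)] \<phi>(2)[OF l] Comp_assoc[OF g(1)[OF l] i[OF l] r(1), symmetric] r(2)[OF l]
          Ide_Comp[OF g(1)[OF l]] zer_comp'[OF g(1)[OF l] XO(1)[OF j]] by (cases "l = j") simp_all
      ultimately show "g j \<cdot> p j \<cdot> \<iota>' l = r \<cdot> \<phi> \<cdot> \<iota>' l" by simp
    qed
    then have "g j \<cdot> (p j \<cdot> k) = r \<cdot> (\<phi> \<cdot> k)" using comp_ext[OF _ p(1)[OF j] g(1)[OF j] \<phi>(1) r(1) k(1)] by blast
    also have "\<dots> = zer K (X j)" using k(2) comp_zer'[OF r(1) KO] by simp
    finally show ?thesis using mono_zerD[OF g(2,1)[OF j] Comp_Hom[OF k(1) p(1)[OF j]]] by blast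
  qed
  have "\<exists>e \<in> mor P' P'. \<forall>i\<in>I. e \<cdot> \<iota>' i = (if i \<in> F then \<iota>' i else zer (X' i) P')" for F
  proof -
    obtain e where "e \<in> mor P' P'" "\<And>i. i \<in> I \<Longrightarrow> e \<cdot> \<iota>' i = (if i \<in> F then \<iota>' i else zer (X' i) P')"
      by (rule coproduct_copair[OF P' O', of "\<lambda>i. if i \<in> F then \<iota>' i else zer (X' i) P'"]) (use i' XO zer_hom O' in auto)
    then show ?thesis by blast
  qed
  then obtain e where e: "\<And>F. e F \<in> mor P' P'" "\<And>F i. i \<in> I \<Longrightarrow> e F \<cdot> \<iota>' i = (if i \<in> F then \<iota>' i else zer (X' i) P')" by metis
  \<comment> \<open>Adding \<open>j\<close> to \<open>F\<close> changes the projection by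
    \<open>\<iota>' j \<cdot> p j\<close>, which kills \<open>k\<close>; so every finite projection
    kills \<open>k\<close>.\<close>
  have ek: "e F \<cdot> k = zer K P'" if "finite F" "F \<subseteq> I" for F
    using that
  proof (induction F rule: finite_induct)
    case empty
    have "e {} = zer P' P'" by (rule coproduct_zer[OF P' e(1)]) (simp add: e(2))
    then show ?case using zer_comp'[OF k(1) O'] by simp
  next
    case (insert j F)
    then have j: "j \<in> I" by blast
    note jp = Comp_Hom[OF p(1)[OF j] i'[OF j]]
    have "dif (e (insert j F)) (e F) = \<iota>' j \<cdot> p j"
    proof (rule coproduct_eq[OF P' dif_hom[OF e(1) e(1)] jp])
      fix l assume l: "l \<in> I"
      note z = zer_hom[OF XO(2)[OF l] O']
      have "dif (e (insert j F)) (e F) \<cdot> \<iota>' l = (if l = j then \<iota>' l else zer (X' l) P')"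
        using dif_comp[OF e(1) e(1) i'[OF l]] e(2)[OF l] insert(2) dif_eq[OF i'[OF l] i'[OF l]] dif_eq[OF z z] dif_zer[OF i'[OF l]] by auto
      moreover have "\<iota>' j \<cdot> p j \<cdot> \<iota>' l = (if l = j then \<iota>' l else zer (X' l) P')"
        using Comp_assoc[OF i'[OF l] p(1)[OF j] i'[OF j]] p(2)[OF j l] Comp_Ide[OF i'[OF j]] comp_zer'[OF i'[OF j] XO(2)[OF l]] by auto
      ultimately show "dif (e (insert j F)) (e F) \<cdot> \<iota>' l = \<iota>' j \<cdot> p j \<cdot> \<iota>' l" by simp
    qed
    then have "dif (e (insert j F) \<cdot> k) (e F \<cdot> k) = zer K P'"
      using dif_comp[OF e(1) e(1) k(1)] Comp_assoc[OF k(1) p(1)[OF j] i'[OF j]] pk[OF j] comp_zer'[OF i'[OF j] KO] by metis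
    then show ?case using dif_eq[OF Comp_Hom[OF k(1) e(1)] Comp_Hom[OF k(1) e(1)]] insert by simp
  qed
  define \<D> where "\<D> = {m. subobj C P' m \<and> (\<exists>F. finite F \<and> F \<subseteq> I \<and>
      (\<forall>T. \<forall>x \<in> mor T P'. (\<exists>y \<in> mor T (Dom C m). m \<cdot> y = x) \<longleftrightarrow> e F \<cdot> x = x))}"
  have ex: "\<exists>m\<in>\<D>. \<forall>T. \<forall>x \<in> mor T P'. (\<exists>y \<in> mor T (Dom C m). m \<cdot> y = x) \<longleftrightarrow> e F \<cdot> x = x" if F: "finite F" "F \<subseteq> I" for F
  proof -
    note d = dif_hom[OF Ide_Hom[OF O'] e(1)[of F]]
    obtain m M where m: "is_kernel C m (dif (Ide C P') (e F))" "m \<in> mor M P'" "is_mono C m" "dif (Ide C P') (e F) \<cdot> m = zer M P'"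
      using obtain_kernel[OF d] .
    have "(\<exists>y \<in> mor T M. m \<cdot> y = x) \<longleftrightarrow> e F \<cdot> x = x" if x: "x \<in> mor T P'" for T x
    proof -
      have "(\<exists>y \<in> mor T M. m \<cdot> y = x) \<longleftrightarrow> dif (Ide C P') (e F) \<cdot> x = zer T P'"
        using kernelE[OF m(1) d m(2) x] comp_eq_zer[OF m(2) d _ m(4)] by metis
      also have "\<dots> \<longleftrightarrow> e F \<cdot> x = x" using dif_comp[OF Ide_Hom[OF O'] e(1) x] Ide_Comp[OF x] dif_eq[OF x Comp_Hom[OF x e(1)]] by auto
      finally show ?thesis .
    qed
    then show ?thesis using subobjI[OF m(3,2)] hom_DC[OF m(2)] F unfolding \<D>_def by blast
  qed
  have "k = zer K P'"
  proof (rule directed_cover_preimage[where \<D> = \<D>, OF _ _ _ _ k(1) k(1)])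
    show "\<D> \<noteq> {}" using ex[of "{}"] by blast
    show "subobj C P' m" if "m \<in> \<D>" for m using that by (simp add: \<D>_def)
    show "\<exists>n\<in>\<D>. sub_le C m n \<and> sub_le C m' n" if mm: "m \<in> \<D>" "m' \<in> \<D>" for m m'
    proof -
      obtain F where F: "finite F" "F \<subseteq> I" "\<And>T x. x \<in> mor T P' \<Longrightarrow> (\<exists>y \<in> mor T (Dom C m). m \<cdot> y = x) \<longleftrightarrow> e F \<cdot> x = x"
        using mm(1) unfolding \<D>_def by blast
      obtain F' where F': "finite F'" "F' \<subseteq> I" "\<And>T x. x \<in> mor T P' \<Longrightarrow> (\<exists>y \<in> mor T (Dom C m'). m' \<cdot> y = x) \<longleftrightarrow> e F' \<cdot> x = x"
        using mm(2) unfolding \<D>_def by blast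
      obtain n where n: "n \<in> \<D>" "\<And>T x. x \<in> mor T P' \<Longrightarrow> (\<exists>y \<in> mor T (Dom C n). n \<cdot> y = x) \<longleftrightarrow> e (F \<union> F') \<cdot> x = x"
        using ex[of "F \<union> F'"] F F' by blast
      have nm: "n \<in> mor (Dom C n) P'" using n(1) subobj_mor by (simp add: \<D>_def)
      have le: "sub_le C l n" if l: "l \<in> \<D>" "H \<subseteq> F \<union> F'" "\<And>T x. x \<in> mor T P' \<Longrightarrow> (\<exists>y \<in> mor T (Dom C l). l \<cdot> y = x) \<longleftrightarrow> e H \<cdot> x = x" for l H
      proof -
        have lm: "l \<in> mor (Dom C l) P'" using l(1) subobj_mor by (simp add: \<D>_def)
        have "\<exists>y \<in> mor (Dom C l) (Dom C l). l \<cdot> y = l" using Comp_Ide[OF lm] Ide_Hom hom_obj[OF lm] by blast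
        then have 1: "e H \<cdot> l = l" using l(3)[OF lm] by blast
        have "e (F \<union> F') \<cdot> e H = e H"
        proof (rule coproduct_eq[OF P' Comp_Hom[OF e(1) e(1)] e(1)])
          fix i assume i: "i \<in> I"
          show "e (F \<union> F') \<cdot> e H \<cdot> \<iota>' i = e H \<cdot> \<iota>' i"
            using Comp_assoc[OF i'[OF i] e(1) e(1)] e(2)[OF i] l(2) comp_zer'[OF e(1) XO(2)[OF i]] by auto
        qed
        then have "e (F \<union> F') \<cdot> l = l" using Comp_assoc[OF lm e(1) e(1)] 1 by metis
        then show ?thesis using n(2)[OF lm] sub_le_iff[OF lm nm] by blast
      qed
      show ?thesis using n(1) le[OF mm(1) _ F(3)] le[OF mm(2) _ F'(3)] by blast
    qed
    show "h = zer P' Z" if h: "h \<in> mor P' Z" "\<And>m. m \<in> \<D> \<Longrightarrow> h \<cdot> m = zer (Dom C m) Z" for Z h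
    proof (rule coproduct_zer[OF P' h(1)])
      fix i assume i: "i \<in> I"
      obtain m where m: "m \<in> \<D>" "\<And>T x. x \<in> mor T P' \<Longrightarrow> (\<exists>y \<in> mor T (Dom C m). m \<cdot> y = x) \<longleftrightarrow> e {i} \<cdot> x = x"
        using ex[of "{i}"] i by blast
      have mm: "m \<in> mor (Dom C m) P'" using m(1) subobj_mor by (simp add: \<D>_def)
      have "e {i} \<cdot> \<iota>' i = \<iota>' i" using e(2)[OF i] by simp
      then obtain y where y: "y \<in> mor (X' i) (Dom C m)" "m \<cdot> y = \<iota>' i" using m(2)[OF i'[OF i]] by blast
      then show "h \<cdot> \<iota>' i = zer (X' i) Z" using comp_eq_zer[OF mm h(1) y(1) h(2)[OF m(1)]] by simp
    qed
    fix m T x y assume m: "m \<in> \<D>" and x: "x \<in> mor T K" and y: "y \<in> mor T (Dom C m)" and eq: "k \<cdot> x = m \<cdot> y"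
    obtain F where F: "finite F" "F \<subseteq> I" "\<And>T x. x \<in> mor T P' \<Longrightarrow> (\<exists>y \<in> mor T (Dom C m). m \<cdot> y = x) \<longleftrightarrow> e F \<cdot> x = x"
        using m unfolding \<D>_def by blast
    have "e F \<cdot> (k \<cdot> x) = k \<cdot> x" using F(3)[OF Comp_Hom[OF x k(1)]] eq y by metis
    then show "k \<cdot> x = zer T P'" using comp_eq_zer[OF k(1) e(1) x ek[OF F(1,2)]] by simp
  qed
  then show "k = zer K P'" .
qed

end

section \<open>Reflection onto closed objects\<close>

text \<open>The extra axiom is closure under sums, stated by arrows: an object generated by the
  images of objects of \<open>\<X>\<close> belongs to \<open>\<X>\<close>.\<close>

locale torsion_class = grothendieck_category U C + serre C \<X>
  for U :: "'u set" and C :: "('o, 'a, 'm) preadd_cat_scheme" (structure) and \<X> :: "'o set" +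
  assumes generated: "M \<in> Obj C \<Longrightarrow>
    (\<And>Z g. g \<in> Hom C M Z \<Longrightarrow> (\<And>D x. D \<in> \<X> \<Longrightarrow> x \<in> Hom C D M \<Longrightarrow> g \<cdot> x = ZeroArr C D Z) \<Longrightarrow> g = ZeroArr C M Z) \<Longrightarrow> M \<in> \<X>"

definition (in serre) torsionfree :: "'o \<Rightarrow> bool" where
  "torsionfree R \<longleftrightarrow> R \<in> Obj C \<and> (\<forall>D\<in>\<X>. \<forall>x \<in> mor D R. x = zer D R)"

lemma (in serre) torsionfree_negl:
  assumes R: "torsionfree R" and x: "x \<in> mor T R" "negl \<X> x" shows "x = zer T R"
proof -
  obtain D a b X' Y' where d: "D \<in> \<X>" "b \<in> mor X' D" "a \<in> mor D Y'" "x = a \<cdot> b"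
    using x(2) unfolding negl_def by blast
  have "X' = T" "Y' = R" using Comp_Hom[OF d(2,3)] d(4) x(1) by (simp_all add: hom_iff)
  then have a: "a \<in> mor D R" and b: "b \<in> mor T D" using d by auto
  have "a = zer D R" using R d(1) a by (simp add: torsionfree_def)
  then show ?thesis using d(4) zer_comp'[OF b] hom_obj[OF a] by simp
qed

text \<open>An arrow from \<open>D\<close> to \<open>Y'\<close> pulls back to an arrow into
  \<open>Y\<close> from an extension of \<open>D\<close> by an object of \<open>\<X>\<close>. This
  extension lies in \<open>\<X>\<close>, so \<open>q\<close> kills it, and it covers
  \<open>D\<close>.\<close>

lemma (in serre) torsionfree_quotient:
  assumes q: "q \<in> mor Y Y'" "is_epi C q" and k: "\<And>T x. x \<in> mor T Y \<Longrightarrow> q \<cdot> x = zer T Y' \<Longrightarrow> negl \<X> x"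
    and D: "\<And>D x. D \<in> \<X> \<Longrightarrow> x \<in> mor D Y \<Longrightarrow> q \<cdot> x = zer D Y'"
  shows "torsionfree Y'"
  unfolding torsionfree_def
proof (intro conjI ballI)
  show "Y' \<in> Obj C" using q hom_obj by blast
  fix D x assume Dx: "D \<in> \<X>" "x \<in> mor D Y'"
  obtain P p r where P: "p \<in> mor P Y" "r \<in> mor P D" "q \<cdot> p = x \<cdot> r"
    "\<And>T t. t \<in> mor T P \<Longrightarrow> p \<cdot> t = zer T Y \<Longrightarrow> r \<cdot> t = zer T D \<Longrightarrow> t = zer T P" "is_epi C r"
    by (rule obtain_pullback[OF q(1) Dx(2)]) (use q(2) in \<open>blast intro: that\<close>)
  obtain l L where l: "is_kernel C l r" "l \<in> mor L P" "is_mono C l" "r \<cdot> l = zer L D" using obtain_kernel[OF P(2)] .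
  have pl: "p \<cdot> l \<in> mor L Y" using Comp_Hom[OF l(2) P(1)] .
  have "q \<cdot> (p \<cdot> l) = x \<cdot> (r \<cdot> l)" using comp_ext[OF P(3,1) q(1) P(2) Dx(2) l(2)] .
  also have "\<dots> = zer L Y'" using l(4) comp_zer'[OF Dx(2)] hom_obj[OF l(2)] by simp
  finally have n: "negl \<X> (p \<cdot> l)" using k[OF pl] by blast
  have "is_mono C (p \<cdot> l)"
  proof (rule mono_zerI[OF pl])
    fix W t assume t: "t \<in> mor W L" "p \<cdot> l \<cdot> t = zer W Y"
    have "p \<cdot> (l \<cdot> t) = zer W Y" using t Comp_assoc[OF t(1) l(2) P(1)] by simp
    then have "l \<cdot> t = zer W P" using P(4)[OF Comp_Hom[OF t(1) l(2)]] comp_eq_zer[OF l(2) P(2) t(1) l(4)] by blast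
    then show "t = zer W L" using mono_zerD[OF l(3,2) t(1)] by blast
  qed
  then have "L \<in> \<X>" using negl_mono[OF n _ pl] by blast
  then have "P \<in> \<X>" using X_ext[OF l(1,2) P(2) _ Dx(1)] by blast
  then have "x \<cdot> r = zer P Y'" using D[OF _ P(1)] P(3) by simp
  then show "x = zer D Y'" using epi_zerD[OF P(5,2) Dx(2)] by blast
qed

text \<open>Only the existence half of orthogonality to the inverted arrows; uniqueness of the
  extensions comes from \<open>torsionfree\<close>.\<close>

definition (in serre) closed :: "'o \<Rightarrow> bool" where
  "closed R \<longleftrightarrow> (\<forall>P X s f. s \<in> mor P X \<longrightarrow> quot_iso C \<X> s \<longrightarrow> f \<in> mor P R \<longrightarrow> (\<exists>h \<in> mor X R. h \<cdot> s = f))"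

context torsion_class
begin

text \<open>The quotient by the joint image of all arrows from \<open>\<X>\<close> to
  \<open>Y\<close>. The kernel \<open>V\<close> is generated by these arrows, so
  \<open>generated\<close> puts it into \<open>\<X>\<close>.\<close>

lemma torsion_quotient:
  assumes Y: "Y \<in> Obj C"
  obtains q Y' where "q \<in> mor Y Y'" "quot_iso C \<X> q" "torsionfree Y'"
proof -
  let ?J = "{x. \<exists>D\<in>\<X>. x \<in> mor D Y}"
  have J: "j \<in> mor (Dom C j) Y" if "j \<in> ?J" for j using that hom_DC by auto
  obtain q Q where q: "q \<in> mor Y Q" "is_epi C q" "\<And>j. j \<in> ?J \<Longrightarrow> q \<cdot> j = zer (Dom C j) Q"
    "\<And>Z g. g \<in> mor Y Z \<Longrightarrow> (\<And>j. j \<in> ?J \<Longrightarrow> g \<cdot> j = zer (Dom C j) Z) \<Longrightarrow> \<exists>h \<in> mor Q Z. h \<cdot> q = g"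
    by (rule joint_cokernel[OF Y J]) (assumption, blast intro: that)
  have qD: "q \<cdot> x = zer D Q" if "D \<in> \<X>" "x \<in> mor D Y" for D x using q(3)[of x] that hom_DC(1)[OF that(2)] by auto
  obtain u V where u: "is_kernel C u q" "u \<in> mor V Y" "is_mono C u" "q \<cdot> u = zer V Q" using obtain_kernel[OF q(1)] .
  have V: "V \<in> \<X>"
  proof (rule generated)
    show "V \<in> Obj C" using u hom_obj by blast
    fix Z g assume g: "g \<in> mor V Z" "\<And>D x. D \<in> \<X> \<Longrightarrow> x \<in> mor D V \<Longrightarrow> g \<cdot> x = zer D Z"
    show "g = zer V Z"
    proof (rule joint_cokernel_kernel[OF J q(1,3,4) u(1,2) g(1)])
      fix j y assume "j \<in> ?J" and y: "y \<in> mor (Dom C j) V"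
      then have "Dom C j \<in> \<X>" using hom_DC by auto
      then show "g \<cdot> y = zer (Dom C j) Z" using g(2) y by blast
    qed
  qed
  have k: "negl \<X> x" if "x \<in> mor T Y" "q \<cdot> x = zer T Q" for T x
    using kernelE[OF u(1) q(1) u(2) that] V u(2) negl_def by metis
  have "quot_iso C \<X> q"
  proof (rule quot_isoI[OF q(1) k])
    fix Z y assume y: "y \<in> mor Q Z" "y \<cdot> q = zer Y Z"
    then have "y = zer Q Z" using epi_zerD[OF q(2,1)] by blast
    then show "negl \<X> y" using negl_zer hom_obj[OF y(1)] by simp
  qed
  moreover have "torsionfree Q" by (rule torsionfree_quotient[OF q(1,2)]) (use k qD in blast)+
  ultimately show ?thesis using that[OF q(1)] by blast
qed

text \<open>If \<open>y\<close> kills \<open>\<phi>\<close>, each component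
  \<open>e \<cdot> \<iota> l\<close> onto the image \<open>J\<close> of \<open>y\<close> kills
  \<open>g l\<close>, so it factors through an object of \<open>\<X>\<close>. The image is generated
  by these objects and therefore lies in \<open>\<X>\<close>.\<close>

lemma coproduct_quot_iso:
  assumes P': "is_coproduct C I X' P' \<iota>'" and P: "is_coproduct C I X P \<iota>"
    and g: "\<And>i. i \<in> I \<Longrightarrow> g i \<in> mor (X' i) (X i)" "\<And>i. i \<in> I \<Longrightarrow> is_mono C (g i)" "\<And>i. i \<in> I \<Longrightarrow> quot_iso C \<X> (g i)"
    and \<phi>: "\<phi> \<in> mor P' P" "\<And>i. i \<in> I \<Longrightarrow> \<phi> \<cdot> \<iota>' i = \<iota> i \<cdot> g i"
  shows "is_mono C \<phi>" "quot_iso C \<X> \<phi>"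
proof -
  show m: "is_mono C \<phi>" using coproduct_mono[OF P' P g(1,2) \<phi>] .
  note i' = coproduct_inj[OF P'] and i = coproduct_inj[OF P]
  show "quot_iso C \<X> \<phi>"
  proof (rule mono_quot_iso[OF m \<phi>(1)])
    fix Z y assume y: "y \<in> mor P Z" "y \<cdot> \<phi> = zer P' Z"
    obtain J e n where em: "e \<in> mor P J" "n \<in> mor J Z" "is_epi C e" "is_mono C n" "n \<cdot> e = y" using image_factorization[OF y(1)] .
    have "J \<in> \<X>"
    proof (rule generated)
      show "J \<in> Obj C" using em hom_obj by blast
      fix W t assume t: "t \<in> mor J W" "\<And>D x. D \<in> \<X> \<Longrightarrow> x \<in> mor D J \<Longrightarrow> t \<cdot> x = zer D W"
      have "t \<cdot> e = zer P W"
      proof (rule coproduct_zer[OF P Comp_Hom[OF em(1) t(1)]])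
        fix l assume l: "l \<in> I"
        have el: "e \<cdot> \<iota> l \<in> mor (X l) J" using Comp_Hom[OF i[OF l] em(1)] .
        have "n \<cdot> (e \<cdot> \<iota> l \<cdot> g l) = y \<cdot> (\<iota> l \<cdot> g l)"
          using Comp_assoc[OF g(1)[OF l] i[OF l] em(1)] comp_ext1[OF em(5,1,2) Comp_Hom[OF g(1)[OF l] i[OF l]]] by simp
        also have "\<dots> = zer (X' l) Z" using \<phi>(2)[OF l] comp_eq_zer[OF \<phi>(1) y(1) i'[OF l] y(2)] by simp
        finally have "e \<cdot> \<iota> l \<cdot> g l = zer (X' l) J" using mono_zerD[OF em(4,2) Comp_Hom[OF g(1)[OF l] el]] by blast
        then have "negl \<X> (e \<cdot> \<iota> l)" using quot_isoD2[OF g(3)[OF l] g(1)[OF l] el] by blast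
        then obtain D a b A B where d: "D \<in> \<X>" "b \<in> mor A D" "a \<in> mor D B" "e \<cdot> \<iota> l = a \<cdot> b" unfolding negl_def by blast
        have "A = X l" "B = J" using Comp_Hom[OF d(2,3)] d(4) el by (simp_all add: hom_iff)
        then have ab: "b \<in> mor (X l) D" "a \<in> mor D J" using d by auto
        have "t \<cdot> (a \<cdot> b) = zer (X l) W" using comp_eq_zer[OF ab(2) t(1) ab(1) t(2)[OF d(1) ab(2)]] .
        then show "t \<cdot> e \<cdot> \<iota> l = zer (X l) W" using Comp_assoc[OF i[OF l] em(1) t(1)] d(4) by simp
      qed
      then show "t = zer J W" using epi_zerD[OF em(3,1) t(1)] by blast
    qed
    then show "negl \<X> y" using em negl_def by blast
  qed
qed

text \<open>A criterion in the style of Baer, in which uniqueness of extensions into a torsionfree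
  object replaces Zorn's lemma. Cover \<open>X\<close> by a coproduct of copies of \<open>G\<close>,
  one for each arrow \<open>g : G -> X\<close>, and extend on each copy from the preimage of
  \<open>X'\<close>. The extensions combine to \<open>F\<close> on the coproduct, which vanishes on
  the kernel of the covering \<open>p\<close> and so descends to \<open>X\<close>.\<close>

lemma closed_from_generator:
  assumes R: "torsionfree R"
    and G: "G \<in> Obj C" "\<And>X Y f. f \<in> mor X Y \<Longrightarrow> (\<And>h. h \<in> mor G X \<Longrightarrow> f \<cdot> h = zer G Y) \<Longrightarrow> f = zer X Y"
    and ext: "\<And>A g f. g \<in> mor A G \<Longrightarrow> is_mono C g \<Longrightarrow> quot_iso C \<X> g \<Longrightarrow> f \<in> mor A R \<Longrightarrow> \<exists>h \<in> mor G R. h \<cdot> g = f"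
  shows "closed R"
  unfolding closed_def
proof (intro allI impI)
  fix S X s f0 assume s: "s \<in> mor S X" "quot_iso C \<X> s" and f0: "f0 \<in> mor S R"
  obtain X' e m where em: "e \<in> mor S X'" "m \<in> mor X' X" "is_epi C e" "is_mono C m" "m \<cdot> e = s" using image_factorization[OF s(1)] .
  obtain f where f: "f \<in> mor X' R" "f \<cdot> e = f0"
  proof (rule epi_factor_all[OF em(3,1) f0])
    fix T t assume t: "t \<in> mor T S" "e \<cdot> t = zer T X'"
    have "s \<cdot> t = zer T X" using comp_ext1[OF em(5,1,2) t(1)] t(2) comp_zer'[OF em(2)] hom_obj[OF t(1)] by simp
    then have "negl \<X> t" using quot_isoD1[OF s(2,1) t(1)] by blast
    then show "f0 \<cdot> t = zer T R" using torsionfree_negl[OF R Comp_Hom[OF t(1) f0]] negl_comp_left[OF _ t(1) f0] by blast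
  qed
  have mq: "quot_iso C \<X> m"
  proof (rule mono_quot_iso[OF em(4,2)])
    fix Z y assume y: "y \<in> mor X Z" "y \<cdot> m = zer X' Z"
    have "y \<cdot> s = zer S Z" using comp_eq_zer[OF em(2) y(1) em(1) y(2)] em(5) by simp
    then show "negl \<X> y" using quot_isoD2[OF s(2,1) y(1)] by blast
  qed
  have XO: "X \<in> Obj C" "R \<in> Obj C" "X' \<in> Obj C" using s f0 em hom_obj by auto
  let ?H = "mor G X"
  define Q where "Q g A a k \<longleftrightarrow> a \<in> mor A X' \<and> k \<in> mor A G \<and> m \<cdot> a = g \<cdot> k \<and> quot_iso C \<X> k \<and> is_mono C k \<and>
    (\<forall>T x y. x \<in> mor T X' \<longrightarrow> y \<in> mor T G \<longrightarrow> m \<cdot> x = g \<cdot> y \<longrightarrow> (\<exists>t \<in> mor T A. a \<cdot> t = x \<and> k \<cdot> t = y))" for g A a k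
  have "\<exists>A a k. Q g A a k" if g: "g \<in> ?H" for g
  proof -
    obtain A a k where A: "a \<in> mor A X'" "k \<in> mor A G" "m \<cdot> a = g \<cdot> k" "quot_iso C \<X> k"
    "\<And>T x y. x \<in> mor T X' \<Longrightarrow> y \<in> mor T G \<Longrightarrow> m \<cdot> x = g \<cdot> y \<Longrightarrow> \<exists>t \<in> mor T A. a \<cdot> t = x \<and> k \<cdot> t = y"
    "is_mono C k"
      by (rule pullback_quot_iso[OF em(2) mq g]) (use em(4) in \<open>blast intro: that\<close>)
    then show ?thesis unfolding Q_def by blast
  qed
  then obtain A a k where Q: "\<And>g. g \<in> ?H \<Longrightarrow> Q g (A g) (a g) (k g)" by metis
  have A: "a g \<in> mor (A g) X'" "k g \<in> mor (A g) G" "m \<cdot> a g = g \<cdot> k g" "quot_iso C \<X> (k g)" "is_mono C (k g)"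
    "x \<in> mor T X' \<Longrightarrow> y \<in> mor T G \<Longrightarrow> m \<cdot> x = g \<cdot> y \<Longrightarrow> \<exists>t \<in> mor T (A g). a g \<cdot> t = x \<and> k g \<cdot> t = y"
    if "g \<in> ?H" for g T x y
    using Q[OF that] unfolding Q_def by blast+
  have "\<exists>h \<in> mor G R. h \<cdot> k g = f \<cdot> a g" if g: "g \<in> ?H" for g
    using ext[OF A(2,5,4)[OF g] Comp_Hom[OF A(1)[OF g] f(1)]] .
  then obtain b where b: "\<And>g. g \<in> ?H \<Longrightarrow> b g \<in> mor G R" "\<And>g. g \<in> ?H \<Longrightarrow> b g \<cdot> k g = f \<cdot> a g" by metis
  have small: "small U ?H" using locally_small[OF G(1) XO(1)] .
  obtain P \<iota> where P: "is_coproduct C ?H (\<lambda>_. G) P \<iota>" using coproduct_exists[OF small, of "\<lambda>_. G"] G(1) by blast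
  have AO: "A g \<in> Obj C" if "g \<in> ?H" for g using hom_obj[OF A(1)[OF that]] by blast
  obtain P' \<iota>' where P': "is_coproduct C ?H A P' \<iota>'" using coproduct_exists[OF small, of A] AO by blast
  note i = coproduct_inj[OF P] and i' = coproduct_inj[OF P'] and PO = coproduct_obj[OF P]
  obtain p where p: "p \<in> mor P X" "\<And>g. g \<in> ?H \<Longrightarrow> p \<cdot> \<iota> g = g" using coproduct_copair[OF P XO(1), of "\<lambda>g. g"] by blast
  obtain F where F: "F \<in> mor P R" "\<And>g. g \<in> ?H \<Longrightarrow> F \<cdot> \<iota> g = b g" using coproduct_copair[OF P XO(2), of b] b(1) by blast
  have ik: "\<iota> g \<cdot> k g \<in> mor (A g) P" if "g \<in> ?H" for g using Comp_Hom[OF A(2) i] that by blast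
  obtain \<phi> where \<phi>: "\<phi> \<in> mor P' P" "\<And>g. g \<in> ?H \<Longrightarrow> \<phi> \<cdot> \<iota>' g = \<iota> g \<cdot> k g" using coproduct_copair[OF P' PO, of "\<lambda>g. \<iota> g \<cdot> k g"] ik by blast
  obtain p' where p': "p' \<in> mor P' X'" "\<And>g. g \<in> ?H \<Longrightarrow> p' \<cdot> \<iota>' g = a g" using coproduct_copair[OF P' XO(3), of a] A(1) by blast
  have \<phi>q: "quot_iso C \<X> \<phi>" using coproduct_quot_iso(2)[OF P' P A(2,5,4) \<phi>] .
  have mp: "m \<cdot> p' = p \<cdot> \<phi>"
  proof (rule coproduct_eq[OF P' Comp_Hom[OF p'(1) em(2)] Comp_Hom[OF \<phi>(1) p(1)]])
    fix g assume g: "g \<in> ?H"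
    have "p \<cdot> \<phi> \<cdot> \<iota>' g = p \<cdot> (\<iota> g \<cdot> k g)" using Comp_assoc[OF i'[OF g] \<phi>(1) p(1)] \<phi>(2)[OF g] by simp
    also have "\<dots> = g \<cdot> k g" using comp_ext1[OF p(2)[OF g] i[OF g] p(1) A(2)[OF g]] .
    also have "\<dots> = m \<cdot> p' \<cdot> \<iota>' g" using Comp_assoc[OF i'[OF g] p'(1) em(2)] p'(2)[OF g] A(3)[OF g] by simp
    finally show "m \<cdot> p' \<cdot> \<iota>' g = p \<cdot> \<phi> \<cdot> \<iota>' g" by simp
  qed
  have Fp: "F \<cdot> \<phi> = f \<cdot> p'"
  proof (rule coproduct_eq[OF P' Comp_Hom[OF \<phi>(1) F(1)] Comp_Hom[OF p'(1) f(1)]])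
    fix g assume g: "g \<in> ?H"
    have "F \<cdot> \<phi> \<cdot> \<iota>' g = F \<cdot> (\<iota> g \<cdot> k g)" using Comp_assoc[OF i'[OF g] \<phi>(1) F(1)] \<phi>(2)[OF g] by simp
    also have "\<dots> = b g \<cdot> k g" using comp_ext1[OF F(2)[OF g] i[OF g] F(1) A(2)[OF g]] .
    also have "\<dots> = f \<cdot> p' \<cdot> \<iota>' g" using Comp_assoc[OF i'[OF g] p'(1) f(1)] p'(2)[OF g] b(2)[OF g] by simp
    finally show "F \<cdot> \<phi> \<cdot> \<iota>' g = f \<cdot> p' \<cdot> \<iota>' g" .
  qed
  have pe: "is_epi C p"
  proof (rule epi_zerI[OF p(1)])
    fix Z t assume t: "t \<in> mor X Z" "t \<cdot> p = zer P Z"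
    show "t = zer X Z"
    proof (rule G(2)[OF t(1)])
      fix g assume g: "g \<in> ?H"
      show "t \<cdot> g = zer G Z" using comp_eq_zer[OF p(1) t(1) i[OF g] t(2)] p(2)[OF g] by simp
    qed
  qed
  obtain l L where l: "is_kernel C l p" "l \<in> mor L P" "is_mono C l" "p \<cdot> l = zer L X" using obtain_kernel[OF p(1)] .
  \<comment> \<open>Along \<open>d\<close>, which is inverted modulo \<open>\<X>\<close>, the arrow
    \<open>F l\<close> becomes \<open>f \<cdot> (p' \<cdot> c)\<close>, and
    \<open>p' \<cdot> c\<close> is zero because \<open>m\<close> is monic. Torsionfreeness of
    \<open>R\<close> removes \<open>d\<close>.\<close>
  have Fl: "F \<cdot> l = zer L R"
  proof -
    obtain B c d where B: "c \<in> mor B P'" "d \<in> mor B L" "\<phi> \<cdot> c = l \<cdot> d" "quot_iso C \<X> d"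
      by (rule pullback_quot_iso[OF \<phi>(1) \<phi>q l(2)]) (blast intro: that)
    have BO: "B \<in> Obj C" using B hom_obj by blast
    have "m \<cdot> (p' \<cdot> c) = p \<cdot> (\<phi> \<cdot> c)" using comp_ext[OF mp p'(1) em(2) \<phi>(1) p(1) B(1)] .
    also have "\<dots> = zer B X" using B(3) comp_eq_zer[OF l(2) p(1) B(2) l(4)] by simp
    finally have pc: "p' \<cdot> c = zer B X'" using mono_zerD[OF em(4,2) Comp_Hom[OF B(1) p'(1)]] by blast
    have "F \<cdot> l \<cdot> d = F \<cdot> (\<phi> \<cdot> c)" using Comp_assoc[OF B(2) l(2) F(1)] B(3) by simp
    also have "\<dots> = f \<cdot> (p' \<cdot> c)" using comp_ext[OF Fp \<phi>(1) F(1) p'(1) f(1) B(1)] .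
    also have "\<dots> = zer B R" using pc comp_zer'[OF f(1) BO] by simp
    finally have "negl \<X> (F \<cdot> l)" using quot_isoD2[OF B(4,2) Comp_Hom[OF l(2) F(1)]] by blast
    then show ?thesis using torsionfree_negl[OF R Comp_Hom[OF l(2) F(1)]] by blast
  qed
  obtain h where h: "h \<in> mor X R" "h \<cdot> p = F" using epi_factor[OF pe p(1) l(1,2) F(1) Fl] .
  have hm: "h \<cdot> m \<in> mor X' R" using Comp_Hom[OF em(2) h(1)] .
  have "dif (h \<cdot> m) f = zer X' R"
  proof (rule G(2)[OF dif_hom[OF hm f(1)]])
    fix x assume x: "x \<in> mor G X'"
    \<comment> \<open>An arrow from \<open>G\<close> that already lands in \<open>X'\<close> has a
      split preimage: \<open>z\<close> is a section of \<open>k g\<close>, so \<open>b g\<close> is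
      forced to be \<open>f \<cdot> x\<close>.\<close>
    define g where "g = m \<cdot> x"
    have g: "g \<in> ?H" using Comp_Hom[OF x em(2)] by (simp add: g_def)
    have "m \<cdot> x = g \<cdot> Ide C G" using Comp_Ide[OF g] by (simp add: g_def)
    then obtain z where z: "z \<in> mor G (A g)" "a g \<cdot> z = x" "k g \<cdot> z = Ide C G" using A(6)[OF g x Ide_Hom[OF G(1)]] by blast
    have "h \<cdot> m \<cdot> x = h \<cdot> (p \<cdot> \<iota> g)" using Comp_assoc[OF x em(2) h(1)] p(2)[OF g] by (simp add: g_def)
    also have "\<dots> = b g" using comp_ext1[OF h(2) p(1) h(1) i[OF g]] F(2)[OF g] by simp
    also have "\<dots> = b g \<cdot> (k g \<cdot> z)" using z(3) Comp_Ide[OF b(1)[OF g]] by simp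
    also have "\<dots> = f \<cdot> (a g \<cdot> z)" using comp_ext[OF b(2)[OF g] A(2)[OF g] b(1)[OF g] A(1)[OF g] f(1) z(1)] .
    finally have "h \<cdot> m \<cdot> x = f \<cdot> x" using z(2) by simp
    then show "dif (h \<cdot> m) f \<cdot> x = zer G R" using dif_comp[OF hm f(1) x] dif_eq[OF Comp_Hom[OF x hm] Comp_Hom[OF x f(1)]] by simp
  qed
  then have "h \<cdot> m = f" using dif_eq[OF hm f(1)] by simp
  then have "h \<cdot> s = f0" using Comp_assoc[OF em(1,2) h(1)] em(5) f(2) by simp
  then show "\<exists>h\<in>mor X R. h \<cdot> s = f0" using h(1) by blast
qed

text \<open>One simultaneous pushout extends all arrows from \<open>\<X>\<close>-dense subobjects of a generator into
  \<open>Y'\<close>. Such an arrow enters the index set only through its graph on generalised elements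
  from the generator, which makes the index set small.\<close>

lemma generator_extension:
  assumes Y: "torsionfree Y'"
    and G: "G \<in> Obj C" "\<And>X Y f. f \<in> mor X Y \<Longrightarrow> (\<And>h. h \<in> mor G X \<Longrightarrow> f \<cdot> h = zer G Y) \<Longrightarrow> f = zer X Y"
  obtains i Y1 where "i \<in> mor Y' Y1" "quot_iso C \<X> i"
    "\<And>A g f. g \<in> mor A G \<Longrightarrow> is_mono C g \<Longrightarrow> quot_iso C \<X> g \<Longrightarrow> f \<in> mor A Y' \<Longrightarrow> \<exists>h \<in> mor G Y1. h \<cdot> g = i \<cdot> f"
proof -
  have YO: "Y' \<in> Obj C" using Y by (simp add: torsionfree_def)
  define gr where "gr A g f = {(g \<cdot> h, f \<cdot> h) | h. h \<in> mor G A}" for A g f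
  define J where "J = {gr A g f | A g f. g \<in> mor A G \<and> is_mono C g \<and> quot_iso C \<X> g \<and> f \<in> mor A Y'}"
  have "J \<subseteq> Pow (mor G G \<times> mor G Y')" using Comp_Hom by (auto simp: J_def gr_def)
  then have sJ: "small U J" using small_subset small_Pow small_Times locally_small G(1) YO by metis
  have "\<exists>A g f. g \<in> mor A G \<and> is_mono C g \<and> quot_iso C \<X> g \<and> f \<in> mor A Y' \<and> gr A g f = j" if "j \<in> J" for j
    using that unfolding J_def by blast
  then obtain A g f where A: "\<And>j. j \<in> J \<Longrightarrow> g j \<in> mor (A j) G" "\<And>j. j \<in> J \<Longrightarrow> is_mono C (g j)" "\<And>j. j \<in> J \<Longrightarrow> quot_iso C \<X> (g j)"
    "\<And>j. j \<in> J \<Longrightarrow> f j \<in> mor (A j) Y'" "\<And>j. j \<in> J \<Longrightarrow> gr (A j) (g j) (f j) = j" by metis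
  obtain P \<iota> where P: "is_coproduct C J (\<lambda>_. G) P \<iota>" using coproduct_exists[OF sJ, of "\<lambda>_. G"] G(1) by blast
  have AO: "A j \<in> Obj C" if "j \<in> J" for j using hom_obj[OF A(1)[OF that]] by blast
  obtain P' \<iota>' where P': "is_coproduct C J A P' \<iota>'" using coproduct_exists[OF sJ, of A] AO by blast
  note i = coproduct_inj[OF P] and i' = coproduct_inj[OF P'] and PO = coproduct_obj[OF P]
  have ig: "\<iota> j \<cdot> g j \<in> mor (A j) P" if "j \<in> J" for j using Comp_Hom[OF A(1) i] that by blast
  obtain \<phi> where \<phi>: "\<phi> \<in> mor P' P" "\<And>j. j \<in> J \<Longrightarrow> \<phi> \<cdot> \<iota>' j = \<iota> j \<cdot> g j" using coproduct_copair[OF P' PO, of "\<lambda>j. \<iota> j \<cdot> g j"] ig by blast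
  obtain \<psi> where \<psi>: "\<psi> \<in> mor P' Y'" "\<And>j. j \<in> J \<Longrightarrow> \<psi> \<cdot> \<iota>' j = f j" using coproduct_copair[OF P' YO, of f] A(4) by blast
  note \<phi>q = coproduct_quot_iso[OF P' P A(1,2,3) \<phi>]
  obtain B a b p q where B: "a \<in> mor P B" "b \<in> mor Y' B" "p \<in> mor B P" "q \<in> mor B Y'"
    "p \<cdot> a = Ide C P" "q \<cdot> b = Ide C Y'" "p \<cdot> b = zer Y' P" "q \<cdot> a = zer P Y'"
    "\<And>T x y. x \<in> mor T P \<Longrightarrow> y \<in> mor T Y' \<Longrightarrow> \<exists>t \<in> mor T B. p \<cdot> t = x \<and> q \<cdot> t = y"
    "\<And>T t. t \<in> mor T B \<Longrightarrow> p \<cdot> t = zer T P \<Longrightarrow> q \<cdot> t = zer T Y' \<Longrightarrow> t = zer T B"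
    "\<And>Z x y. x \<in> mor P Z \<Longrightarrow> y \<in> mor Y' Z \<Longrightarrow> \<exists>t \<in> mor B Z. t \<cdot> a = x \<and> t \<cdot> b = y"
    "\<And>Z t. t \<in> mor B Z \<Longrightarrow> t \<cdot> a = zer P Z \<Longrightarrow> t \<cdot> b = zer Y' Z \<Longrightarrow> t = zer B Z"
    by (rule obtain_biproduct[OF PO YO]) (blast intro: that)
  have ab: "a \<cdot> \<phi> \<in> mor P' B" "b \<cdot> \<psi> \<in> mor P' B" using Comp_Hom \<phi> \<psi> B by blast+
  \<comment> \<open>The pushout of \<open>\<phi>\<close> along \<open>\<psi>\<close> is the cokernel
    of this difference into the biproduct.\<close>
  define \<kappa> where "\<kappa> = dif (a \<cdot> \<phi>) (b \<cdot> \<psi>)"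
  have \<kappa>: "\<kappa> \<in> mor P' B" using dif_hom[OF ab] by (simp add: \<kappa>_def)
  \<comment> \<open>Consequently an element of the image of \<open>\<kappa>\<close> that lies in the
    summand \<open>Y'\<close> is zero, as \<open>\<phi>\<close> is monic; so \<open>i0\<close> has
    no kernel.\<close>
  have p\<kappa>: "p \<cdot> \<kappa> = \<phi>"
    using comp_dif[OF ab B(3)] Comp_assoc[OF \<phi>(1) B(1,3)] Comp_assoc[OF \<psi>(1) B(2,3)] B(5,7) Ide_Comp[OF \<phi>(1)] zer_comp'[OF \<psi>(1) PO] dif_zer[OF \<phi>(1)]
    by (simp add: \<kappa>_def)
  obtain c Y1 where c: "is_cokernel C c \<kappa>" "c \<in> mor B Y1" "is_epi C c" "c \<cdot> \<kappa> = zer P' Y1" using obtain_cokernel[OF \<kappa>] .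
  define i0 where "i0 = c \<cdot> b"
  define h1 where "h1 = c \<cdot> a"
  have i0: "i0 \<in> mor Y' Y1" and h1: "h1 \<in> mor P Y1" using Comp_Hom[OF B(2) c(2)] Comp_Hom[OF B(1) c(2)] by (simp_all add: i0_def h1_def)
  have eq: "h1 \<cdot> \<phi> = i0 \<cdot> \<psi>"
    using c(4) comp_dif[OF ab c(2)] dif_eq[OF Comp_Hom[OF ab(1) c(2)] Comp_Hom[OF ab(2) c(2)]] Comp_assoc[OF \<phi>(1) B(1) c(2)] Comp_assoc[OF \<psi>(1) B(2) c(2)]
    by (simp add: \<kappa>_def h1_def i0_def)
  have bm: "is_mono C b" using mono_cancel[OF _ B(2,4)] B(6) ide_mono[OF YO] by simp
  have "quot_iso C \<X> i0"
  proof (rule quot_isoI[OF i0])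
    fix T y assume y: "y \<in> mor T Y'" "i0 \<cdot> y = zer T Y1"
    have by': "b \<cdot> y \<in> mor T B" using Comp_Hom[OF y(1) B(2)] .
    have "c \<cdot> (b \<cdot> y) = zer T Y1" using y Comp_assoc[OF y(1) B(2) c(2)] by (simp add: i0_def)
    then obtain S r x where S: "r \<in> mor S T" "is_epi C r" "x \<in> mor S P'" "\<kappa> \<cdot> x = b \<cdot> y \<cdot> r" using cokernel_lift[OF \<kappa> c(1,2) by'] by metis
    have SO: "S \<in> Obj C" using S hom_obj by blast
    have "p \<cdot> (b \<cdot> y \<cdot> r) = zer S P"
      using comp_eq_zer[OF B(2,3) Comp_Hom[OF S(1) y(1)] B(7)] Comp_assoc[OF S(1) y(1) B(2)] by simp
    then have "\<phi> \<cdot> x = zer S P" using comp_ext1[OF p\<kappa> \<kappa> B(3) S(3)] S(4) by simp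
    then have "x = zer S P'" using mono_zerD[OF \<phi>q(1) \<phi>(1) S(3)] by blast
    then have "b \<cdot> y \<cdot> r = zer S B" using S(4) comp_zer'[OF \<kappa> SO] by simp
    then have "b \<cdot> y = zer T B" using epi_zerD[OF S(2,1) by'] by blast
    then have "y = zer T Y'" using mono_zerD[OF bm B(2) y(1)] by blast
    then show "negl \<X> y" using negl_zer hom_obj[OF y(1)] by simp
  next
    fix Z y assume y: "y \<in> mor Y1 Z" "y \<cdot> i0 = zer Y' Z"
    have ZO: "Z \<in> Obj C" using y hom_obj by blast
    have yh: "y \<cdot> h1 \<in> mor P Z" using Comp_Hom[OF h1 y(1)] .
    have "y \<cdot> h1 \<cdot> \<phi> = y \<cdot> (i0 \<cdot> \<psi>)" using Comp_assoc[OF \<phi>(1) h1 y(1)] eq by simp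
    also have "\<dots> = zer P' Z" using comp_eq_zer[OF i0 y(1) \<psi>(1) y(2)] .
    finally have n: "negl \<X> (y \<cdot> h1)" using quot_isoD2[OF \<phi>q(2) \<phi>(1) yh] by blast
    have yc: "y \<cdot> c \<in> mor B Z" and yp: "y \<cdot> h1 \<cdot> p \<in> mor B Z" using Comp_Hom[OF c(2) y(1)] Comp_Hom[OF B(3) yh] by auto
    \<comment> \<open>\<open>y \<cdot> c\<close> vanishes on the summand \<open>Y'\<close>, so it is
      its restriction to \<open>P\<close> composed with the projection; that restriction is
      negligible.\<close>
    have "dif (y \<cdot> c) (y \<cdot> h1 \<cdot> p) = zer B Z"
    proof (rule B(12)[OF dif_hom[OF yc yp]])
      have "y \<cdot> c \<cdot> a = y \<cdot> h1" "y \<cdot> h1 \<cdot> p \<cdot> a = y \<cdot> h1"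
        using Comp_assoc[OF B(1) c(2) y(1)] Comp_assoc[OF B(1,3) yh] B(5) Comp_Ide[OF yh] by (simp_all add: h1_def)
      then show "dif (y \<cdot> c) (y \<cdot> h1 \<cdot> p) \<cdot> a = zer P Z" using dif_comp[OF yc yp B(1)] dif_eq[OF yh yh] by simp
      have "y \<cdot> c \<cdot> b = zer Y' Z" "y \<cdot> h1 \<cdot> p \<cdot> b = zer Y' Z"
        using Comp_assoc[OF B(2) c(2) y(1)] y(2) Comp_assoc[OF B(2,3) yh] B(7) comp_zer'[OF yh YO] by (simp_all add: i0_def)
      then show "dif (y \<cdot> c) (y \<cdot> h1 \<cdot> p) \<cdot> b = zer Y' Z" using dif_comp[OF yc yp B(2)] dif_zer[OF zer_hom[OF YO ZO]] by simp
    qed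
    then have "y \<cdot> c = y \<cdot> h1 \<cdot> p" using dif_eq[OF yc yp] by simp
    then have "negl \<X> (y \<cdot> c)" using negl_comp_right[OF n yh B(3)] by simp
    then show "negl \<X> y" using negl_epi_cancel[OF _ c(3,2) y(1)] by blast
  qed
  moreover have "\<exists>h \<in> mor G Y1. h \<cdot> g' = i0 \<cdot> f'" if g': "g' \<in> mor A' G" "is_mono C g'" "quot_iso C \<X> g'" and f': "f' \<in> mor A' Y'" for A' g' f'
  proof -
    define j where "j = gr A' g' f'"
    have j: "j \<in> J" using g' f' by (auto simp: J_def j_def)
    define h where "h = h1 \<cdot> \<iota> j"
    have h: "h \<in> mor G Y1" using Comp_Hom[OF i[OF j] h1] by (simp add: h_def)
    have hg: "h \<cdot> g j = i0 \<cdot> f j"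
    proof -
      have "h \<cdot> g j = h1 \<cdot> (\<phi> \<cdot> \<iota>' j)" using Comp_assoc[OF A(1)[OF j] i[OF j] h1] \<phi>(2)[OF j] by (simp add: h_def)
      also have "\<dots> = i0 \<cdot> (\<psi> \<cdot> \<iota>' j)" using comp_ext[OF eq \<phi>(1) h1 \<psi>(1) i0 i'[OF j]] .
      finally show ?thesis using \<psi>(2)[OF j] by simp
    qed
    have hg': "h \<cdot> g' \<in> mor A' Y1" and if': "i0 \<cdot> f' \<in> mor A' Y1" using Comp_Hom[OF g'(1) h] Comp_Hom[OF f' i0] by auto
    have "dif (h \<cdot> g') (i0 \<cdot> f') = zer A' Y1"
    proof (rule G(2)[OF dif_hom[OF hg' if']])
      fix x assume x: "x \<in> mor G A'"
      \<comment> \<open>The index \<open>j\<close> is the graph of the pair \<open>(g', f')\<close>,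
        so each element of \<open>A'\<close> has a partner in the chosen \<open>A j\<close> with the
        same two values.\<close>
      have "(g' \<cdot> x, f' \<cdot> x) \<in> gr (A j) (g j) (f j)" using A(5)[OF j] x by (auto simp: j_def gr_def)
      then obtain y where y: "y \<in> mor G (A j)" "g j \<cdot> y = g' \<cdot> x" "f j \<cdot> y = f' \<cdot> x" by (auto simp: gr_def)
      have "h \<cdot> g' \<cdot> x = h \<cdot> (g j \<cdot> y)" using Comp_assoc[OF x g'(1) h] y(2) by simp
      also have "\<dots> = i0 \<cdot> (f j \<cdot> y)" using comp_ext[OF hg A(1)[OF j] h A(4)[OF j] i0 y(1)] .
      also have "\<dots> = i0 \<cdot> f' \<cdot> x" using y(3) Comp_assoc[OF x f' i0] by simp
      finally show "dif (h \<cdot> g') (i0 \<cdot> f') \<cdot> x = zer G Y1"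
        using dif_comp[OF hg' if' x] dif_eq[OF Comp_Hom[OF x hg'] Comp_Hom[OF x if']] by simp
    qed
    then show ?thesis using dif_eq[OF hg' if'] h by auto
  qed
  ultimately show ?thesis using that[OF i0] by blast
qed

text \<open>One extension step suffices: given an arrow from a dense subobject \<open>A\<close> of
  \<open>G\<close> to \<open>R\<close>, pulling back \<open>Y'\<close> leaves a dense
  \<open>B\<close> that maps into \<open>Y'\<close>, and from there
  \<open>generator_extension\<close> reaches \<open>Y1\<close>. The extension agrees with the given
  arrow on \<open>B\<close>, hence on \<open>A\<close>, since \<open>R\<close> is
  torsionfree.\<close>

lemma reflection_exists:
  assumes Y: "Y \<in> Obj C"
  obtains \<eta> R where "\<eta> \<in> mor Y R" "quot_iso C \<X> \<eta>" "torsionfree R" "closed R"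
proof -
  obtain G where G: "G \<in> Obj C" "\<And>X Y f. f \<in> mor X Y \<Longrightarrow> (\<And>h. h \<in> mor G X \<Longrightarrow> f \<cdot> h = zer G Y) \<Longrightarrow> f = zer X Y"
    by (rule obtain_generator) (blast intro: that)
  obtain q0 Y' where q0: "q0 \<in> mor Y Y'" "quot_iso C \<X> q0" "torsionfree Y'" using torsion_quotient[OF Y] .
  obtain i Y1 where i: "i \<in> mor Y' Y1" "quot_iso C \<X> i"
    "\<And>A g f. g \<in> mor A G \<Longrightarrow> is_mono C g \<Longrightarrow> quot_iso C \<X> g \<Longrightarrow> f \<in> mor A Y' \<Longrightarrow> \<exists>h \<in> mor G Y1. h \<cdot> g = i \<cdot> f"
    by (rule generator_extension[OF q0(3) G]) (assumption, assumption, blast intro: that)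
  have Y1: "Y1 \<in> Obj C" using i hom_obj by blast
  obtain q1 R where q1: "q1 \<in> mor Y1 R" "quot_iso C \<X> q1" "torsionfree R" using torsion_quotient[OF Y1] .
  define j where "j = q1 \<cdot> i"
  have j: "j \<in> mor Y' R" "quot_iso C \<X> j" using Comp_Hom[OF i(1) q1(1)] quot_iso_comp[OF i(2,1) q1(2,1)] by (simp_all add: j_def)
  have jm: "is_mono C j"
    by (rule mono_zerI[OF j(1)]) (use torsionfree_negl[OF q0(3)] quot_isoD1[OF j(2,1)] in blast)
  have "closed R"
  proof (rule closed_from_generator[OF q1(3) G])
    fix A g f assume g: "g \<in> mor A G" "is_mono C g" "quot_iso C \<X> g" and f: "f \<in> mor A R"
    obtain B f' b where B: "f' \<in> mor B Y'" "b \<in> mor B A" "j \<cdot> f' = f \<cdot> b" "quot_iso C \<X> b" "is_mono C b"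
      by (rule pullback_quot_iso[OF j f]) (use jm in \<open>blast intro: that\<close>)
    have gb: "g \<cdot> b \<in> mor B G" "is_mono C (g \<cdot> b)" "quot_iso C \<X> (g \<cdot> b)"
      using Comp_Hom[OF B(2) g(1)] mono_comp[OF B(5) g(2) B(2) g(1)] quot_iso_comp[OF B(4,2) g(3,1)] by auto
    obtain h where h: "h \<in> mor G Y1" "h \<cdot> (g \<cdot> b) = i \<cdot> f'" using i(3)[OF gb B(1)] by blast
    have qh: "q1 \<cdot> h \<in> mor G R" using Comp_Hom[OF h(1) q1(1)] .
    have qhg: "q1 \<cdot> h \<cdot> g \<in> mor A R" using Comp_Hom[OF g(1) qh] .
    have "q1 \<cdot> h \<cdot> g \<cdot> b = q1 \<cdot> (h \<cdot> (g \<cdot> b))"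
      using Comp_assoc[OF B(2) g(1) qh] Comp_assoc[OF gb(1) h(1) q1(1)] by simp
    also have "\<dots> = f \<cdot> b" using h(2) Comp_assoc[OF B(1) i(1) q1(1)] B(3) by (simp add: j_def)
    finally have "dif (q1 \<cdot> h \<cdot> g) f \<cdot> b = zer B R" using dif_comp[OF qhg f B(2)] dif_eq[OF Comp_Hom[OF B(2) qhg] Comp_Hom[OF B(2) f]] by simp
    then have "negl \<X> (dif (q1 \<cdot> h \<cdot> g) f)" using quot_isoD2[OF B(4,2) dif_hom[OF qhg f]] by blast
    then have "q1 \<cdot> h \<cdot> g = f" using torsionfree_negl[OF q1(3) dif_hom[OF qhg f]] dif_eq[OF qhg f] by blast
    then show "\<exists>h\<in>mor G R. h \<cdot> g = f" using qh by blast
  qed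
  moreover have "j \<cdot> q0 \<in> mor Y R" "quot_iso C \<X> (j \<cdot> q0)" using Comp_Hom[OF q0(1) j(1)] quot_iso_comp[OF q0(2,1) j(2,1)] by auto
  ultimately show ?thesis using that q1(3) by blast
qed

end

section \<open>The right adjoint of the quotient functor\<close>

text \<open>An arrow \<open>X \<rightarrow> Y\<close> of the quotient category is encoded by its value, the arrow
  \<open>h : X \<rightarrow> R Y\<close> with \<open>h s = \<eta> f\<close> for all roofs \<open>(s, f)\<close> representing it. The quotient category
  thus becomes the Kleisli category of the reflection \<open>R\<close>.\<close>

locale reflection = serre C \<X> for C :: "('o, 'a, 'm) preadd_cat_scheme" (structure) and \<X> :: "'o set" +
  fixes R :: "'o \<Rightarrow> 'o" and \<eta> :: "'o \<Rightarrow> 'a"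
  assumes unit_hom: "Y \<in> Obj C \<Longrightarrow> \<eta> Y \<in> Hom C Y (R Y)"
    and unit_iso: "Y \<in> Obj C \<Longrightarrow> quot_iso C \<X> (\<eta> Y)"
    and extension: "Y \<in> Obj C \<Longrightarrow> s \<in> Hom C P X \<Longrightarrow> quot_iso C \<X> s \<Longrightarrow> f \<in> Hom C P (R Y) \<Longrightarrow>
      \<exists>!h. h \<in> Hom C X (R Y) \<and> h \<cdot> s = f"
begin

definition val :: "'a \<times> 'a \<Rightarrow> 'a" where
  "val r = (THE h. h \<in> mor (Cod C (fst r)) (R (Cod C (snd r))) \<and> h \<cdot> fst r = \<eta> (Cod C (snd r)) \<cdot> snd r)"

text \<open>The arrow of the quotient category with value \<open>h\<close>, as the class of all
  roofs representing it; see \<open>roof_class_cls\<close> and \<open>arr_cls\<close>.\<close>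

definition cls :: "'o \<Rightarrow> 'o \<Rightarrow> 'a \<Rightarrow> ('a \<times> 'a) set" where
  "cls X Y h = {r \<in> roofs C \<X>. Cod C (fst r) = X \<and> Cod C (snd r) = Y \<and> val r = h}"

text \<open>The Kleisli extension of an arrow \<open>Y -> R Z\<close> along the unit.\<close>

definition hat :: "'o \<Rightarrow> 'o \<Rightarrow> 'a \<Rightarrow> 'a" where
  "hat Y Z k = (THE h. h \<in> mor (R Y) (R Z) \<and> h \<cdot> \<eta> Y = k)"

text \<open>Inverse to \<open>cls\<close> for fixed ends. Any representative will do, since
  equivalent roofs have the same value.\<close>

definition Val :: "('a \<times> 'a) set \<Rightarrow> 'a" where
  "Val a = val (SOME r. r \<in> a)"

abbreviation "Q \<equiv> quot_cat C \<X>"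

lemma roofI: "s \<in> mor P X \<Longrightarrow> quot_iso C \<X> s \<Longrightarrow> f \<in> mor P Y \<Longrightarrow> (s, f) \<in> roofs C \<X>"
  by (auto simp: roofs_def hom_iff)

lemma roofE:
  assumes "r \<in> roofs C \<X>"
  obtains s f P X Y where "r = (s, f)" "s \<in> mor P X" "quot_iso C \<X> s" "f \<in> mor P Y" "Y \<in> Obj C" "X \<in> Obj C"
proof -
  obtain s f where r: "r = (s, f)" "quot_iso C \<X> s" "f \<in> Arr C" "Dom C s = Dom C f" using assms by (auto simp: roofs_def)
  have s: "s \<in> mor (Dom C s) (Cod C s)" using r(2) homI by (simp add: quot_iso_def)
  have f: "f \<in> mor (Dom C s) (Cod C f)" using homI[OF r(3)] r(4) by simp
  show ?thesis using that[OF r(1) s r(2) f] hom_obj s f by blast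
qed

lemma roof_pairE:
  assumes "(s, f) \<in> roofs C \<X>"
  obtains P X Y where "s \<in> mor P X" "quot_iso C \<X> s" "f \<in> mor P Y" "Y \<in> Obj C"
  using roofE[OF assms] by blast

lemma unit_comp: "f \<in> mor P Y \<Longrightarrow> \<eta> Y \<cdot> f \<in> mor P (R Y)"
  using Comp_Hom unit_hom hom_obj by blast

lemma val_prop:
  assumes "s \<in> mor P X" "quot_iso C \<X> s" "f \<in> mor P Y"
  shows "val (s, f) \<in> mor X (R Y)" "val (s, f) \<cdot> s = \<eta> Y \<cdot> f"
proof -
  have Y: "Y \<in> Obj C" using assms hom_obj by blast
  have e: "Cod C s = X" "Cod C f = Y" using assms hom_DC by blast+
  have "val (s, f) \<in> mor X (R Y) \<and> val (s, f) \<cdot> s = \<eta> Y \<cdot> f"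
    unfolding val_def fst_conv snd_conv e by (rule theI'[OF extension[OF Y assms(1,2) unit_comp[OF assms(3)]]])
  then show "val (s, f) \<in> mor X (R Y)" "val (s, f) \<cdot> s = \<eta> Y \<cdot> f" by auto
qed

lemma extension_unique:
  "Y \<in> Obj C \<Longrightarrow> s \<in> mor P X \<Longrightarrow> quot_iso C \<X> s \<Longrightarrow> h \<in> mor X (R Y) \<Longrightarrow> k \<in> mor X (R Y) \<Longrightarrow> h \<cdot> s = k \<cdot> s \<Longrightarrow> h = k"
  using extension[of Y s P X "k \<cdot> s"] Comp_Hom by blast

lemma val_unique:
  assumes "s \<in> mor P X" "quot_iso C \<X> s" "f \<in> mor P Y" "h \<in> mor X (R Y)" "h \<cdot> s = \<eta> Y \<cdot> f"
  shows "val (s, f) = h"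
  using extension_unique[OF _ assms(1,2) val_prop(1)[OF assms(1-3)] assms(4)] val_prop(2)[OF assms(1-3)] assms(5) hom_obj[OF assms(3)] by simp

lemma hat_prop:
  assumes k: "k \<in> mor Y (R Z)" and Z: "Z \<in> Obj C"
  shows "hat Y Z k \<in> mor (R Y) (R Z)" "hat Y Z k \<cdot> \<eta> Y = k"
proof -
  have Y: "Y \<in> Obj C" using k hom_obj by blast
  have "hat Y Z k \<in> mor (R Y) (R Z) \<and> hat Y Z k \<cdot> \<eta> Y = k"
    unfolding hat_def by (rule theI'[OF extension[OF Z unit_hom[OF Y] unit_iso[OF Y] k]])
  then show "hat Y Z k \<in> mor (R Y) (R Z)" "hat Y Z k \<cdot> \<eta> Y = k" by auto
qed

lemma hat_unique:
  assumes k: "k \<in> mor Y (R Z)" and Z: "Z \<in> Obj C" and h: "h \<in> mor (R Y) (R Z)" "h \<cdot> \<eta> Y = k"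
  shows "hat Y Z k = h"
proof -
  have Y: "Y \<in> Obj C" using k hom_obj by blast
  show ?thesis using extension_unique[OF Z unit_hom[OF Y] unit_iso[OF Y] hat_prop(1)[OF k Z] h(1)] hat_prop(2)[OF k Z] h(2) by simp
qed

text \<open>For the converse, compare the two roofs over the pullback \<open>W\<close> of
  \<open>s\<close> and \<open>t\<close>. Equal values mean that the unit kills
  \<open>f p - g q\<close>, so this difference is negligible, and the roofs agree on its kernel
  \<open>K\<close>, which is dense in \<open>W\<close>.\<close>

lemma roof_equiv_iff:
  "roof_equiv C \<X> r r' \<longleftrightarrow> r \<in> roofs C \<X> \<and> r' \<in> roofs C \<X> \<and> Cod C (fst r) = Cod C (fst r') \<and>
     Cod C (snd r) = Cod C (snd r') \<and> val r = val r'"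
proof
  obtain s f where r: "r = (s, f)" by (cases r)
  obtain t g where r': "r' = (t, g)" by (cases r')
  assume "roof_equiv C \<X> r r'"
  then have e: "r \<in> roofs C \<X>" "r' \<in> roofs C \<X>" "Cod C s = Cod C t" "Cod C f = Cod C g" and
    "\<exists>W. \<exists>u \<in> mor W (Dom C s). \<exists>v \<in> mor W (Dom C t). s \<cdot> u = t \<cdot> v \<and> f \<cdot> u = g \<cdot> v \<and> quot_iso C \<X> (s \<cdot> u)"
    by (auto simp: roof_equiv_def r r')
  then obtain W u v where uv: "u \<in> mor W (Dom C s)" "v \<in> mor W (Dom C t)" "s \<cdot> u = t \<cdot> v" "f \<cdot> u = g \<cdot> v" "quot_iso C \<X> (s \<cdot> u)" by blast
  obtain P X Y where s: "s \<in> mor P X" "quot_iso C \<X> s" "f \<in> mor P Y" "Y \<in> Obj C" using roof_pairE[OF e(1)[unfolded r]] .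
  obtain P' X' Y' where t: "t \<in> mor P' X'" "quot_iso C \<X> t" "g \<in> mor P' Y'" using roof_pairE[OF e(2)[unfolded r']] .
  have XY: "X' = X" "Y' = Y" "Dom C s = P" "Dom C t = P'" using e(3,4) s t hom_DC by metis+
  have u: "u \<in> mor W P" and v: "v \<in> mor W P'" and t: "t \<in> mor P' X" "g \<in> mor P' Y" "quot_iso C \<X> t" using uv t XY by auto
  note vs = val_prop[OF s(1,2,3)] and vt = val_prop[OF t(1,3,2)]
  have "val (s, f) \<cdot> (s \<cdot> u) = \<eta> Y \<cdot> (f \<cdot> u)" using comp_ext[OF vs(2) s(1) vs(1) s(3) unit_hom[OF s(4)] u] .
  also have "\<dots> = val (t, g) \<cdot> (t \<cdot> v)" using uv(4) comp_ext[OF vt(2) t(1) vt(1) t(2) unit_hom[OF s(4)] v] by simp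
  finally have "val (s, f) = val (t, g)" using extension_unique[OF s(4) Comp_Hom[OF u s(1)] uv(5) vs(1) vt(1)] uv(3) by simp
  then show "r \<in> roofs C \<X> \<and> r' \<in> roofs C \<X> \<and> Cod C (fst r) = Cod C (fst r') \<and>
     Cod C (snd r) = Cod C (snd r') \<and> val r = val r'" using e r r' by simp
next
  assume a: "r \<in> roofs C \<X> \<and> r' \<in> roofs C \<X> \<and> Cod C (fst r) = Cod C (fst r') \<and>
     Cod C (snd r) = Cod C (snd r') \<and> val r = val r'"
  obtain s f P X Y where s: "r = (s, f)" "s \<in> mor P X" "quot_iso C \<X> s" "f \<in> mor P Y" "Y \<in> Obj C" using a roofE by metis
  obtain t g P' X' Y' where t: "r' = (t, g)" "t \<in> mor P' X'" "quot_iso C \<X> t" "g \<in> mor P' Y'" using a roofE by metis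
  have XY: "X' = X" "Y' = Y" using a s t hom_DC by (metis fst_conv snd_conv)+
  have t': "t \<in> mor P' X" "g \<in> mor P' Y" using t XY by auto
  note vs = val_prop[OF s(2,3,4)] and vt = val_prop[OF t'(1) t(3) t'(2)]
  have vv: "val (s, f) = val (t, g)" using a s t by simp
  obtain W p q where W: "p \<in> mor W P" "q \<in> mor W P'" "s \<cdot> p = t \<cdot> q" "quot_iso C \<X> q"
    by (rule pullback_quot_iso[OF s(2,3) t'(1)]) (blast intro: that)
  have fp: "f \<cdot> p \<in> mor W Y" "g \<cdot> q \<in> mor W Y" using Comp_Hom W s t' by blast+
  note d = dif_hom[OF fp] and eh = unit_hom[OF s(5)]
  obtain k K where k: "is_kernel C k (dif (f \<cdot> p) (g \<cdot> q))" "k \<in> mor K W" "is_mono C k" "dif (f \<cdot> p) (g \<cdot> q) \<cdot> k = zer K Y"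
    using obtain_kernel[OF d] .
  have "\<eta> Y \<cdot> (f \<cdot> p) = val (s, f) \<cdot> (s \<cdot> p)" using comp_ext[OF vs(2) s(2) vs(1) s(4) eh W(1)] by simp
  also have "\<dots> = \<eta> Y \<cdot> (g \<cdot> q)" using W(3) vv comp_ext[OF vt(2) t'(1) vt(1) t'(2) eh W(2)] by simp
  finally have "\<eta> Y \<cdot> dif (f \<cdot> p) (g \<cdot> q) = zer W (R Y)"
    using comp_dif[OF fp eh] dif_eq[OF Comp_Hom[OF fp(1) eh] Comp_Hom[OF fp(2) eh]] by simp
  then have n: "negl \<X> (dif (f \<cdot> p) (g \<cdot> q))" using quot_isoD1[OF unit_iso[OF s(5)] eh d] by blast
  \<comment> \<open>The kernel of a negligible arrow is dense: \<open>W / K\<close> is its image, an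
    object of \<open>\<X>\<close>.\<close>
  have kq: "quot_iso C \<X> k"
  proof (rule mono_quot_iso[OF k(3,2)])
    fix Z y assume y: "y \<in> mor W Z" "y \<cdot> k = zer K Z"
    obtain I e m where em: "e \<in> mor W I" "m \<in> mor I Y" "is_epi C e" "is_mono C m" "m \<cdot> e = dif (f \<cdot> p) (g \<cdot> q)" using image_factorization[OF d] .
    have I: "I \<in> \<X>" using negl_image[OF em(1-4)] n em(5) by simp
    obtain h where h: "h \<in> mor I Z" "h \<cdot> e = y"
    proof (rule epi_factor_all[OF em(3,1) y(1)])
      fix T t assume t: "t \<in> mor T W" "e \<cdot> t = zer T I"
      have "dif (f \<cdot> p) (g \<cdot> q) \<cdot> t = zer T Y" using comp_ext1[OF em(5,1,2) t(1)] t(2) comp_zer'[OF em(2)] hom_obj[OF t(1)] by simp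
      then obtain x where "x \<in> mor T K" "k \<cdot> x = t" using kernelE[OF k(1) d k(2) t(1)] by metis
      then show "y \<cdot> t = zer T Z" using comp_eq_zer[OF k(2) y(1) _ y(2)] by blast
    qed
    then show "negl \<X> y" using I em(1) negl_def by blast
  qed
  have pk: "p \<cdot> k \<in> mor K P" "q \<cdot> k \<in> mor K P'" using Comp_Hom W k by blast+
  have "s \<cdot> (p \<cdot> k) = t \<cdot> (q \<cdot> k)" using comp_ext[OF W(3,1) s(2) W(2) t'(1) k(2)] .
  moreover have "f \<cdot> (p \<cdot> k) = g \<cdot> (q \<cdot> k)"
    using k(4) dif_comp[OF fp k(2)] dif_eq[OF Comp_Hom[OF k(2) fp(1)] Comp_Hom[OF k(2) fp(2)]]
      Comp_assoc[OF k(2) W(1) s(4)] Comp_assoc[OF k(2) W(2) t'(2)] by simp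
  moreover have "quot_iso C \<X> (t \<cdot> (q \<cdot> k))" using quot_iso_comp[OF quot_iso_comp[OF kq k(2) W(4,2)] pk(2) t(3) t'(1)] .
  moreover have "Dom C s = P" "Dom C t = P'" using s t hom_DC by blast+
  ultimately have "\<exists>W. \<exists>u \<in> mor W (Dom C s). \<exists>v \<in> mor W (Dom C t). s \<cdot> u = t \<cdot> v \<and> f \<cdot> u = g \<cdot> v \<and> quot_iso C \<X> (s \<cdot> u)"
    using pk by metis
  then show "roof_equiv C \<X> r r'" using a by (simp add: roof_equiv_def s(1) t(1))
qed

lemma roof_class_cls: "r \<in> roofs C \<X> \<Longrightarrow> roof_class C \<X> r = cls (Cod C (fst r)) (Cod C (snd r)) (val r)"
  by (auto simp: roof_class_def cls_def roof_equiv_iff)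

text \<open>The pullback of the unit along \<open>h\<close> is a roof with value
  \<open>h\<close>.\<close>

lemma cls_roof:
  assumes h: "h \<in> mor X (R Y)" and Y: "Y \<in> Obj C"
  obtains s f P where "s \<in> mor P X" "quot_iso C \<X> s" "f \<in> mor P Y" "(s, f) \<in> cls X Y h" "roof_class C \<X> (s, f) = cls X Y h"
    "(s, f) \<in> roofs C \<X>"
proof -
  obtain P f s where P: "f \<in> mor P Y" "s \<in> mor P X" "\<eta> Y \<cdot> f = h \<cdot> s" "quot_iso C \<X> s"
    by (rule pullback_quot_iso[OF unit_hom[OF Y] unit_iso[OF Y] h]) (blast intro: that)
  have v: "val (s, f) = h" using val_unique[OF P(2,4,1) h] P(3) by simp
  have r: "(s, f) \<in> roofs C \<X>" using roofI[OF P(2,4,1)] .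
  have c: "Cod C s = X" "Cod C f = Y" using P hom_DC by blast+
  show ?thesis using that[OF P(2,4,1) _ _ r] roof_class_cls[OF r] r v c by (simp add: cls_def)
qed

lemma cls_some:
  assumes h: "h \<in> mor X (R Y)" and Y: "Y \<in> Obj C"
  shows "(SOME r. r \<in> cls X Y h) \<in> cls X Y h"
  using cls_roof[OF assms] someI by metis

lemma Val_cls: "h \<in> mor X (R Y) \<Longrightarrow> Y \<in> Obj C \<Longrightarrow> Val (cls X Y h) = h"
  using cls_some[of h X Y] by (auto simp: Val_def cls_def)

lemma quot_obj: "Obj Q = Obj C"
  by (simp add: quot_cat_def)

lemma cls_hom:
  assumes h: "h \<in> mor X (R Y)" and Y: "Y \<in> Obj C"
  shows "cls X Y h \<in> Hom Q X Y"
proof -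
  obtain r where "r \<in> roofs C \<X>" "roof_class C \<X> r = cls X Y h" using cls_roof[OF assms] by metis
  then have "cls X Y h \<in> Arr Q" by (force simp: quot_cat_def)
  moreover have "Dom Q (cls X Y h) = X" "Cod Q (cls X Y h) = Y"
    using cls_some[OF assms] by (auto simp: quot_cat_def cls_def)
  ultimately show ?thesis by (simp add: Hom_def)
qed

lemma arr_cls:
  assumes "a \<in> Arr Q"
  obtains X Y h where "h \<in> mor X (R Y)" "X \<in> Obj C" "Y \<in> Obj C" "a = cls X Y h"
proof -
  obtain r where r: "r \<in> roofs C \<X>" "a = roof_class C \<X> r" using assms by (auto simp: quot_cat_def)
  obtain s f P X Y where s: "r = (s, f)" "s \<in> mor P X" "quot_iso C \<X> s" "f \<in> mor P Y" "Y \<in> Obj C" "X \<in> Obj C" using roofE[OF r(1)] .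
  have "a = cls X Y (val r)" using r roof_class_cls[OF r(1)] s hom_DC by simp
  then show ?thesis using that val_prop(1)[OF s(2-4)] s by blast
qed

lemma hom_cls:
  assumes "a \<in> Hom Q X Y"
  obtains h where "h \<in> mor X (R Y)" "X \<in> Obj C" "Y \<in> Obj C" "a = cls X Y h"
proof -
  have a: "a \<in> Arr Q" "Dom Q a = X" "Cod Q a = Y" using assms by (auto simp: Hom_def)
  obtain X' Y' h where h: "h \<in> mor X' (R Y')" "X' \<in> Obj C" "Y' \<in> Obj C" "a = cls X' Y' h" using arr_cls[OF a(1)] .
  have "a \<in> Hom Q X' Y'" using cls_hom[OF h(1,3)] h(4) by simp
  then have "X' = X" "Y' = Y" using a by (auto simp: Hom_def)
  then show ?thesis using that h by blast
qed

text \<open>Every roof that arises from representatives and a completed square has the value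
  \<open>hat Y Z k \<cdot> h\<close>, so the composite does not depend on these choices. That it is
  a full class and not empty comes from one square obtained by pullback.\<close>

lemma comp_cls:
  assumes h: "h \<in> mor X (R Y)" and k: "k \<in> mor Y (R Z)" and Z: "Z \<in> Obj C"
  shows "cls Y Z k \<cdot>\<^bsub>Q\<^esub> cls X Y h = cls X Z (hat Y Z k \<cdot> h)"
proof -
  have Y: "Y \<in> Obj C" using k hom_obj by blast
  note hk = hat_prop[OF k Z]
  have kh: "hat Y Z k \<cdot> h \<in> mor X (R Z)" using Comp_Hom[OF h hk(1)] .
  have key: "val (s \<cdot> u, g \<cdot> v) = hat Y Z k \<cdot> h \<and> (s \<cdot> u, g \<cdot> v) \<in> roofs C \<X> \<and> Cod C (s \<cdot> u) = X \<and> Cod C (g \<cdot> v) = Z"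
    if sf: "(s, f) \<in> cls X Y h" and tg: "(t, g) \<in> cls Y Z k" and u: "u \<in> mor W (Dom C f)" and v: "v \<in> mor W (Dom C t)"
      and uq: "quot_iso C \<X> u" and eq: "f \<cdot> u = t \<cdot> v" for s f t g W u v
  proof -
    have "(s, f) \<in> roofs C \<X>" "(t, g) \<in> roofs C \<X>" using sf tg by (auto simp: cls_def)
    then obtain P X' Y' P2 Y2 Z' where 1: "s \<in> mor P X'" "quot_iso C \<X> s" "f \<in> mor P Y'"
      and 2: "t \<in> mor P2 Y2" "quot_iso C \<X> t" "g \<in> mor P2 Z'" using roofE by (metis prod.inject)
    have "Cod C s = X" "Cod C f = Y" "Cod C t = Y" "Cod C g = Z" using sf tg by (auto simp: cls_def)
    then have e: "X' = X" "Y' = Y" "Y2 = Y" "Z' = Z" "Dom C f = P" "Dom C t = P2" using 1 2 hom_DC by metis+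
    have s: "s \<in> mor P X" and f: "f \<in> mor P Y" and t: "t \<in> mor P2 Y" and g: "g \<in> mor P2 Z" and u: "u \<in> mor W P" and v: "v \<in> mor W P2"
      using 1 2 e u v by auto
    have vh: "val (s, f) = h" and vk: "val (t, g) = k" using sf tg by (auto simp: cls_def)
    note ph = val_prop(2)[OF s 1(2) f, unfolded vh] and pk = val_prop(2)[OF t 2(2) g, unfolded vk]
    have su: "s \<cdot> u \<in> mor W X" "quot_iso C \<X> (s \<cdot> u)" "g \<cdot> v \<in> mor W Z"
      using Comp_Hom[OF u s] quot_iso_comp[OF uq u 1(2) s] Comp_Hom[OF v g] by auto
    have "hat Y Z k \<cdot> h \<cdot> (s \<cdot> u) = hat Y Z k \<cdot> (h \<cdot> (s \<cdot> u))" using Comp_assoc[OF su(1) h hk(1)] .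
    also have "h \<cdot> (s \<cdot> u) = \<eta> Y \<cdot> (f \<cdot> u)" using comp_ext[OF ph s h f unit_hom[OF Y] u] .
    also have "hat Y Z k \<cdot> (\<eta> Y \<cdot> (f \<cdot> u)) = k \<cdot> (t \<cdot> v)" using comp_ext1[OF hk(2) unit_hom[OF Y] hk(1) Comp_Hom[OF u f]] eq by simp
    also have "\<dots> = \<eta> Z \<cdot> (g \<cdot> v)" using comp_ext[OF pk t k g unit_hom[OF Z] v] .
    finally have "val (s \<cdot> u, g \<cdot> v) = hat Y Z k \<cdot> h" using val_unique[OF su(1,2,3) kh] by blast
    then show ?thesis using roofI[OF su] hom_DC(2)[OF su(1)] hom_DC(2)[OF su(3)] by simp
  qed
  obtain s f P where s: "s \<in> mor P X" "quot_iso C \<X> s" "f \<in> mor P Y" "(s, f) \<in> cls X Y h" by (rule cls_roof[OF h Y]) (blast intro: that)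
  obtain t g P2 where t: "t \<in> mor P2 Y" "quot_iso C \<X> t" "g \<in> mor P2 Z" "(t, g) \<in> cls Y Z k" by (rule cls_roof[OF k Z]) (blast intro: that)
  obtain W v u where W: "v \<in> mor W P2" "u \<in> mor W P" "t \<cdot> v = f \<cdot> u" "quot_iso C \<X> u"
    by (rule pullback_quot_iso[OF t(1,2) s(3)]) (blast intro: that)
  have u: "u \<in> mor W (Dom C f)" and v: "v \<in> mor W (Dom C t)" using W hom_DC(1)[OF s(3)] hom_DC(1)[OF t(1)] by auto
  have "r \<in> quot_comp C \<X> (cls Y Z k) (cls X Y h) \<longleftrightarrow> r \<in> cls X Z (hat Y Z k \<cdot> h)" for r
  proof
    assume "r \<in> quot_comp C \<X> (cls Y Z k) (cls X Y h)"
    then show "r \<in> cls X Z (hat Y Z k \<cdot> h)" unfolding quot_comp_def using key by (force simp: roof_equiv_iff cls_def)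
  next
    assume r: "r \<in> cls X Z (hat Y Z k \<cdot> h)"
    have "roof_equiv C \<X> (s \<cdot> u, g \<cdot> v) r" using key[OF s(4) t(4) u v W(4) W(3)[symmetric]] r by (simp add: roof_equiv_iff cls_def)
    then show "r \<in> quot_comp C \<X> (cls Y Z k) (cls X Y h)" unfolding quot_comp_def using s(4) t(4) u v W(3)[symmetric] W(4) by blast
  qed
  then show ?thesis by (auto simp: quot_cat_def)
qed

lemma functor_cls:
  assumes f: "f \<in> mor X Y" shows "quot_functor_arr C \<X> f = cls X Y (\<eta> Y \<cdot> f)"
proof -
  have XY: "X \<in> Obj C" "Y \<in> Obj C" using f hom_obj by auto
  have D: "Dom C f = X" "Cod C f = Y" using f hom_DC by blast+
  note i = Ide_Hom[OF XY(1)]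
  have "val (Ide C X, f) = \<eta> Y \<cdot> f"
    using val_unique[OF i quot_iso_ide[OF XY(1)] f unit_comp[OF f]] Comp_Ide[OF unit_comp[OF f]] by simp
  then show ?thesis using roof_class_cls[OF roofI[OF i quot_iso_ide[OF XY(1)] f]] hom_DC(2)[OF i] D
    by (simp add: quot_functor_arr_def)
qed

lemma ide_cls: assumes X: "X \<in> Obj C" shows "Ide Q X = cls X X (\<eta> X)"
  using functor_cls[OF Ide_Hom[OF X]] Comp_Ide[OF unit_hom[OF X]] hom_DC[OF Ide_Hom[OF X]]
  by (simp add: quot_functor_arr_def quot_cat_def)

text \<open>The Kleisli adjunction: \<open>R\<close> acts on arrows by \<open>hat\<close>, and
  \<open>Val\<close> is the bijection between arrows \<open>X -> Y\<close> of the quotient and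
  arrows \<open>X -> R Y\<close>. Naturality is \<open>comp_cls\<close> read on values.\<close>

lemma right_adjoint: "has_right_adjoint C Q (\<lambda>M. M) (quot_functor_arr C \<X>)"
proof -
  define Ga where "Ga b = hat (Dom Q b) (Cod Q b) (Val b)" for b
  have D: "Dom Q (cls X Y h) = X" "Cod Q (cls X Y h) = Y" if "h \<in> mor X (R Y)" "Y \<in> Obj C" for X Y h
    using cls_hom[OF that] by (auto simp: Hom_def)
  have Ga: "Ga (cls X Y h) = hat X Y h" if "h \<in> mor X (R Y)" "Y \<in> Obj C" for X Y h
    using D[OF that] Val_cls[OF that] by (simp add: Ga_def)
  have RO: "R X \<in> Obj C" if "X \<in> Obj C" for X using unit_hom[OF that] hom_obj by blast
  have "is_functor Q C R Ga" unfolding is_functor_def quot_obj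
  proof (intro conjI ballI impI)
    fix X assume X: "X \<in> Obj C"
    show "R X \<in> Obj C" using RO[OF X] .
    show "Ga (Ide Q X) = Ide C (R X)"
      using ide_cls[OF X] Ga[OF unit_hom[OF X] X] hat_unique[OF unit_hom[OF X] X Ide_Hom[OF RO[OF X]]] Ide_Comp[OF unit_hom[OF X]] by simp
  next
    fix b assume "b \<in> Arr Q"
    then obtain X Y h where h: "h \<in> mor X (R Y)" "X \<in> Obj C" "Y \<in> Obj C" "b = cls X Y h" by (rule arr_cls)
    show "Ga b \<in> mor (R (Dom Q b)) (R (Cod Q b))" using h(4) D[OF h(1,3)] Ga[OF h(1,3)] hat_prop(1)[OF h(1,3)] by simp
  next
    fix f g assume "f \<in> Arr Q" "g \<in> Arr Q" and e: "Cod Q f = Dom Q g"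
    then obtain X Y h Y' Z k where h: "h \<in> mor X (R Y)" "X \<in> Obj C" "Y \<in> Obj C" "f = cls X Y h"
      and k: "k \<in> mor Y' (R Z)" "Y' \<in> Obj C" "Z \<in> Obj C" "g = cls Y' Z k" using arr_cls by metis
    have Y': "Y' = Y" using e D[OF h(1,3)] D[OF k(1,3)] h(4) k(4) by simp
    have k: "k \<in> mor Y (R Z)" "Z \<in> Obj C" "g = cls Y Z k" using k Y' by auto
    note hh = hat_prop[OF h(1,3)] and hk = hat_prop[OF k(1,2)]
    have kh: "hat Y Z k \<cdot> h \<in> mor X (R Z)" using Comp_Hom[OF h(1) hk(1)] .
    have "hat X Z (hat Y Z k \<cdot> h) = hat Y Z k \<cdot> hat X Y h"
      by (rule hat_unique[OF kh k(2) Comp_Hom[OF hh(1) hk(1)]])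
        (use Comp_assoc[OF unit_hom[OF h(2)] hh(1) hk(1)] hh(2) in simp)
    then show "Ga (g \<cdot>\<^bsub>Q\<^esub> f) = Ga g \<cdot> Ga f"
      using comp_cls[OF h(1) k(1,2)] Ga[OF kh k(2)] Ga[OF h(1,3)] Ga[OF k(1,2)] h(4) k(3) by simp
  qed
  moreover have "bij_betw Val (Hom Q X Y) (mor X (R Y))" if X: "X \<in> Obj C" and Y: "Y \<in> Obj C" for X Y
    unfolding bij_betw_def
  proof (rule conjI, rule inj_onI)
    fix a b assume "a \<in> Hom Q X Y" "b \<in> Hom Q X Y" and e: "Val a = Val b"
    then obtain h k where "h \<in> mor X (R Y)" "a = cls X Y h" "k \<in> mor X (R Y)" "b = cls X Y k" using hom_cls by metis
    then show "a = b" using e Val_cls Y by simp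
  next
    show "Val ` Hom Q X Y = mor X (R Y)"
    proof (intro equalityI subsetI)
      fix v assume "v \<in> Val ` Hom Q X Y"
      then obtain a where a: "a \<in> Hom Q X Y" "v = Val a" by blast
      obtain h where "h \<in> mor X (R Y)" "Y \<in> Obj C" "a = cls X Y h" using hom_cls[OF a(1)] by metis
      then show "v \<in> mor X (R Y)" using a Val_cls by simp
    next
      fix h assume h: "h \<in> mor X (R Y)"
      then have "h = Val (cls X Y h)" using Val_cls Y by simp
      then show "h \<in> Val ` Hom Q X Y" using cls_hom[OF h Y] by blast
    qed
  qed
  moreover have "Val (g \<cdot>\<^bsub>Q\<^esub> h \<cdot>\<^bsub>Q\<^esub> quot_functor_arr C \<X> f) = Ga g \<cdot> Val h \<cdot> f"
    if f: "f \<in> Arr C" and g: "g \<in> Arr Q" and h: "h \<in> Hom Q (Cod C f) (Dom Q g)" for f g h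
  proof -
    obtain X' Z k where k: "k \<in> mor X' (R Z)" "X' \<in> Obj C" "Z \<in> Obj C" "g = cls X' Z k" using arr_cls[OF g] .
    have Dg: "Dom Q g = X'" using D[OF k(1,3)] k(4) by simp
    obtain j where j: "j \<in> mor (Cod C f) (R X')" "h = cls (Cod C f) X' j" using hom_cls[OF h] Dg by metis
    have fh: "f \<in> mor (Dom C f) (Cod C f)" using homI[OF f] .
    have Y: "Cod C f \<in> Obj C" using fh hom_obj by blast
    note hk = hat_prop[OF k(1,3)] and hj = hat_prop[OF j(1) k(2)]
    have kj: "hat X' Z k \<cdot> j \<in> mor (Cod C f) (R Z)" using Comp_Hom[OF j(1) hk(1)] .
    note hkj = hat_prop[OF kj k(3)]
    have "g \<cdot>\<^bsub>Q\<^esub> h = cls (Cod C f) Z (hat X' Z k \<cdot> j)" using comp_cls[OF j(1) k(1,3)] j(2) k(4) by simp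
    then have "g \<cdot>\<^bsub>Q\<^esub> h \<cdot>\<^bsub>Q\<^esub> quot_functor_arr C \<X> f = cls (Dom C f) Z (hat (Cod C f) Z (hat X' Z k \<cdot> j) \<cdot> (\<eta> (Cod C f) \<cdot> f))"
      using functor_cls[OF fh] comp_cls[OF unit_comp[OF fh] kj k(3)] by simp
    moreover have "hat (Cod C f) Z (hat X' Z k \<cdot> j) \<cdot> (\<eta> (Cod C f) \<cdot> f) = hat X' Z k \<cdot> j \<cdot> f"
      using comp_ext1[OF hkj(2) unit_hom[OF Y] hkj(1) fh] .
    moreover have "hat X' Z k \<cdot> j \<cdot> f \<in> mor (Dom C f) (R Z)" using Comp_Hom[OF fh kj] .
    ultimately show ?thesis using Val_cls[OF _ k(3)] Ga[OF k(1,3)] k(4) Val_cls[OF j(1) k(2)] j(2) by simp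
  qed
  ultimately have "\<exists>Go Ga \<Phi>. is_functor Q C Go Ga \<and>
        (\<forall>X \<in> Obj C. \<forall>Y \<in> Obj Q. bij_betw (\<Phi> X Y) (Hom Q X Y) (mor X (Go Y))) \<and>
        (\<forall>f \<in> Arr C. \<forall>g \<in> Arr Q. \<forall>h \<in> Hom Q (Cod C f) (Dom Q g).
           \<Phi> (Dom C f) (Cod Q g) (g \<cdot>\<^bsub>Q\<^esub> h \<cdot>\<^bsub>Q\<^esub> quot_functor_arr C \<X> f) = Ga g \<cdot> \<Phi> (Cod C f) (Dom Q g) h \<cdot> f)"
    unfolding quot_obj by (intro exI[of _ R] exI[of _ Ga] exI[of _ "\<lambda>_ _. Val"] conjI) blast+
  then show ?thesis unfolding has_right_adjoint_def .
qed

end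

lemma (in torsion_class) localizing: "localizing_subcat C \<X>"
proof -
  have "\<exists>\<eta> R. \<eta> \<in> mor Y R \<and> quot_iso C \<X> \<eta> \<and> torsionfree R \<and> closed R" if "Y \<in> Obj C" for Y
    using reflection_exists[OF that] by metis
  then obtain \<eta> R where r: "\<And>Y. Y \<in> Obj C \<Longrightarrow> \<eta> Y \<in> mor Y (R Y)" "\<And>Y. Y \<in> Obj C \<Longrightarrow> quot_iso C \<X> (\<eta> Y)"
    "\<And>Y. Y \<in> Obj C \<Longrightarrow> torsionfree (R Y)" "\<And>Y. Y \<in> Obj C \<Longrightarrow> closed (R Y)" by metis
  interpret reflection C \<X> R \<eta>
  proof unfold_locales
    show "\<eta> Y \<in> mor Y (R Y)" "quot_iso C \<X> (\<eta> Y)" if "Y \<in> Obj C" for Y using r that by auto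
    fix Y s P X f assume Y: "Y \<in> Obj C" and s: "s \<in> mor P X" "quot_iso C \<X> s" and f: "f \<in> mor P (R Y)"
    have "\<exists>h \<in> mor X (R Y). h \<cdot> s = f" using r(4)[OF Y] s f unfolding closed_def by blast
    \<comment> \<open>Here torsionfreeness enters: the difference of two extensions kills
      \<open>s\<close>, so it is negligible.\<close>
    moreover have "h = k" if h: "h \<in> mor X (R Y)" "k \<in> mor X (R Y)" "h \<cdot> s = k \<cdot> s" for h k
    proof -
      have "dif h k \<cdot> s = zer P (R Y)" using dif_comp[OF h(1,2) s(1)] dif_eq[OF Comp_Hom[OF s(1) h(1)] Comp_Hom[OF s(1) h(2)]] h(3) by simp
      then have "dif h k = zer X (R Y)" using torsionfree_negl[OF r(3)[OF Y] dif_hom[OF h(1,2)]] quot_isoD2[OF s(2,1) dif_hom[OF h(1,2)]] by blast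
      then show ?thesis using dif_eq[OF h(1,2)] by simp
    qed
    ultimately show "\<exists>!h. h \<in> mor X (R Y) \<and> h \<cdot> s = f" by blast
  qed
  show ?thesis using right_adjoint serre by (simp add: localizing_subcat_def)
qed

text \<open>The bridge that makes local stability applicable to classes given by their
  supports.\<close>

lemma (in grothendieck_category) localizing_supported: "localizing_subcat C (supported \<Phi>)"
proof -
  interpret torsion_class U C "supported \<Phi>"
    by unfold_locales (use serre_supported supported_generated in blast)+
  show ?thesis by (rule localizing)
qed

section \<open>Atoms of stable local categories\<close>

context grothendieck_category
begin

text \<open>\<open>M\<close> is an essential extension of a nonzero \<open>D\<close> that it shares
  with \<open>H\<close> and that embeds in \<open>I\<close>. The class of objects supported in
  \<open>ASupp C D\<close> is stable, so it contains \<open>M\<close>. Thus \<open>M\<close> has the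
  least support among the objects of its atom.\<close>

lemma support_of_monoform:
  assumes ls: "locally_stable C" and M: "monoform C M" and v: "v \<in> mor V M" "is_mono C v" "\<not> is_zero C V"
    and j: "j \<in> mor V I" "is_mono C j" "injective_obj C I" and H: "H \<in> atom_of C M"
  shows "ASupp C M \<subseteq> ASupp C H"
proof -
  have V: "monoform C V" "atom_of C V = atom_of C M" using atom_of_sub[OF M v(2,1,3)] by auto
  then have "atom_equiv C V H" using H by (auto simp: atom_of_def)
  then obtain D a b where D: "\<not> is_zero C D" "a \<in> mor D V" "is_mono C a" "b \<in> mor D H" "is_mono C b" unfolding atom_equiv_iff by blast
  have va: "v \<cdot> a \<in> mor D M" "is_mono C (v \<cdot> a)" using Comp_Hom[OF D(2) v(1)] mono_comp[OF D(3) v(2) D(2) v(1)] by auto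
  have ja: "j \<cdot> a \<in> mor D I" "is_mono C (j \<cdot> a)" using Comp_Hom[OF D(2) j(1)] mono_comp[OF D(3) j(2) D(2) j(1)] by auto
  have "D \<in> supported (ASupp C D)" using hom_obj[OF D(2)] by (simp add: supported_def)
  then have "M \<in> supported (ASupp C D)"
    using stable_essential_extension[OF ls localizing_supported monoform_ess[OF M va(2,1) D(1)] va(1) _ ja(2,1) j(3)] by blast
  then have "ASupp C M \<subseteq> ASupp C D" by (simp add: supported_def)
  also have "\<dots> \<subseteq> ASupp C H" using ASupp_sub[OF D(5,4)] .
  finally show ?thesis .
qed

lemma Gamma_factor:
  assumes \<gamma>: "is_Gamma C \<mm> M \<gamma>" and x: "x \<in> mor D M" "D \<in> supported {\<mm>}"
  obtains h where "h \<in> mor D (Dom C \<gamma>)" "\<gamma> \<cdot> h = x"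
proof -
  interpret serre C "supported {\<mm>}" by unfold_locales (rule serre_supported)
  have gm: "\<gamma> \<in> mor (Dom C \<gamma>) M" using \<gamma> subobj_mor by (simp add: is_Gamma_def)
  obtain I e m where em: "e \<in> mor D I" "m \<in> mor I M" "is_epi C e" "is_mono C m" "m \<cdot> e = x" using image_factorization[OF x(1)] .
  have "I \<in> supported {\<mm>}" using X_quot[OF em(3,1) x(2)] .
  then have "sub_le C m \<gamma>" using \<gamma> subobjI[OF em(4,2)] hom_DC(1)[OF em(2)] unfolding is_Gamma_def supported_def by blast
  then obtain h where h: "h \<in> mor I (Dom C \<gamma>)" "\<gamma> \<cdot> h = m" using sub_le_iff[OF em(2) gm] by blast
  show ?thesis using that[OF Comp_Hom[OF em(1) h(1)]] comp_ext1[OF h(2,1) gm em(1)] em(5) by simp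
qed

text \<open>Torsion objects are closed under extensions, so the preimage of torsion in the quotient
  is torsion and \<open>\<gamma>\<close> absorbs it.\<close>

lemma Gamma_quotient_torsionfree:
  assumes \<gamma>: "is_Gamma C \<mm> M \<gamma>" and c: "is_cokernel C c \<gamma>"
  shows "serre.torsionfree C (supported {\<mm>}) (Cod C c)"
proof -
  interpret serre C "supported {\<mm>}" by unfold_locales (rule serre_supported)
  have gm: "\<gamma> \<in> mor (Dom C \<gamma>) M" "is_mono C \<gamma>" using \<gamma> subobj_mor subobj_mono by (auto simp: is_Gamma_def)
  have T: "Dom C \<gamma> \<in> supported {\<mm>}" using \<gamma> hom_obj[OF gm(1)] by (simp add: is_Gamma_def supported_def)
  note cm = cokernel_hom[OF c gm(1)] and ce = cokernel_epi[OF c] and c0 = cokernel_eq[OF c gm(1) cokernel_hom[OF c gm(1)]]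
  show ?thesis
  proof (rule torsionfree_quotient[OF cm ce])
    fix S x assume x: "x \<in> mor S M" "c \<cdot> x = zer S (Cod C c)"
    obtain h where "h \<in> mor S (Dom C \<gamma>)" "\<gamma> \<cdot> h = x" using mono_factor[OF gm(2,1) c cm x] .
    then show "negl (supported {\<mm>}) x" using T gm(1) negl_def by blast
  next
    fix D x assume D: "D \<in> supported {\<mm>}" "x \<in> mor D M"
    obtain h where h: "h \<in> mor D (Dom C \<gamma>)" "\<gamma> \<cdot> h = x" using Gamma_factor[OF \<gamma> D(2,1)] .
    show "c \<cdot> x = zer D (Cod C c)" using comp_eq_zer[OF gm(1) cm h(1) c0] h(2) by simp
  qed
qed

text \<open>If no subobject of \<open>N\<close> had the given associated atom of \<open>N / \<Gamma> N\<close>, then \<open>\<Gamma> N\<close> would be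
  essential in the preimage of a subobject of \<open>N / \<Gamma> N\<close>, contradicting stability.\<close>

lemma associated_atom_lifts:
  assumes ls: "locally_stable C" and m: "maximal_atom C \<mm>"
    and \<gamma>: "is_Gamma C \<mm> N \<gamma>" and \<pi>: "is_cokernel C \<pi> \<gamma>" and \<alpha>: "\<alpha> \<in> AAss C (Cod C \<pi>)"
    and e: "is_mono C e" "e \<in> mor N I" "injective_obj C I"
  obtains L l where "monoform C L" "\<alpha> = atom_of C L" "l \<in> mor L N" "is_mono C l" "\<alpha> \<noteq> \<mm>"
proof -
  interpret serre C "supported {\<mm>}" by unfold_locales (rule serre_supported)
  let ?T = "Dom C \<gamma>" and ?K = "Cod C \<pi>"
  have tf: "torsionfree ?K" using Gamma_quotient_torsionfree[OF \<gamma> \<pi>] .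
  have g: "\<gamma> \<in> mor ?T N" "is_mono C \<gamma>" using \<gamma> subobj_mor subobj_mono by (auto simp: is_Gamma_def)
  have T: "?T \<in> supported {\<mm>}" using \<gamma> hom_obj[OF g(1)] by (simp add: is_Gamma_def supported_def)
  note pm = cokernel_hom[OF \<pi> g(1)] and p0 = cokernel_eq[OF \<pi> g(1) cokernel_hom[OF \<pi> g(1)]] and pe = cokernel_epi[OF \<pi>]
  obtain H s where H: "monoform C H" "\<alpha> = atom_of C H" "s \<in> mor H ?K" "is_mono C s"
    using \<alpha> in_ASpec subobj_mor subobj_mono unfolding AAss_def by blast
  have notin: "H \<notin> supported {\<mm>}"
    using tf H(3) nonzero_mono[OF H(4,3) monoform_nonzero[OF H(1)]] unfolding torsionfree_def by blast
  \<comment> \<open>Otherwise \<open>H\<close> would share a nonzero subobject with a simple object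
    of atom \<open>\<mm>\<close>, and this would be torsion in a torsionfree object.\<close>
  have am: "\<alpha> \<noteq> \<mm>"
  proof
    assume "\<alpha> = \<mm>"
    obtain S where S: "simple_obj C S" "\<mm> = atom_of C S" using m by (auto simp: maximal_atom_def)
    have "atom_equiv C H S" using atom_of_eq[OF H(1) simple_monoform[OF S(1)]] H(2) S(2) \<open>\<alpha> = \<mm>\<close> by simp
    then obtain V a b where V: "\<not> is_zero C V" "a \<in> mor V H" "is_mono C a" "b \<in> mor V S" "is_mono C b" unfolding atom_equiv_iff by blast
    have "V \<in> supported {\<mm>}" using ASupp_sub[OF V(5,4)] simple_ASupp[OF S(1)] S(2) hom_obj[OF V(2)] by (auto simp: supported_def)
    then have "s \<cdot> a = zer V ?K" using tf Comp_Hom[OF V(2) H(3)] unfolding torsionfree_def by blast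
    then show False using mono_zero[OF mono_comp[OF V(3) H(4) V(2) H(3)] Comp_Hom[OF V(2) H(3)]] V(1) by blast
  qed
  obtain P y \<epsilon> where P: "y \<in> mor P N" "\<epsilon> \<in> mor P H" "\<pi> \<cdot> y = s \<cdot> \<epsilon>"
    "\<And>T x z. x \<in> mor T N \<Longrightarrow> z \<in> mor T H \<Longrightarrow> \<pi> \<cdot> x = s \<cdot> z \<Longrightarrow> \<exists>t \<in> mor T P. y \<cdot> t = x \<and> \<epsilon> \<cdot> t = z"
    "is_mono C y" "is_epi C \<epsilon>"
    by (rule obtain_pullback[OF pm H(3)]) (use pe H(4) in \<open>blast intro: that\<close>)
  note ym = P(5)
  have TO: "?T \<in> Obj C" "H \<in> Obj C" using g H hom_obj by auto
  obtain t where t: "t \<in> mor ?T P" "y \<cdot> t = \<gamma>" "\<epsilon> \<cdot> t = zer ?T H"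
    using P(4)[OF g(1) zer_hom[OF TO]] p0 comp_zer'[OF H(3) TO(1)] by metis
  have tm: "is_mono C t" using mono_cancel[OF _ t(1) P(1)] t(2) g(2) by simp
  have "\<not> ess t"
  proof
    assume "ess t"
    moreover have "e \<cdot> \<gamma> \<in> mor ?T I" "is_mono C (e \<cdot> \<gamma>)" using Comp_Hom[OF g(1) e(2)] mono_comp[OF g(2) e(1) g(1) e(2)] by auto
    ultimately have "P \<in> supported {\<mm>}" using stable_essential_extension[OF ls localizing_supported _ t(1) T _ _ e(3)] by blast
    then show False using X_quot[OF P(6,2)] notin by blast
  qed
  then obtain S x where x: "x \<in> mor S P" "x \<noteq> zer S P" "\<And>W w z. w \<in> mor W S \<Longrightarrow> z \<in> mor W ?T \<Longrightarrow> x \<cdot> w = t \<cdot> z \<Longrightarrow> x \<cdot> w = zer W P"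
    using essI[OF tm t(1)] by metis
  obtain L f n where fn: "f \<in> mor S L" "n \<in> mor L P" "is_epi C f" "is_mono C n" "n \<cdot> f = x" using image_factorization[OF x(1)] .
  have en: "\<epsilon> \<cdot> n \<in> mor L H" using Comp_Hom[OF fn(2) P(2)] .
  \<comment> \<open>\<open>L\<close> is a subobject of \<open>P\<close> that meets
    \<open>\<Gamma> N\<close> only in zero, and \<open>\<Gamma> N\<close> is the kernel of
    \<open>\<epsilon>\<close>; so \<open>L\<close> injects into \<open>H\<close> and carries its
    atom.\<close>
  have enm: "is_mono C (\<epsilon> \<cdot> n)"
  proof (rule mono_zerI[OF en])
    fix W u assume u: "u \<in> mor W L" "\<epsilon> \<cdot> n \<cdot> u = zer W H"
    have WO: "W \<in> Obj C" using u hom_obj by blast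
    have nu: "n \<cdot> u \<in> mor W P" using Comp_Hom[OF u(1) fn(2)] .
    have "\<pi> \<cdot> (y \<cdot> (n \<cdot> u)) = s \<cdot> (\<epsilon> \<cdot> (n \<cdot> u))" using comp_ext[OF P(3,1) pm P(2) H(3) nu] .
    also have "\<dots> = zer W ?K" using Comp_assoc[OF u(1) fn(2) P(2)] u(2) comp_zer'[OF H(3) WO] by simp
    finally obtain z where z: "z \<in> mor W ?T" "\<gamma> \<cdot> z = y \<cdot> (n \<cdot> u)" using mono_factor[OF g(2,1) \<pi> pm Comp_Hom[OF nu P(1)]] by metis
    have "y \<cdot> (t \<cdot> z) = y \<cdot> (n \<cdot> u)" using comp_ext1[OF t(2,1) P(1) z(1)] z(2) by simp
    then have tz: "t \<cdot> z = n \<cdot> u" using monoD[OF ym P(1) Comp_Hom[OF z(1) t(1)] nu] by blast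
    obtain R r v where R: "r \<in> mor R W" "is_epi C r" "v \<in> mor R S" "f \<cdot> v = u \<cdot> r" using epi_lift[OF fn(1,3) u(1)] .
    have xv: "x \<cdot> v = n \<cdot> (u \<cdot> r)" using R(4) fn(5) Comp_assoc[OF R(3) fn(1,2)] by simp
    also have "\<dots> = t \<cdot> (z \<cdot> r)" using comp_ext[OF tz z(1) t(1) u(1) fn(2) R(1)] by simp
    finally have "x \<cdot> v = zer R P" using x(3)[OF R(3) Comp_Hom[OF R(1) z(1)]] by blast
    then have "n \<cdot> u \<cdot> r = zer R P" using xv Comp_assoc[OF R(1) u(1) fn(2)] by simp
    then have "n \<cdot> u = zer W P" using epi_zerD[OF R(2,1) nu] by blast
    then show "u = zer W L" using mono_zerD[OF fn(4,2) u(1)] by blast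
  qed
  have L: "\<not> is_zero C L" using nonzero_factor[OF fn(1,2)] fn(5) x(2) by simp
  have "monoform C L" "\<alpha> = atom_of C L" using atom_of_sub[OF H(1) enm en L] H(2) by auto
  then show ?thesis using that[of L "y \<cdot> n"] Comp_Hom[OF fn(2) P(1)] mono_comp[OF fn(4) ym fn(2) P(1)] am by blast
qed

end

section \<open>Endomorphism rings of monoform objects\<close>

context abelian_category
begin

lemma End_ring_ring: assumes X: "X \<in> Obj C" shows "ring (End_ring C X)"
proof -
  interpret G: comm_group "hom_group C X X" using hom_comm_group[OF X X] .
  note i = Ide_Hom[OF X]
  show ?thesis
  proof (rule ringI)
    show "abelian_group (End_ring C X)"
    proof (rule abelian_groupI)
      fix x assume "x \<in> carrier (End_ring C X)"
      then have x: "x \<in> mor X X" by (simp add: End_ring_def)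
      show "\<exists>y\<in>carrier (End_ring C X). y \<oplus>\<^bsub>End_ring C X\<^esub> x = \<zero>\<^bsub>End_ring C X\<^esub>"
        using G.l_inv_ex[of x] x by (auto simp: End_ring_def)
    qed (use G.m_closed G.one_closed G.m_assoc G.m_comm G.l_one in \<open>auto simp: End_ring_def\<close>)
    show "monoid (End_ring C X)"
      by unfold_locales (use i Comp_Hom Comp_assoc Ide_Comp Comp_Ide in \<open>auto simp: End_ring_def\<close>)
  qed (use Comp_Add_left Comp_Add_right in \<open>auto simp: End_ring_def\<close>)
qed

text \<open>A nonzero endomorphism of a monoform object is monic, and a right inverse of a monic
  endomorphism is two-sided. A nonzero endomorphism that is not a unit therefore has no right
  inverse.\<close>

lemma monoform_not_skew_field:
  assumes M: "monoform C M" and n: "\<not> skew_field (End_ring C M)"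
  obtains f where "f \<in> mor M M" "is_mono C f" "\<And>h. h \<in> mor M M \<Longrightarrow> f \<cdot> h \<noteq> Ide C M"
proof -
  have MO: "M \<in> Obj C" using monoform_obj[OF M] .
  note i = Ide_Hom[OF MO]
  have "\<exists>f \<in> mor M M. f \<noteq> zer M M \<and> \<not> (\<exists>h \<in> mor M M. h \<cdot> f = Ide C M \<and> f \<cdot> h = Ide C M)"
  proof (rule ccontr)
    assume a: "\<not> ?thesis"
    have "\<not> (\<exists>h \<in> mor M M. h \<cdot> zer M M = Ide C M)"
      using comp_zer' MO nonzero_ide[OF MO monoform_nonzero[OF M]] by metis
    then have "Units (End_ring C M) = carrier (End_ring C M) - {\<zero>\<^bsub>End_ring C M\<^esub>}"
      using a by (auto simp: Units_def End_ring_def)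
    then show False using n End_ring_ring[OF MO] by (simp add: skew_field_def)
  qed
  then obtain f where f: "f \<in> mor M M" "f \<noteq> zer M M" "\<And>h. h \<in> mor M M \<Longrightarrow> h \<cdot> f = Ide C M \<Longrightarrow> f \<cdot> h \<noteq> Ide C M" by blast
  have fm: "is_mono C f" using monoformD[OF M i ide_mono[OF MO] f(1,2)] .
  have "f \<cdot> h \<noteq> Ide C M" if h: "h \<in> mor M M" for h
  proof
    assume e: "f \<cdot> h = Ide C M"
    have "f \<cdot> (h \<cdot> f) = f \<cdot> Ide C M" using e Comp_assoc[OF f(1) h f(1)] Ide_Comp[OF f(1)] Comp_Ide[OF f(1)] by simp
    then have "h \<cdot> f = Ide C M" using monoD[OF fm f(1) Comp_Hom[OF f(1) h] i] by blast
    then show False using f(3)[OF h] e by blast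
  qed
  then show ?thesis using that f(1) fm by blast
qed

text \<open>\<open>f\<close> embeds a nonzero object in a monoform one, so it is essential, and
  extending a monomorphism along it keeps it monic. The last clause records that every
  \<open>g n\<close> restricts to \<open>g0\<close>, along a power of \<open>f\<close>.\<close>

lemma extension_chain:
  assumes M: "monoform C M" and f: "f \<in> mor M M" "is_mono C f" and I: "injective_obj C I" and g0: "g0 \<in> mor M I" "is_mono C g0"
  obtains g where "g 0 = g0" "\<And>n :: nat. g n \<in> mor M I" "\<And>n. is_mono C (g n)" "\<And>n. g (Suc n) \<cdot> f = g n"
    "\<And>n. \<exists>a \<in> mor M M. g n \<cdot> a = g0"
proof -
  have fe: "ess f" using monoform_ess[OF M f(2,1) monoform_nonzero[OF M]] .
  have "\<exists>h. (h \<in> mor M I \<and> is_mono C h) \<and> h \<cdot> f = g" if g: "g \<in> mor M I \<and> is_mono C g" for g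
  proof -
    obtain h where h: "h \<in> mor M I" "h \<cdot> f = g" using I f g hom_DC[OF f(1)] unfolding injective_obj_def by metis
    then show ?thesis using ess_mono_cancel[OF fe f(1) h(1)] g by auto
  qed
  then have "\<exists>g. \<forall>n. (g n \<in> mor M I \<and> is_mono C (g n) \<and> (n = 0 \<longrightarrow> g n = g0)) \<and> g (Suc n) \<cdot> f = g n"
    using g0 dependent_nat_choice[of "\<lambda>n h. h \<in> mor M I \<and> is_mono C h \<and> (n = 0 \<longrightarrow> h = g0)" "\<lambda>_ h h'. h' \<cdot> f = h"] by auto
  then obtain g where g: "\<And>n. g n \<in> mor M I" "\<And>n. is_mono C (g n)" "g 0 = g0" "\<And>n::nat. g (Suc n) \<cdot> f = g n" by metis
  have "\<exists>a \<in> mor M M. g n \<cdot> a = g0" for n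
  proof (induction n)
    case 0
    then show ?case using g(3) Comp_Ide[OF g0(1)] Ide_Hom monoform_obj[OF M] by auto
  next
    case (Suc n)
    then obtain a where a: "a \<in> mor M M" "g n \<cdot> a = g0" by blast
    then have "g (Suc n) \<cdot> (f \<cdot> a) = g0" using comp_ext1[OF g(4) f(1) g(1) a(1)] by simp
    then show ?case using Comp_Hom[OF a(1) f(1)] by blast
  qed
  then show ?thesis using that g by blast
qed

text \<open>If the chain stops at \<open>n\<close>, then
  \<open>s (Suc n) = s n \<cdot> h = s (Suc n) \<cdot> f \<cdot> h\<close>, and cancelling the
  monomorphism splits \<open>f\<close>.\<close>

lemma chain_split:
  assumes W: "noetherian_obj C W" and f: "f \<in> mor M M"
    and s: "\<And>n :: nat. s n \<in> mor M W" "\<And>n. is_mono C (s n)" "\<And>n. s (Suc n) \<cdot> f = s n"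
  obtains h where "h \<in> mor M M" "f \<cdot> h = Ide C M"
proof -
  have D: "Dom C (s n) = M" for n using s(1) hom_DC by blast
  have "sub_le C (s n) (s (Suc n))" for n using sub_le_iff[OF s(1) s(1)] s(3) f by blast
  then obtain n where "\<And>k. k \<ge> n \<Longrightarrow> sub_le C (s k) (s n)" using noethD[where s = s, OF W] subobjI[OF s(2,1)] by blast
  then have "sub_le C (s (Suc n)) (s n)" by simp
  then obtain h where h: "h \<in> mor M M" "s n \<cdot> h = s (Suc n)" using sub_le_iff[OF s(1) s(1)] by blast
  have "s (Suc n) \<cdot> (f \<cdot> h) = s (Suc n) \<cdot> Ide C M" using comp_ext1[OF s(3) f s(1) h(1)] h(2) Comp_Ide[OF s(1)] by simp
  then have "f \<cdot> h = Ide C M" using monoD[OF s(2,1) Comp_Hom[OF h(1) f] Ide_Hom] hom_obj[OF f] by blast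
  then show ?thesis using that h by blast
qed

text \<open>For a resolution \<open>N \<rightarrow> I\<^sub>0 \<rightarrow> I\<^sub>1 \<rightarrow> I\<^sub>2\<close> with torsion subobjects \<open>T\<^sub>i\<close>, the preimage \<open>W\<close> of
  \<open>T\<^sub>1\<close> in \<open>I\<^sub>0\<close> satisfies \<open>H\<^sup>1 = W / (N + T\<^sub>0)\<close>, so \<open>W / T\<^sub>0\<close> is an extension of \<open>H\<^sup>1\<close> by
  a quotient of \<open>N\<close>.\<close>

lemma preimage_noetherian:
  assumes N: "noetherian_obj C N" and e: "e \<in> mor N I0" "is_kernel C e d0" and d: "d0 \<in> mor I0 I1" "d1 \<in> mor I1 I2" "exact_at C d0 d1"
    and g: "g0 \<in> mor T0 I0" "g1 \<in> mor T1 I1" "is_mono C g1" "g2 \<in> mor T2 I2" "is_mono C g2"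
    and \<delta>: "\<delta>0 \<in> mor T0 T1" "g1 \<cdot> \<delta>0 = d0 \<cdot> g0" "\<delta>1 \<in> mor T1 T2" "g2 \<cdot> \<delta>1 = d1 \<cdot> g1"
    and k: "is_kernel C k \<delta>1" and b: "b \<in> mor T0 (Dom C k)" "k \<cdot> b = \<delta>0"
    and c: "is_cokernel C c b" and H: "noetherian_obj C (Cod C c)"
    and q: "is_cokernel C q g1" and w: "is_kernel C w (q \<cdot> d0)" "w \<in> mor W I0"
    and t: "t \<in> mor T0 W" "w \<cdot> t = g0" and p: "is_cokernel C p t"
  shows "noetherian_obj C (Cod C p)"
proof -
  let ?Z = "Dom C k" and ?H = "Cod C c" and ?B = "Cod C p"
  have km: "k \<in> mor ?Z T1" "is_mono C k" using kernel_hom[OF k \<delta>(3)] kernel_mono[OF k] by auto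
  have cm: "c \<in> mor ?Z ?H" "c \<cdot> b = zer T0 ?H" using cokernel_hom[OF c b(1)] cokernel_eq[OF c b(1)] by auto
  have pm: "p \<in> mor W ?B" "is_epi C p" "p \<cdot> t = zer T0 ?B" using cokernel_hom[OF p t(1)] cokernel_epi[OF p] cokernel_eq[OF p t(1)] by auto
  have qm: "q \<in> mor I1 (Cod C q)" using cokernel_hom[OF q g(2)] .
  have qd: "q \<cdot> d0 \<in> mor I0 (Cod C q)" using Comp_Hom[OF d(1) qm] .
  have wm: "is_mono C w" using kernel_mono[OF w(1)] .
  have WO: "W \<in> Obj C" "N \<in> Obj C" "I0 \<in> Obj C" using w e hom_obj by auto
  \<comment> \<open>The image of \<open>d0\<close> and the kernel of \<open>d1\<close> are given by
    the same \<open>k'\<close>, so \<open>d0\<close> factors through it.\<close>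
  have d10: "d1 \<cdot> d0 = zer I0 I2"
  proof -
    obtain c' k' where x: "is_cokernel C c' d0" "is_kernel C k' c'" "is_kernel C k' d1" using d(3) by (auto simp: exact_at_def)
    note c'm = cokernel_hom[OF x(1) d(1)]
    note k'm = kernel_hom[OF x(2) c'm]
    obtain h where h: "h \<in> mor I0 (Dom C k')" "k' \<cdot> h = d0" using kernelE[OF x(2) c'm k'm d(1) cokernel_eq[OF x(1) d(1) c'm]] .
    show ?thesis using comp_eq_zer[OF k'm d(2) h(1) kernel_eq[OF x(3) d(2) k'm]] h(2) by simp
  qed
  \<comment> \<open>\<open>d0\<close> carries \<open>W\<close> into \<open>T1\<close>, and even into
    the cycles \<open>?Z\<close>, because \<open>d1 d0 = 0\<close> and \<open>g2\<close> is
    monic.\<close>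
  have "q \<cdot> (d0 \<cdot> w) = zer W (Cod C q)" using kernel_eq[OF w(1) qd w(2)] Comp_assoc[OF w(2) d(1) qm] by simp
  then obtain v where v: "v \<in> mor W T1" "g1 \<cdot> v = d0 \<cdot> w" using mono_factor[OF g(3,2) q qm Comp_Hom[OF w(2) d(1)]] by metis
  have "g2 \<cdot> (\<delta>1 \<cdot> v) = d1 \<cdot> (g1 \<cdot> v)" using comp_ext[OF \<delta>(4,3) g(4,2) d(2) v(1)] .
  also have "\<dots> = zer W I2" using v(2) comp_eq_zer[OF d(1,2) w(2) d10] by simp
  finally have "\<delta>1 \<cdot> v = zer W T2" using mono_zerD[OF g(5,4) Comp_Hom[OF v(1) \<delta>(3)]] by blast
  then obtain v' where v': "v' \<in> mor W ?Z" "k \<cdot> v' = v" using kernelE[OF k \<delta>(3) km(1) v(1)] by metis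
  have gk: "g1 \<cdot> k \<in> mor ?Z I1" "is_mono C (g1 \<cdot> k)" using Comp_Hom[OF km(1) g(2)] mono_comp[OF km(2) g(3) km(1) g(2)] by auto
  have gkv: "g1 \<cdot> k \<cdot> v' = d0 \<cdot> w" using Comp_assoc[OF v'(1) km(1) g(2)] v'(2) v(2) by simp
  have v't: "v' \<cdot> t = b"
  proof -
    have "g1 \<cdot> k \<cdot> (v' \<cdot> t) = d0 \<cdot> (w \<cdot> t)" using comp_ext[OF gkv v'(1) gk(1) w(2) d(1) t(1)] .
    also have "\<dots> = g1 \<cdot> k \<cdot> b" using t(2) \<delta>(2) Comp_assoc[OF b(1) km(1) g(2)] b(2) by simp
    finally show ?thesis using monoD[OF gk(2,1) Comp_Hom[OF t(1) v'(1)] b(1)] by blast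
  qed
  have cv: "c \<cdot> v' \<in> mor W ?H" using Comp_Hom[OF v'(1) cm(1)] .
  have "c \<cdot> v' \<cdot> t = zer T0 ?H" using Comp_assoc[OF t(1) v'(1) cm(1)] v't cm(2) by simp
  then obtain h where h: "h \<in> mor ?B ?H" "h \<cdot> p = c \<cdot> v'" using cokernelE[OF p t(1) pm(1) cv] by metis
  have "q \<cdot> d0 \<cdot> e = zer N (Cod C q)" using Comp_assoc[OF e(1) d(1) qm] kernel_eq[OF e(2) d(1) e(1)] comp_zer'[OF qm WO(2)] by simp
  then obtain e' where e': "e' \<in> mor N W" "w \<cdot> e' = e" using kernelE[OF w(1) qd w(2) e(1)] by metis
  \<comment> \<open>An element of \<open>?B\<close> that dies in \<open>?H\<close> is represented
    locally by some \<open>y\<close> in \<open>W\<close> whose image in \<open>?Z\<close> is a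
    boundary \<open>b z\<close>. Subtracting \<open>t z\<close> puts it into the kernel of
    \<open>d0\<close>, that is into \<open>N\<close>, and does not change its class in
    \<open>?B\<close>.\<close>
  show ?thesis
  proof (rule noeth_ext'[OF Comp_Hom[OF e'(1) pm(1)] h(1) N H])
    fix S x assume x: "x \<in> mor S ?B" "h \<cdot> x = zer S ?H"
    obtain S1 r1 y where y: "r1 \<in> mor S1 S" "is_epi C r1" "y \<in> mor S1 W" "p \<cdot> y = x \<cdot> r1" using epi_lift[OF pm(1,2) x(1)] .
    have v'y: "v' \<cdot> y \<in> mor S1 ?Z" using Comp_Hom[OF y(3) v'(1)] .
    have "c \<cdot> (v' \<cdot> y) = h \<cdot> (p \<cdot> y)" using comp_ext[OF h(2) pm(1) h(1) v'(1) cm(1) y(3)] by simp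
    also have "\<dots> = zer S1 ?H" using y(4) comp_eq_zer[OF x(1) h(1) y(1) x(2)] by simp
    finally obtain S2 r2 z where z: "r2 \<in> mor S2 S1" "is_epi C r2" "z \<in> mor S2 T0" "b \<cdot> z = v' \<cdot> y \<cdot> r2"
      using cokernel_lift[OF b(1) c cm(1) v'y] by metis
    have yr: "y \<cdot> r2 \<in> mor S2 W" and tz: "t \<cdot> z \<in> mor S2 W" using Comp_Hom[OF z(1) y(3)] Comp_Hom[OF z(3) t(1)] by auto
    note dd = dif_hom[OF yr tz]
    have "v' \<cdot> (y \<cdot> r2) = v' \<cdot> (t \<cdot> z)" using z(4) Comp_assoc[OF z(1) y(3) v'(1)] comp_ext1[OF v't t(1) v'(1) z(3)] by simp
    then have "v' \<cdot> dif (y \<cdot> r2) (t \<cdot> z) = zer S2 ?Z" using comp_dif[OF yr tz v'(1)] dif_eq[OF Comp_Hom[OF yr v'(1)] Comp_Hom[OF tz v'(1)]] by simp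
    then have "d0 \<cdot> (w \<cdot> dif (y \<cdot> r2) (t \<cdot> z)) = zer S2 I1"
      using comp_ext[OF gkv v'(1) gk(1) w(2) d(1) dd] comp_zer'[OF gk(1)] hom_obj[OF z(1)] by simp
    then obtain n where n: "n \<in> mor S2 N" "e \<cdot> n = w \<cdot> dif (y \<cdot> r2) (t \<cdot> z)" using kernelE[OF e(2) d(1) e(1) Comp_Hom[OF dd w(2)]] by metis
    have "w \<cdot> (e' \<cdot> n) = w \<cdot> dif (y \<cdot> r2) (t \<cdot> z)" using comp_ext1[OF e'(2,1) w(2) n(1)] n(2) by simp
    then have en: "e' \<cdot> n = dif (y \<cdot> r2) (t \<cdot> z)" using monoD[OF wm w(2) Comp_Hom[OF n(1) e'(1)] dd] by blast
    have "p \<cdot> e' \<cdot> n = dif (p \<cdot> (y \<cdot> r2)) (p \<cdot> (t \<cdot> z))" using Comp_assoc[OF n(1) e'(1) pm(1)] en comp_dif[OF yr tz pm(1)] by simp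
    also have "p \<cdot> (t \<cdot> z) = zer S2 ?B" using comp_eq_zer[OF t(1) pm(1) z(3) pm(3)] .
    also have "dif (p \<cdot> (y \<cdot> r2)) (zer S2 ?B) = p \<cdot> (y \<cdot> r2)" using dif_zer[OF Comp_Hom[OF yr pm(1)]] .
    also have "\<dots> = x \<cdot> (r1 \<cdot> r2)" using comp_ext[OF y(4,3) pm(1) y(1) x(1) z(1)] .
    finally show "\<exists>S'. \<exists>p'\<in>mor S' S. \<exists>y\<in>mor S' N. is_epi C p' \<and> p \<cdot> e' \<cdot> y = x \<cdot> p'"
      using n(1) Comp_Hom[OF z(1) y(1)] epi_comp[OF z(2) y(2) z(1) y(1)] by blast
  qed
qed

end

section \<open>Locally noetherian local categories and the conclusion\<close>

context locally_noetherian_grothendieck_category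
begin

lemma noetherian_subobject:
  assumes X: "X \<in> Obj C" "\<not> is_zero C X"
  obtains D s where "s \<in> mor D X" "is_mono C s" "noetherian_obj C D" "\<not> is_zero C D"
proof -
  obtain S where S: "\<forall>G\<in>S. noetherian_obj C G" "generating_set C S" using noetherian_generators by blast
  have "Ide C X \<noteq> zer X X" using nonzero_ide[OF X] .
  then obtain G h where h: "G \<in> S" "h \<in> mor G X" "Ide C X \<cdot> h \<noteq> zer X X \<cdot> h"
    using S(2) Ide_Hom[OF X(1)] zer_hom[OF X(1) X(1)] unfolding generating_set_def by blast
  have h0: "h \<noteq> zer G X" using h(3) Ide_Comp[OF h(2)] zer_comp'[OF h(2) X(1)] by simp
  obtain I e m where em: "e \<in> mor G I" "m \<in> mor I X" "is_epi C e" "is_mono C m" "m \<cdot> e = h" using image_factorization[OF h(2)] .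
  have "\<not> is_zero C I" using nonzero_factor[OF em(1,2)] em(5) h0 by simp
  then show ?thesis using that[OF em(2,4)] noeth_quot[OF em(3,1)] S(1) h(1) by blast
qed

lemma monoform_subobject:
  assumes X: "X \<in> Obj C" "\<not> is_zero C X"
  obtains H s where "monoform C H" "s \<in> mor H X" "is_mono C s"
proof -
  obtain D s where D: "s \<in> mor D X" "is_mono C s" "noetherian_obj C D" "\<not> is_zero C D" using noetherian_subobject[OF X] .
  obtain H t where "monoform C H" "t \<in> mor H D" "is_mono C t" using noeth_monoform_sub[OF D(3,4)] .
  then show ?thesis using that[of H "s \<cdot> t"] Comp_Hom D mono_comp by blast
qed

text \<open>A nonzero noetherian subobject has a simple quotient, and in a local category all simple
  objects have the atom \<open>\<mm>\<close>.\<close>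

lemma maximal_atom_in_ASupp:
  assumes l: "local_cat C" "maximal_atom C \<mm>" and X: "X \<in> Obj C" "\<not> is_zero C X"
  shows "\<mm> \<in> ASupp C X"
proof -
  obtain D s where D: "s \<in> mor D X" "is_mono C s" "noetherian_obj C D" "\<not> is_zero C D" using noetherian_subobject[OF X] .
  obtain S e where S: "simple_obj C S" "e \<in> mor D S" "is_epi C e" using noeth_simple_quot[OF D(3,4)] .
  have "maximal_atom C (atom_of C S)" using S(1) atom_of_ASpec[OF simple_monoform[OF S(1)]] by (auto simp: maximal_atom_def)
  then have "atom_of C S = \<mm>" using l unfolding local_cat_def by blast
  moreover have "subquotient C X S" unfolding subquotient_iff using D S by blast
  ultimately show ?thesis using ASuppI[OF simple_monoform[OF S(1)]] by blast
qed

lemma atom_le_maximal: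
  assumes l: "local_cat C" "maximal_atom C \<mm>" and b: "\<beta> \<in> ASpec C"
  shows "atom_le C \<beta> \<mm>"
  unfolding atom_le_def
proof (intro allI impI)
  fix \<Phi> assume "open_atoms C \<Phi> \<and> \<beta> \<in> \<Phi>"
  then obtain H where H: "H \<in> \<beta>" "ASupp C H \<subseteq> \<Phi>" unfolding open_atoms_def by blast
  have "monoform C H" using in_ASpec[OF b H(1)] by blast
  then show "\<mm> \<in> \<Phi>" using maximal_atom_in_ASupp[OF l monoform_obj monoform_nonzero] H(2) by blast
qed

text \<open>Since \<open>M\<close> has the least support in its atom, that atom lies below every
  \<open>\<beta>\<close> in \<open>ASupp C M\<close>, and every atom lies below
  \<open>\<mm>\<close>. A third atom would give a chain of length two in the support of
  \<open>N\<close>.\<close>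

lemma dimension_one_support:
  assumes l: "local_cat C" "maximal_atom C \<mm>" and dim: "has_dimension C N 1" and N: "N \<in> Obj C" "\<not> is_zero C N"
    and M: "monoform C M" "\<And>H. H \<in> atom_of C M \<Longrightarrow> ASupp C M \<subseteq> ASupp C H"
    and L: "L \<in> atom_of C M" "l \<in> mor L N" "is_mono C l"
  shows "ASupp C M \<subseteq> {atom_of C M, \<mm>}"
proof
  fix \<beta> assume b: "\<beta> \<in> ASupp C M"
  have LN: "ASupp C L \<subseteq> ASupp C N" using ASupp_sub[OF L(3,2)] .
  have bN: "\<beta> \<in> ASupp C N" using b M(2)[OF L(1)] LN by blast
  have aN: "atom_of C M \<in> ASupp C N" using atom_in_ASupp[OF M(1)] M(2)[OF L(1)] LN by blast
  have mN: "\<mm> \<in> ASupp C N" using maximal_atom_in_ASupp[OF l N] .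
  have ab: "atom_le C (atom_of C M) \<beta>" unfolding atom_le_def
  proof (intro allI impI)
    fix \<Phi> assume "open_atoms C \<Phi> \<and> atom_of C M \<in> \<Phi>"
    then obtain H where "H \<in> atom_of C M" "ASupp C H \<subseteq> \<Phi>" unfolding open_atoms_def by blast
    then show "\<beta> \<in> \<Phi>" using M(2) b by blast
  qed
  have bm: "atom_le C \<beta> \<mm>" using atom_le_maximal[OF l] b by (simp add: ASupp_def)
  show "\<beta> \<in> {atom_of C M, \<mm>}"
  proof (rule ccontr)
    assume n: "\<beta> \<notin> {atom_of C M, \<mm>}"
    define \<alpha> where "\<alpha> i = (if i = 0 then atom_of C M else if i = 1 then \<beta> else \<mm>)" for i :: nat
    have "\<forall>i\<le>2. \<alpha> i \<in> ASupp C N" using aN bN mN by (simp add: \<alpha>_def)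
    moreover have "atom_less C (\<alpha> i) (\<alpha> (Suc i))" if "i < 2" for i
    proof -
      have "i = 0 \<or> i = 1" using that by auto
      then show ?thesis using ab bm n by (auto simp: \<alpha>_def atom_less_def)
    qed
    ultimately have "atom_chain C N 2" unfolding atom_chain_def by blast
    then show False using dim unfolding has_dimension_def by fastforce
  qed
qed

lemma local_cohomology_not_noetherian:
  assumes ls: "locally_stable C" and l: "local_cat C" "maximal_atom C \<mm>"
    and N: "noetherian_obj C N" and dim: "has_dimension C N 1"
    and \<gamma>: "is_Gamma C \<mm> N \<gamma>" and \<pi>: "is_cokernel C \<pi> \<gamma>"
    and ass: "\<And>\<alpha>. \<alpha> \<in> AAss C (Cod C \<pi>) \<Longrightarrow> \<exists>M. monoform C M \<and> \<not> skew_field (End_ring C M) \<and> \<alpha> = atom_of C M"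
    and H: "is_local_cohomology C \<mm> 1 N H"
  shows "\<not> noetherian_obj C H"
proof
  assume HN: "noetherian_obj C H"
  interpret serre C "supported {\<mm>}" by unfold_locales (rule serre_supported)
  obtain e I d g \<delta> where res: "is_injective_resolution C N e I d" and g: "\<And>n. is_Gamma C \<mm> (I n) (g n)"
    and \<delta>: "\<And>n. \<delta> n \<in> mor (Dom C (g n)) (Dom C (g (Suc n)))" "\<And>n. g (Suc n) \<cdot> \<delta> n = d n \<cdot> g n"
    and coh: "is_cohomology C \<delta> 1 H"
    using H unfolding is_local_cohomology_def by blast
  have I: "injective_obj C (I n)" and d: "d n \<in> mor (I n) (I (Suc n))" and ex: "exact_at C (d n) (d (Suc n))" for n
    using res by (auto simp: is_injective_resolution_def)
  have e: "e \<in> mor N (I 0)" "is_kernel C e (d 0)" using res by (auto simp: is_injective_resolution_def)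
  have em: "is_mono C e" using kernel_mono[OF e(2)] .
  let ?T = "Dom C (g 0)"
  have gm: "g n \<in> mor (Dom C (g n)) (I n)" and go: "is_mono C (g n)" for n
    using g[of n] subobj_mor subobj_mono by (auto simp: is_Gamma_def)
  have T: "?T \<in> supported {\<mm>}" using g[of 0] hom_obj[OF gm[of 0]] by (simp add: is_Gamma_def supported_def)
  obtain k b c where k: "is_kernel C k (\<delta> 1)" "b \<in> mor (Dom C (\<delta> 0)) (Dom C k)" "k \<cdot> b = \<delta> 0" "is_cokernel C c b" "Cod C c = H"
    using coh unfolding is_cohomology_def by auto
  have b: "b \<in> mor ?T (Dom C k)" using k(2) hom_DC(1)[OF \<delta>(1)[of 0]] by simp
  have NO: "N \<in> Obj C" using noeth_obj[OF N] .

  \<comment> \<open>Dimension one provides two distinct atoms in the support of \<open>N\<close>,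
    and at least one of them differs from \<open>\<mm>\<close>; hence \<open>N\<close> is not
    torsion and \<open>N / \<Gamma> N\<close> is not zero.\<close>
  obtain \<beta> where \<beta>: "\<beta> \<in> ASupp C N" "\<beta> \<noteq> \<mm>"
  proof -
    obtain a :: "nat \<Rightarrow> _" where "\<forall>i\<le>1. a i \<in> ASupp C N" "\<forall>i<1. atom_less C (a i) (a (Suc i))"
      using dim unfolding has_dimension_def atom_chain_def by blast
    then have "a 0 \<in> ASupp C N" "a 1 \<in> ASupp C N" "a 0 \<noteq> a 1" by (auto simp: atom_less_def)
    then show thesis using that by metis
  qed
  have N0: "\<not> is_zero C N" using zero_supported[of N "{}"] \<beta> by (auto simp: supported_def)
  have \<gamma>m: "\<gamma> \<in> mor (Dom C \<gamma>) N" "is_mono C \<gamma>" using \<gamma> subobj_mor subobj_mono by (auto simp: is_Gamma_def)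
  note \<pi>m = cokernel_hom[OF \<pi> \<gamma>m(1)]
  have "\<not> is_zero C (Cod C \<pi>)"
  proof
    assume z: "is_zero C (Cod C \<pi>)"
    have "\<pi> \<cdot> Ide C N = zer N (Cod C \<pi>)" using zero_hom(2)[OF z Comp_Hom[OF Ide_Hom[OF NO] \<pi>m]] .
    then obtain h where h: "h \<in> mor N (Dom C \<gamma>)" "\<gamma> \<cdot> h = Ide C N" using mono_factor[OF \<gamma>m(2,1) \<pi> \<pi>m Ide_Hom[OF NO]] by metis
    have "is_mono C h" using mono_cancel[OF _ h(1) \<gamma>m(1)] h(2) ide_mono[OF NO] by simp
    then have "ASupp C N \<subseteq> {\<mm>}" using ASupp_sub[OF _ h(1)] \<gamma> unfolding is_Gamma_def by blast
    then show False using \<beta> by blast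
  qed
  then obtain H0 s0 where H0: "monoform C H0" "s0 \<in> mor H0 (Cod C \<pi>)" "is_mono C s0"
    using monoform_subobject hom_obj[OF \<pi>m] by blast
  define \<alpha> where "\<alpha> = atom_of C H0"
  have \<alpha>: "\<alpha> \<in> AAss C (Cod C \<pi>)" unfolding AAss_def \<alpha>_def
    using atom_of_ASpec[OF H0(1)] atom_of_self[OF H0(1)] subobjI[OF H0(3,2)] hom_DC(1)[OF H0(2)] by blast
  obtain L j where L: "monoform C L" "\<alpha> = atom_of C L" "j \<in> mor L N" "is_mono C j" "\<alpha> \<noteq> \<mm>"
    using associated_atom_lifts[OF ls l(2) \<gamma> \<pi> \<alpha> em e(1) I] .
  obtain M where M: "monoform C M" "\<not> skew_field (End_ring C M)" "\<alpha> = atom_of C M" using ass[OF \<alpha>] by blast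
  obtain f where f: "f \<in> mor M M" "is_mono C f" "\<And>h. h \<in> mor M M \<Longrightarrow> f \<cdot> h \<noteq> Ide C M"
    by (rule monoform_not_skew_field[OF M(1,2)]) (blast intro: that)

  have "atom_equiv C M L" using atom_of_eq[OF M(1) L(1)] M(3) L(2) by simp
  then obtain V a a' where V: "\<not> is_zero C V" "a \<in> mor V M" "is_mono C a" "a' \<in> mor V L" "is_mono C a'" unfolding atom_equiv_iff by blast
  \<comment> \<open>\<open>V\<close> embeds in \<open>M\<close> by \<open>a\<close> and, through
    \<open>L\<close> and \<open>N\<close>, in \<open>I 0\<close>: it is the common piece on which
    \<open>M\<close> and \<open>N\<close> agree inside \<open>I 0\<close>.\<close>
  define x where "x = e \<cdot> (j \<cdot> a')"
  have ja: "j \<cdot> a' \<in> mor V N" "is_mono C (j \<cdot> a')" using Comp_Hom[OF V(4) L(3)] mono_comp[OF V(5) L(4) V(4) L(3)] by auto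
  have x: "x \<in> mor V (I 0)" "is_mono C x" using Comp_Hom[OF ja(1) e(1)] mono_comp[OF ja(2) em ja(1) e(1)] by (simp_all add: x_def)
  have dx: "d 0 \<cdot> x = zer V (I 1)" using comp_eq_zer[OF e(1) d ja(1) kernel_eq[OF e(2) d e(1)]] by (simp add: x_def)
  have LM: "L \<in> atom_of C M" using atom_of_self[OF L(1)] L(2) M(3) by simp
  have "ASupp C M \<subseteq> {atom_of C M, \<mm>}"
    by (rule dimension_one_support[OF l dim NO N0 M(1) _ LM L(3,4)])
      (rule support_of_monoform[OF ls M(1) V(2,3,1) x I])
  then have suppM: "ASupp C M \<subseteq> {\<alpha>, \<mm>}" using M(3) by simp
  obtain g0 where g0: "g0 \<in> mor M (I 0)" "g0 \<cdot> a = x" using I[of 0] V(2,3) x(1) hom_DC[OF V(2)] unfolding injective_obj_def by metis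
  have g0m: "is_mono C g0" using ess_mono_cancel[OF monoform_ess[OF M(1) V(3,2,1)] V(2) g0(1)] g0(2) x(2) by simp
  obtain G where G: "G 0 = g0" "\<And>n :: nat. G n \<in> mor M (I 0)" "\<And>n. is_mono C (G n)" "\<And>n. G (Suc n) \<cdot> f = G n"
    "\<And>n. \<exists>a \<in> mor M M. G n \<cdot> a = g0"
    by (rule extension_chain[OF M(1) f(1,2) I g0(1) g0m]) (blast intro: that)

  obtain q Q where q: "is_cokernel C q (g 1)" "q \<in> mor (I 1) Q" "q \<cdot> g 1 = zer (Dom C (g 1)) Q" using obtain_cokernel[OF gm[of 1]] .
  have tfQ: "torsionfree Q" using Gamma_quotient_torsionfree[OF g[of 1] q(1)] hom_DC(2)[OF q(2)] by simp
  have d0: "d 0 \<in> mor (I 0) (I 1)" using d[of 0] by simp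
  have qd: "q \<cdot> d 0 \<in> mor (I 0) Q" using Comp_Hom[OF d0 q(2)] .
  obtain w W where w: "is_kernel C w (q \<cdot> d 0)" "w \<in> mor W (I 0)" "is_mono C w" "q \<cdot> d 0 \<cdot> w = zer W Q" using obtain_kernel[OF qd] .
  have gd: "g 1 \<cdot> \<delta> 0 = d 0 \<cdot> g 0" "\<delta> 0 \<in> mor ?T (Dom C (g 1))" using \<delta>(2)[of 0] \<delta>(1)[of 0] by simp_all
  have "q \<cdot> d 0 \<cdot> g 0 = zer ?T Q"
    using Comp_assoc[OF gm[of 0] d0 q(2)] gd(1) comp_eq_zer[OF gm[of 1] q(2) gd(2) q(3)] by simp
  then obtain t where t: "t \<in> mor ?T W" "w \<cdot> t = g 0" using kernelE[OF w(1) qd w(2) gm] by metis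
  have tm: "is_mono C t" using mono_cancel[OF _ t(1) w(2)] t(2) go[of 0] by simp
  obtain p B where p: "is_cokernel C p t" "p \<in> mor W B" "is_epi C p" "p \<cdot> t = zer ?T B" using obtain_cokernel[OF t(1)] .
  have "noetherian_obj C (Cod C p)"
    by (rule preimage_noetherian[OF N e d0 _ _ gm[of 0] gm[of 1] go[of 1] gm[of 2] go[of 2] gd(2,1) _ _ k(1) b k(3,4) _ q(1) w(1,2) t p(1)])
      (use d[of 1] ex[of 0] \<delta>[of 1] HN k(5) in \<open>simp_all add: numeral_2_eq_2\<close>)
  then have BN: "noetherian_obj C B" using hom_DC(2)[OF p(2)] by simp

  \<comment> \<open>The piece \<open>V\<close> comes from \<open>N\<close>, so \<open>d 0\<close>
    kills it, and the image \<open>J\<close> of \<open>M\<close> in \<open>Q\<close> is a quotient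
    by a nonzero subobject. Its support omits \<open>\<alpha>\<close> and is thus contained in
    \<open>{\<mm>}\<close>, while \<open>Q\<close> is torsionfree.\<close>
  have "q \<cdot> d 0 \<cdot> G n = zer M Q" for n
  proof -
    have r: "q \<cdot> d 0 \<cdot> G n \<in> mor M Q" using Comp_Hom[OF G(2) qd] .
    obtain J \<epsilon> \<mu> where em': "\<epsilon> \<in> mor M J" "\<mu> \<in> mor J Q" "is_epi C \<epsilon>" "is_mono C \<mu>" "\<mu> \<cdot> \<epsilon> = q \<cdot> d 0 \<cdot> G n" using image_factorization[OF r] .
    obtain y where y: "y \<in> mor M M" "G n \<cdot> y = g0" using G(5) by blast
    have ya: "y \<cdot> a \<in> mor V M" using Comp_Hom[OF V(2) y(1)] .
    have Gya: "G n \<cdot> (y \<cdot> a) = x" using comp_ext1[OF y(2,1) G(2) V(2)] g0(2) by simp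
    have VO: "V \<in> Obj C" using hom_obj[OF V(2)] by blast
    have "\<mu> \<cdot> (\<epsilon> \<cdot> (y \<cdot> a)) = q \<cdot> d 0 \<cdot> (G n \<cdot> (y \<cdot> a))" using comp_ext[OF em'(5,1,2) G(2) qd ya] .
    also have "\<dots> = zer V Q" using Gya Comp_assoc[OF x(1) d0 q(2)] dx comp_zer'[OF q(2) VO] by simp
    finally have "\<epsilon> \<cdot> (y \<cdot> a) = zer V J" using mono_zerD[OF em'(4,2) Comp_Hom[OF ya em'(1)]] by blast
    moreover have "y \<cdot> a \<noteq> zer V M" using Gya nonzero_mono[OF x(2,1) V(1)] comp_zer'[OF G(2) VO] by auto
    ultimately have "\<alpha> \<notin> ASupp C J" using atom_notin_proper_quotient[OF M(1) ya _ em'(1,3)] M(3) by blast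
    then have "J \<in> supported {\<mm>}" using ASupp_quot[OF em'(3,1)] suppM hom_obj[OF em'(1)] by (auto simp: supported_def)
    then have "\<mu> = zer J Q" using tfQ em'(2) unfolding torsionfree_def by blast
    then show ?thesis using em'(5) zer_comp'[OF em'(1)] hom_obj[OF r] by simp
  qed
  then have "\<exists>u \<in> mor M W. w \<cdot> u = G n" for n using kernelE[OF w(1) qd w(2) G(2)] by blast
  then obtain u where u: "\<And>n. u n \<in> mor M W" "\<And>n. w \<cdot> u n = G n" by metis
  have uf: "u (Suc n) \<cdot> f = u n" for n
  proof -
    have "w \<cdot> (u (Suc n) \<cdot> f) = w \<cdot> u n" using comp_ext1[OF u(2,1) w(2) f(1)] G(4) u(2) by simp
    then show ?thesis using monoD[OF w(3,2) Comp_Hom[OF f(1) u(1)] u(1)] by blast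
  qed
  have pu: "p \<cdot> u n \<in> mor M B" for n using Comp_Hom[OF u(1) p(2)] .
  have puf: "p \<cdot> u (Suc n) \<cdot> f = p \<cdot> u n" for n using Comp_assoc[OF f(1) u(1) p(2)] uf by simp
  \<comment> \<open>An element of \<open>M\<close> killed here lands in
    \<open>\<Gamma> (I 0)\<close> and is therefore negligible; \<open>M\<close> has no torsion,
    since its atom is not \<open>\<mm>\<close>.\<close>
  have pum: "is_mono C (p \<cdot> u n)" for n
  proof (rule mono_zerI[OF pu])
    fix S z assume z: "z \<in> mor S M" "p \<cdot> u n \<cdot> z = zer S B"
    have "p \<cdot> (u n \<cdot> z) = zer S B" using z Comp_assoc[OF z(1) u(1) p(2)] by simp
    then obtain y where y: "y \<in> mor S ?T" "t \<cdot> y = u n \<cdot> z" using mono_factor[OF tm t(1) p(1,2) Comp_Hom[OF z(1) u(1)]] by metis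
    have "G n \<cdot> z = g 0 \<cdot> y" using comp_ext1[OF u(2,1) w(2) z(1)] y(2) comp_ext1[OF t(2,1) w(2) y(1)] by simp
    then have "negl (supported {\<mm>}) (G n \<cdot> z)" using T y(1) gm[of 0] negl_def by metis
    then have "negl (supported {\<mm>}) z" using negl_mono_cancel[OF _ G(3) z(1) G(2)] by blast
    moreover have "atom_of C M \<notin> {\<mm>}" using M(3) L(5) by simp
    ultimately show "z = zer S M" using negl_to_monoform[OF M(1) _ z(1)] by blast
  qed
  obtain h where "h \<in> mor M M" "f \<cdot> h = Ide C M" using chain_split[where s = "\<lambda>n. p \<cdot> u n", OF BN f(1) pu pum puf] .
  then show False using f(3) by blast
qed

end

theorem theorem4p10:
  fixes U :: "'u set"
    and A :: "('o, 'a, 'm) preadd_cat_scheme"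
    and \<mm> :: "'o set"
    and N :: 'o
  assumes "locally_noetherian_grothendieck_category U A"
    and "locally_stable A"
    and "local_cat A"
    and "maximal_atom A \<mm>"
    and "noetherian_obj A N"
    and "has_dimension A N 1"
    and "is_Gamma A \<mm> N \<gamma>"
    and "is_cokernel A \<pi> \<gamma>"
    and "\<forall>\<alpha> \<in> AAss A (Cod A \<pi>).
           \<exists>M. monoform A M \<and> \<not> skew_field (End_ring A M) \<and> \<alpha> = atom_of A M"
    and "is_local_cohomology A \<mm> 1 N H"
  shows "\<not> noetherian_obj A H"
proof -
  interpret locally_noetherian_grothendieck_category U A by (rule assms(1))
  show ?thesis
    by (rule local_cohomology_not_noetherian[OF assms(2-8) _ assms(10)]) (use assms(9) in blast)
qed

end
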